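(* For an integer $g\ge 0$ and $i\in\{1,2\}$, let $\mathcal{K}_i(g)=\{K \mid K \text{ a long virtual knot with } sg_i(K)\le g\}$, where $sg_1$ and $sg_2$ are the $1$- and $2$-supporting genera. Then: (i) $\mathcal{K}_1(0)\neq\mathcal{K}_2(0)$; (ii) $\mathcal{K}_2(0)\neq\mathcal{K}_1(1)$; (iii) $\mathcal{K}_1(1)\neq\mathcal{K}_2(1)$. Moreover, there are infinitely many long virtual knots realizing the difference in each case: each of the sets $\mathcal{K}_2(0)\setminus\mathcal{K}_1(0)$, $\mathcal{K}_1(1)\setminus\mathcal{K}_2(0)$ and $\mathcal{K}_2(1)\setminus\mathcal{K}_1(1)$ contains infinitely many long virtual knots.
   Context: Long virtual knots. A long virtual knot diagram is an oriented immersed line in $\mathbb{R}^2$ that coincides with the $x$-axis outside a $2$-disk (oriented from $-\infty$ to $\infty$), each of whose double points is either a real crossing (with over/under information) or a virtual crossing. A long virtual knot is an equivalence class of such diagrams under the generalized (real, virtual and mixed) Reidemeister moves performed inside a $2$-disk. Surface realizations on closed surfaces. Let $\Sigma_g$ be a connected oriented closed surface of genus $g$. A surface realization $(\Sigma_g,D)$ of a long virtual knot diagram $D$ is an oriented closed-curve diagram with a basepoint on $\Sigma_g$, having only real crossings, such that traversing it from the basepoint one meets the same real crossings, in the same order and with the same over/under information and signs, as when traversing $D$ from $-\infty$ to $\infty$ (the basepoint corresponds to $\pm\infty$). A surface realization of a long virtual knot $K$ is a surface realization of some diagram of $K$. The $1$-supporting genus of $K$ is $sg_1(K)=\min\{g\mid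 (\Sigma_g,D)\text{ is a surface realization of }K\}$. Surface realizations on $2$-punctured surfaces. Let $\Sigma_{g,2}$ be a connected oriented compact surface of genus $g$ with two boundary components. Regarding a long virtual knot diagram $D$ as an arc diagram with two boundary points, a surface realization $(\Sigma_{g,2},D)$ of $D$ is an oriented arc diagram on $\Sigma_{g,2}$ with only real crossings, with the same sequence of crossings, over/under information and signs as $D$, whose two boundary points lie on distinct boundary components of $\Sigma_{g,2}$. The $2$-supporting genus of $K$ is $sg_2(K)=\min\{g\mid (\Sigma_{g,2},D)\text{ is a surface realization of (some diagram of) }K\}$. One has $\mathcal{K}_1(0)\subset\mathcal{K}_2(0)\subset\mathcal{K}_1(1)\subset\mathcal{K}_2(1)\subset\cdots$. *)

theory Defs
  imports
    "HOL-Analysis.Analysis"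
    "HOL-Combinatorics.Orbits"
    "HOL-Library.Extended_Nat"
begin

section \<open>Long virtual knots\<close>

text \<open>
  The plane is the type of complex numbers and the x-axis is the real line. A pair \<open>(s, t)\<close> in
  \<open>arrows D\<close> records a real crossing at which the strand passing at time \<open>s\<close> runs over the strand
  passing at time \<open>t\<close>. The double points that carry no arrow are the virtual crossings.
\<close>

record diagram =
  curve :: "real \<Rightarrow> complex"
  arrows :: "(real \<times> real) set"

definition double_pairs :: "(real \<Rightarrow> complex) \<Rightarrow> (real \<times> real) set" where
  "double_pairs \<gamma> = {(s, t). s \<noteq> t \<and> \<gamma> s = \<gamma> t}"

definition det2 :: "complex \<Rightarrow> complex \<Rightarrow> real" where
  "det2 v w = Re v * Im w - Im v * Re w"

definition velocity :: "(real \<Rightarrow> complex) \<Rightarrow> real \<Rightarrow> complex" where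
  "velocity \<gamma> t = vector_derivative \<gamma> (at t)"

text \<open>
  Immersions are taken in a category that contains both the smooth and the piecewise linear curves:
  only at the double points is a tangent required. Local injectivity is implied by the finiteness
  of \<open>double_pairs\<close>. The curve being \<open>t \<mapsto> t\<close> for large \<open>\<bar>t\<bar>\<close>, it coincides with the x-axis outside
  every sufficiently large disk.
\<close>

definition long_immersed_line :: "(real \<Rightarrow> complex) \<Rightarrow> bool" where
  "long_immersed_line \<gamma> \<longleftrightarrow>
     continuous_on UNIV \<gamma> \<and>
     (\<exists>r. \<forall>t. r \<le> \<bar>t\<bar> \<longrightarrow> \<gamma> t = complex_of_real t) \<and>
     finite (double_pairs \<gamma>) \<and>
     (\<forall>s t u. (s, t) \<in> double_pairs \<gamma> \<and> (s, u) \<in> double_pairs \<gamma> \<longrightarrow> t = u) \<and>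
     (\<forall>(s, t) \<in> double_pairs \<gamma>.
        \<gamma> differentiable (at s) \<and> \<gamma> differentiable (at t) \<and>
        det2 (velocity \<gamma> s) (velocity \<gamma> t) \<noteq> 0)"

definition long_virtual_diagram :: "diagram \<Rightarrow> bool" where
  "long_virtual_diagram D \<longleftrightarrow>
     long_immersed_line (curve D) \<and>
     arrows D \<subseteq> double_pairs (curve D) \<and>
     (\<forall>s t. (s, t) \<in> arrows D \<longrightarrow> (t, s) \<notin> arrows D)"

text \<open>The crossing at which time \<open>s\<close> is over and time \<open>t\<close> is under is positive.\<close>

definition positive :: "diagram \<Rightarrow> real \<Rightarrow> real \<Rightarrow> bool" where
  "positive D s t \<longleftrightarrow> det2 (velocity (curve D) s) (velocity (curve D) t) > 0"

subsection \<open>Generalized Reidemeister moves\<close>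

text \<open>
  Planar isotopy together with reparametrization. A homeomorphism of the plane that is the identity
  outside a disk is isotopic to the identity by the Alexander trick. In particular it
  preserves orientation, so the condition on signs is implied by the others; it is kept so that
  the preservation of signs can be read off.
\<close>

definition planar_isotopy :: "diagram \<Rightarrow> diagram \<Rightarrow> bool" where
  "planar_isotopy D D' \<longleftrightarrow>
     long_virtual_diagram D \<and> long_virtual_diagram D' \<and>
     (\<exists>h h' \<tau>.
        homeomorphism UNIV UNIV h h' \<and> (\<exists>r. \<forall>z. r \<le> norm z \<longrightarrow> h z = z) \<and>
        strict_mono \<tau> \<and> continuous_on UNIV \<tau> \<and> surj \<tau> \<and>
        curve D' = h \<circ> curve D \<circ> \<tau> \<and>
        arrows D' = {(s, t). (\<tau> s, \<tau> t) \<in> arrows D} \<and>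
        (\<forall>(s, t) \<in> arrows D'. positive D' s t \<longleftrightarrow> positive D (\<tau> s) (\<tau> t)))"

definition arc_times :: "(real \<times> real) list \<Rightarrow> real set" where
  "arc_times S = (\<Union>(a, b) \<in> set S. {a..b})"

text \<open>The part of the curve in the disk \<open>\<Delta>\<close> consists of proper arcs, one for each interval in \<open>S\<close>.\<close>

definition meets_in_arcs :: "(real \<Rightarrow> complex) \<Rightarrow> complex set \<Rightarrow> (real \<times> real) list \<Rightarrow> bool" where
  "meets_in_arcs \<gamma> \<Delta> S \<longleftrightarrow>
     (\<forall>(a, b) \<in> set S. a < b \<and> \<gamma> a \<in> frontier \<Delta> \<and> \<gamma> b \<in> frontier \<Delta> \<and>
        \<gamma> ` {a<..<b} \<subseteq> interior \<Delta>) \<and>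
     sorted_wrt (\<lambda>(a, b) (c, d). {a..b} \<inter> {c..d} = {}) S \<and>
     \<gamma> -` \<Delta> = arc_times S"

definition agree_outside :: "diagram \<Rightarrow> diagram \<Rightarrow> (real \<times> real) list \<Rightarrow> bool" where
  "agree_outside D D' S \<longleftrightarrow>
     long_virtual_diagram D \<and> long_virtual_diagram D' \<and>
     (\<exists>\<Delta>. \<Delta> homeomorphic (cball 0 1 :: complex set) \<and>
        meets_in_arcs (curve D) \<Delta> S \<and> meets_in_arcs (curve D') \<Delta> S) \<and>
     (\<forall>t. t \<notin> arc_times S \<longrightarrow> curve D t = curve D' t) \<and>
     arrows D - arc_times S \<times> arc_times S = arrows D' - arc_times S \<times> arc_times S"

definition local_doubles :: "diagram \<Rightarrow> (real \<times> real) list \<Rightarrow> (real \<times> real) set" where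
  "local_doubles D S = double_pairs (curve D) \<inter> arc_times S \<times> arc_times S"

definition local_arrows :: "diagram \<Rightarrow> (real \<times> real) list \<Rightarrow> (real \<times> real) set" where
  "local_arrows D S = arrows D \<inter> arc_times S \<times> arc_times S"

text \<open>
  Inside the disk the two sides of a move are described by the pattern in which the arcs cross.
  For the patterns below this determines the picture up to a homeomorphism of the disk:
  an arc with one double point is a kink, two simple arcs with two crossings bound
  a bigon, and three simple arcs that cross pairwise once bound a triangle.
\<close>

definition reidemeister1 :: "diagram \<Rightarrow> diagram \<Rightarrow> bool" where
  "reidemeister1 D D' \<longleftrightarrow>
     (\<exists>a b s t.
        agree_outside D D' [(a, b)] \<and>
        s \<in> {a<..<b} \<and> t \<in> {a<..<b} \<and>
        local_doubles D [(a, b)] = {(s, t), (t, s)} \<and>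
        local_doubles D' [(a, b)] = {})"

text \<open>
  The two crossings are both virtual, or both real with the same arc above. Two arcs in a disk that
  cross exactly twice do so with opposite signs, so the condition on signs is again implied.
\<close>

definition reidemeister2 :: "diagram \<Rightarrow> diagram \<Rightarrow> bool" where
  "reidemeister2 D D' \<longleftrightarrow>
     (\<exists>a b c d s s' t t'. let S = [(a, b), (c, d)] in
        agree_outside D D' S \<and>
        {s, s'} \<subseteq> {a<..<b} \<and> s \<noteq> s' \<and> {t, t'} \<subseteq> {c<..<d} \<and> t \<noteq> t' \<and>
        local_doubles D S = {(s, t), (t, s), (s', t'), (t', s')} \<and>
        (positive D s t \<longleftrightarrow> \<not> positive D s' t') \<and>
        local_arrows D S \<in> {{}, {(s, t), (s', t')}} \<and>
        local_doubles D' S = {})"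

text \<open>
  \<open>p i j\<close> is the time at which arc \<open>i\<close> crosses arc \<open>j\<close>. Arcs may be listed in any order, so it
  may be assumed that in the real move arc 0 is above arc 1 and arc 1 above arc 2, and that in the
  mixed move arc 2 is the one with two virtual crossings. Each crossing keeps its sign, because
  the sign is determined by the position of the end points of the arcs.
\<close>

definition triangle ::
  "diagram \<Rightarrow> (real \<times> real) list \<Rightarrow> (nat \<Rightarrow> nat \<Rightarrow> real) \<Rightarrow> bool" where
  "triangle D S p \<longleftrightarrow>
     (\<forall>i < 3. \<forall>j < 3. i \<noteq> j \<longrightarrow> fst (S ! i) < p i j \<and> p i j < snd (S ! i)) \<and>
     local_doubles D S = {(p i j, p j i) | i j. i < 3 \<and> j < 3 \<and> i \<noteq> j}"

definition reidemeister3 :: "diagram \<Rightarrow> diagram \<Rightarrow> bool" where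
  "reidemeister3 D D' \<longleftrightarrow>
     (\<exists>S p q.
        length S = 3 \<and> agree_outside D D' S \<and> triangle D S p \<and> triangle D' S q \<and>
        (\<forall>i < 3. \<forall>j < 3. \<forall>k < 3. distinct [i, j, k] \<longrightarrow> (p i j < p i k \<longleftrightarrow> q i k < q i j)) \<and>
        (\<forall>i < 3. \<forall>j < 3. i \<noteq> j \<longrightarrow>
           (positive D (p i j) (p j i) \<longleftrightarrow> positive D' (q i j) (q j i))) \<and>
        (\<exists>I \<in> {{}, {(0, 1)}, {(0, 1), (0, 2), (1, 2)}}.
           local_arrows D S = {(p i j, p j i) | i j. (i, j) \<in> I} \<and>
           local_arrows D' S = {(q i j, q j i) | i j. (i, j) \<in> I}))"

definition move :: "diagram \<Rightarrow> diagram \<Rightarrow> bool" where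
  "move D D' \<longleftrightarrow>
     planar_isotopy D D' \<or> reidemeister1 D D' \<or> reidemeister2 D D' \<or> reidemeister3 D D'"

definition long_virtual_knots :: "diagram set set" where
  "long_virtual_knots =
     {D. long_virtual_diagram D} //
       {(D, D'). long_virtual_diagram D \<and> long_virtual_diagram D' \<and> equivclp move D D'}"

section \<open>Surfaces\<close>

text \<open>
  Surfaces are used in the piecewise linear category: a closed oriented surface is
  obtained from finitely many disjoint oriented polygons (monogons and bigons are allowed) by gluing
  their sides in pairs, reversing orientation. \<open>follow\<close> maps a side to the following side
  of the same polygon in counterclockwise order, and \<open>glue\<close> maps a side to the one it is glued to.
  So a side is an edge of the surface with a direction, the polygon lying on its left, and \<open>glue\<close>
  reverses the direction.
\<close>

record surface =
  sides :: "nat set"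
  follow :: "nat \<Rightarrow> nat"
  glue :: "nat \<Rightarrow> nat"

definition closed_surface :: "surface \<Rightarrow> bool" where
  "closed_surface \<Sigma> \<longleftrightarrow>
     finite (sides \<Sigma>) \<and> sides \<Sigma> \<noteq> {} \<and>
     follow \<Sigma> permutes sides \<Sigma> \<and> glue \<Sigma> permutes sides \<Sigma> \<and>
     (\<forall>d \<in> sides \<Sigma>. glue \<Sigma> d \<noteq> d \<and> glue \<Sigma> (glue \<Sigma> d) = d) \<and>
     (\<forall>d \<in> sides \<Sigma>. \<forall>e \<in> sides \<Sigma>.
        (d, e) \<in> ({(x, follow \<Sigma> x) | x. x \<in> sides \<Sigma>} \<union> {(x, glue \<Sigma> x) | x. x \<in> sides \<Sigma>})\<^sup>*)"

text \<open>
  \<open>turn \<Sigma> d\<close> is the side that follows \<open>d\<close> in counterclockwise order around the initial vertex of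
  \<open>d\<close>: one crosses the polygon on the left of \<open>d\<close> and arrives at its preceding side, reversed.
  A vertex is identified with the set of sides that start there.
\<close>

definition turn :: "surface \<Rightarrow> nat \<Rightarrow> nat" where
  "turn \<Sigma> d = glue \<Sigma> (inv (follow \<Sigma>) d)"

definition initial_vertex :: "surface \<Rightarrow> nat \<Rightarrow> nat set" where
  "initial_vertex \<Sigma> d = orbit (turn \<Sigma>) d"

definition final_vertex :: "surface \<Rightarrow> nat \<Rightarrow> nat set" where
  "final_vertex \<Sigma> d = initial_vertex \<Sigma> (glue \<Sigma> d)"

definition vertices :: "surface \<Rightarrow> nat set set" where
  "vertices \<Sigma> = initial_vertex \<Sigma> ` sides \<Sigma>"

definition edges :: "surface \<Rightarrow> nat set set" where
  "edges \<Sigma> = (\<lambda>d. {d, glue \<Sigma> d}) ` sides \<Sigma>"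

definition polygons :: "surface \<Rightarrow> nat set set" where
  "polygons \<Sigma> = orbit (follow \<Sigma>) ` sides \<Sigma>"

definition has_genus :: "surface \<Rightarrow> nat \<Rightarrow> bool" where
  "has_genus \<Sigma> g \<longleftrightarrow>
     int (card (vertices \<Sigma>)) - int (card (edges \<Sigma>)) + int (card (polygons \<Sigma>)) = 2 - 2 * int g"

text \<open>
  The compact surface with two boundary components is the closed surface \<open>\<Sigma>\<close> with
  the open polygons \<open>B\<close> and \<open>C\<close> removed. Their boundaries are disjoint simple closed curves,
  since no vertex occurs twice on them. Its genus is that of \<open>\<Sigma>\<close>.
\<close>

definition two_holed_surface :: "surface \<Rightarrow> nat set \<Rightarrow> nat set \<Rightarrow> bool" where
  "two_holed_surface \<Sigma> B C \<longleftrightarrow>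
     closed_surface \<Sigma> \<and> B \<in> polygons \<Sigma> \<and> C \<in> polygons \<Sigma> \<and> B \<noteq> C \<and>
     inj_on (initial_vertex \<Sigma>) (B \<union> C)"

section \<open>Curve and arc diagrams on surfaces\<close>

text \<open>
  A curve on a surface is an edge path. The decomposition into polygons is arbitrary, so there is no
  requirement that the complement of the curve consist of disks.
\<close>

definition counterclockwise :: "surface \<Rightarrow> nat \<Rightarrow> nat \<Rightarrow> nat \<Rightarrow> nat \<Rightarrow> bool" where
  "counterclockwise \<Sigma> a b c d \<longleftrightarrow>
     (\<exists>i j k. 0 < i \<and> i < j \<and> j < k \<and> k < card (initial_vertex \<Sigma> a) \<and>
        b = (turn \<Sigma> ^^ i) a \<and> c = (turn \<Sigma> ^^ j) a \<and> d = (turn \<Sigma> ^^ k) a)"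

text \<open>
  At time \<open>i > 0\<close> the path \<open>p\<close> is at the initial vertex of \<open>p ! i\<close>, which it enters through the
  reverse of the side \<open>glue \<Sigma> (p ! (i - 1))\<close>. If it is there at times \<open>i\<close> and \<open>j\<close>, then the
  visit at \<open>j\<close> may cross the one at \<open>i\<close> from right to left or from left to right.
\<close>

definition crosses_right_to_left :: "surface \<Rightarrow> nat list \<Rightarrow> nat \<Rightarrow> nat \<Rightarrow> bool" where
  "crosses_right_to_left \<Sigma> p i j \<longleftrightarrow>
     counterclockwise \<Sigma> (p ! i) (p ! j) (glue \<Sigma> (p ! (i - 1))) (glue \<Sigma> (p ! (j - 1)))"

definition crosses_left_to_right :: "surface \<Rightarrow> nat list \<Rightarrow> nat \<Rightarrow> nat \<Rightarrow> bool" where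
  "crosses_left_to_right \<Sigma> p i j \<longleftrightarrow>
     counterclockwise \<Sigma> (p ! i) (glue \<Sigma> (p ! (j - 1))) (glue \<Sigma> (p ! (i - 1))) (p ! j)"

definition crossing_times :: "surface \<Rightarrow> nat list \<Rightarrow> (nat \<times> nat) set" where
  "crossing_times \<Sigma> p =
     {(i, j). i \<in> {1..<length p} \<and> j \<in> {1..<length p} \<and> i \<noteq> j \<and>
        initial_vertex \<Sigma> (p ! i) = initial_vertex \<Sigma> (p ! j)}"

definition generic_path :: "surface \<Rightarrow> nat list \<Rightarrow> bool" where
  "generic_path \<Sigma> p \<longleftrightarrow>
     p \<noteq> [] \<and> set p \<subseteq> sides \<Sigma> \<and>
     (\<forall>i. Suc i < length p \<longrightarrow> final_vertex \<Sigma> (p ! i) = initial_vertex \<Sigma> (p ! Suc i)) \<and>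
     distinct p \<and> (\<forall>d \<in> set p. glue \<Sigma> d \<notin> set p) \<and>
     (\<forall>i j k. (i, j) \<in> crossing_times \<Sigma> p \<and> (i, k) \<in> crossing_times \<Sigma> p \<longrightarrow> j = k) \<and>
     (\<forall>(i, j) \<in> crossing_times \<Sigma> p.
        crosses_right_to_left \<Sigma> p i j \<or> crosses_left_to_right \<Sigma> p i j)"

text \<open>The base point is the initial vertex of the first side of the path, and is not a crossing.\<close>

definition based_closed_curve :: "surface \<Rightarrow> nat list \<Rightarrow> bool" where
  "based_closed_curve \<Sigma> p \<longleftrightarrow>
     closed_surface \<Sigma> \<and> generic_path \<Sigma> p \<and>
     final_vertex \<Sigma> (last p) = initial_vertex \<Sigma> (hd p) \<and>
     (\<forall>i \<in> {1..<length p}. initial_vertex \<Sigma> (p ! i) \<noteq> initial_vertex \<Sigma> (hd p))"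

definition arc_between_holes :: "surface \<Rightarrow> nat set \<Rightarrow> nat set \<Rightarrow> nat list \<Rightarrow> bool" where
  "arc_between_holes \<Sigma> B C p \<longleftrightarrow>
     two_holed_surface \<Sigma> B C \<and> generic_path \<Sigma> p \<and>
     initial_vertex \<Sigma> (hd p) \<in> initial_vertex \<Sigma> ` B \<and>
     final_vertex \<Sigma> (last p) \<in> initial_vertex \<Sigma> ` C \<and>
     (\<forall>i \<in> {1..<length p}. initial_vertex \<Sigma> (p ! i) \<notin> initial_vertex \<Sigma> ` (B \<union> C))"

text \<open>
  All crossings on a surface are real: \<open>R\<close> contains each of them once, as the pair of its over time
  and its under time.
\<close>

definition over_under :: "surface \<Rightarrow> nat list \<Rightarrow> (nat \<times> nat) set \<Rightarrow> bool" where
  "over_under \<Sigma> p R \<longleftrightarrow>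
     R \<subseteq> crossing_times \<Sigma> p \<and>
     (\<forall>(i, j) \<in> crossing_times \<Sigma> p. (i, j) \<in> R \<longleftrightarrow> (j, i) \<notin> R)"

text \<open>
  Traversing the path one meets the same real crossings, in the same order and with the same
  over/under information and signs, as when traversing \<open>D\<close>. The virtual crossings of \<open>D\<close> play no role.
\<close>

definition same_crossings :: "diagram \<Rightarrow> surface \<Rightarrow> nat list \<Rightarrow> (nat \<times> nat) set \<Rightarrow> bool" where
  "same_crossings D \<Sigma> p R \<longleftrightarrow>
     (\<exists>f. strict_mono_on (Field (arrows D)) f \<and>
        R = map_prod f f ` arrows D \<and>
        (\<forall>(s, t) \<in> arrows D. positive D s t \<longleftrightarrow> crosses_right_to_left \<Sigma> p (f s) (f t)))"

definition realized_on_closed_surface :: "diagram \<Rightarrow> nat \<Rightarrow> bool" where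
  "realized_on_closed_surface D g \<longleftrightarrow>
     (\<exists>\<Sigma> p R. has_genus \<Sigma> g \<and> based_closed_curve \<Sigma> p \<and> over_under \<Sigma> p R \<and>
        same_crossings D \<Sigma> p R)"

definition realized_on_two_holed_surface :: "diagram \<Rightarrow> nat \<Rightarrow> bool" where
  "realized_on_two_holed_surface D g \<longleftrightarrow>
     (\<exists>\<Sigma> B C p R. has_genus \<Sigma> g \<and> arc_between_holes \<Sigma> B C p \<and> over_under \<Sigma> p R \<and>
        same_crossings D \<Sigma> p R)"

section \<open>Supporting genera\<close>

text \<open>
  The minimum is written as an infimum of extended naturals, which is a minimum for a nonempty set
  and \<open>\<infinity>\<close> for the empty one.
\<close>

definition sg1 :: "diagram set \<Rightarrow> enat" where
  "sg1 K = Inf {enat g | g. \<exists>D \<in> K. realized_on_closed_surface D g}"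

definition sg2 :: "diagram set \<Rightarrow> enat" where
  "sg2 K = Inf {enat g | g. \<exists>D \<in> K. realized_on_two_holed_surface D g}"

definition K1 :: "nat \<Rightarrow> diagram set set" where
  "K1 g = {K \<in> long_virtual_knots. sg1 K \<le> enat g}"

definition K2 :: "nat \<Rightarrow> diagram set set" where
  "K2 g = {K \<in> long_virtual_knots. sg2 K \<le> enat g}"

end

theory Submission
  imports Defs "HOL-Library.Z2" "HOL-Complex_Analysis.Riemann_Mapping"
begin

text \<open>
  For a chord \<open>c\<close> of a Gauss diagram let the loop of \<open>c\<close> be the part of the curve between the two visits
  of the crossing. On a surface that realizes the diagram, the intersection numbers modulo 2 of the
  loop of \<open>c\<close> with the curve and with the loop of \<open>d\<close> are \<open>par c\<close> and \<open>lk c d\<close>, which can be read off from the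
  diagram. Hence \<open>par = 0\<close> on a closed sphere and \<open>lk = 0\<close> on a sphere with two holes; on a closed
  torus any three classes are linearly dependent.

  Call a crossing odd if \<open>par = 1\<close>. The signed number of odd crossings with the over
  passage first, the total \<open>lk\<close> between those and the odd crossings with the under passage first, and the signed number
  of the former that have even total \<open>lk\<close> with either class, are invariants of long virtual knots. They detect
  the three differences, and three families of diagrams on explicit surfaces have infinitely many values of them.

  Every Gauss diagram comes from a plane curve: in a thrackle-like zigzag any two nonadjacent edges cross, so it
  suffices to choose which double points are real.
\<close>

section \<open>Double points and winding numbers\<close>

text \<open>Capping the holes turns the arc into a path that is no cycle, while the loops of its
  crossings remain cycles. So holes release \<open>par\<close>, and only more genus releases
  \<open>lk\<close>. For the same reason the curve itself, seen by a crossing of odd parity,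
  supplies the third independent class that a closed torus cannot hold. A single value of
  \<open>lk\<close> is no invariant, because the second Reidemeister move creates and deletes
  crossings. It does so in pairs that agree in parity, in type and in \<open>lk\<close> with the
  others, hence sums over all odd crossings of one type survive; the opposite signs make a pair
  cancel in the integer counts, which are what takes infinitely many values. A kink is an even
  crossing, so the restriction to odd ones deals with the first move. The two types, over first and
  under first, make sense because a long knot has a beginning. The third move only involves
  triangles that fit into a disk: orders and signs are tied by a relation on which the invariance of
  \<open>lk\<close> rests, and this relation is the reason for the winding numbers.\<close>

lemma det2_add_right: "det2 v (x + y) = det2 v x + det2 v y"
  by (simp add: det2_def algebra_simps)

lemma det2_diff_right: "det2 v (x - y) = det2 v x - det2 v y"
  by (simp add: det2_def algebra_simps)

lemma det2_scaleR_right: "det2 v (r *\<^sub>R x) = r * det2 v x"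
  by (simp add: det2_def algebra_simps)

lemma det2_swap: "det2 v w = - det2 w v"
  by (simp add: det2_def)

lemma abs_det2_le: "\<bar>det2 v w\<bar> \<le> norm v * norm w"
proof -
  have "det2 v w = Im (cnj v * w)" by (simp add: det2_def)
  also have "\<bar>\<dots>\<bar> \<le> norm (cnj v * w)" by (rule abs_Im_le_cmod)
  finally show ?thesis by (simp add: norm_mult)
qed

section \<open>Jump of the winding number at a transversal crossing\<close>

text \<open>The loop \<open>exp (e u)\<close> meets the nonpositive half axis only at time
  \<open>s\<close>, where it passes from the upper to the lower half plane, so its argument grows by
  exactly one full turn. Comparison with the principal logarithm before and after \<open>s\<close>
  makes this precise.\<close>

lemma log_jump:
  fixes e :: "real \<Rightarrow> complex"
  assumes cont: "continuous_on {0..1} e" and s: "0 < s" "s < 1"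
    and closed: "exp (e 1) = exp (e 0)"
    and avoid: "\<And>u. u \<in> {0..1} \<Longrightarrow> u \<noteq> s \<Longrightarrow> exp (e u) \<notin> \<real>\<^sub>\<le>\<^sub>0"
    and at_s: "exp (e s) = -1"
    and \<delta>: "\<delta> > 0"
    and left: "\<And>u. u \<in> {0..1} \<Longrightarrow> s - \<delta> < u \<Longrightarrow> u < s \<Longrightarrow> Im (exp (e u)) > 0"
    and right: "\<And>u. u \<in> {0..1} \<Longrightarrow> s < u \<Longrightarrow> u < s + \<delta> \<Longrightarrow> Im (exp (e u)) < 0"
  shows "e 1 - e 0 = 2 * of_real pi * \<i>"
proof -
  \<comment> \<open>\<open>g\<close> is continuous off \<open>s\<close> with values in the discrete
    set of multiples of 2 pi i, hence constant on either side of \<open>s\<close>.\<close>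
  define g where "g u = e u - Ln (exp (e u))" for u
  have int: "\<exists>n::int. g u = of_int (2 * n) * pi * \<i>" if "exp (e u) \<noteq> 0" for u
  proof -
    have "exp (g u) = 1" unfolding g_def by (simp add: exp_diff)
    then show ?thesis by (simp add: exp_eq_1) (simp add: complex_eq_iff)
  qed
  have const: "\<exists>n::int. \<forall>u\<in>A. g u = of_int (2 * n) * pi * \<i>"
    if A: "A \<subseteq> {0..1} - {s}" "connected A" for A
  proof -
    have cg: "continuous_on A g"
      unfolding g_def using A(1)
      by (intro continuous_intros continuous_on_subset[OF cont] avoid) (auto dest: subsetD)
    have "\<exists>e>0. \<forall>y. y \<in> A \<and> g y \<noteq> g x \<longrightarrow> e \<le> norm (g y - g x)" if "x \<in> A" for x
    proof (intro exI[of _ 1] conjI allI impI)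
      fix y assume y: "y \<in> A \<and> g y \<noteq> g x"
      obtain n m :: int where nm: "g x = of_int (2 * n) * pi * \<i>" "g y = of_int (2 * m) * pi * \<i>"
        using int by (meson exp_not_eq_zero)
      have "n \<noteq> m" using y nm by auto
      have "g y - g x = of_int (2 * (m - n)) * pi * \<i>" by (simp add: nm algebra_simps)
      then have "norm (g y - g x) = norm (complex_of_int (2 * (m - n))) * pi" by (simp add: norm_mult)
      then have "norm (g y - g x) = 2 * \<bar>of_int (m - n)\<bar> * pi"
        unfolding norm_of_int by (simp only: of_int_mult abs_mult abs_numeral of_int_numeral)
      moreover have "1 \<le> \<bar>m - n\<bar>" using \<open>n \<noteq> m\<close> by linarith
      then have "1 \<le> \<bar>real_of_int (m - n)\<bar>" by linarith
      then have "2 * 1 * pi \<le> 2 * \<bar>real_of_int (m - n)\<bar> * pi" 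
        by (intro mult_right_mono mult_left_mono) auto
      ultimately show "1 \<le> norm (g y - g x)" using pi_gt3 by linarith
    qed simp
    then have "g constant_on A"
      by (intro continuous_discrete_range_constant[OF A(2) cg]) auto
    then obtain z where z: "\<And>u. u \<in> A \<Longrightarrow> g u = z" unfolding constant_on_def by blast
    show ?thesis
    proof (cases "A = {}")
      case False
      then obtain u where "u \<in> A" by blast
      then show ?thesis using z int[of u] by auto
    qed simp
  qed
  obtain n1 :: int where n1: "\<And>u. u \<in> {0..<s} \<Longrightarrow> g u = of_int (2 * n1) * pi * \<i>"
    using const[of "{0..<s}"] s by fastforce
  obtain n2 :: int where n2: "\<And>u. u \<in> {s<..1} \<Longrightarrow> g u = of_int (2 * n2) * pi * \<i>"
    using const[of "{s<..1}"] s by fastforce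
  have diff: "e 1 - e 0 = of_int (2 * (n2 - n1)) * pi * \<i>"
    using n1[of 0] n2[of 1] s closed by (simp add: g_def algebra_simps)
  have Ime: "isCont (\<lambda>u. Im (e u)) s"
    using cont s by (intro continuous_intros continuous_on_interior[of "{0..1}"]) auto
  then have tl: "((\<lambda>u. Im (e u)) \<longlongrightarrow> Im (e s)) (at_left s)" 
    and tr: "((\<lambda>u. Im (e u)) \<longlongrightarrow> Im (e s)) (at_right s)"
    by (simp_all add: isCont_def filterlim_at_split)
  have l: "2 * pi * n1 < Im (e u) \<and> Im (e u) < 2 * pi * n1 + pi"
    if u: "u \<in> {max 0 (s - \<delta>)<..<s}" for u
  proof -
    have "Im (exp (e u)) > 0" using left[of u] u s by auto
    then have "0 < Im (Ln (exp (e u)))" "Im (Ln (exp (e u))) < pi"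
      using Im_Ln_pos_lt_imp Im_Ln_pos_lt[of "exp (e u)"] by auto
    moreover have "Im (g u) = 2 * pi * n1" using n1[of u] u by simp
    ultimately show ?thesis by (simp add: g_def)
  qed
  have r: "2 * pi * n2 - pi < Im (e u) \<and> Im (e u) < 2 * pi * n2"
    if u: "u \<in> {s<..<min 1 (s + \<delta>)}" for u
  proof -
    have im: "Im (exp (e u)) < 0" using right[of u] u s by auto
    then have "Im (Ln (exp (e u))) < 0"
      using Im_Ln_pos_le[of "exp (e u)"] by (metis exp_not_eq_zero mpi_less_Im_Ln Im_Ln_le_pi linorder_not_less)
    moreover have "Im (g u) = 2 * pi * n2" using n2[of u] u by simp
    moreover have "- pi < Im (Ln (exp (e u)))" by (simp add: mpi_less_Im_Ln)
    ultimately show ?thesis by (simp add: g_def)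
  qed
  have evl: "eventually (\<lambda>u. u \<in> {max 0 (s - \<delta>)<..<s}) (at_left s)"
    using s \<delta> by (intro eventually_at_leftI[of "max 0 (s - \<delta>)"]) auto
  have evr: "eventually (\<lambda>u. u \<in> {s<..<min 1 (s + \<delta>)}) (at_right s)"
    using s \<delta> by (intro eventually_at_rightI[of _ "min 1 (s + \<delta>)"]) auto
  have b1: "2 * pi * n1 \<le> Im (e s)" "Im (e s) \<le> 2 * pi * n1 + pi"
    by (rule tendsto_lowerbound[OF tl], rule eventually_mono[OF evl], use l in force, simp)
       (rule tendsto_upperbound[OF tl], rule eventually_mono[OF evl], use l in force, simp)
  have b2: "2 * pi * n2 - pi \<le> Im (e s)" "Im (e s) \<le> 2 * pi * n2"
    by (rule tendsto_lowerbound[OF tr], rule eventually_mono[OF evr], use r in force, simp)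
       (rule tendsto_upperbound[OF tr], rule eventually_mono[OF evr], use r in force, simp)
  \<comment> \<open>The half plane conditions confine \<open>Im (e s)\<close> to a closed strip of
    height pi from either side, and these strips have a common point only for \<open>n2 = n1\<close>
    or \<open>n2 = n1 + 1\<close>. In the first case the value \<open>exp (e s)\<close> would be
    positive instead of -1.\<close>
  have "2 * pi * n1 \<le> 2 * pi * n2" "2 * pi * n2 - pi \<le> 2 * pi * n1 + pi" using b1 b2 by linarith+
  then have "n1 \<le> n2" "2 * pi * n2 \<le> 2 * pi * (n1 + 1)" by (auto simp: algebra_simps)
  then have "n1 \<le> n2" "n2 \<le> n1 + 1" by simp_all
  moreover have "n1 \<noteq> n2"
  proof
    assume "n1 = n2"
    then have "Im (e s) = 2 * pi * n1" using b1(1) b2(2) by simp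
    then have "exp (e s) = of_real (exp (Re (e s)))"
      by (simp add: complex_eq_iff Re_exp Im_exp mult.assoc) (metis cos_int_2pin sin_int_2pin mult.commute mult.left_commute)
    then have "Re (exp (e s)) > 0" by simp
    then show False using at_s by simp
  qed
  ultimately have "n2 = n1 + 1" by linarith
  then show ?thesis using diff by simp
qed

text \<open>Up to the factor 2 pi i, the difference of the two winding numbers is the total change
  of a logarithm of \<open>(c u - c s - \<zeta>) / (c u - c s + \<zeta>)\<close>. This quotient is a
  nonpositive real only if \<open>c u - c s\<close> lies on the segment from
  \<open>- \<zeta>\<close> to \<open>\<zeta>\<close>, which happens at \<open>u = s\<close> alone,
  and its imaginary part has the sign of \<open>det2 \<zeta> (c u - c s)\<close>.\<close>

lemma winding_jump_sym:
  fixes c :: "real \<Rightarrow> complex"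
  assumes c: "path c" "pathfinish c = pathstart c" and s: "0 < s" "s < 1"
    and z: "c s + \<zeta> \<notin> path_image c" "c s - \<zeta> \<notin> path_image c"
    and away: "\<And>u. u \<in> {0..1} \<Longrightarrow> u \<noteq> s \<Longrightarrow> norm (c u - c s) \<le> norm \<zeta> \<Longrightarrow> det2 \<zeta> (c u - c s) \<noteq> 0"
    and \<delta>: "\<delta> > 0"
    and left: "\<And>u. u \<in> {0..1} \<Longrightarrow> s - \<delta> < u \<Longrightarrow> u < s \<Longrightarrow> det2 \<zeta> (c u - c s) > 0"
    and right: "\<And>u. u \<in> {0..1} \<Longrightarrow> s < u \<Longrightarrow> u < s + \<delta> \<Longrightarrow> det2 \<zeta> (c u - c s) < 0"
  shows "winding_number c (c s + \<zeta>) = winding_number c (c s - \<zeta>) + 1"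
proof -
  obtain p1 where p1: "path p1" "pathfinish p1 - pathstart p1 = 2 * of_real pi * \<i> * winding_number c (c s + \<zeta>)"
    "\<And>t. t \<in> {0..1} \<Longrightarrow> c t = c s + \<zeta> + exp (p1 t)"
    using winding_number_as_continuous_log[OF c(1) z(1)] by metis
  obtain p2 where p2: "path p2" "pathfinish p2 - pathstart p2 = 2 * of_real pi * \<i> * winding_number c (c s - \<zeta>)"
    "\<And>t. t \<in> {0..1} \<Longrightarrow> c t = c s - \<zeta> + exp (p2 t)"
    using winding_number_as_continuous_log[OF c(1) z(2)] by metis
  define e where "e u = p1 u - p2 u" for u
  have nz: "\<zeta> \<noteq> 0" using z(1) s unfolding path_image_def by (auto simp: image_iff)
  have E: "exp (e u) = (c u - c s - \<zeta>) / (c u - c s + \<zeta>)" and E0: "c u - c s + \<zeta> \<noteq> 0" "c u - c s - \<zeta> \<noteq> 0"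
    if "u \<in> {0..1}" for u
  proof -
    have 1: "exp (p1 u) = c u - c s - \<zeta>" and 2: "exp (p2 u) = c u - c s + \<zeta>"
      using p1(3)[OF that] p2(3)[OF that] by (simp_all add: algebra_simps)
    show "exp (e u) = (c u - c s - \<zeta>) / (c u - c s + \<zeta>)" by (simp add: e_def exp_diff 1 2)
    show "c u - c s + \<zeta> \<noteq> 0" "c u - c s - \<zeta> \<noteq> 0" using 1 2 exp_not_eq_zero by metis+
  qed
  have ImE: "Im (exp (e u)) = 2 * det2 \<zeta> (c u - c s) / (cmod (c u - c s + \<zeta>))\<^sup>2"
    if "u \<in> {0..1}" for u
  proof -
    define y where "y = c u - c s"
    have "Im ((y - \<zeta>) / (y + \<zeta>)) = Im ((y - \<zeta>) * cnj (y + \<zeta>)) / (cmod (y + \<zeta>))\<^sup>2"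
      by (subst complex_div_cnj) (simp flip: of_real_power)
    also have "Im ((y - \<zeta>) * cnj (y + \<zeta>)) = 2 * det2 \<zeta> y" by (simp add: det2_def algebra_simps)
    finally show ?thesis using E[OF that] by (simp add: y_def)
  qed
  have sgnE: "0 < Im (exp (e u)) \<longleftrightarrow> 0 < det2 \<zeta> (c u - c s)" "Im (exp (e u)) < 0 \<longleftrightarrow> det2 \<zeta> (c u - c s) < 0"
    if "u \<in> {0..1}" for u
    using E0[OF that] by (simp_all add: ImE[OF that] zero_less_divide_iff divide_less_0_iff)
  have "e 1 - e 0 = 2 * of_real pi * \<i>"
  proof (rule log_jump[OF _ s])
    show "continuous_on {0..1} e" unfolding e_def using p1(1) p2(1) by (intro continuous_intros) (auto simp: path_def)
    show "exp (e 1) = exp (e 0)" using c(2) by (simp add: E pathfinish_def pathstart_def)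
    show "exp (e s) = -1" using E[of s] s nz by (simp add: divide_eq_eq)
    show "Im (exp (e u)) > 0" if "u \<in> {0..1}" "s - \<delta> < u" "u < s" for u
      using left[OF that] sgnE(1)[OF that(1)] by simp
    show "Im (exp (e u)) < 0" if "u \<in> {0..1}" "s < u" "u < s + \<delta>" for u
      using right[OF that] sgnE(2)[OF that(1)] by simp
    show "exp (e u) \<notin> \<real>\<^sub>\<le>\<^sub>0" if u: "u \<in> {0..1}" "u \<noteq> s" for u
    proof
      assume neg: "exp (e u) \<in> \<real>\<^sub>\<le>\<^sub>0"
      then obtain x where x: "exp (e u) = of_real x" "x \<le> 0" by (auto elim: nonpos_Reals_cases)
      define y where "y = c u - c s"
      have "y - \<zeta> = of_real x * (y + \<zeta>)" using E[OF u(1)] E0[OF u(1)] x(1) by (simp add: y_def field_simps)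
      then have "of_real (1 - x) * y = of_real (1 + x) * \<zeta>" by (simp add: algebra_simps)
      then have "cmod (of_real (1 - x) * y) = cmod (of_real (1 + x) * \<zeta>)" by simp
      then have n: "(1 - x) * cmod y = \<bar>1 + x\<bar> * cmod \<zeta>" using x(2) by (simp only: norm_mult norm_of_real)
      also have "\<dots> \<le> (1 - x) * cmod \<zeta>" using x(2) by (intro mult_right_mono) auto
      finally have "cmod y \<le> cmod \<zeta>" using x(2) by (simp add: mult_le_cancel_left)
      moreover have "det2 \<zeta> y = 0"
        using ImE[OF u(1)] E0[OF u(1)] x(1) by (simp add: y_def)
      ultimately show False using away[OF u] by (simp add: y_def)
    qed
  qed (use \<delta> in auto)
  moreover have "e 1 - e 0 = 2 * of_real pi * \<i> * (winding_number c (c s + \<zeta>) - winding_number c (c s - \<zeta>))"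
    using p1(2) p2(2) by (simp add: e_def pathfinish_def pathstart_def algebra_simps)
  ultimately have "2 * of_real pi * \<i> * (winding_number c (c s + \<zeta>) - winding_number c (c s - \<zeta>)) = 2 * of_real pi * \<i> * 1" by simp
  then have "winding_number c (c s + \<zeta>) - winding_number c (c s - \<zeta>) = 1"
    by (subst (asm) mult_left_cancel) auto
  then show ?thesis by (simp add: algebra_simps)
qed


lemma det2_scaleR_left: "det2 (r *\<^sub>R v) w = r * det2 v w"
  by (simp add: det2_def algebra_simps)

lemma det2_self [simp]: "det2 v v = 0"
  by (simp add: det2_def)

lemma has_vector_derivative_approx:
  assumes "(f has_vector_derivative v) (at s)" "e > 0"
  obtains d where "d > 0" "\<And>u. \<bar>u - s\<bar> < d \<Longrightarrow> norm (f u - f s - (u - s) *\<^sub>R v) \<le> e * \<bar>u - s\<bar>"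
  using assms unfolding has_vector_derivative_def has_derivative_at_alt
  by (metis real_norm_def)

text \<open>The directions well to the left of \<open>v\<close>. Convexity is wanted for
  connectedness, since the winding number is constant on connected sets off the curve.\<close>

lemma convex_det2_cone:
  assumes "k \<ge> 0"
  shows "convex {z. k * norm z < det2 v z}"
proof (rule convexI)
  fix x y :: complex and a b :: real
  assume xy: "x \<in> {z. k * norm z < det2 v z}" "y \<in> {z. k * norm z < det2 v z}"
    and ab: "0 \<le> a" "0 \<le> b" "a + b = 1"
  have "k * norm (a *\<^sub>R x + b *\<^sub>R y) \<le> k * (a * norm x + b * norm y)"
    using ab assms by (intro mult_left_mono norm_triangle_le) auto
  also have "\<dots> = a * (k * norm x) + b * (k * norm y)" by (simp add: algebra_simps)
  also have "\<dots> < a * det2 v x + b * det2 v y"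
  proof (cases "a = 0")
    case False
    then have "a * (k * norm x) < a * det2 v x" using xy ab by simp
    moreover have "b * (k * norm y) \<le> b * det2 v y" using xy ab by (intro mult_left_mono) auto
    ultimately show ?thesis by linarith
  qed (use xy ab in auto)
  finally show "a *\<^sub>R x + b *\<^sub>R y \<in> {z. k * norm z < det2 v z}"
    by (simp add: det2_add_right det2_scaleR_right)
qed

text \<open>Derivatives exist only at the two times of the crossing, so neither curve is straight or
  even injective nearby by assumption. Near the crossing \<open>c\<close> stays outside the cones
  \<open>U\<close> and \<open>V\<close> to the left and to the right of its tangent, whereas
  \<open>\<eta>\<close> comes from \<open>V\<close> and enters \<open>U\<close>. The winding number
  is constant on each cone and can be compared at two symmetric points on the tangent of
  \<open>\<eta>\<close>.\<close>

lemma winding_number_jump: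
  fixes c \<eta> :: "real \<Rightarrow> complex"
  assumes c: "path c" "pathfinish c = pathstart c" and s: "0 < s" "s < 1"
    and dc: "(c has_vector_derivative v) (at s)"
    and uniq: "\<And>u. u \<in> {0..1} \<Longrightarrow> c u = c s \<Longrightarrow> u = s"
    and de: "(\<eta> has_vector_derivative w) (at t)" and meet: "\<eta> t = c s"
    and pos: "det2 v w > 0"
  shows "\<exists>\<delta>>0. \<forall>\<epsilon>. 0 < \<epsilon> \<and> \<epsilon> < \<delta> \<longrightarrow> \<eta> (t + \<epsilon>) \<notin> path_image c \<and> \<eta> (t - \<epsilon>) \<notin> path_image c \<and>
           winding_number c (\<eta> (t + \<epsilon>)) = winding_number c (\<eta> (t - \<epsilon>)) + 1"
proof -
  define P where "P = c s"
  have vw: "norm v > 0" "norm w > 0" using pos by (auto simp: det2_def)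
  \<comment> \<open>With this \<open>k\<close> one has \<open>det2 v w = 2 * k * norm w\<close>, so
    the direction \<open>w\<close> lies in the cone \<open>k * norm z < det2 v z\<close> with a
    margin of one half.\<close>
  define k where "k = det2 v w / (2 * norm w)"
  have k: "k > 0" using pos vw by (simp add: k_def)
  \<comment> \<open>The solution of \<open>norm v * \<mu> = k * (norm v - \<mu>)\<close>: a relative
    error \<open>\<mu>\<close> in the linear approximation still leaves \<open>c\<close> outside the
    cones.\<close>
  define \<mu> where "\<mu> = k * norm v / (norm v + k)"
  have nk: "norm v + k > 0" using k vw by (intro add_pos_pos)
  have \<mu>: "\<mu> > 0" "\<mu> \<le> k" "norm v * \<mu> = k * (norm v - \<mu>)"
  proof -
    have e: "\<mu> * (norm v + k) = k * norm v" using nk by (simp add: \<mu>_def)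
    then show "norm v * \<mu> = k * (norm v - \<mu>)" by (simp add: algebra_simps)
    show "\<mu> > 0" using k vw nk by (simp add: \<mu>_def)
    have "k * norm v \<le> k * (norm v + k)" using k by (intro mult_left_mono) auto
    then show "\<mu> \<le> k" using nk by (simp add: \<mu>_def pos_divide_le_eq)
  qed
  obtain d where d: "d > 0" "\<And>u. \<bar>u - s\<bar> < d \<Longrightarrow> norm (c u - P - (u - s) *\<^sub>R v) \<le> \<mu> * \<bar>u - s\<bar>"
    using has_vector_derivative_approx[OF dc \<mu>(1)] P_def by metis
  have near: "\<bar>det2 v (c u - P)\<bar> \<le> k * norm (c u - P)"
    and near2: "u < s \<Longrightarrow> det2 w (c u - P) > 0" "s < u \<Longrightarrow> det2 w (c u - P) < 0"
    if u: "\<bar>u - s\<bar> < d" for u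
  proof -
    define r where "r = c u - P - (u - s) *\<^sub>R v"
    have r: "norm r \<le> \<mu> * \<bar>u - s\<bar>" using d(2)[OF u] by (simp add: r_def)
    have y: "c u - P = (u - s) *\<^sub>R v + r" by (simp add: r_def)
    have "\<bar>det2 v (c u - P)\<bar> = \<bar>det2 v r\<bar>" by (simp add: y det2_add_right det2_scaleR_right)
    also have "\<dots> \<le> norm v * (\<mu> * \<bar>u - s\<bar>)"
      using abs_det2_le[of v r] mult_left_mono[OF r norm_ge_zero[of v]] by linarith
    also have "\<dots> = k * ((norm v - \<mu>) * \<bar>u - s\<bar>)" using \<mu>(3) by (simp add: mult.assoc[symmetric])
    also have "\<dots> \<le> k * norm (c u - P)"
    proof (rule mult_left_mono)
      have "norm ((u - s) *\<^sub>R v) \<le> norm (c u - P) + norm r"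
        unfolding y using norm_triangle_ineq4[of "(u - s) *\<^sub>R v + r" r] by simp
      then have "\<bar>u - s\<bar> * norm v \<le> norm (c u - P) + norm r" by (simp only: norm_scaleR)
      then show "(norm v - \<mu>) * \<bar>u - s\<bar> \<le> norm (c u - P)" using r by (simp add: algebra_simps)
    qed (use k in simp)
    finally show "\<bar>det2 v (c u - P)\<bar> \<le> k * norm (c u - P)" .
    have e: "det2 w (c u - P) = - (u - s) * det2 v w + det2 w r"
      by (simp add: y det2_add_right det2_scaleR_right det2_swap[of w v] left_diff_distrib)
    have "\<bar>det2 w r\<bar> \<le> norm w * (\<mu> * \<bar>u - s\<bar>)"
      using abs_det2_le[of w r] mult_left_mono[OF r norm_ge_zero[of w]] by linarith
    also have "\<dots> \<le> norm w * (k * \<bar>u - s\<bar>)" using \<mu>(2) by (intro mult_left_mono mult_right_mono) auto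
    also have "\<dots> = \<bar>u - s\<bar> * det2 v w / 2" using vw by (simp add: k_def)
    finally have b: "\<bar>det2 w r\<bar> \<le> \<bar>u - s\<bar> * det2 v w / 2" .
    show "det2 w (c u - P) > 0" if "u < s"
    proof -
      have "(s - u) * det2 v w > 0" using that pos by simp
      then show ?thesis using b that e by (simp add: algebra_simps)
    qed
    show "det2 w (c u - P) < 0" if "s < u"
    proof -
      have "(u - s) * det2 v w > 0" using that pos by simp
      then show ?thesis using b that e by (simp add: algebra_simps)
    qed
  qed
  \<comment> \<open>The part of \<open>c\<close> away from time \<open>s\<close> is compact and
    misses the crossing, so a whole ball of radius \<open>\<rho>\<close> is free of it.\<close>
  define K where "K = c ` ({0..1} - {s - d<..<s + d})"
  have "compact K" unfolding K_def using c(1)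
    by (intro compact_continuous_image compact_diff) (auto simp: path_def intro: continuous_on_subset)
  moreover have "P \<notin> K" using uniq d(1) by (force simp: K_def P_def)
  ultimately obtain \<rho> where \<rho>: "\<rho> > 0" "\<And>z. z \<in> K \<Longrightarrow> \<rho> \<le> dist P z"
    using separate_point_closed[of K P] compact_imp_closed by blast
  define U where "U = ball P \<rho> \<inter> (\<lambda>z. P + z) ` {z. k * norm z < det2 v z}"
  define V where "V = ball P \<rho> \<inter> (\<lambda>z. P + z) ` {z. k * norm z < det2 (-v) z}"
  have detm: "det2 (-v) z = - det2 v z" for z by (simp add: det2_def)
  have UV: "connected U" "connected V" unfolding U_def V_def
    using k by (auto intro!: convex_connected convex_Int convex_translation convex_det2_cone)
  have disj: "z \<notin> path_image c" if z: "z \<in> ball P \<rho>" "k * norm (z - P) < \<bar>det2 v (z - P)\<bar>" for z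
  proof
    assume "z \<in> path_image c"
    then obtain u where u: "u \<in> {0..1}" "z = c u" by (auto simp: path_image_def)
    show False
    proof (cases "\<bar>u - s\<bar> < d")
      case True
      then show ?thesis using near z(2) u by fastforce
    next
      case False
      then have "z \<in> K" using u unfolding K_def by (auto intro!: imageI)
      then show ?thesis using \<rho>(2) z(1) by fastforce
    qed
  qed
  have dU: "U \<inter> path_image c = {}" "V \<inter> path_image c = {}"
    using disj by (fastforce simp: U_def V_def detm)+
  define \<zeta> where "\<zeta> = (\<rho> / (2 * norm w)) *\<^sub>R w"
  have n\<zeta>: "norm \<zeta> = \<rho> / 2" using vw \<rho> by (simp add: \<zeta>_def)
  have det\<zeta>: "det2 v \<zeta> = \<rho> * k" by (simp add: \<zeta>_def det2_scaleR_right k_def)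
  have \<zeta>U: "P + \<zeta> \<in> U" "P - \<zeta> \<in> V"
    using n\<zeta> det\<zeta> \<rho>(1) k by (auto simp: U_def V_def detm dist_norm image_iff det2_diff_right
       intro!: exI[of _ "\<zeta>"] exI[of _ "-\<zeta>"]) (simp add: det2_def algebra_simps)
  have sgn: "det2 \<zeta> y = \<rho> / (2 * norm w) * det2 w y" for y by (simp add: \<zeta>_def det2_scaleR_left)
  have main: "winding_number c (P + \<zeta>) = winding_number c (P - \<zeta>) + 1"
    unfolding P_def
  proof (rule winding_jump_sym[OF c s])
    show "c s + \<zeta> \<notin> path_image c" "c s - \<zeta> \<notin> path_image c" using dU \<zeta>U by (auto simp: P_def)
    show "d > 0" by fact
    show "det2 \<zeta> (c u - c s) > 0" if "s - d < u" "u < s" for u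
      using near2(1)[of u] that vw \<rho> by (simp add: sgn P_def)
    show "det2 \<zeta> (c u - c s) < 0" if "s < u" "u < s + d" for u
      using near2(2)[of u] that vw \<rho> by (simp add: sgn P_def mult_less_0_iff divide_less_0_iff)
    show "det2 \<zeta> (c u - c s) \<noteq> 0" if u: "u \<in> {0..1}" "u \<noteq> s" "norm (c u - c s) \<le> norm \<zeta>" for u
    proof (cases "\<bar>u - s\<bar> < d")
      case True
      then show ?thesis using near2[of u] u(2) vw \<rho> by (force simp: sgn P_def neq_iff)
    next
      case False
      then have "c u \<in> K" using u unfolding K_def by (auto intro!: imageI)
      then have "\<rho> \<le> norm (c u - c s)" using \<rho>(2) by (metis P_def dist_commute dist_norm)
      then show ?thesis using u(3) n\<zeta> \<rho>(1) by simp
    qed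
  qed
  \<comment> \<open>The cone condition costs \<open>k * norm w\<close>, which is half of
    \<open>det2 v w\<close>; the approximation errors of \<open>\<eta>\<close> add a quarter by this
    choice, and three quarters stay below the whole.\<close>
  define e where "e = det2 v w / 4 / (norm v + k)"
  have e: "e > 0" "(norm v + k) * e = det2 v w / 4"
  proof -
    have *: "0 < q \<Longrightarrow> e = det2 v w / 4 / q \<Longrightarrow> 0 < e \<and> q * e = det2 v w / 4" for q using pos by simp
    show "e > 0" "(norm v + k) * e = det2 v w / 4" using *[OF nk e_def] by blast+
  qed
  obtain d' where d': "d' > 0" "\<And>u. \<bar>u - t\<bar> < d' \<Longrightarrow> norm (\<eta> u - P - (u - t) *\<^sub>R w) \<le> e * \<bar>u - t\<bar>"
    using has_vector_derivative_approx[OF de e(1)] P_def meet by metis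
  define \<delta> where "\<delta> = min d' (\<rho> / (norm w + e))"
  have \<delta>: "\<delta> > 0" using d' \<rho> e vw by (simp add: \<delta>_def add_pos_pos)
  have cone: "\<eta> u \<in> ball P \<rho> \<and> k * norm (\<eta> u - P) < sgn (u - t) * det2 v (\<eta> u - P)"
    if u: "u \<noteq> t" "\<bar>u - t\<bar> < \<delta>" for u
  proof -
    define r where "r = \<eta> u - P - (u - t) *\<^sub>R w"
    have r: "norm r \<le> e * \<bar>u - t\<bar>" using d'(2)[of u] u by (simp add: r_def \<delta>_def)
    have y: "\<eta> u - P = (u - t) *\<^sub>R w + r" by (simp add: r_def)
    have ny: "norm (\<eta> u - P) \<le> (norm w + e) * \<bar>u - t\<bar>"
    proof -
      have "norm (\<eta> u - P) \<le> \<bar>u - t\<bar> * norm w + norm r"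
        unfolding y using norm_triangle_ineq[of "(u - t) *\<^sub>R w" r] by (simp only: norm_scaleR)
      then show ?thesis using r by (simp add: algebra_simps)
    qed
    also have "\<dots> < (norm w + e) * (\<rho> / (norm w + e))"
      using u e vw by (intro mult_strict_left_mono) (auto simp: \<delta>_def add_pos_pos)
    also have "\<dots> = \<rho>" using e vw by (simp add: add_pos_pos less_imp_neq[symmetric])
    finally have 1: "\<eta> u \<in> ball P \<rho>" by (simp add: dist_norm norm_minus_commute)
    have "sgn (u - t) * det2 v (\<eta> u - P) = \<bar>u - t\<bar> * det2 v w + sgn (u - t) * det2 v r"
      unfolding y det2_add_right det2_scaleR_right abs_sgn by (simp only: algebra_simps)
    moreover have "\<bar>sgn (u - t) * det2 v r\<bar> \<le> norm v * (e * \<bar>u - t\<bar>)"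
      using abs_det2_le[of v r] mult_left_mono[OF r norm_ge_zero[of v]] u by (simp add: abs_mult)
    ultimately have "\<bar>u - t\<bar> * det2 v w - norm v * (e * \<bar>u - t\<bar>) \<le> sgn (u - t) * det2 v (\<eta> u - P)"
      by linarith
    moreover have "k * norm (\<eta> u - P) \<le> k * ((norm w + e) * \<bar>u - t\<bar>)"
      using ny k by (intro mult_left_mono) auto
    moreover have "k * ((norm w + e) * \<bar>u - t\<bar>) + norm v * (e * \<bar>u - t\<bar>) = \<bar>u - t\<bar> * (det2 v w * (3 / 4))"
    proof -
      have "k * ((norm w + e) * \<bar>u - t\<bar>) + norm v * (e * \<bar>u - t\<bar>)
        = \<bar>u - t\<bar> * (k * norm w + (norm v + k) * e)"
        by (simp add: algebra_simps)
      also have "k * norm w + (norm v + k) * e = det2 v w * (3 / 4)" unfolding e(2) using vw by (simp add: k_def)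
      finally show ?thesis .
    qed
    moreover have "\<bar>u - t\<bar> * (det2 v w * (3 / 4)) < \<bar>u - t\<bar> * det2 v w" using u pos by simp
    ultimately have "k * norm (\<eta> u - P) < sgn (u - t) * det2 v (\<eta> u - P)" by linarith
    with 1 show ?thesis by blast
  qed
  show ?thesis
  proof (intro exI[of _ \<delta>] conjI allI impI \<delta>)
    fix \<epsilon> assume \<epsilon>: "0 < \<epsilon> \<and> \<epsilon> < \<delta>"
    have *: "z \<in> (\<lambda>z. P + z) ` {z. k * norm z < det2 w z}" if "k * norm (z - P) < det2 w (z - P)" for w z
      using that by (intro image_eqI[of _ _ "z - P"]) simp_all
    have inU: "\<eta> (t + \<epsilon>) \<in> U" and inV: "\<eta> (t - \<epsilon>) \<in> V"
      using cone[of "t + \<epsilon>"] cone[of "t - \<epsilon>"] \<epsilon> *[of "\<eta> (t + \<epsilon>)" v] *[of "\<eta> (t - \<epsilon>)" "-v"]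
      unfolding U_def V_def by (simp_all add: detm)
    show "\<eta> (t + \<epsilon>) \<notin> path_image c" "\<eta> (t - \<epsilon>) \<notin> path_image c" using inU inV dU by auto
    have "winding_number c constant_on U" "winding_number c constant_on V"
      using c UV dU by (auto intro: winding_number_constant)
    then have "winding_number c (\<eta> (t + \<epsilon>)) = winding_number c (P + \<zeta>)"
      "winding_number c (\<eta> (t - \<epsilon>)) = winding_number c (P - \<zeta>)"
      using inU inV \<zeta>U unfolding constant_on_def by metis+
    then show "winding_number c (\<eta> (t + \<epsilon>)) = winding_number c (\<eta> (t - \<epsilon>)) + 1"
      using main by simp
  qed
qed

section \<open>Sides of a crosscut and the triangle relation\<close>

text \<open>The arc is closed up by an arc in \<open>frontier \<Delta>\<close>, which is a
  topological circle. The winding number about the resulting Jordan curve takes two consecutive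
  values, and \<open>left\<close> is where it takes the larger one. A passage across the arc from
  right to left raises it by one, whatever the orientation of the Jordan curve.\<close>

lemma crosscut_sides:
  fixes \<gamma> :: "real \<Rightarrow> complex"
  assumes disk: "\<Delta> homeomorphic (cball 0 1 :: complex set)" and ab: "a < b"
    and cont: "continuous_on {a..b} \<gamma>" and inj: "inj_on \<gamma> {a..b}"
    and ends: "\<gamma> a \<in> frontier \<Delta>" "\<gamma> b \<in> frontier \<Delta>" and int: "\<gamma> ` {a<..<b} \<subseteq> interior \<Delta>"
  obtains left :: "complex \<Rightarrow> bool" where
    "\<And>S. connected S \<Longrightarrow> S \<subseteq> interior \<Delta> - \<gamma> ` {a..b} \<Longrightarrow> left constant_on S"
    "\<And>s \<eta> t v w. \<lbrakk>a < s; s < b; (\<gamma> has_vector_derivative v) (at s); (\<eta> has_vector_derivative w) (at t);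
        \<eta> t = \<gamma> s; det2 v w \<noteq> 0\<rbrakk> \<Longrightarrow>
      \<exists>\<delta>>0. \<forall>\<epsilon>. 0 < \<epsilon> \<and> \<epsilon> < \<delta> \<longrightarrow> (left (\<eta> (t + \<epsilon>)) \<longleftrightarrow> det2 v w > 0) \<and> (left (\<eta> (t - \<epsilon>)) \<longleftrightarrow> det2 v w < 0)"
proof -
  have "closed \<Delta>" using disk compact_cball homeomorphic_compactness compact_imp_closed by blast
  then have "frontier \<Delta> homeomorphic frontier (cball 0 1 :: complex set)"
    using ab int by (intro homeomorphic_frontiers disk) auto
  moreover have "path_connected (frontier (cball 0 1 :: complex set))"
    by (simp add: path_connected_sphere)
  ultimately have "path_connected (frontier \<Delta>)"
    using homeomorphic_path_connectedness by blast
  moreover have "\<gamma> b \<noteq> \<gamma> a" using inj ab by (auto dest: inj_onD)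
  ultimately obtain g where g: "arc g" "path_image g \<subseteq> frontier \<Delta>" "pathstart g = \<gamma> b" "pathfinish g = \<gamma> a"
    using ends unfolding path_connected_arcwise by meson
  define f where "f x = \<gamma> (a + x * (b - a))" for x
  have range: "(\<lambda>x. a + x * (b - a)) ` {0..1} = {a..b}"
    using ab by (auto simp: image_affinity_atLeastAtMost mult.commute[of _ "b - a"] add.commute[of a])
  have f: "arc f" "path_image f = \<gamma> ` {a..b}" "pathstart f = \<gamma> a" "pathfinish f = \<gamma> b"
  proof -
    show im: "path_image f = \<gamma> ` {a..b}" unfolding path_image_def f_def using range by (metis image_image)
    have "path f" unfolding path_def f_def using range
      by (intro continuous_on_compose2[OF cont] continuous_intros) auto
    moreover have "inj_on f {0..1}"
    proof (rule inj_onI)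
      fix x y assume xy: "x \<in> {0..1}" "y \<in> {0..1}" "f x = f y"
      then have "a + x * (b - a) = a + y * (b - a)"
        using range by (intro inj_onD[OF inj]) (simp add: f_def, blast+)
      then show "x = y" using ab by simp
    qed
    ultimately show "arc f" by (simp add: arc_def)
  qed (simp_all add: pathstart_def pathfinish_def f_def)
  have arc_int: "\<gamma> ` {a..b} \<inter> frontier \<Delta> \<subseteq> {\<gamma> a, \<gamma> b}"
  proof
    fix z assume z: "z \<in> \<gamma> ` {a..b} \<inter> frontier \<Delta>"
    then obtain u where u: "u \<in> {a..b}" "z = \<gamma> u" by auto
    have "\<gamma> u \<notin> interior \<Delta>" using z u(2) by (auto simp: frontier_def)
    then have "u \<notin> {a<..<b}" using int by blast
    then show "z \<in> {\<gamma> a, \<gamma> b}" using u by (auto simp: less_le)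
  qed
  define c where "c = f +++ g"
  have simple: "simple_path c" unfolding c_def
    using f g arc_int by (intro simple_path_join_loop) auto
  have c: "path c" "pathfinish c = pathstart c" "path_image c = \<gamma> ` {a..b} \<union> path_image g"
    using simple f g by (auto simp: c_def simple_path_imp_path path_image_join)
  \<comment> \<open>The value is 0 outside and either 1 or -1 inside; \<open>m\<close> is the
    smaller of the two.\<close>
  obtain m where m: "\<And>z. z \<notin> path_image c \<Longrightarrow> winding_number c z = m \<or> winding_number c z = m + 1"
  proof -
    have out: "winding_number c z = 0" if "z \<notin> path_image c" "z \<notin> inside (path_image c)" for z
    proof -
      have "z \<in> outside (path_image c)" using that inside_Un_outside[of "path_image c"] by blast
      then show ?thesis using c winding_number_zero_in_outside by blast
    qed
    consider "\<And>z. z \<in> inside (path_image c) \<Longrightarrow> winding_number c z = 1"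
      | "\<And>z. z \<in> inside (path_image c) \<Longrightarrow> winding_number c z = -1"
      using simple_closed_path_winding_number_inside[OF simple] by blast
    then show thesis
    proof cases
      case 1
      show ?thesis by (rule that[of 0]) (use 1 out in force)
    next
      case 2
      show ?thesis by (rule that[of "-1"]) (use 2 out in force)
    qed
  qed
  define left where "left z \<longleftrightarrow> winding_number c z = m + 1" for z
  show thesis
  proof (rule that[of left])
    fix S assume S: "connected S" "S \<subseteq> interior \<Delta> - \<gamma> ` {a..b}"
    have "interior \<Delta> \<inter> frontier \<Delta> = {}" by (auto simp: frontier_def)
    then have "S \<inter> path_image c = {}" using S(2) g(2) unfolding c(3) by blast
    then have "winding_number c constant_on S" using c S by (intro winding_number_constant) auto
    then obtain w where "\<And>z. z \<in> S \<Longrightarrow> winding_number c z = w" unfolding constant_on_def by blast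
    then show "left constant_on S" unfolding constant_on_def left_def by (intro exI[of _ "w = m + 1"]) simp
  next
    fix s t :: real and \<eta> :: "real \<Rightarrow> complex" and v w
    assume s: "a < s" "s < b" and ds: "(\<gamma> has_vector_derivative v) (at s)"
      and dt: "(\<eta> has_vector_derivative w) (at t)" and meet: "\<eta> t = \<gamma> s" and det: "det2 v w \<noteq> 0"
    \<comment> \<open>The parameter of the crossing on the joined path, whose first half traverses
      the arc.\<close>
    define u where "u = (s - a) / (2 * (b - a))"
    have u: "0 < u" "u < 1/2" "a + 2 * u * (b - a) = s" 
    proof -
      have "u * (2 * (b - a)) = s - a" using ab by (simp add: u_def)
      then show "a + 2 * u * (b - a) = s" by (simp add: algebra_simps)
      show "0 < u" "u < 1/2" using s ab by (simp_all add: u_def divide_simps)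
    qed
    have cu: "c x = \<gamma> (a + 2 * x * (b - a))" if "x < 1/2" for x
      using that by (simp add: c_def joinpaths_def f_def)
    have "((\<gamma> \<circ> (\<lambda>x. a + 2 * x * (b - a))) has_vector_derivative (2 * (b - a)) *\<^sub>R v) (at u)"
      using ds u(3) by (intro vector_diff_chain_at) (auto intro!: derivative_eq_intros)
    then have dc: "(c has_vector_derivative (2 * (b - a)) *\<^sub>R v) (at u)"
      by (rule has_vector_derivative_transform_within_open[of _ _ _ "{..<1/2}"]) (use u cu in auto)
    have uniq: "x = u" if "x \<in> {0..1}" "c x = c u" for x
      proof -
      have "x = u \<or> x = 0 \<and> u = 1 \<or> x = 1 \<and> u = 0"
      proof -
        have "u \<in> {0..1}" using u by simp
        then show ?thesis using simple that unfolding simple_path_def loop_free_def by blast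
      qed
      then show ?thesis using u by auto
    qed
    have jump: "\<exists>\<delta>>0. \<forall>\<epsilon>. 0 < \<epsilon> \<and> \<epsilon> < \<delta> \<longrightarrow> left (\<eta>' (t' + \<epsilon>)) \<and> \<not> left (\<eta>' (t' - \<epsilon>))"
      if \<eta>': "(\<eta>' has_vector_derivative w') (at t')" "\<eta>' t' = \<gamma> s" "det2 v w' > 0" for \<eta>' w' t'
    proof -
      have "\<exists>\<delta>>0. \<forall>\<epsilon>. 0 < \<epsilon> \<and> \<epsilon> < \<delta> \<longrightarrow> \<eta>' (t' + \<epsilon>) \<notin> path_image c \<and> \<eta>' (t' - \<epsilon>) \<notin> path_image c \<and>
           winding_number c (\<eta>' (t' + \<epsilon>)) = winding_number c (\<eta>' (t' - \<epsilon>)) + 1"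
        using ab u \<eta>' uniq by (intro winding_number_jump[OF c(1,2) _ _ dc _ \<eta>'(1)])
          (auto simp: cu det2_scaleR_left)
      then obtain \<delta> where \<delta>: "\<delta> > 0" "\<And>\<epsilon>. 0 < \<epsilon> \<and> \<epsilon> < \<delta> \<Longrightarrow>
          \<eta>' (t' + \<epsilon>) \<notin> path_image c \<and> \<eta>' (t' - \<epsilon>) \<notin> path_image c \<and>
          winding_number c (\<eta>' (t' + \<epsilon>)) = winding_number c (\<eta>' (t' - \<epsilon>)) + 1"
        by blast
      have "left (\<eta>' (t' + \<epsilon>)) \<and> \<not> left (\<eta>' (t' - \<epsilon>))" if "0 < \<epsilon> \<and> \<epsilon> < \<delta>" for \<epsilon>
        using \<delta>(2)[OF that] m[of "\<eta>' (t' + \<epsilon>)"] m[of "\<eta>' (t' - \<epsilon>)"] unfolding left_def by auto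
      then show ?thesis using \<delta>(1) by blast
    qed
    show "\<exists>\<delta>>0. \<forall>\<epsilon>. 0 < \<epsilon> \<and> \<epsilon> < \<delta> \<longrightarrow> (left (\<eta> (t + \<epsilon>)) \<longleftrightarrow> det2 v w > 0) \<and> (left (\<eta> (t - \<epsilon>)) \<longleftrightarrow> det2 v w < 0)"
    proof (cases "det2 v w > 0")
      case True
      then show ?thesis using jump[OF dt meet] by auto
    next
      case False
      \<comment> \<open>Reversing the time of \<open>\<eta>\<close> changes the sign of the
        determinant and reduces to the case already treated.\<close>
      have "((\<eta> \<circ> uminus) has_vector_derivative (-1) *\<^sub>R w) (at (- t))"
        using dt by (intro vector_diff_chain_at) (auto intro!: derivative_eq_intros)
      then have "\<exists>\<delta>>0. \<forall>\<epsilon>. 0 < \<epsilon> \<and> \<epsilon> < \<delta> \<longrightarrow> left ((\<eta> \<circ> uminus) (- t + \<epsilon>)) \<and> \<not> left ((\<eta> \<circ> uminus) (- t - \<epsilon>))"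
        by (rule jump) (use meet det False in \<open>auto simp: det2_def\<close>)
      then show ?thesis using False det by (auto simp: add.commute)
    qed
  qed
qed

text \<open>A strand that meets the crosscut only at time \<open>t\<close> stays on one side before
  \<open>t\<close> and on one side after it; the sign of the crossing decides which is
  which.\<close>

lemma crosscut_crossing:
  fixes \<gamma> :: "real \<Rightarrow> complex"
  assumes "\<Delta> homeomorphic (cball 0 1 :: complex set)" "a < b"
    and "continuous_on UNIV \<gamma>" and "inj_on \<gamma> {a..b}"
    and "\<gamma> a \<in> frontier \<Delta>" "\<gamma> b \<in> frontier \<Delta>" "\<gamma> ` {a<..<b} \<subseteq> interior \<Delta>"
  obtains left :: "complex \<Rightarrow> bool" where
    "\<And>c d s t x. \<lbrakk>c < t; t < d; \<gamma> ` {c<..<d} \<subseteq> interior \<Delta>; \<gamma> ` ({c<..<d} - {t}) \<inter> \<gamma> ` {a..b} = {};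
        a < s; s < b; \<gamma> differentiable at s; \<gamma> differentiable at t; \<gamma> t = \<gamma> s;
        det2 (velocity \<gamma> s) (velocity \<gamma> t) \<noteq> 0; c < x; x < d; x \<noteq> t\<rbrakk> \<Longrightarrow>
      left (\<gamma> x) \<longleftrightarrow> (t < x \<longleftrightarrow> det2 (velocity \<gamma> s) (velocity \<gamma> t) > 0)"
proof -
  obtain left :: "complex \<Rightarrow> bool" where const:
    "\<And>S. connected S \<Longrightarrow> S \<subseteq> interior \<Delta> - \<gamma> ` {a..b} \<Longrightarrow> left constant_on S"
    and jump: "\<And>s \<eta> t v w. \<lbrakk>a < s; s < b; (\<gamma> has_vector_derivative v) (at s); (\<eta> has_vector_derivative w) (at t);
        \<eta> t = \<gamma> s; det2 v w \<noteq> 0\<rbrakk> \<Longrightarrow>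
      \<exists>\<delta>>0. \<forall>\<epsilon>. 0 < \<epsilon> \<and> \<epsilon> < \<delta> \<longrightarrow> (left (\<eta> (t + \<epsilon>)) \<longleftrightarrow> det2 v w > 0) \<and> (left (\<eta> (t - \<epsilon>)) \<longleftrightarrow> det2 v w < 0)"
    by (rule crosscut_sides[OF assms(1,2) continuous_on_subset[OF assms(3) subset_UNIV] assms(4-7)]) blast
  show thesis
  proof (rule that[of left])
    fix c d s t x
    assume ct: "c < t" "t < d" and int: "\<gamma> ` {c<..<d} \<subseteq> interior \<Delta>"
      and dis: "\<gamma> ` ({c<..<d} - {t}) \<inter> \<gamma> ` {a..b} = {}" and s: "a < s" "s < b"
      and diff: "\<gamma> differentiable at s" "\<gamma> differentiable at t" and meet: "\<gamma> t = \<gamma> s"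
      and det: "det2 (velocity \<gamma> s) (velocity \<gamma> t) \<noteq> 0" and x: "c < x" "x < d" "x \<noteq> t"
    let ?D = "det2 (velocity \<gamma> s) (velocity \<gamma> t)"
    obtain \<delta> where \<delta>: "\<delta> > 0" "\<And>\<epsilon>. 0 < \<epsilon> \<Longrightarrow> \<epsilon> < \<delta> \<Longrightarrow> (left (\<gamma> (t + \<epsilon>)) \<longleftrightarrow> ?D > 0) \<and> (left (\<gamma> (t - \<epsilon>)) \<longleftrightarrow> ?D < 0)"
      using jump[OF s, of "velocity \<gamma> s" \<gamma> "velocity \<gamma> t" t] diff meet det
      by (auto simp: velocity_def vector_derivative_works)
    define \<epsilon> where "\<epsilon> = min (\<delta> / 2) (min ((t - c) / 2) ((d - t) / 2))"
    have \<epsilon>: "0 < \<epsilon>" "\<epsilon> < \<delta>" "t + \<epsilon> < d" "c < t - \<epsilon>" 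
    proof -
      have "\<epsilon> \<le> \<delta> / 2" "\<epsilon> \<le> (t - c) / 2" "\<epsilon> \<le> (d - t) / 2" 
        unfolding \<epsilon>_def by (rule min.cobounded1, intro order.trans[OF min.cobounded2] min.cobounded1,
          intro order.trans[OF min.cobounded2] min.cobounded2)
      moreover show "0 < \<epsilon>" using \<delta>(1) ct by (simp add: \<epsilon>_def)
      ultimately show "\<epsilon> < \<delta>" "t + \<epsilon> < d" "c < t - \<epsilon>" using \<delta>(1) ct by simp_all
    qed
    have "left constant_on \<gamma> ` {c<..<t}" "left constant_on \<gamma> ` {t<..<d}"
      using int dis ct by (auto intro!: const connected_continuous_image continuous_on_subset[OF assms(3)]) force+
    moreover have "\<gamma> (t + \<epsilon>) \<in> \<gamma> ` {t<..<d}" "\<gamma> (t - \<epsilon>) \<in> \<gamma> ` {c<..<t}" using \<epsilon> by auto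
    ultimately have "t < x \<Longrightarrow> left (\<gamma> x) = left (\<gamma> (t + \<epsilon>))" "x < t \<Longrightarrow> left (\<gamma> x) = left (\<gamma> (t - \<epsilon>))"
      using x unfolding constant_on_def by (metis greaterThanLessThan_iff imageI)+
    then show "left (\<gamma> x) \<longleftrightarrow> (t < x \<longleftrightarrow> ?D > 0)"
      using \<delta>(2)[OF \<epsilon>(1,2)] x(3) det by (cases "t < x") auto
  qed
qed

text \<open>The crossing of arcs \<open>j\<close> and \<open>k\<close> lies on one side of arc
  \<open>i\<close>. This side can be computed along arc \<open>j\<close> and along arc
  \<open>k\<close>, each time from the order of two crossings and a sign, and the results must
  agree. That \<open>lk\<close> between two crossings of a triangle survives the third move comes
  from this relation.\<close>

lemma triangle_constraint:
  assumes D: "long_virtual_diagram D" and S: "length S = 3"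
    and disk: "\<Delta> homeomorphic (cball 0 1 :: complex set)" and arcs: "meets_in_arcs (curve D) \<Delta> S"
    and T: "triangle D S p" and ijk: "i < 3" "j < 3" "k < 3" "distinct [i, j, k]"
  shows "(p j i < p j k \<longleftrightarrow> positive D (p i j) (p j i)) \<longleftrightarrow> (p k i < p k j \<longleftrightarrow> positive D (p i k) (p k i))"
proof -
  define \<gamma> where "\<gamma> = curve D"
  define a b where "a l = fst (S ! l)" and "b l = snd (S ! l)" for l
  have imm: "long_immersed_line \<gamma>" using D by (simp add: long_virtual_diagram_def \<gamma>_def)
  have sub: "{a l..b l} \<subseteq> arc_times S" if "l < 3" for l
  proof -
    have "(a l, b l) \<in> set S" using that S nth_mem[of l S] by (simp add: a_def b_def)
    then show ?thesis unfolding arc_times_def by blast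
  qed
  have arc: "a l < b l" "\<gamma> (a l) \<in> frontier \<Delta>" "\<gamma> (b l) \<in> frontier \<Delta>" "\<gamma> ` {a l<..<b l} \<subseteq> interior \<Delta>"
    if "l < 3" for l
  proof -
    have "(a l, b l) \<in> set S" using that S nth_mem[of l S] by (simp add: a_def b_def)
    then show "a l < b l" "\<gamma> (a l) \<in> frontier \<Delta>" "\<gamma> (b l) \<in> frontier \<Delta>" "\<gamma> ` {a l<..<b l} \<subseteq> interior \<Delta>"
      using arcs unfolding meets_in_arcs_def \<gamma>_def by blast+
  qed
  have disj: "{a l..b l} \<inter> {a l'..b l'} = {}" if "l < 3" "l' < 3" "l \<noteq> l'" for l l'
  proof -
    have *: "{a l..b l} \<inter> {a l'..b l'} = {}" if "l < l'" "l' < 3" for l l'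
      using arcs that S unfolding meets_in_arcs_def sorted_wrt_iff_nth_less
      by (auto simp: a_def b_def case_prod_beta)
    then show ?thesis using that by (metis Int_commute nat_neq_iff)
  qed
  have p: "a l < p l l'" "p l l' < b l" if "l < 3" "l' < 3" "l \<noteq> l'" for l l'
    using T that by (auto simp: triangle_def a_def b_def)
  have dbl: "\<exists>l l'. l < 3 \<and> l' < 3 \<and> l \<noteq> l' \<and> s = p l l' \<and> t = p l' l"
    if "s \<noteq> t" "\<gamma> s = \<gamma> t" "s \<in> arc_times S" "t \<in> arc_times S" for s t
  proof -
    have "(s, t) \<in> local_doubles D S" using that by (auto simp: local_doubles_def double_pairs_def \<gamma>_def)
    then show ?thesis using T by (auto simp: triangle_def)
  qed
  have cross: "(p l l', p l' l) \<in> double_pairs \<gamma>" if "l < 3" "l' < 3" "l \<noteq> l'" for l l'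
  proof -
    have "(p l l', p l' l) \<in> local_doubles D S" using T that unfolding triangle_def by blast
    then show ?thesis by (simp add: local_doubles_def \<gamma>_def)
  qed
  have which: "l = m" if "l < 3" "m < 3" "x \<in> {a l..b l}" "x \<in> {a m..b m}" for l m x
    using disj that by blast
  have inj: "inj_on \<gamma> {a i..b i}"
  proof (rule inj_onI)
    fix s t assume st: "s \<in> {a i..b i}" "t \<in> {a i..b i}" "\<gamma> s = \<gamma> t"
    show "s = t"
    proof (rule ccontr)
      assume "s \<noteq> t"
      then obtain l l' where l: "l < 3" "l' < 3" "l \<noteq> l'" "s = p l l'" "t = p l' l"
        using dbl st sub[OF ijk(1)] by (meson subsetD)
      then have "l = i" "l' = i" using which[of l i s] which[of l' i t] p[of l l'] p[of l' l] st ijk by auto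
      then show False using l by simp
    qed
  qed
  have cont: "continuous_on UNIV \<gamma>" using imm by (simp add: long_immersed_line_def)
  obtain left where left: 
    "\<And>c d s t x. \<lbrakk>c < t; t < d; \<gamma> ` {c<..<d} \<subseteq> interior \<Delta>; \<gamma> ` ({c<..<d} - {t}) \<inter> \<gamma> ` {a i..b i} = {};
        a i < s; s < b i; \<gamma> differentiable at s; \<gamma> differentiable at t; \<gamma> t = \<gamma> s;
        det2 (velocity \<gamma> s) (velocity \<gamma> t) \<noteq> 0; c < x; x < d; x \<noteq> t\<rbrakk> \<Longrightarrow>
      left (\<gamma> x) \<longleftrightarrow> (t < x \<longleftrightarrow> det2 (velocity \<gamma> s) (velocity \<gamma> t) > 0)"
    by (rule crosscut_crossing[OF disk arc(1)[OF ijk(1)] cont inj arc(2-4)[OF ijk(1)]]) blast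
  have transversal: "\<gamma> differentiable at s \<and> \<gamma> differentiable at t \<and>
      det2 (velocity \<gamma> s) (velocity \<gamma> t) \<noteq> 0 \<and> \<gamma> t = \<gamma> s" if "(s, t) \<in> double_pairs \<gamma>" for s t
  proof -
    have "\<gamma> t = \<gamma> s" using that by (simp add: double_pairs_def)
    moreover have "\<forall>(s, t)\<in>double_pairs \<gamma>. \<gamma> differentiable at s \<and> \<gamma> differentiable at t \<and>
      det2 (velocity \<gamma> s) (velocity \<gamma> t) \<noteq> 0"
      using imm unfolding long_immersed_line_def by blast
    ultimately show ?thesis using that by blast
  qed
  have side: "left (\<gamma> (p l l')) \<longleftrightarrow> (p l i < p l l' \<longleftrightarrow> positive D (p i l) (p l i))"
    if l: "l < 3" "l' < 3" "l \<noteq> i" "l' \<noteq> i" "l \<noteq> l'" for l l'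
    unfolding positive_def \<gamma>_def[symmetric]
  proof (rule left[of "a l" _ "b l"])
    show "p l l' \<noteq> p l i"
    proof
      assume eq: "p l l' = p l i"
      then have "p l' l = p i l"
        using cross[of l l'] cross[of l i] l ijk imm unfolding long_immersed_line_def by metis
      then show False using which[of l' i "p l' l"] p[of l' l] p[of i l] l ijk by auto
    qed
    show "\<gamma> ` ({a l<..<b l} - {p l i}) \<inter> \<gamma> ` {a i..b i} = {}"
    proof (rule ccontr)
      assume "\<gamma> ` ({a l<..<b l} - {p l i}) \<inter> \<gamma> ` {a i..b i} \<noteq> {}"
      then obtain s t where st: "s \<in> {a l<..<b l}" "s \<noteq> p l i" "t \<in> {a i..b i}" "\<gamma> s = \<gamma> t" by blast
      then have "s \<noteq> t" using which[of l i s] l ijk by auto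
      then obtain m m' where m: "m < 3" "m' < 3" "m \<noteq> m'" "s = p m m'" "t = p m' m"
        using dbl[of s t] st sub[OF ijk(1)] sub[OF l(1)] by (metis atLeastAtMost_iff greaterThanLessThan_iff less_imp_le subsetD)
      then have "m = l" "m' = i"
        using which[of m l s] which[of m' i t] p[of m m'] p[of m' m] st l ijk by auto
      then show False using m st by simp
    qed
    show "\<gamma> differentiable at (p i l)" "\<gamma> differentiable at (p l i)" 
      "det2 (velocity \<gamma> (p i l)) (velocity \<gamma> (p l i)) \<noteq> 0" "\<gamma> (p l i) = \<gamma> (p i l)"
      using transversal[OF cross[of i l]] l ijk by simp_all
    show "a l < p l i" "p l i < b l" "\<gamma> ` {a l<..<b l} \<subseteq> interior \<Delta>" "a i < p i l" "p i l < b i"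
      "a l < p l l'" "p l l' < b l"
      using p[of l i] p[of i l] p[of l l'] arc(4)[of l] l ijk by simp_all
  qed
  have "\<gamma> (p j k) = \<gamma> (p k j)" using cross[of j k] ijk by (auto simp: double_pairs_def)
  then show ?thesis using side[of j k] side[of k j] ijk by auto
qed

section \<open>Gauss diagrams modulo two\<close>

text \<open>\<open>HOL-Library.Z2\<close> rewrites field operations to bit operations, which defeats ring normalization.\<close>

declare add_bit_eq_xor [simp del] mult_bit_eq_and [simp del]

lemma bit_add_self [simp]: "x + x = (0::bit)"
  by (cases x) simp_all

lemma bit_add_cancel [simp]: "x + (x + y) = (y::bit)"
  by (cases x; cases y) simp_all

lemma bit_add_eq_0 [simp]: "x + y = (0::bit) \<longleftrightarrow> x = y"
  by (cases x; cases y) simp_all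

section \<open>Chords, parity and linking modulo 2\<close>

definition chords :: "('a::linorder \<times> 'a) set \<Rightarrow> bool" where
  "chords A \<longleftrightarrow> finite A \<and> (\<forall>e\<in>A. fst e \<noteq> snd e) \<and>
     (\<forall>e\<in>A. \<forall>e'\<in>A. {fst e, snd e} \<inter> {fst e', snd e'} \<noteq> {} \<longrightarrow> e = e')"

definition lo :: "'a::linorder \<times> 'a \<Rightarrow> 'a" where "lo c = min (fst c) (snd c)"

definition hi :: "'a::linorder \<times> 'a \<Rightarrow> 'a" where "hi c = max (fst c) (snd c)"

text \<open>Half open to match the edges of a path: edge \<open>x\<close> runs from visit
  \<open>x\<close> to the next one, so the loop of \<open>c\<close> consists of the edges
  \<open>x\<close> with \<open>ins c x = 1\<close>.\<close>

definition ins :: "'a::linorder \<times> 'a \<Rightarrow> 'a \<Rightarrow> bit" where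
  "ins c x = of_bool (lo c \<le> x \<and> x < hi c)"

text \<open>The number modulo 2 of chords that interlace with \<open>c\<close>. The half-open
  interval contains exactly one end of \<open>c\<close> itself, which the summand 1 removes.\<close>

definition par :: "('a::linorder \<times> 'a) set \<Rightarrow> 'a \<times> 'a \<Rightarrow> bit" where
  "par A c = 1 + (\<Sum>e\<in>A. ins c (fst e) + ins c (snd e))"

text \<open>The sum counts chords with one end on the loop of \<open>c\<close> and the other on the
  loop of \<open>d\<close>. At the crossings \<open>c\<close> and \<open>d\<close> themselves the
  loops have corners; the two terms that depend on the signs correct the half-open count there, and
  the last term makes the form vanish on the diagonal.\<close>

definition lk :: "('a::linorder \<times> 'a) set \<Rightarrow> ('a \<times> 'a \<Rightarrow> bool) \<Rightarrow> 'a \<times> 'a \<Rightarrow> 'a \<times> 'a \<Rightarrow> bit" where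
  "lk A P c d = (\<Sum>e\<in>A. ins c (fst e) * ins d (snd e) + ins c (snd e) * ins d (fst e)) +
     ins d (if P c then snd c else fst c) + ins c (if P d then fst d else snd d) + of_bool (c = d)"

definition early_over :: "('a::linorder \<times> 'a) set \<Rightarrow> ('a \<times> 'a) set" where
  "early_over A = {c \<in> A. fst c < snd c \<and> par A c = 1}"

definition early_under :: "('a::linorder \<times> 'a) set \<Rightarrow> ('a \<times> 'a) set" where
  "early_under A = {c \<in> A. snd c < fst c \<and> par A c = 1}"

definition over_lk :: "('a::linorder \<times> 'a) set \<Rightarrow> ('a \<times> 'a \<Rightarrow> bool) \<Rightarrow> 'a \<times> 'a \<Rightarrow> bit" where
  "over_lk A P c = (\<Sum>d\<in>early_over A. lk A P c d)"

definition under_lk :: "('a::linorder \<times> 'a) set \<Rightarrow> ('a \<times> 'a \<Rightarrow> bool) \<Rightarrow> 'a \<times> 'a \<Rightarrow> bit" where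
  "under_lk A P c = (\<Sum>d\<in>early_under A. lk A P c d)"

definition chord_sign :: "('a \<times> 'a \<Rightarrow> bool) \<Rightarrow> 'a \<times> 'a \<Rightarrow> int" where
  "chord_sign P c = (if P c then 1 else -1)"

definition odd_writhe :: "('a::linorder \<times> 'a) set \<Rightarrow> ('a \<times> 'a \<Rightarrow> bool) \<Rightarrow> int" where
  "odd_writhe A P = (\<Sum>c\<in>early_over A. chord_sign P c)"

definition cross_lk :: "('a::linorder \<times> 'a) set \<Rightarrow> ('a \<times> 'a \<Rightarrow> bool) \<Rightarrow> bit" where
  "cross_lk A P = (\<Sum>c\<in>early_over A. under_lk A P c)"

text \<open>The chords counted here are those that a closed torus forbids once
  \<open>cross_lk\<close> is odd; the signs are kept in order to obtain an integer.\<close>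

definition free_writhe :: "('a::linorder \<times> 'a) set \<Rightarrow> ('a \<times> 'a \<Rightarrow> bool) \<Rightarrow> int" where
  "free_writhe A P = (\<Sum>c\<in>{c \<in> early_over A. over_lk A P c = 0 \<and> under_lk A P c = 0}. chord_sign P c)"

definition gauss_inv :: "('a::linorder \<times> 'a) set \<Rightarrow> ('a \<times> 'a \<Rightarrow> bool) \<Rightarrow> int \<times> bit \<times> int" where
  "gauss_inv A P = (odd_writhe A P, cross_lk A P, free_writhe A P)"

lemma chordsD:
  assumes "chords A"
  shows "finite A" "e \<in> A \<Longrightarrow> fst e \<noteq> snd e"
    "\<lbrakk>e \<in> A; e' \<in> A; fst e = fst e'\<rbrakk> \<Longrightarrow> e = e'" "\<lbrakk>e \<in> A; e' \<in> A; snd e = snd e'\<rbrakk> \<Longrightarrow> e = e'"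
    "\<lbrakk>e \<in> A; e' \<in> A\<rbrakk> \<Longrightarrow> fst e \<noteq> snd e'"
  using assms unfolding chords_def by blast+

lemma lo_less_hi: "fst c \<noteq> snd c \<Longrightarrow> lo c < hi c"
  by (auto simp: lo_def hi_def min_def max_def)

lemma ins_own: "fst c \<noteq> snd c \<Longrightarrow> ins c (fst c) + ins c (snd c) = 1"
  by (auto simp: ins_def lo_def hi_def min_def max_def)

lemma sum_delta_endpoint:
  assumes "chords A" "d \<in> A" and f: "\<And>e. e \<in> A \<Longrightarrow> e \<noteq> d \<Longrightarrow> f e = (0::bit)"
  shows "(\<Sum>e\<in>A. f e) = f d"
proof -
  have "(\<Sum>e\<in>A. f e) = f d + (\<Sum>e\<in>A - {d}. f e)"
    using assms chordsD(1) by (intro sum.remove) auto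
  also have "(\<Sum>e\<in>A - {d}. f e) = 0" using f by (intro sum.neutral) auto
  finally show ?thesis by simp
qed

text \<open>For different chords the two sides differ by the number of ends of \<open>c\<close> in
  the interval of \<open>d\<close> plus the number of ends of \<open>d\<close> in the interval of
  \<open>c\<close>. Both numbers are odd exactly when the chords interlace.\<close>

lemma lk_commute:
  assumes A: "chords A" and "c \<in> A" "d \<in> A"
  shows "lk A P c d = lk A P d c"
proof (cases "c = d")
  case False
  then have ne: "fst c \<noteq> fst d" "fst c \<noteq> snd d" "snd c \<noteq> fst d" "snd c \<noteq> snd d" "fst c \<noteq> snd c" "fst d \<noteq> snd d"
    using assms chordsD[OF A] by metis+
  have link: "of_bool (y \<le> w \<and> w < z) + of_bool (y \<le> x \<and> x < z) =
      (of_bool (w \<le> y \<and> y < x) + of_bool (w \<le> z \<and> z < x) :: bit)"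
    if "w < x" "y < z" "w \<noteq> y" "w \<noteq> z" "x \<noteq> y" "x \<noteq> z" for w x y z :: 'a
    using that by (cases "w < y"; cases "w < z"; cases "x < y"; cases "x < z") auto
  have ends: "f (fst c) + f (snd c) = f (lo c) + f (hi c)" for f :: "'a \<Rightarrow> bit" and c :: "'a \<times> 'a"
    by (simp add: lo_def hi_def min_def max_def add.commute)
  have "lo c < hi c" "lo d < hi d" "lo c \<noteq> lo d" "lo c \<noteq> hi d" "hi c \<noteq> lo d" "hi c \<noteq> hi d"
    using ne by (simp_all add: lo_less_hi) (simp_all add: lo_def hi_def min_def max_def)
  then have "ins d (fst c) + ins d (snd c) = ins c (fst d) + ins c (snd d)"
    unfolding ends[of "ins d"] ends[of "ins c"] unfolding ins_def by (rule link)
  then have "ins d (if P c then snd c else fst c) + ins c (if P d then fst d else snd d) =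
     ins c (if P d then snd d else fst d) + ins d (if P c then fst c else snd c)"
    by (cases "ins d (fst c)"; cases "ins d (snd c)"; cases "ins c (fst d)"; cases "ins c (snd d)"; cases "P c"; cases "P d") simp_all
  then show ?thesis using False unfolding lk_def by (simp add: algebra_simps)
qed simp

lemma lk_self: "chords A \<Longrightarrow> c \<in> A \<Longrightarrow> lk A P c c = 0"
  using ins_own[of c] chordsD(2)[of A c] unfolding lk_def by (simp add: algebra_simps)

lemma sum_alternating:
  fixes f :: "'b \<Rightarrow> 'b \<Rightarrow> bit"
  assumes "finite S" "\<And>x y. x \<in> S \<Longrightarrow> y \<in> S \<Longrightarrow> f x y = f y x" "\<And>x. x \<in> S \<Longrightarrow> f x x = 0"
  shows "(\<Sum>x\<in>S. \<Sum>y\<in>S. f x y) = 0"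
  using assms
proof (induction S rule: finite_induct)
  case (insert a S)
  have "(\<Sum>x\<in>insert a S. \<Sum>y\<in>insert a S. f x y) =
      f a a + (\<Sum>y\<in>S. f a y) + (\<Sum>x\<in>S. f x a) + (\<Sum>x\<in>S. \<Sum>y\<in>S. f x y)"
    using insert by (simp add: sum.distrib add.assoc)
  also have "(\<Sum>x\<in>S. f x a) = (\<Sum>y\<in>S. f a y)" using insert by (intro sum.cong) auto
  finally show ?case using insert by simp
qed simp

text \<open>The invariants see a chord only through its type, its sign, its parity and its
  \<open>lk\<close> with the others. The third move needs this generality, because it is not induced
  by a monotone map of the ends.\<close>

lemma gauss_inv_bij:
  assumes bij: "bij_betw b A A'"
    and "\<And>c. c \<in> A \<Longrightarrow> fst (b c) < snd (b c) \<longleftrightarrow> fst c < snd c"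
    and "\<And>c. c \<in> A \<Longrightarrow> snd (b c) < fst (b c) \<longleftrightarrow> snd c < fst c"
    and P: "\<And>c. c \<in> A \<Longrightarrow> P' (b c) = P c"
    and "\<And>c. c \<in> A \<Longrightarrow> par A' (b c) = par A c"
    and lk: "\<And>c d. c \<in> A \<Longrightarrow> d \<in> A \<Longrightarrow> lk A' P' (b c) (b d) = lk A P c d"
  shows "gauss_inv A P = gauss_inv A' P'"
proof -
  have im: "A' = b ` A" and inj: "inj_on b A" using bij by (auto simp: bij_betw_def)
  have S: "early_over A' = b ` early_over A" and T: "early_under A' = b ` early_under A"
    using assms(2-6) unfolding early_over_def early_under_def im by auto
  have sub: "early_over A \<subseteq> A" "early_under A \<subseteq> A" by (auto simp: early_over_def early_under_def)
  have injS: "inj_on b (early_over A)" "inj_on b (early_under A)" using inj sub by (auto intro: inj_on_subset)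
  have p: "over_lk A' P' (b c) = over_lk A P c" "under_lk A' P' (b c) = under_lk A P c" if "c \<in> A" for c
    unfolding over_lk_def under_lk_def S T sum.reindex[OF injS(1)] sum.reindex[OF injS(2)] comp_def
    using that lk subsetD[OF sub(1)] subsetD[OF sub(2)] by (intro sum.cong refl; blast)+
  have 1: "odd_writhe A P = odd_writhe A' P'" unfolding odd_writhe_def S
    using P sub injS by (auto simp: sum.reindex chord_sign_def subset_iff intro!: sum.cong)
  have 2: "cross_lk A P = cross_lk A' P'" unfolding cross_lk_def S
    using p sub injS by (auto simp: sum.reindex subset_iff intro!: sum.cong)
  have "{c \<in> early_over A'. over_lk A' P' c = 0 \<and> under_lk A' P' c = 0} =
     b ` {c \<in> early_over A. over_lk A P c = 0 \<and> under_lk A P c = 0}"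
    using p sub unfolding S by auto
  moreover have "inj_on b {c \<in> early_over A. over_lk A P c = 0 \<and> under_lk A P c = 0}"
    using injS(1) by (rule inj_on_subset) auto
  ultimately have 3: "free_writhe A P = free_writhe A' P'" unfolding free_writhe_def
    using P sub by (auto simp: sum.reindex chord_sign_def subset_iff intro!: sum.cong)
  show ?thesis unfolding gauss_inv_def 1 2 3 ..
qed

lemma gauss_inv_strict_mono:
  fixes A :: "('a::linorder \<times> 'a) set" and f :: "'a \<Rightarrow> 'b::linorder"
  assumes f: "strict_mono_on (Field A) f"
    and P: "\<And>c. c \<in> A \<Longrightarrow> P' (map_prod f f c) = P c"
  shows "gauss_inv A P = gauss_inv (map_prod f f ` A) P'"
proof -
  let ?b = "map_prod f f"
  have F: "fst c \<in> Field A" "snd c \<in> Field A" if "c \<in> A" for c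
    using that by (auto simp: Field_def Domain_fst Range_snd)
  have less: "f x < f y \<longleftrightarrow> x < y" "f x \<le> f y \<longleftrightarrow> x \<le> y" "f x = f y \<longleftrightarrow> x = y" if "x \<in> Field A" "y \<in> Field A" for x y
    using that f by (auto simp: strict_mono_on_less strict_mono_on_less_eq strict_mono_on_eq)
  have inj: "inj_on ?b A"
    using F less by (auto intro!: inj_onI simp: prod_eq_iff)
  have I: "ins (?b c) (f x) = ins c x" if "c \<in> A" "x \<in> Field A" for c x
    using F[OF that(1)] that(2) less unfolding ins_def lo_def hi_def by (auto simp: min_def max_def)
  show ?thesis
  proof (rule gauss_inv_bij[of ?b])
    show "bij_betw ?b A (?b ` A)" using inj by (simp add: bij_betw_def)
    show "par (?b ` A) (?b c) = par A c" if "c \<in> A" for c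
      unfolding par_def using that F I by (simp add: sum.reindex[OF inj])
    show "lk (?b ` A) P' (?b c) (?b d) = lk A P c d" if "c \<in> A" "d \<in> A" for c d
    proof -
      have "?b c = ?b d \<longleftrightarrow> c = d" using inj that by (auto dest: inj_onD)
      then show ?thesis
        unfolding lk_def using that F I P by (simp add: sum.reindex[OF inj])
    qed
  qed (use P F less in auto)
qed

section \<open>Deleting chords: the first two moves\<close>

lemma sum_lk_Diff:
  assumes "finite A" "K \<subseteq> A" "(\<Sum>e\<in>K. f e) = (0::bit)"
  shows "(\<Sum>e\<in>A. f e) = (\<Sum>e\<in>A - K. f e)"
  using sum.subset_diff[OF assms(2,1), of f] assms(3) by simp

text \<open>Collects what has to be checked for a deletion: the data of the remaining chords do not
  change, and the deleted ones contribute zero to each sum, including the sums inside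
  \<open>over_lk\<close> and \<open>under_lk\<close>.\<close>

lemma gauss_inv_Diff:
  assumes A: "chords A" and K: "K \<subseteq> A"
    and par: "\<And>c. c \<in> A - K \<Longrightarrow> par (A - K) c = par A c"
    and lk: "\<And>c d. c \<in> A - K \<Longrightarrow> d \<in> A - K \<Longrightarrow> lk (A - K) P c d = lk A P c d"
    and S0: "\<And>c. c \<in> A - K \<Longrightarrow> (\<Sum>d\<in>K \<inter> early_over A. lk A P c d) = 0"
    and T0: "\<And>c. c \<in> A - K \<Longrightarrow> (\<Sum>d\<in>K \<inter> early_under A. lk A P c d) = 0"
    and w: "(\<Sum>c\<in>K \<inter> early_over A. chord_sign P c) = 0"
    and cr: "(\<Sum>c\<in>K \<inter> early_over A. under_lk A P c) = 0"
    and fr: "(\<Sum>c\<in>{c \<in> K \<inter> early_over A. over_lk A P c = 0 \<and> under_lk A P c = 0}. chord_sign P c) = 0"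
  shows "gauss_inv (A - K) P = gauss_inv A P"
proof -
  have fin: "finite A" using A by (rule chordsD)
  have S: "early_over (A - K) = early_over A - K" "early_under (A - K) = early_under A - K"
    using par unfolding early_over_def early_under_def by auto
  have split: "(\<Sum>c\<in>X. f c) = (\<Sum>c\<in>K \<inter> X. f c) + (\<Sum>c\<in>X - K. f c)" if "X \<subseteq> A" for X and f :: "_ \<Rightarrow> 'c::comm_monoid_add"
    using sum.Int_Diff[of X f K] that fin finite_subset by (auto simp: Int_commute)
  have sub: "early_over A \<subseteq> A" "early_under A \<subseteq> A" by (auto simp: early_over_def early_under_def)
  have p: "over_lk (A - K) P c = over_lk A P c" "under_lk (A - K) P c = under_lk A P c" if c: "c \<in> A - K" for c
  proof -
    have "(\<Sum>d\<in>X - K. lk (A - K) P c d) = (\<Sum>d\<in>X - K. lk A P c d)" if "X \<subseteq> A" for X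
      using that c by (intro sum.cong lk) auto
    then show "over_lk (A - K) P c = over_lk A P c" "under_lk (A - K) P c = under_lk A P c"
      using S0[of c] T0[of c] c sub
      unfolding over_lk_def under_lk_def S split[OF sub(1)] split[OF sub(2)] by auto
  qed
  have "odd_writhe (A - K) P = odd_writhe A P"
    unfolding odd_writhe_def S split[OF sub(1)] using w by simp
  moreover have "cross_lk (A - K) P = cross_lk A P"
  proof -
    have "(\<Sum>c\<in>early_over A - K. under_lk (A - K) P c) = (\<Sum>c\<in>early_over A - K. under_lk A P c)"
      using sub by (intro sum.cong p) auto
    then show ?thesis unfolding cross_lk_def S split[OF sub(1), of "under_lk A P"] using cr by simp
  qed
  moreover have "free_writhe (A - K) P = free_writhe A P"
  proof -
    let ?X = "{c \<in> early_over A. over_lk A P c = 0 \<and> under_lk A P c = 0}"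
    have "{c \<in> early_over A - K. over_lk (A - K) P c = 0 \<and> under_lk (A - K) P c = 0} = ?X - K"
      using sub p by auto
    moreover have "K \<inter> ?X = {c \<in> K \<inter> early_over A. over_lk A P c = 0 \<and> under_lk A P c = 0}" by auto
    ultimately show ?thesis
      unfolding free_writhe_def S using split[of ?X "chord_sign P"] fr sub by (simp add: subset_iff)
  qed
  ultimately show ?thesis by (simp add: gauss_inv_def)
qed

text \<open>With no foreign end between its own ends, the chord is even and has \<open>lk\<close>
  zero with every chord, so it belongs to neither class and influences no other chord.\<close>

lemma gauss_inv_isolated:
  assumes A: "chords A" and k: "k \<in> A"
    and iso: "\<And>e. e \<in> A - {k} \<Longrightarrow> fst e \<notin> {lo k..hi k} \<and> snd e \<notin> {lo k..hi k}"
  shows "gauss_inv (A - {k}) P = gauss_inv A P"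
proof -
  have fin: "finite A" using A by (rule chordsD)
  have kne: "fst k \<noteq> snd k" using A k chordsD by blast
  have 1: "ins k (fst e) = 0 \<and> ins k (snd e) = 0" if "e \<in> A - {k}" for e
    using iso[OF that] by (auto simp: ins_def)
  have 2: "ins e (fst k) = ins e (snd k)" if "e \<in> A - {k}" for e
    using iso[OF that] chordsD(2)[OF A] that unfolding ins_def lo_def hi_def by (auto simp: min_def max_def split: if_splits)
  have p0: "par A k = 0"
    unfolding par_def using 1 ins_own[OF kne] by (subst sum_delta_endpoint[OF A k]) auto
  have l0: "lk A P k d = 0" if "d \<in> A" for d
  proof (cases "d = k")
    case False
    then have "(\<Sum>e\<in>A. ins k (fst e) * ins d (snd e) + ins k (snd e) * ins d (fst e)) =
      ins k (fst k) * ins d (snd k) + ins k (snd k) * ins d (fst k)"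
      using 1 by (intro sum_delta_endpoint[OF A k]) auto
    also have "\<dots> = ins d (fst k)"
      using ins_own[OF kne] 2[of d] that False by (simp flip: distrib_right)
    finally show ?thesis using 1[of d] 2[of d] that False by (simp add: lk_def)
  qed (use lk_self[OF A k] in simp)
  have K: "{k} \<inter> early_over A = {}" "{k} \<inter> early_under A = {}"
    using p0 by (auto simp: early_over_def early_under_def)
  show ?thesis
  proof (rule gauss_inv_Diff[OF A])
    show "par (A - {k}) c = par A c" if "c \<in> A - {k}" for c
      unfolding par_def using 2[OF that] k by (subst sum_lk_Diff[OF fin, of "{k}"]) auto
    show "lk (A - {k}) P c d = lk A P c d" if "c \<in> A - {k}" "d \<in> A - {k}" for c d
    proof -
      have "(\<Sum>e\<in>A. ins c (fst e) * ins d (snd e) + ins c (snd e) * ins d (fst e)) =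
        (\<Sum>e\<in>A - {k}. ins c (fst e) * ins d (snd e) + ins c (snd e) * ins d (fst e))"
        using 2[OF that(1)] 2[OF that(2)] k by (intro sum_lk_Diff fin) auto
      then show ?thesis by (simp add: lk_def)
    qed
  qed (use k K in auto)
qed

text \<open>Both chords have the same parity, type and \<open>lk\<close> with all others, hence they
  cancel modulo 2; having opposite signs, they also cancel in the integer counts. The two strands
  may be parallel or antiparallel, so the order of the ends inside \<open>I\<close> and inside
  \<open>J\<close> is left open.\<close>

lemma gauss_inv_pair:
  assumes A: "chords A" and k: "k \<in> A" "k' \<in> A" "k \<noteq> k'"
    and out: "\<And>e. e \<in> A - {k, k'} \<Longrightarrow> fst e \<notin> I \<union> J \<and> snd e \<notin> I \<union> J"
    and I: "I = {min (fst k) (fst k')..max (fst k) (fst k')}" and J: "J = {min (snd k) (snd k')..max (snd k) (snd k')}"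
    and IJ: "(\<forall>x\<in>I. \<forall>y\<in>J. x < y) \<or> (\<forall>x\<in>I. \<forall>y\<in>J. y < x)"
    and sgn: "P k \<noteq> P k'"
  shows "gauss_inv (A - {k, k'}) P = gauss_inv A P"
proof -
  have fin: "finite A" using A by (rule chordsD)
  have inI: "fst k \<in> I" "fst k' \<in> I" "snd k \<in> J" "snd k' \<in> J" by (auto simp: I J)
  have ne: "fst k \<noteq> fst k'" "snd k \<noteq> snd k'" "fst k \<noteq> snd k" "fst k' \<noteq> snd k'" "fst k \<noteq> snd k'" "fst k' \<noteq> snd k"
    using chordsD[OF A] k by metis+
  have const: "ins e (fst k) = ins e (fst k')" "ins e (snd k) = ins e (snd k')" if e: "e \<in> A - {k, k'}" for e
  proof -
    have "lo e \<notin> I \<union> J" "hi e \<notin> I \<union> J" using out[OF e] by (auto simp: lo_def hi_def min_def max_def)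
    then show "ins e (fst k) = ins e (fst k')" "ins e (snd k) = ins e (snd k')"
      unfolding ins_def I J by (auto simp: min_def max_def split: if_splits)
  qed
  have IJ': "(fst k < snd k \<and> fst k < snd k' \<and> fst k' < snd k \<and> fst k' < snd k') \<or>
     (snd k < fst k \<and> snd k < fst k' \<and> snd k' < fst k \<and> snd k' < fst k')"
    using IJ inI by blast
  have same: "ins k (fst e) = ins k' (fst e)" "ins k (snd e) = ins k' (snd e)" if e: "e \<in> A - {k, k'}" for e
  proof -
    have "ins k x = ins k' x" if "x \<notin> I \<union> J" for x
    proof -
      have "x \<le> fst k \<longleftrightarrow> x \<le> fst k'" "x < fst k \<longleftrightarrow> x < fst k'" "fst k \<le> x \<longleftrightarrow> fst k' \<le> x"
        "x < snd k \<longleftrightarrow> x < snd k'" "snd k \<le> x \<longleftrightarrow> snd k' \<le> x"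
        using that unfolding I J by (auto simp: min_def max_def split: if_splits)
      then show ?thesis using IJ' unfolding ins_def lo_def hi_def by (auto simp: min_def max_def)
    qed
    then show "ins k (fst e) = ins k' (fst e)" "ins k (snd e) = ins k' (snd e)" using out[OF e] by auto
  qed
  \<comment> \<open>Each interval contains its own lower end and not its upper end, and of two
    neighbouring ends of \<open>k\<close> and \<open>k'\<close> exactly one lies in the interval of
    the other chord.\<close>
  have own: "ins k (fst k) + ins k (fst k') + ins k' (fst k) + ins k' (fst k') = 1"
    "ins k (snd k) + ins k (snd k') + ins k' (snd k) + ins k' (snd k') = 1"
    "ins k (fst k) + ins k (fst k') + ins k (snd k) + ins k (snd k') =
     ins k' (fst k) + ins k' (fst k') + ins k' (snd k) + ins k' (snd k')"
  proof -
    consider (1) "fst k < snd k" "fst k < snd k'" "fst k' < snd k" "fst k' < snd k'"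
      | (2) "snd k < fst k" "snd k < fst k'" "snd k' < fst k" "snd k' < fst k'"
      using IJ' by blast
    then have "ins k (fst k) + ins k (fst k') + ins k' (fst k) + ins k' (fst k') = 1 \<and>
      ins k (snd k) + ins k (snd k') + ins k' (snd k) + ins k' (snd k') = 1 \<and>
      ins k (fst k) + ins k (fst k') + ins k (snd k) + ins k (snd k') =
      ins k' (fst k) + ins k' (fst k') + ins k' (snd k) + ins k' (snd k')"
    proof cases
      case 1
      then have "lo k = fst k" "hi k = snd k" "lo k' = fst k'" "hi k' = snd k'" by (simp_all add: lo_def hi_def)
      then have "ins k (fst k) = 1" "ins k (fst k') = of_bool (fst k < fst k')" "ins k' (fst k) = of_bool (fst k' < fst k)"
        "ins k' (fst k') = 1" "ins k (snd k) = 0" "ins k (snd k') = of_bool (snd k' < snd k)"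
        "ins k' (snd k) = of_bool (snd k < snd k')" "ins k' (snd k') = 0"
        using 1 ne by (auto simp: ins_def le_less)
      then show ?thesis using ne by (cases "fst k < fst k'"; cases "snd k < snd k'") auto
    next
      case 2
      then have "lo k = snd k" "hi k = fst k" "lo k' = snd k'" "hi k' = fst k'" by (simp_all add: lo_def hi_def)
      then have "ins k (snd k) = 1" "ins k (snd k') = of_bool (snd k < snd k')" "ins k' (snd k) = of_bool (snd k' < snd k)"
        "ins k' (snd k') = 1" "ins k (fst k) = 0" "ins k (fst k') = of_bool (fst k' < fst k)"
        "ins k' (fst k) = of_bool (fst k < fst k')" "ins k' (fst k') = 0"
        using 2 ne by (auto simp: ins_def le_less)
      then show ?thesis using ne by (cases "fst k < fst k'"; cases "snd k < snd k'") auto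
    qed
    then show "ins k (fst k) + ins k (fst k') + ins k' (fst k) + ins k' (fst k') = 1"
      "ins k (snd k) + ins k (snd k') + ins k' (snd k) + ins k' (snd k') = 1"
      "ins k (fst k) + ins k (fst k') + ins k (snd k) + ins k (snd k') =
       ins k' (fst k) + ins k' (fst k') + ins k' (snd k) + ins k' (snd k')" by blast+
  qed
  have own': "ins k' (fst k') = 1 + (ins k (fst k) + (ins k (fst k') + ins k' (fst k)))"
    "ins k' (snd k') = 1 + (ins k (snd k) + (ins k (snd k') + ins k' (snd k)))"
    using own(1,2) by (cases "ins k (fst k)"; cases "ins k (fst k')"; cases "ins k' (fst k)"; simp)
      (use own(2) in \<open>cases "ins k (snd k)"; cases "ins k (snd k')"; cases "ins k' (snd k)"; simp\<close>)
  have split: "(\<Sum>e\<in>A. f e) = f k + f k' + (\<Sum>e\<in>A - {k, k'}. f e)" for f :: "_ \<Rightarrow> bit"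
    using sum.subset_diff[of "{k, k'}" A f] k fin by (simp add: add.commute)
  have par_eq: "par A k = par A k'"
  proof -
    have "(\<Sum>e\<in>A - {k, k'}. ins k (fst e) + ins k (snd e)) = (\<Sum>e\<in>A - {k, k'}. ins k' (fst e) + ins k' (snd e))"
      using same by (intro sum.cong) auto
    then show ?thesis unfolding par_def split using own(3) by (simp add: algebra_simps)
  qed
  have type: "fst k < snd k \<longleftrightarrow> fst k' < snd k'" "snd k < fst k \<longleftrightarrow> snd k' < fst k'" using IJ' by auto
  \<comment> \<open>The sign-dependent term selects the first end for one chord and the second end
    for the other; by \<open>own'\<close> the summands for \<open>k\<close> and \<open>k'\<close> in
    the sum over \<open>A\<close> differ by just the same amount.\<close>
  have lk_eq: "lk A P k d = lk A P k' d" if d: "d \<in> A - {k, k'}" for d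
  proof -
    have "(\<Sum>e\<in>A - {k, k'}. ins k (fst e) * ins d (snd e) + ins k (snd e) * ins d (fst e)) =
      (\<Sum>e\<in>A - {k, k'}. ins k' (fst e) * ins d (snd e) + ins k' (snd e) * ins d (fst e))"
      using same by (intro sum.cong) auto
    moreover have "ins d (fst k') = ins d (fst k)" "ins d (snd k') = ins d (snd k)" using const[OF d] by auto
    moreover have "P k' = (\<not> P k)" using sgn by auto
    moreover have nd: "k \<noteq> d" "k' \<noteq> d" using d by auto
    moreover have "ins k (fst d) = ins k' (fst d)" "ins k (snd d) = ins k' (snd d)" using same[OF d] by auto
    ultimately show ?thesis
      unfolding lk_def split using nd
      by (cases "ins d (fst k)"; cases "ins d (snd k)"; cases "P k") (simp_all add: own' algebra_simps)
  qed
  have lk_eq': "lk A P c k = lk A P c k'" if "c \<in> A - {k, k'}" for c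
    using lk_eq[OF that] lk_commute[OF A] k that by (metis DiffD1)
  have memS: "k \<in> early_over A \<longleftrightarrow> k' \<in> early_over A" "k \<in> early_under A \<longleftrightarrow> k' \<in> early_under A"
    using par_eq type k by (auto simp: early_over_def early_under_def)
  have tot: "(\<Sum>d\<in>{k, k'} \<inter> X. lk A P c d) = 0" if "c \<in> A - {k, k'}" "k \<in> X \<longleftrightarrow> k' \<in> X" for c X
  proof (cases "k \<in> X")
    case True
    then have "{k, k'} \<inter> X = {k, k'}" using that by auto
    then show ?thesis using lk_eq'[OF that(1)] k by simp
  next
    case False
    then have "{k, k'} \<inter> X = {}" using that by auto
    then show ?thesis by simp
  qed
  have eqX: "(\<Sum>d\<in>X. lk A P k d) = (\<Sum>d\<in>X. lk A P k' d)" if X: "X \<subseteq> A" "k \<in> X \<longleftrightarrow> k' \<in> X" for X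
  proof -
    have sp: "(\<Sum>d\<in>X. f d) = (\<Sum>d\<in>X \<inter> {k, k'}. f d) + (\<Sum>d\<in>X - {k, k'}. f d)" for f :: "_ \<Rightarrow> bit"
      using sum.Int_Diff[of X f "{k, k'}"] X fin finite_subset by auto
    have 1: "(\<Sum>d\<in>X - {k, k'}. lk A P k d) = (\<Sum>d\<in>X - {k, k'}. lk A P k' d)"
      using X by (intro sum.cong lk_eq) auto
    have 2: "(\<Sum>d\<in>X \<inter> {k, k'}. lk A P k d) = (\<Sum>d\<in>X \<inter> {k, k'}. lk A P k' d)"
    proof (cases "k \<in> X")
      case True
      then have "X \<inter> {k, k'} = {k, k'}" using X by auto
      then show ?thesis using lk_self[OF A k(1)] lk_self[OF A k(2)] lk_commute[OF A k(1,2)] k by simp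
    next
      case False
      then have "X \<inter> {k, k'} = {}" using X by auto
      then show ?thesis by simp
    qed
    show ?thesis unfolding sp[of "lk A P k"] sp[of "lk A P k'"] 1 2 ..
  qed
  have sub: "early_over A \<subseteq> A" "early_under A \<subseteq> A" by (auto simp: early_over_def early_under_def)
  have p: "over_lk A P k = over_lk A P k'" "under_lk A P k = under_lk A P k'"
    unfolding over_lk_def under_lk_def using eqX sub memS by blast+
  have KS: "{k, k'} \<inter> early_over A = (if k \<in> early_over A then {k, k'} else {})" using memS by auto
  have opp: "chord_sign P k + chord_sign P k' = 0" using sgn by (simp add: chord_sign_def)
  have zero: "ins e (fst k) * ins f (snd k) + ins e (snd k) * ins f (fst k) +
     (ins e (fst k') * ins f (snd k') + ins e (snd k') * ins f (fst k')) = 0"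
    if "e \<in> A - {k, k'}" "f \<in> A - {k, k'}" for e f
    using const[OF that(1)] const[OF that(2)] by simp
  show ?thesis
  proof (rule gauss_inv_Diff[OF A])
    show "par (A - {k, k'}) c = par A c" if "c \<in> A - {k, k'}" for c
      unfolding par_def using const[OF that] k by (subst sum_lk_Diff[OF fin, of "{k, k'}"]) auto
    show "lk (A - {k, k'}) P c d = lk A P c d" if "c \<in> A - {k, k'}" "d \<in> A - {k, k'}" for c d
    proof -
      have "(\<Sum>e\<in>A. ins c (fst e) * ins d (snd e) + ins c (snd e) * ins d (fst e)) =
        (\<Sum>e\<in>A - {k, k'}. ins c (fst e) * ins d (snd e) + ins c (snd e) * ins d (fst e))"
        using zero[OF that] k by (intro sum_lk_Diff fin) auto
      then show ?thesis by (simp add: lk_def)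
    qed
    show "(\<Sum>c\<in>{k, k'} \<inter> early_over A. chord_sign P c) = 0"
      "(\<Sum>c\<in>{k, k'} \<inter> early_over A. under_lk A P c) = 0"
      using opp p k unfolding KS by auto
    show "(\<Sum>c\<in>{c \<in> {k, k'} \<inter> early_over A. over_lk A P c = 0 \<and> under_lk A P c = 0}. chord_sign P c) = 0"
    proof (cases "k \<in> early_over A \<and> over_lk A P k = 0 \<and> under_lk A P k = 0")
      case True
      then have "{c \<in> {k, k'} \<inter> early_over A. over_lk A P c = 0 \<and> under_lk A P c = 0} = {k, k'}"
        using p memS by auto
      then show ?thesis using opp k by simp
    next
      case False
      then have "{c \<in> {k, k'} \<inter> early_over A. over_lk A P c = 0 \<and> under_lk A P c = 0} = {}"
        using p memS by auto
      then show ?thesis by (simp only: sum.empty)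
    qed
  qed (use tot memS k in auto)
qed

section \<open>Sliding three chords: the third move\<close>

text \<open>\<open>p i j\<close> is the point at which the interval \<open>{a i..b i}\<close> is joined to \<open>{a j..b j}\<close>.\<close>

definition joins :: "(nat \<Rightarrow> 'a::linorder) \<Rightarrow> (nat \<Rightarrow> 'a) \<Rightarrow> (nat \<Rightarrow> nat \<Rightarrow> 'a) \<Rightarrow> bool" where
  "joins a b p \<longleftrightarrow> (\<forall>i<3. \<forall>j<3. i \<noteq> j \<longrightarrow> a i < p i j \<and> p i j < b i) \<and>
     (\<forall>i<3. \<forall>j<3. i \<noteq> j \<longrightarrow> b i < a j \<or> b j < a i) \<and>
     (\<forall>i<3. \<forall>j<3. \<forall>k<3. distinct [i, j, k] \<longrightarrow> p i j \<noteq> p i k)"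

lemma joins_order:
  assumes "joins a b p" "i < 3" "j < 3" "i \<noteq> j" "k < 3" "k \<noteq> i" "l < 3" "l \<noteq> j"
  shows "p i k < p j l \<longleftrightarrow> a i < a j" "p i k \<noteq> p j l" "a i \<noteq> a j"
proof -
  have "a i < p i k" "p i k < b i" "a j < p j l" "p j l < b j" "b i < a j \<or> b j < a i"
    using assms unfolding joins_def by metis+
  then show "p i k < p j l \<longleftrightarrow> a i < a j" "p i k \<noteq> p j l" "a i \<noteq> a j" by auto
qed

lemma joins_neq:
  assumes "joins a b p" "i < 3" "j < 3" "k < 3" "distinct [i, j, k]"
  shows "p i j \<noteq> p i k"
  using assms unfolding joins_def by simp

text \<open>Points of different intervals compare as the intervals do, so everything depends on the
  order of the intervals and on the order of the two points within one interval.\<close>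

lemma ins_joins:
  assumes J: "joins a b p" and ijk: "i < 3" "j < 3" "k < 3" "distinct [i, j, k]"
  shows "ins (p i j, p j i) (p i j) = of_bool (a i < a j)"
    "ins (p i j, p j i) (p j i) = of_bool (a j < a i)"
    "ins (p i j, p j i) (p i k) = of_bool ((a i < a j) = (p i j < p i k))"
    "ins (p i j, p j i) (p j k) = of_bool ((a j < a i) = (p j i < p j k))"
    "ins (p i j, p j i) (p k i) = of_bool ((a i < a k) \<noteq> (a j < a k))"
    "ins (p i j, p j i) (p k j) = of_bool ((a i < a k) \<noteq> (a j < a k))"
proof -
  have d: "i \<noteq> j" "j \<noteq> i" "i \<noteq> k" "k \<noteq> i" "j \<noteq> k" "k \<noteq> j" using ijk(4) by auto
  have ne: "p i j \<noteq> p i k" "p j i \<noteq> p j k" using J ijk(1-3) d unfolding joins_def by simp_all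
  have an: "a i \<noteq> a j" "a i \<noteq> a k" "a j \<noteq> a k"
    using joins_order(3)[OF J, of i j k k] joins_order(3)[OF J, of i k j j] joins_order(3)[OF J, of j k i i] ijk(1-3) d
    by simp_all
  have ij: "p i j < p j i \<longleftrightarrow> a i < a j" "p j i < p i j \<longleftrightarrow> a j < a i" "p i j < p j k \<longleftrightarrow> a i < a j"
    "p j k < p i j \<longleftrightarrow> a j < a i" "p i k < p j i \<longleftrightarrow> a i < a j" "p j i < p i k \<longleftrightarrow> a j < a i"
    "p i j < p k i \<longleftrightarrow> a i < a k" "p k i < p i j \<longleftrightarrow> a k < a i" "p i j < p k j \<longleftrightarrow> a i < a k" "p k j < p i j \<longleftrightarrow> a k < a i"
    "p j i < p k i \<longleftrightarrow> a j < a k" "p k i < p j i \<longleftrightarrow> a k < a j" "p j i < p k j \<longleftrightarrow> a j < a k" "p k j < p j i \<longleftrightarrow> a k < a j"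
    by (simp_all only: joins_order(1)[OF J] ijk(1-3) d not_False_eq_True)
  have le: "p i j \<le> p j i \<longleftrightarrow> a i < a j" "p j i \<le> p i j \<longleftrightarrow> a j < a i" "p i j \<le> p j k \<longleftrightarrow> a i < a j"
    "p j k \<le> p i j \<longleftrightarrow> a j < a i" "p i k \<le> p j i \<longleftrightarrow> a i < a j" "p j i \<le> p i k \<longleftrightarrow> a j < a i"
    "p i j \<le> p k i \<longleftrightarrow> a i < a k" "p k i \<le> p i j \<longleftrightarrow> a k < a i" "p i j \<le> p k j \<longleftrightarrow> a i < a k" "p k j \<le> p i j \<longleftrightarrow> a k < a i"
    "p j i \<le> p k i \<longleftrightarrow> a j < a k" "p k i \<le> p j i \<longleftrightarrow> a k < a j" "p j i \<le> p k j \<longleftrightarrow> a j < a k" "p k j \<le> p j i \<longleftrightarrow> a k < a j"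
    by (simp_all only: joins_order(1)[OF J] ijk(1-3) d not_False_eq_True not_less[symmetric])
      (use an in \<open>auto simp: not_less\<close>)
  have kk: "p i j \<le> p i k \<longleftrightarrow> p i j < p i k" "p i k < p i j \<longleftrightarrow> \<not> p i j < p i k"
    "p j i \<le> p j k \<longleftrightarrow> p j i < p j k" "p j k < p j i \<longleftrightarrow> \<not> p j i < p j k" using ne by auto
  have lohi: "lo (p i j, p j i) = (if a i < a j then p i j else p j i)" "hi (p i j, p j i) = (if a i < a j then p j i else p i j)"
    using an by (simp_all add: lo_def hi_def min_def max_def le)
  show "ins (p i j, p j i) (p i j) = of_bool (a i < a j)"
    "ins (p i j, p j i) (p j i) = of_bool (a j < a i)"
    "ins (p i j, p j i) (p i k) = of_bool ((a i < a j) = (p i j < p i k))"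
    "ins (p i j, p j i) (p j k) = of_bool ((a j < a i) = (p j i < p j k))"
    "ins (p i j, p j i) (p k i) = of_bool ((a i < a k) \<noteq> (a j < a k))"
    "ins (p i j, p j i) (p k j) = of_bool ((a i < a k) \<noteq> (a j < a k))"
    using an by (cases "a i < a j"; auto simp: ins_def lohi ij le kk not_less)+
qed

lemma ins_outside:
  assumes "joins a b p" "i < 3" "j < 3" "i \<noteq> j" "\<And>k. k < 3 \<Longrightarrow> x \<notin> {a k..b k}"
  shows "ins (p i j, p j i) x = of_bool ((a i < x) \<noteq> (a j < x))"
proof -
  have "a i < p i j" "p i j < b i" "a j < p j i" "p j i < b j" using assms unfolding joins_def by metis+
  moreover have "x < a i \<or> b i < x" "x < a j \<or> b j < x" 
    using assms(5)[OF assms(2)] assms(5)[OF assms(3)] unfolding atLeastAtMost_iff not_le[symmetric] by blast+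
  ultimately show ?thesis unfolding ins_def lo_def hi_def by (auto simp: min_def max_def)
qed

lemma ins_interval_const:
  assumes "joins a b p" "i < 3" "j < 3" "i \<noteq> j" 
    and "fst d \<notin> {a i..b i}" "snd d \<notin> {a i..b i}"
  shows "ins d (p i j) = ins d (a i)"
proof -
  have "a i < p i j" "p i j < b i" using assms unfolding joins_def by metis+
  then show ?thesis using assms(5,6) unfolding ins_def lo_def hi_def by (auto simp: min_def max_def)
qed

text \<open>Rewrites Boolean conditions as polynomials over the field with two elements, reduced by
  \<open>x * x = x\<close>, so that case distinctions on orders and signs become ring
  identities.\<close>

lemma bit_polynomial:
  "of_bool (A = B) = 1 + (of_bool A + of_bool B :: bit)" "of_bool (A \<noteq> B) = (of_bool A + of_bool B :: bit)"
  "of_bool (\<not> A) = (1 + of_bool A :: bit)" "(if A then u else v) = of_bool A * u + (1 + of_bool A) * (v :: bit)"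
  "x * x = (x :: bit)" "x * (x * y) = x * (y :: bit)"
proof -
  show "of_bool (A = B) = 1 + (of_bool A + of_bool B :: bit)" "of_bool (A \<noteq> B) = (of_bool A + of_bool B :: bit)"
    by (cases A; cases B; simp)+
  show "of_bool (\<not> A) = (1 + of_bool A :: bit)" "(if A then u else v) = of_bool A * u + (1 + of_bool A) * (v :: bit)"
    by (cases A; simp)+
  show "x * x = (x :: bit)" "x * (x * y) = x * (y :: bit)"
    by (cases x; simp)+
qed

text \<open>Exchanging the two points on each arc affects \<open>ins\<close> only for points of the
  triangle, and the parities and \<open>lk\<close> with outside chords come out unchanged. For two
  chords of the triangle, \<open>lk\<close> changes by a sum of two order bits and two sign bits,
  which is zero by the triangle relation \<open>c0\<close>, \<open>c1\<close> or
  \<open>c2\<close>.\<close>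

lemma gauss_inv_triangle:
  fixes A0 :: "('a::linorder \<times> 'a) set"
  assumes p: "joins a b p" and q: "joins a b q"
    and A: "chords (A0 \<union> {(p 0 1, p 1 0), (p 0 2, p 2 0), (p 1 2, p 2 1)})"
    and A': "chords (A0 \<union> {(q 0 1, q 1 0), (q 0 2, q 2 0), (q 1 2, q 2 1)})"
    and out: "\<And>e i. e \<in> A0 \<Longrightarrow> i < 3 \<Longrightarrow> fst e \<notin> {a i..b i} \<and> snd e \<notin> {a i..b i}"
    and rev: "\<And>i j k. \<lbrakk>i < 3; j < 3; k < 3; distinct [i, j, k]\<rbrakk> \<Longrightarrow> p i j < p i k \<longleftrightarrow> q i k < q i j"
    and P0: "\<And>e. e \<in> A0 \<Longrightarrow> P' e = P e"
    and P: "P' (q 0 1, q 1 0) = P (p 0 1, p 1 0)" "P' (q 0 2, q 2 0) = P (p 0 2, p 2 0)"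
      "P' (q 1 2, q 2 1) = P (p 1 2, p 2 1)"
    and c0: "(p 1 0 < p 1 2 \<longleftrightarrow> P (p 0 1, p 1 0)) \<longleftrightarrow> (p 2 0 < p 2 1 \<longleftrightarrow> P (p 0 2, p 2 0))"
    and c1: "(p 0 1 < p 0 2 \<longleftrightarrow> \<not> P (p 0 1, p 1 0)) \<longleftrightarrow> (p 2 1 < p 2 0 \<longleftrightarrow> P (p 1 2, p 2 1))"
    and c2: "(p 0 2 < p 0 1 \<longleftrightarrow> \<not> P (p 0 2, p 2 0)) \<longleftrightarrow> (p 1 2 < p 1 0 \<longleftrightarrow> \<not> P (p 1 2, p 2 1))"
  shows "gauss_inv (A0 \<union> {(p 0 1, p 1 0), (p 0 2, p 2 0), (p 1 2, p 2 1)}) P =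
    gauss_inv (A0 \<union> {(q 0 1, q 1 0), (q 0 2, q 2 0), (q 1 2, q 2 1)}) P'"
proof -
  define t01 where "t01 = (p 0 1, p 1 0)"
  define t02 where "t02 = (p 0 2, p 2 0)"
  define t12 where "t12 = (p 1 2, p 2 1)"
  define u01 where "u01 = (q 0 1, q 1 0)"
  define u02 where "u02 = (q 0 2, q 2 0)"
  define u12 where "u12 = (q 1 2, q 2 1)"
  note t = t01_def t02_def t12_def
  note u = u01_def u02_def u12_def
  define R where "R = A0 \<union> {t01, t02, t12}"
  define R' where "R' = A0 \<union> {u01, u02, u12}"
  have R: "chords R" "chords R'" using A A' by (simp_all add: R_def R'_def t u)
  have in_arc: "r i j \<in> {a i..b i}" if "joins a b r" "i < 3" "j < 3" "i \<noteq> j" for r i j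
    using that unfolding joins_def by (auto simp: less_imp_le)
  have notin: "t01 \<notin> A0" "t02 \<notin> A0" "t12 \<notin> A0" "u01 \<notin> A0" "u02 \<notin> A0" "u12 \<notin> A0"
    using out[of _ 0] out[of _ 1] in_arc[OF p, of 0 1] in_arc[OF p, of 0 2] in_arc[OF p, of 1 2]
      in_arc[OF q, of 0 1] in_arc[OF q, of 0 2] in_arc[OF q, of 1 2] by (force simp: t u)+
  have dist: "distinct [t01, t02, t12]" "distinct [u01, u02, u12]"
    using joins_order(2)[OF p, of 0 1] joins_order(2)[OF p, of 0 2] joins_order(2)[OF p, of 1 2]
      joins_order(2)[OF q, of 0 1] joins_order(2)[OF q, of 0 2] joins_order(2)[OF q, of 1 2]
    by (auto simp: t u)
  have fin: "finite A0" using R by (auto simp: R_def chords_def)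
  have sumR: "(\<Sum>e\<in>R. f e) = (\<Sum>e\<in>A0. f e) + (f t01 + f t02 + f t12)" 
    "(\<Sum>e\<in>R'. f e) = (\<Sum>e\<in>A0. f e) + (f u01 + f u02 + f u12)" for f :: "_ \<Rightarrow> bit"
    unfolding R_def R'_def using fin notin dist by (subst sum.union_disjoint; auto simp: add.assoc)+
  define b01 where "b01 = (a 0 < a 1)" define b02 where "b02 = (a 0 < a 2)" define b12 where "b12 = (a 1 < a 2)"
  define o0 where "o0 = (p 0 1 < p 0 2)" define o1 where "o1 = (p 1 0 < p 1 2)" define o2 where "o2 = (p 2 0 < p 2 1)"
  have ane: "a 0 \<noteq> a 1" "a 0 \<noteq> a 2" "a 1 \<noteq> a 2"
    using joins_order(3)[OF p, of 0 1 1 0] joins_order(3)[OF p, of 0 2 1 0] joins_order(3)[OF p, of 1 2 0 0] by auto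
  have b: "a 0 < a 1 \<longleftrightarrow> b01" "a 0 < a 2 \<longleftrightarrow> b02" "a 1 < a 2 \<longleftrightarrow> b12" 
    "a 1 < a 0 \<longleftrightarrow> \<not> b01" "a 2 < a 0 \<longleftrightarrow> \<not> b02" "a 2 < a 1 \<longleftrightarrow> \<not> b12"
    using ane by (auto simp: b01_def b02_def b12_def)
  have tr: "\<not> (b01 \<and> b12 \<and> \<not> b02)" "\<not> (\<not> b01 \<and> \<not> b12 \<and> b02)" 
    unfolding b01_def b02_def b12_def by auto
  have pne: "p i j \<noteq> p i k" "q i j \<noteq> q i k" if "i < 3" "j < 3" "k < 3" "distinct [i, j, k]" for i j k
    using joins_neq[OF p that] joins_neq[OF q that] by blast+
  have o: "p 0 1 < p 0 2 \<longleftrightarrow> o0" "p 1 0 < p 1 2 \<longleftrightarrow> o1" "p 2 0 < p 2 1 \<longleftrightarrow> o2" 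
    "p 0 2 < p 0 1 \<longleftrightarrow> \<not> o0" "p 1 2 < p 1 0 \<longleftrightarrow> \<not> o1" "p 2 1 < p 2 0 \<longleftrightarrow> \<not> o2"
    using pne[of 0 1 2] pne[of 1 0 2] pne[of 2 0 1] by (auto simp: o0_def o1_def o2_def)
  have o': "q 0 1 < q 0 2 \<longleftrightarrow> \<not> o0" "q 1 0 < q 1 2 \<longleftrightarrow> \<not> o1" "q 2 0 < q 2 1 \<longleftrightarrow> \<not> o2" 
    "q 0 2 < q 0 1 \<longleftrightarrow> o0" "q 1 2 < q 1 0 \<longleftrightarrow> o1" "q 2 1 < q 2 0 \<longleftrightarrow> o2"
    using rev[of 0 1 2] rev[of 1 0 2] rev[of 2 0 1] pne[of 0 1 2] pne[of 1 0 2] pne[of 2 0 1] o by auto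
  have swap: "ins (x, y) = ins (y, x)" for x y :: 'a
    by (simp add: ins_def lo_def hi_def fun_eq_iff min.commute max.commute)
  note ip = ins_joins[OF p, of 0 1 2] ins_joins[OF p, of 0 2 1] ins_joins[OF p, of 1 2 0]
  note iq = ins_joins[OF q, of 0 1 2] ins_joins[OF q, of 0 2 1] ins_joins[OF q, of 1 2 0]
  have tp: "ins t01 (fst t01) = of_bool b01" "ins t01 (snd t01) = of_bool (\<not> b01)"
    "ins t01 (fst t02) = of_bool (b01 = o0)" "ins t01 (snd t02) = of_bool (b02 \<noteq> b12)"
    "ins t01 (fst t12) = of_bool ((\<not> b01) = o1)" "ins t01 (snd t12) = of_bool (b02 \<noteq> b12)"
    "ins t02 (fst t02) = of_bool b02" "ins t02 (snd t02) = of_bool (\<not> b02)"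
    "ins t02 (fst t01) = of_bool (b02 = (\<not> o0))" "ins t02 (snd t01) = of_bool (b01 \<noteq> (\<not> b12))"
    "ins t02 (fst t12) = of_bool (b01 \<noteq> (\<not> b12))" "ins t02 (snd t12) = of_bool ((\<not> b02) = o2)"
    "ins t12 (fst t12) = of_bool b12" "ins t12 (snd t12) = of_bool (\<not> b12)"
    "ins t12 (fst t01) = of_bool ((\<not> b01) \<noteq> (\<not> b02))" "ins t12 (snd t01) = of_bool (b12 = (\<not> o1))"
    "ins t12 (fst t02) = of_bool ((\<not> b01) \<noteq> (\<not> b02))" "ins t12 (snd t02) = of_bool ((\<not> b12) = (\<not> o2))"
    using ip unfolding t fst_conv snd_conv b o by simp_all
  have uq: "ins u01 (fst u01) = of_bool b01" "ins u01 (snd u01) = of_bool (\<not> b01)"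
    "ins u01 (fst u02) = of_bool (b01 = (\<not> o0))" "ins u01 (snd u02) = of_bool (b02 \<noteq> b12)"
    "ins u01 (fst u12) = of_bool ((\<not> b01) = (\<not> o1))" "ins u01 (snd u12) = of_bool (b02 \<noteq> b12)"
    "ins u02 (fst u02) = of_bool b02" "ins u02 (snd u02) = of_bool (\<not> b02)"
    "ins u02 (fst u01) = of_bool (b02 = o0)" "ins u02 (snd u01) = of_bool (b01 \<noteq> (\<not> b12))"
    "ins u02 (fst u12) = of_bool (b01 \<noteq> (\<not> b12))" "ins u02 (snd u12) = of_bool ((\<not> b02) = (\<not> o2))"
    "ins u12 (fst u12) = of_bool b12" "ins u12 (snd u12) = of_bool (\<not> b12)"
    "ins u12 (fst u01) = of_bool ((\<not> b01) \<noteq> (\<not> b02))" "ins u12 (snd u01) = of_bool (b12 = o1)"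
    "ins u12 (fst u02) = of_bool ((\<not> b01) \<noteq> (\<not> b02))" "ins u12 (snd u02) = of_bool ((\<not> b12) = o2)"
    using iq unfolding u fst_conv snd_conv b o' by simp_all
  have cst: "ins d (fst u01) = ins d (fst t01)" "ins d (snd u01) = ins d (snd t01)"
    "ins d (fst u02) = ins d (fst t02)" "ins d (snd u02) = ins d (snd t02)"
    "ins d (fst u12) = ins d (fst t12)" "ins d (snd u12) = ins d (snd t12)"
    "ins d (fst t02) = ins d (fst t01)" "ins d (snd t02) = ins d (snd t12)" "ins d (fst t12) = ins d (snd t01)"
    if "d \<in> A0" for d
    using out[OF that] by (simp_all add: t u ins_interval_const[OF p] ins_interval_const[OF q])
  have ext: "ins u01 x = ins t01 x" "ins u02 x = ins t02 x" "ins u12 x = ins t12 x"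
    "ins t02 x = ins t01 x + ins t12 x"
    if "\<And>k. k < 3 \<Longrightarrow> x \<notin> {a k..b k}" for x
    using ins_outside[OF p _ _ _ that] ins_outside[OF q _ _ _ that] by (simp_all add: t u)
  have extA: "ins u01 (fst e) = ins t01 (fst e)" "ins u02 (fst e) = ins t02 (fst e)" "ins u12 (fst e) = ins t12 (fst e)"
    "ins u01 (snd e) = ins t01 (snd e)" "ins u02 (snd e) = ins t02 (snd e)" "ins u12 (snd e) = ins t12 (snd e)"
    if "e \<in> A0" for e
    using ext out[OF that] by auto
  have PP: "P' u01 = P t01" "P' u02 = P t02" "P' u12 = P t12" using P by (simp_all add: t u)
  have C: "(o1 = P t01) = (o2 = P t02)" "(o0 = (\<not> P t01)) = ((\<not> o2) = P t12)"
    "((\<not> o0) = (\<not> P t02)) = ((\<not> o1) = (\<not> P t12))"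
    using c0 c1 c2 unfolding o t by simp_all
  define \<beta> where "\<beta> c = (if c = t01 then u01 else if c = t02 then u02 else if c = t12 then u12 else c)" for c
  have \<beta>: "\<beta> t01 = u01" "\<beta> t02 = u02" "\<beta> t12 = u12" "\<And>c. c \<in> A0 \<Longrightarrow> \<beta> c = c"
    using dist notin by (auto simp: \<beta>_def)
  have S0: "(\<Sum>e\<in>A0. ins u01 (fst e) + ins u01 (snd e)) = (\<Sum>e\<in>A0. ins t01 (fst e) + ins t01 (snd e))"
    "(\<Sum>e\<in>A0. ins u02 (fst e) + ins u02 (snd e)) = (\<Sum>e\<in>A0. ins t02 (fst e) + ins t02 (snd e))"
    "(\<Sum>e\<in>A0. ins u12 (fst e) + ins u12 (snd e)) = (\<Sum>e\<in>A0. ins t12 (fst e) + ins t12 (snd e))"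
    by (intro sum.cong refl; simp add: extA)+
  have S1: "(\<Sum>e\<in>A0. ins u01 (fst e) * f (snd e) + ins u01 (snd e) * f (fst e)) = 
      (\<Sum>e\<in>A0. ins t01 (fst e) * f (snd e) + ins t01 (snd e) * f (fst e))"
    "(\<Sum>e\<in>A0. ins u02 (fst e) * f (snd e) + ins u02 (snd e) * f (fst e)) = 
      (\<Sum>e\<in>A0. ins t02 (fst e) * f (snd e) + ins t02 (snd e) * f (fst e))"
    "(\<Sum>e\<in>A0. ins u12 (fst e) * f (snd e) + ins u12 (snd e) * f (fst e)) = 
      (\<Sum>e\<in>A0. ins t12 (fst e) * f (snd e) + ins t12 (snd e) * f (fst e))" for f :: "'a \<Rightarrow> bit"
    by (intro sum.cong refl; simp add: extA)+
  have S2: "(\<Sum>e\<in>A0. ins t01 (fst e) * ins u02 (snd e) + ins t01 (snd e) * ins u02 (fst e)) = 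
      (\<Sum>e\<in>A0. ins t01 (fst e) * ins t02 (snd e) + ins t01 (snd e) * ins t02 (fst e))"
    "(\<Sum>e\<in>A0. ins t01 (fst e) * ins u12 (snd e) + ins t01 (snd e) * ins u12 (fst e)) = 
      (\<Sum>e\<in>A0. ins t01 (fst e) * ins t12 (snd e) + ins t01 (snd e) * ins t12 (fst e))"
    "(\<Sum>e\<in>A0. ins t02 (fst e) * ins u12 (snd e) + ins t02 (snd e) * ins u12 (fst e)) = 
      (\<Sum>e\<in>A0. ins t02 (fst e) * ins t12 (snd e) + ins t02 (snd e) * ins t12 (fst e))"
    by (intro sum.cong refl; simp add: extA)+
  have ne: "t01 \<noteq> t02" "t01 \<noteq> t12" "t02 \<noteq> t12" "u01 \<noteq> u02" "u01 \<noteq> u12" "u02 \<noteq> u12"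
    using dist by auto
  \<comment> \<open>The three triangle relations as linear equations between order bits and sign
    bits. Each pair of triangle chords needs exactly one of them.\<close>
  have CC1: "of_bool o2 = of_bool o1 + (of_bool (P t01) + of_bool (P t02) :: bit)"
    and CC2: "of_bool o2 = of_bool o0 + (of_bool (P t01) + of_bool (P t12) :: bit)"
    and CC3: "of_bool o1 = of_bool o0 + (of_bool (P t02) + of_bool (P t12) :: bit)"
    using C by (cases o0; cases o1; cases o2; cases "P t01"; cases "P t02"; cases "P t12"; simp)+
  have lk0102: "lk R' P' u01 u02 = lk R P t01 t02"
    unfolding lk_def sumR S1 S2 PP if_distrib[of "ins _"] tp uq using ne
    by (simp add: bit_polynomial CC1 algebra_simps)
  have lk0112: "lk R' P' u01 u12 = lk R P t01 t12"
    unfolding lk_def sumR S1 S2 PP if_distrib[of "ins _"] tp uq using ne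
    by (simp add: bit_polynomial CC2 algebra_simps)
  have lk0212: "lk R' P' u02 u12 = lk R P t02 t12"
    unfolding lk_def sumR S1 S2 PP if_distrib[of "ins _"] tp uq using ne
    by (simp add: bit_polynomial CC3 algebra_simps)
  have inR: "t01 \<in> R" "t02 \<in> R" "t12 \<in> R" "u01 \<in> R'" "u02 \<in> R'" "u12 \<in> R'" "A0 \<subseteq> R" "A0 \<subseteq> R'"
    by (auto simp: R_def R'_def)
  have lkA: "lk R' P' u01 d = lk R P t01 d" "lk R' P' u02 d = lk R P t02 d" "lk R' P' u12 d = lk R P t12 d" if d: "d \<in> A0" for d
  proof -
    have ned: "u01 \<noteq> d" "u02 \<noteq> d" "u12 \<noteq> d" "t01 \<noteq> d" "t02 \<noteq> d" "t12 \<noteq> d" using d notin by auto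
    note * = lk_def sumR S1 PP P0[OF d] if_distrib[of "ins _"] tp uq cst[OF d] extA[OF d]
    show "lk R' P' u01 d = lk R P t01 d" unfolding * using ned by (simp add: bit_polynomial algebra_simps)
    show "lk R' P' u02 d = lk R P t02 d" unfolding * using ned by (simp add: bit_polynomial algebra_simps)
    show "lk R' P' u12 d = lk R P t12 d" unfolding * using ned by (simp add: bit_polynomial algebra_simps)
  qed
  have lk00: "lk R' P' c d = lk R P c d" if c: "c \<in> A0" and d: "d \<in> A0" for c d
    unfolding lk_def sumR P0[OF c] P0[OF d] cst[OF c] cst[OF d] by simp
  have par: "par R' (\<beta> c) = par R c" if c: "c \<in> R" for c
  proof -
    consider "c \<in> A0" | "c = t01" | "c = t02" | "c = t12" using c by (auto simp: R_def)
    then show ?thesis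
    proof cases
      case 1
      then show ?thesis by (simp add: \<beta> par_def sumR cst)
    next
      case 2
      show ?thesis unfolding 2 \<beta> par_def sumR S0 tp uq by (simp add: bit_polynomial algebra_simps)
    next
      case 3
      show ?thesis unfolding 3 \<beta> par_def sumR S0 tp uq by (simp add: bit_polynomial algebra_simps)
    next
      case 4
      show ?thesis unfolding 4 \<beta> par_def sumR S0 tp uq by (simp add: bit_polynomial algebra_simps)
    qed
  qed
  have "gauss_inv R P = gauss_inv R' P'"
  proof (rule gauss_inv_bij[of \<beta>])
    show "bij_betw \<beta> R R'"
    proof (rule bij_betw_imageI)
      show "inj_on \<beta> R" using notin ne by (auto simp: R_def inj_on_def \<beta>)
      show "\<beta> ` R = R'" using \<beta> by (force simp: R_def R'_def)
    qed
    have ends_less: "(fst u01 < snd u01) = (fst t01 < snd t01)" "(fst u02 < snd u02) = (fst t02 < snd t02)" "(fst u12 < snd u12) = (fst t12 < snd t12)"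
      "(snd u01 < fst u01) = (snd t01 < fst t01)" "(snd u02 < fst u02) = (snd t02 < fst t02)" "(snd u12 < fst u12) = (snd t12 < fst t12)"
      using joins_order(1)[OF p] joins_order(1)[OF q] by (simp_all add: t u)
    show "fst (\<beta> c) < snd (\<beta> c) \<longleftrightarrow> fst c < snd c" "snd (\<beta> c) < fst (\<beta> c) \<longleftrightarrow> snd c < fst c" "P' (\<beta> c) = P c" if c: "c \<in> R" for c
    proof -
      have "c \<in> A0 \<or> c = t01 \<or> c = t02 \<or> c = t12" using c by (auto simp: R_def)
      then show "fst (\<beta> c) < snd (\<beta> c) \<longleftrightarrow> fst c < snd c" "snd (\<beta> c) < fst (\<beta> c) \<longleftrightarrow> snd c < fst c" "P' (\<beta> c) = P c"
        by (elim disjE; simp only: \<beta> ends_less PP P0)+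
    qed
    show "lk R' P' (\<beta> c) (\<beta> d) = lk R P c d" if "c \<in> R" "d \<in> R" for c d
    proof -
      have "c \<in> A0 \<or> c = t01 \<or> c = t02 \<or> c = t12" "d \<in> A0 \<or> d = t01 \<or> d = t02 \<or> d = t12"
        using that by (auto simp: R_def)
      moreover have c0: "lk R' P' c u01 = lk R P c t01" "lk R' P' c u02 = lk R P c t02" "lk R' P' c u12 = lk R P c t12"
        if "c \<in> A0"
        using lkA[OF that] lk_commute[OF R(1), of c] lk_commute[OF R(2), of c] inR(1-6) subsetD[OF inR(7) that]
          subsetD[OF inR(8) that] by simp_all
      moreover have cm: "lk R' P' u02 u01 = lk R P t02 t01" "lk R' P' u12 u01 = lk R P t12 t01" "lk R' P' u12 u02 = lk R P t12 t02"
        using lk0102 lk0112 lk0212 lk_commute[OF R(1) inR(2) inR(1)] lk_commute[OF R(1) inR(3) inR(1)] lk_commute[OF R(1) inR(3) inR(2)]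
          lk_commute[OF R(2) inR(5) inR(4)] lk_commute[OF R(2) inR(6) inR(4)] lk_commute[OF R(2) inR(6) inR(5)] by simp_all
      moreover have sf: "lk R' P' u01 u01 = lk R P t01 t01" "lk R' P' u02 u02 = lk R P t02 t02" "lk R' P' u12 u12 = lk R P t12 t12"
        using lk_self[OF R(1)] lk_self[OF R(2)] inR by simp_all
      ultimately show ?thesis
        by (elim disjE) (simp_all only: \<beta> lk00 lkA lk0102 lk0112 lk0212 c0 cm sf)
    qed
    show "par R' (\<beta> c) = par R c" if "c \<in> R" for c using par[OF that] .
  qed
  then show ?thesis by (simp add: R_def R'_def t u)
qed

section \<open>Invariance under the moves\<close>

definition sign_of :: "diagram \<Rightarrow> real \<times> real \<Rightarrow> bool" where
  "sign_of D e = positive D (fst e) (snd e)"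

definition diagram_inv :: "diagram \<Rightarrow> int \<times> bit \<times> int" where
  "diagram_inv D = gauss_inv (arrows D) (sign_of D)"

lemma gauss_inv_cong:
  assumes "\<And>c. c \<in> A \<Longrightarrow> P c = P' c"
  shows "gauss_inv A P = gauss_inv A P'"
  by (rule gauss_inv_bij[of id]) (use assms in \<open>auto simp: lk_def\<close>)

lemma double_pairs_unique:
  assumes "long_virtual_diagram D" "(s, t) \<in> double_pairs (curve D)" "(s, u) \<in> double_pairs (curve D)"
  shows "t = u"
  using assms unfolding long_virtual_diagram_def long_immersed_line_def by metis

lemma double_pairs_sym: "(s, t) \<in> double_pairs \<gamma> \<Longrightarrow> (t, s) \<in> double_pairs \<gamma>"
  by (auto simp: double_pairs_def)

lemma arrows_double: "long_virtual_diagram D \<Longrightarrow> (s, t) \<in> arrows D \<Longrightarrow> (s, t) \<in> double_pairs (curve D)"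
  unfolding long_virtual_diagram_def by blast

lemma chords_arrows:
  assumes D: "long_virtual_diagram D"
  shows "chords (arrows D)"
  unfolding chords_def
proof (intro conjI ballI impI)
  have "arrows D \<subseteq> double_pairs (curve D)" "finite (double_pairs (curve D))"
    using D unfolding long_virtual_diagram_def long_immersed_line_def by blast+
  then show "finite (arrows D)" by (rule finite_subset)
next
  fix e assume "e \<in> arrows D"
  then have "(fst e, snd e) \<in> double_pairs (curve D)" using arrows_double[OF D, of "fst e" "snd e"] by simp
  then show "fst e \<noteq> snd e" by (cases e) (simp add: double_pairs_def)
next
  fix e e' assume e: "e \<in> arrows D" "e' \<in> arrows D" "{fst e, snd e} \<inter> {fst e', snd e'} \<noteq> {}"
  obtain s t s' t' where [simp]: "e = (s, t)" "e' = (s', t')" by (cases e, cases e')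
  note u = double_pairs_unique[OF D]
  have d: "(s, t) \<in> double_pairs (curve D)" "(s', t') \<in> double_pairs (curve D)"
    using e arrows_double[OF D] by auto
  note d' = d[THEN double_pairs_sym]
  have anti: "(t, s) \<notin> arrows D" using e(1) D unfolding long_virtual_diagram_def by simp
  have "s = s' \<or> t = t' \<or> s = t' \<or> t = s'" using e(3) by auto
  then show "e = e'"
  proof (elim disjE)
    assume "s = s'" then show ?thesis using u[OF d(1)] d(2) by simp
  next
    assume "t = t'" then show ?thesis using u[OF d'(1)] d'(2) by simp
  next
    assume "s = t'" then have "t = s'" using u[OF d(1)] d'(2) by simp
    then show ?thesis using \<open>s = t'\<close> anti e(2) by simp
  next
    assume "t = s'" then have "s = t'" using u[OF d'(1)] d(2) by simp
    then show ?thesis using \<open>t = s'\<close> anti e(2) by simp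
  qed
qed

lemma planar_isotopy_inv:
  assumes "planar_isotopy D D'"
  shows "diagram_inv D = diagram_inv D'"
proof -
  obtain \<tau> where \<tau>: "strict_mono \<tau>" "surj \<tau>" "arrows D' = {(s, t). (\<tau> s, \<tau> t) \<in> arrows D}"
    "\<forall>(s, t) \<in> arrows D'. positive D' s t \<longleftrightarrow> positive D (\<tau> s) (\<tau> t)"
    using assms unfolding planar_isotopy_def by blast
  have "map_prod \<tau> \<tau> ` arrows D' = arrows D"
  proof (intro subset_antisym subsetI)
    fix e assume e: "e \<in> arrows D"
    obtain s t where "e = (\<tau> s, \<tau> t)" using \<tau>(2) by (metis surj_pair surjD)
    then show "e \<in> map_prod \<tau> \<tau> ` arrows D'" using e by (auto simp: \<tau>(3) image_iff)
  qed (auto simp: \<tau>(3))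
  moreover have "gauss_inv (arrows D') (sign_of D') = gauss_inv (map_prod \<tau> \<tau> ` arrows D') (sign_of D)"
    using \<tau>(1,4) by (intro gauss_inv_strict_mono) (auto simp: strict_mono_on_def strict_mono_def sign_of_def)
  ultimately show ?thesis by (simp add: diagram_inv_def)
qed

text \<open>A double point lies either in the disk or outside of it, so the times of an arrow are
  both in \<open>arc_times S\<close> or both not. Off this closed set the curves agree in a
  neighbourhood of each time, which carries over velocities and hence signs.\<close>

lemma agree_outside_facts:
  assumes ag: "agree_outside D D' S"
  defines "A \<equiv> arrows D - arc_times S \<times> arc_times S"
  shows "arrows D = A \<union> local_arrows D S" "arrows D' = A \<union> local_arrows D' S"
    "\<And>e. e \<in> A \<Longrightarrow> fst e \<notin> arc_times S \<and> snd e \<notin> arc_times S"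
    "\<And>e. e \<in> A \<Longrightarrow> sign_of D' e = sign_of D e"
proof -
  have D: "long_virtual_diagram D" "long_virtual_diagram D'" using ag by (auto simp: agree_outside_def)
  show "arrows D = A \<union> local_arrows D S" by (auto simp: A_def local_arrows_def)
  show "arrows D' = A \<union> local_arrows D' S"
    using ag unfolding agree_outside_def A_def local_arrows_def by blast
  obtain \<Delta> where \<Delta>: "curve D -` \<Delta> = arc_times S"
    using ag unfolding agree_outside_def meets_in_arcs_def by blast
  show out: "fst e \<notin> arc_times S \<and> snd e \<notin> arc_times S" if "e \<in> A" for e
  proof -
    have "(fst e, snd e) \<in> double_pairs (curve D)" using that arrows_double[OF D(1), of "fst e" "snd e"] by (simp add: A_def)
    then have "fst e \<in> arc_times S \<longleftrightarrow> snd e \<in> arc_times S" unfolding \<Delta>[symmetric] by (cases e) (simp add: double_pairs_def)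
    then show ?thesis using that by (cases e) (auto simp: A_def)
  qed
  have "closed (arc_times S)" unfolding arc_times_def by (intro closed_UN) auto
  then have op: "open (- arc_times S)" by auto
  have v: "velocity (curve D) s = velocity (curve D') s" if s: "s \<notin> arc_times S" for s
  proof -
    have eq: "curve D t = curve D' t" if "t \<in> - arc_times S" for t
      using ag that unfolding agree_outside_def by blast
    have "(curve D has_vector_derivative w) (at s) \<longleftrightarrow> (curve D' has_vector_derivative w) (at s)" for w
      using has_vector_derivative_transform_within_open[OF _ op, of _ w s] s eq by (metis ComplI)
    then show ?thesis unfolding velocity_def vector_derivative_def by simp
  qed
  show "sign_of D' e = sign_of D e" if "e \<in> A" for e
    using out[OF that] v by (simp add: sign_of_def positive_def)
qed

lemma local_arrows_subset: "long_virtual_diagram D \<Longrightarrow> local_arrows D S \<subseteq> local_doubles D S"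
  using arrows_double by (auto simp: local_arrows_def local_doubles_def)

lemma reidemeister1_inv:
  assumes "reidemeister1 D D'"
  shows "diagram_inv D = diagram_inv D'"
proof -
  obtain a b s t where ag: "agree_outside D D' [(a, b)]" and st: "s \<in> {a<..<b}" "t \<in> {a<..<b}"
    and ld: "local_doubles D [(a, b)] = {(s, t), (t, s)}" "local_doubles D' [(a, b)] = {}"
    using assms unfolding reidemeister1_def by blast
  have D: "long_virtual_diagram D" "long_virtual_diagram D'" using ag by (auto simp: agree_outside_def)
  define A where "A = arrows D - arc_times [(a, b)] \<times> arc_times [(a, b)]"
  note facts = agree_outside_facts[OF ag, folded A_def]
  have "local_arrows D' [(a, b)] = {}" using local_arrows_subset[OF D(2)] ld(2) by blast
  then have A': "arrows D' = A" using facts(2) by simp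
  have "(s, t) \<in> arrows D \<Longrightarrow> (t, s) \<notin> arrows D" using D(1) unfolding long_virtual_diagram_def by simp
  then consider "local_arrows D [(a, b)] = {}" | k where "local_arrows D [(a, b)] = {k}" "k \<in> {(s, t), (t, s)}"
    using local_arrows_subset[OF D(1), of "[(a, b)]"] unfolding ld local_arrows_def by blast
  then have "gauss_inv (arrows D) (sign_of D) = gauss_inv A (sign_of D)"
  proof cases
    case 1
    then show ?thesis using facts(1) by simp
  next
    case 2
    have arc: "arc_times [(a, b)] = {a..b}" by (simp add: arc_times_def)
    have AD: "arrows D = A \<union> {k}" using facts(1) 2 by simp
    have "k \<notin> A" using 2 st facts(3)[of k] unfolding arc by auto
    then have "arrows D - {k} = A" using AD by auto
    moreover have "gauss_inv (arrows D - {k}) (sign_of D) = gauss_inv (arrows D) (sign_of D)"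
    proof (rule gauss_inv_isolated[OF chords_arrows[OF D(1)]])
      fix e assume "e \<in> arrows D - {k}"
      then have e: "fst e \<notin> {a..b} \<and> snd e \<notin> {a..b}" using facts(3) AD arc by auto
      have "{lo k..hi k} \<subseteq> {a..b}" using 2(2) st by (auto simp: lo_def hi_def)
      then show "fst e \<notin> {lo k..hi k} \<and> snd e \<notin> {lo k..hi k}" using e by blast
    qed (use AD in simp)
    ultimately show ?thesis by simp
  qed
  moreover have "gauss_inv A (sign_of D) = gauss_inv A (sign_of D')"
    using facts(4) by (intro gauss_inv_cong) simp
  ultimately show ?thesis by (simp add: diagram_inv_def A')
qed

lemma reidemeister2_inv:
  assumes "reidemeister2 D D'"
  shows "diagram_inv D = diagram_inv D'"
proof -
  obtain a b c d s s' t t' where ag: "agree_outside D D' [(a, b), (c, d)]" 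
    and st: "{s, s'} \<subseteq> {a<..<b}" "s \<noteq> s'" "{t, t'} \<subseteq> {c<..<d}" "t \<noteq> t'"
    and sg: "positive D s t \<longleftrightarrow> \<not> positive D s' t'"
    and la: "local_arrows D [(a, b), (c, d)] \<in> {{}, {(s, t), (s', t')}}" and ld: "local_doubles D' [(a, b), (c, d)] = {}"
    using assms[unfolded reidemeister2_def Let_def] by (elim exE conjE) (rule that, assumption+)
  define S where "S = [(a, b), (c, d)]"
  have D: "long_virtual_diagram D" "long_virtual_diagram D'" using ag by (auto simp: agree_outside_def)
  define A where "A = arrows D - arc_times S \<times> arc_times S"
  note facts = agree_outside_facts[OF ag, folded S_def, folded A_def]
  have "local_arrows D' S = {}" using local_arrows_subset[OF D(2)] ld unfolding S_def by blast
  then have A': "arrows D' = A" using facts(2) by simp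
  have "gauss_inv (arrows D) (sign_of D) = gauss_inv A (sign_of D)"
  proof (cases "local_arrows D S = {}")
    case True
    then show ?thesis using facts(1) by simp
  next
    case False
    then have AD: "arrows D = A \<union> {(s, t), (s', t')}" using facts(1) la by (auto simp: S_def)
    have arc: "arc_times S = {a..b} \<union> {c..d}" by (auto simp: arc_times_def S_def)
    have "(s, t) \<notin> A" "(s', t') \<notin> A" using st facts(3)[of "(s, t)"] facts(3)[of "(s', t')"] unfolding arc by auto
    then have AK: "arrows D - {(s, t), (s', t')} = A" using AD by auto
    have dis: "{a..b} \<inter> {c..d} = {}" "a < b" "c < d"
    proof -
      obtain \<Delta> where "meets_in_arcs (curve D) \<Delta> [(a, b), (c, d)]" using ag unfolding agree_outside_def by blast
      then show "{a..b} \<inter> {c..d} = {}" "a < b" "c < d" unfolding meets_in_arcs_def by (auto simp: less_imp_le)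
    qed
    have ord: "b < c \<or> d < a"
    proof (rule ccontr)
      assume "\<not> (b < c \<or> d < a)"
      then have "max a c \<in> {a..b} \<inter> {c..d}" using dis(2,3) by auto
      then show False unfolding dis(1) by simp
    qed
    have "gauss_inv (arrows D - {(s, t), (s', t')}) (sign_of D) = gauss_inv (arrows D) (sign_of D)"
    proof (rule gauss_inv_pair[OF chords_arrows[OF D(1)], of _ _ "{min s s'..max s s'}" "{min t t'..max t t'}"])
      have sub: "{min s s'..max s s'} \<subseteq> {a<..<b}" "{min t t'..max t t'} \<subseteq> {c<..<d}" using st by auto
      then show "(\<forall>x\<in>{min s s'..max s s'}. \<forall>y\<in>{min t t'..max t t'}. x < y) \<or>
         (\<forall>x\<in>{min s s'..max s s'}. \<forall>y\<in>{min t t'..max t t'}. y < x)"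
      proof -
        have "x < y" if "b < c" "x \<in> {a<..<b}" "y \<in> {c<..<d}" for x y using that by auto
        moreover have "y < x" if "d < a" "x \<in> {a<..<b}" "y \<in> {c<..<d}" for x y using that by auto
        ultimately show ?thesis using ord sub by blast
      qed
      fix e assume "e \<in> arrows D - {(s, t), (s', t')}"
      then have "fst e \<notin> arc_times S \<and> snd e \<notin> arc_times S" using facts(3) AK by simp
      then show "fst e \<notin> {min s s'..max s s'} \<union> {min t t'..max t t'} \<and> snd e \<notin> {min s s'..max s s'} \<union> {min t t'..max t t'}"
      proof -
        have "{min s s'..max s s'} \<subseteq> {a..b}" "{min t t'..max t t'} \<subseteq> {c..d}" using st by auto
        then show ?thesis using \<open>fst e \<notin> arc_times S \<and> snd e \<notin> arc_times S\<close> unfolding arc by blast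
      qed
    qed (use AD st sg in \<open>auto simp: sign_of_def\<close>)
    then show ?thesis using AK by simp
  qed
  moreover have "gauss_inv A (sign_of D) = gauss_inv A (sign_of D')"
    using facts(4) by (intro gauss_inv_cong) simp
  ultimately show ?thesis by (simp add: diagram_inv_def A')
qed

lemma positive_swap:
  assumes "long_virtual_diagram D" "(s, t) \<in> double_pairs (curve D)"
  shows "positive D t s \<longleftrightarrow> \<not> positive D s t"
proof -
  have "det2 (velocity (curve D) s) (velocity (curve D) t) \<noteq> 0"
    using assms unfolding long_virtual_diagram_def long_immersed_line_def by blast
  then show ?thesis unfolding positive_def using det2_swap[of "velocity (curve D) t" "velocity (curve D) s"] by linarith
qed

text \<open>Three virtual crossings change no arrow, a single real crossing only has its times
  shifted, and three real crossings are the case of \<open>gauss_inv_triangle\<close>, whose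
  relations are three instances of \<open>triangle_constraint\<close>.\<close>

lemma reidemeister3_inv:
  assumes "reidemeister3 D D'"
  shows "diagram_inv D = diagram_inv D'"
proof -
  obtain S p q I where S: "length S = 3" and ag: "agree_outside D D' S"
    and T: "triangle D S p" "triangle D' S q"
    and rev: "\<forall>i < 3. \<forall>j < 3. \<forall>k < 3. distinct [i, j, k] \<longrightarrow> (p i j < p i k \<longleftrightarrow> q i k < q i j)"
    and sg: "\<forall>i < 3. \<forall>j < 3. i \<noteq> j \<longrightarrow> (positive D (p i j) (p j i) \<longleftrightarrow> positive D' (q i j) (q j i))"
    and I: "I \<in> {{}, {(0, 1)}, {(0, 1), (0, 2), (1::nat, 2::nat)}}"
    and la: "local_arrows D S = {(p i j, p j i) | i j. (i, j) \<in> I}" "local_arrows D' S = {(q i j, q j i) | i j. (i, j) \<in> I}"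
    using assms[unfolded reidemeister3_def] by (elim exE conjE bexE) (rule that, assumption+)
  have D: "long_virtual_diagram D" "long_virtual_diagram D'" using ag by (auto simp: agree_outside_def)
  define A where "A = arrows D - arc_times S \<times> arc_times S"
  note facts = agree_outside_facts[OF ag, folded A_def]
  obtain \<Delta> where \<Delta>: "\<Delta> homeomorphic (cball 0 1 :: complex set)" "meets_in_arcs (curve D) \<Delta> S"
    using ag unfolding agree_outside_def by blast
  define a b where "a i = fst (S ! i)" and "b i = snd (S ! i)" for i
  have sub: "{a i..b i} \<subseteq> arc_times S" if "i < 3" for i
  proof -
    have "(a i, b i) \<in> set S" using that S nth_mem[of i S] by (simp add: a_def b_def)
    then show ?thesis unfolding arc_times_def by blast
  qed
  have ab: "a i < b i" if "i < 3" for i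
  proof -
    have "(a i, b i) \<in> set S" using that S nth_mem[of i S] by (simp add: a_def b_def)
    then show ?thesis using \<Delta>(2) unfolding meets_in_arcs_def by blast
  qed
  have order: "b i < a j \<or> b j < a i" if "i < 3" "j < 3" "i \<noteq> j" for i j
  proof -
    have *: "{a i..b i} \<inter> {a j..b j} = {}" if "i < j" "j < 3" for i j
      using \<Delta>(2) that S unfolding meets_in_arcs_def sorted_wrt_iff_nth_less
      by (auto simp: a_def b_def case_prod_beta)
    have "{a i..b i} \<inter> {a j..b j} = {}" using *[of i j] *[of j i] that by (metis Int_commute nat_neq_iff)
    moreover have "a i \<in> {a i..b i}" "a j \<in> {a j..b j}" using ab[of i] ab[of j] that by auto
    ultimately have "a i \<notin> {a j..b j}" "a j \<notin> {a i..b i}" by blast+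
    then show ?thesis using ab[of i] ab[of j] that by auto
  qed
  have dbl: "(p i j, p j i) \<in> double_pairs (curve D)" "(q i j, q j i) \<in> double_pairs (curve D')" if "i < 3" "j < 3" "i \<noteq> j" for i j
  proof -
    have "(p i j, p j i) \<in> local_doubles D S" "(q i j, q j i) \<in> local_doubles D' S"
      using T that unfolding triangle_def by blast+
    then show "(p i j, p j i) \<in> double_pairs (curve D)" "(q i j, q j i) \<in> double_pairs (curve D')"
      by (simp_all add: local_doubles_def)
  qed
  have joins: "joins a b r" if E: "long_virtual_diagram E" "triangle E S r" for E r
  proof -
    have pos: "a i < r i j" "r i j < b i" if "i < 3" "j < 3" "i \<noteq> j" for i j
      using E(2) that unfolding triangle_def a_def b_def by blast+
    have d: "(r i j, r j i) \<in> double_pairs (curve E)" if "i < 3" "j < 3" "i \<noteq> j" for i j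
    proof -
      have "(r i j, r j i) \<in> local_doubles E S" using E(2) that unfolding triangle_def by blast
      then show ?thesis by (simp add: local_doubles_def)
    qed
    have "r i j \<noteq> r i k" if "i < 3" "j < 3" "k < 3" "distinct [i, j, k]" for i j k
    proof
      assume eq: "r i j = r i k"
      have "i \<noteq> j" "i \<noteq> k" "j \<noteq> k" using that(4) by auto
      then have "r j i = r k i" using double_pairs_unique[OF E(1) d[of i j], of "r k i"] d[of i k] eq that by simp
      then show False using pos[of j i] pos[of k i] order[of j k] that \<open>i \<noteq> j\<close> \<open>i \<noteq> k\<close> \<open>j \<noteq> k\<close> by auto
    qed
    then show ?thesis unfolding joins_def using pos order by blast
  qed
  note jp = joins[OF D(1) T(1)] and jq = joins[OF D(2) T(2)]
  have outA: "fst e \<notin> {a i..b i} \<and> snd e \<notin> {a i..b i}" if "e \<in> A" "i < 3" for e i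
    using facts(3)[OF that(1)] sub[OF that(2)] by blast
  have sgA: "gauss_inv A (sign_of D) = gauss_inv A (sign_of D')" using facts(4) by (intro gauss_inv_cong) simp
  consider "I = {}" | "I = {(0, 1)}" | "I = {(0, 1), (0, 2), (1, 2)}" using I by blast
  then show ?thesis
  proof cases
    case 1
    then show ?thesis using facts(1,2) la sgA by (simp add: diagram_inv_def)
  next
    case 2
    then have AD: "arrows D = insert (p 0 1, p 1 0) A" "arrows D' = insert (q 0 1, q 1 0) A"
      using facts(1,2) la by auto
    \<comment> \<open>In the mixed move the ends of the one real crossing move within their arcs. No
      other arrow has an end on these arcs, so the shift of the two times is monotone on all
      ends.\<close>
    define \<beta> where "\<beta> x = (if x = p 0 1 then q 0 1 else if x = p 1 0 then q 1 0 else x)" for x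
    have r: "a 0 < p 0 1" "p 0 1 < b 0" "a 1 < p 1 0" "p 1 0 < b 1" "a 0 < q 0 1" "q 0 1 < b 0" "a 1 < q 1 0" "q 1 0 < b 1"
      using jp jq unfolding joins_def by simp_all
    have o: "b 0 < a 1 \<or> b 1 < a 0" using order[of 0 1] by simp
    have fx: "\<beta> x = x" "x \<notin> {a 0..b 0}" "x \<notin> {a 1..b 1}" if "x \<in> Field A" for x
    proof -
      obtain e where "e \<in> A" "x = fst e \<or> x = snd e" using \<open>x \<in> Field A\<close> unfolding Field_def by force
      then show "x \<notin> {a 0..b 0}" "x \<notin> {a 1..b 1}" using outA[of e 0] outA[of e 1] by auto
      then show "\<beta> x = x" using r by (auto simp: \<beta>_def)
    qed
    have \<beta>p: "\<beta> (p 0 1) = q 0 1" "\<beta> (p 1 0) = q 1 0" using r o by (auto simp: \<beta>_def)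
    have mono: "strict_mono_on (Field (arrows D)) \<beta>"
    proof (rule strict_mono_onI)
      fix x y assume xy: "x \<in> Field (arrows D)" "y \<in> Field (arrows D)" "x < y"
      have F: "Field (arrows D) = Field A \<union> {p 0 1, p 1 0}" unfolding AD by auto
      have "x \<in> Field A \<or> x = p 0 1 \<or> x = p 1 0" "y \<in> Field A \<or> y = p 0 1 \<or> y = p 1 0" using xy unfolding F by auto
      then show "\<beta> x < \<beta> y" using xy(3) fx[of x] fx[of y] \<beta>p r o by (elim disjE) auto
    qed
    have im: "map_prod \<beta> \<beta> ` arrows D = arrows D'"
    proof -
      have "map_prod \<beta> \<beta> e = e" if "e \<in> A" for e
      proof -
        have "fst e \<in> Field A" "snd e \<in> Field A" using that by (auto simp: Field_def Domain_fst Range_snd)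
        then show ?thesis using fx(1) by (cases e) simp
      qed
      then have "map_prod \<beta> \<beta> ` A = A" by force
      then show ?thesis unfolding AD by (simp add: \<beta>p[unfolded One_nat_def])
    qed
    have "gauss_inv (arrows D) (sign_of D) = gauss_inv (map_prod \<beta> \<beta> ` arrows D) (sign_of D')"
    proof (rule gauss_inv_strict_mono[OF mono])
      fix c assume "c \<in> arrows D"
      then consider "c = (p 0 1, p 1 0)" | "c \<in> A" unfolding AD by blast
      then show "sign_of D' (map_prod \<beta> \<beta> c) = sign_of D c"
      proof cases
        case 1
        then show ?thesis using sg[rule_format, of 0 1] by (simp add: sign_of_def \<beta>p[unfolded One_nat_def])
      next
        case 2
        then have "fst c \<in> Field A" "snd c \<in> Field A" by (auto simp: Field_def Domain_fst Range_snd)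
        then have "map_prod \<beta> \<beta> c = c" using fx(1) by (cases c) simp
        then show ?thesis using facts(4)[OF 2] by simp
      qed
    qed
    then show ?thesis unfolding im by (simp add: diagram_inv_def)
  next
    case 3
    have AD: "arrows D = A \<union> {(p 0 1, p 1 0), (p 0 2, p 2 0), (p 1 2, p 2 1)}"
      "arrows D' = A \<union> {(q 0 1, q 1 0), (q 0 2, q 2 0), (q 1 2, q 2 1)}"
      using facts(1,2) unfolding la 3 by auto
    have ps: "positive D (p j i) (p i j) \<longleftrightarrow> \<not> positive D (p i j) (p j i)" if "i < 3" "j < 3" "i \<noteq> j" for i j
      using positive_swap[OF D(1) dbl(1)[OF that]] .
    have c: "(p j i < p j k \<longleftrightarrow> positive D (p i j) (p j i)) \<longleftrightarrow> (p k i < p k j \<longleftrightarrow> positive D (p i k) (p k i))"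
      if "i < 3" "j < 3" "k < 3" "distinct [i, j, k]" for i j k
      by (rule triangle_constraint[OF D(1) S \<Delta> T(1) that])
    have "gauss_inv (A \<union> {(p 0 1, p 1 0), (p 0 2, p 2 0), (p 1 2, p 2 1)}) (sign_of D) =
      gauss_inv (A \<union> {(q 0 1, q 1 0), (q 0 2, q 2 0), (q 1 2, q 2 1)}) (sign_of D')"
    proof (rule gauss_inv_triangle[OF jp jq])
      show "chords (A \<union> {(p 0 1, p 1 0), (p 0 2, p 2 0), (p 1 2, p 2 1)})"
        "chords (A \<union> {(q 0 1, q 1 0), (q 0 2, q 2 0), (q 1 2, q 2 1)})"
        using chords_arrows[OF D(1)] chords_arrows[OF D(2)] unfolding AD .
      show "sign_of D' (q 0 1, q 1 0) = sign_of D (p 0 1, p 1 0)" "sign_of D' (q 0 2, q 2 0) = sign_of D (p 0 2, p 2 0)"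
        "sign_of D' (q 1 2, q 2 1) = sign_of D (p 1 2, p 2 1)"
        using sg[rule_format, of 0 1] sg[rule_format, of 0 2] sg[rule_format, of 1 2] by (simp_all add: sign_of_def)
      show "(p 1 0 < p 1 2 \<longleftrightarrow> sign_of D (p 0 1, p 1 0)) \<longleftrightarrow> (p 2 0 < p 2 1 \<longleftrightarrow> sign_of D (p 0 2, p 2 0))"
        using c[of 0 1 2] by (simp add: sign_of_def)
      show "(p 0 1 < p 0 2 \<longleftrightarrow> \<not> sign_of D (p 0 1, p 1 0)) \<longleftrightarrow> (p 2 1 < p 2 0 \<longleftrightarrow> sign_of D (p 1 2, p 2 1))"
        using c[of 1 0 2] ps[of 0 1] by (simp add: sign_of_def)
      show "(p 0 2 < p 0 1 \<longleftrightarrow> \<not> sign_of D (p 0 2, p 2 0)) \<longleftrightarrow> (p 1 2 < p 1 0 \<longleftrightarrow> \<not> sign_of D (p 1 2, p 2 1))"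
        using c[of 2 0 1] ps[of 0 2] ps[of 1 2] by (simp add: sign_of_def)
      show "sign_of D' e = sign_of D e" if "e \<in> A" for e using facts(4)[OF that] .
      show "fst e \<notin> {a i..b i} \<and> snd e \<notin> {a i..b i}" if "e \<in> A" "i < 3" for e i using outA[OF that] .
      show "p i j < p i k \<longleftrightarrow> q i k < q i j" if "i < 3" "j < 3" "k < 3" "distinct [i, j, k]" for i j k
        using rev that by blast
    qed
    then show ?thesis unfolding diagram_inv_def AD .
  qed
qed

lemma move_inv: "move D D' \<Longrightarrow> diagram_inv D = diagram_inv D'"
  unfolding move_def using planar_isotopy_inv reidemeister1_inv reidemeister2_inv reidemeister3_inv by blast

theorem equivalent_inv: "equivclp move D D' \<Longrightarrow> diagram_inv D = diagram_inv D'"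
  by (induction rule: equivclp_induct) (auto dest: move_inv)

section \<open>Realizing Gauss diagrams by plane curves\<close>

text \<open>
  A polygonal path that runs \<open>N\<close> times across the strip \<open>0 \<le> x \<le> 1\<close>, turning alternately at
  \<open>k\<^sup>2\<close> on the left and at \<open>- k\<^sup>2\<close> on the right. In the coordinate \<open>X = 2 x - 1\<close> its \<open>k\<close>-th edge lies on the
  line \<open>y = - c - (c\<^sup>2 + 1/4) X\<close> with \<open>c = (-1)\<^sup>k (k + 1/2)\<close>. The lines with parameters \<open>c\<close> and \<open>d\<close> meet at
  \<open>X = - 1 / (c + d)\<close>, so any two nonadjacent edges cross, and no three of them in one point.
\<close>

definition turning_point :: "nat \<Rightarrow> complex" where
  "turning_point k = Complex (if even k then 0 else 1) (if even k then (real k)\<^sup>2 else - (real k)\<^sup>2)"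

definition hat :: "real \<Rightarrow> real" where "hat x = max 0 (1 - \<bar>x\<bar>)"

text \<open>The identity corrected by hat functions at the integers up to \<open>N\<close>:
  piecewise linear through the turning points, and back on the axis before time \<open>0\<close> and
  after time \<open>N + 1\<close>.\<close>

definition zigzag :: "nat \<Rightarrow> real \<Rightarrow> complex" where
  "zigzag N t = of_real t + (\<Sum>k\<le>N. hat (t - real k) *\<^sub>R (turning_point k - of_nat k))"

definition slope_param :: "nat \<Rightarrow> real" where
  "slope_param k = (if even k then real k + 1/2 else - (real k + 1/2))"

text \<open>The value \<open>X = - 1 / (c + d)\<close> converted into a time on edge
  \<open>j\<close>, which runs from left to right for even \<open>j\<close> and from right to left
  for odd \<open>j\<close>.\<close>

definition crossing_time :: "nat \<Rightarrow> nat \<Rightarrow> real" where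
  "crossing_time j k = real j + (1 - (if even j then 1 else -1) / (slope_param j + slope_param k)) / 2"

lemma continuous_zigzag: "continuous_on UNIV (zigzag N)"
  unfolding zigzag_def[abs_def] hat_def by (intro continuous_intros)

lemma zigzag_edge:
  assumes j: "j < N" and t: "real j \<le> t" "t \<le> real j + 1"
  shows "zigzag N t = (1 - (t - real j)) *\<^sub>R turning_point j + (t - real j) *\<^sub>R turning_point (Suc j)"
proof -
  have S: "(\<Sum>k\<le>N. hat (t - real k) *\<^sub>R (turning_point k - of_nat k)) =
    (\<Sum>k\<in>{j, Suc j}. hat (t - real k) *\<^sub>R (turning_point k - of_nat k))"
  proof (rule sum.mono_neutral_right)
    show "\<forall>i\<in>{..N} - {j, Suc j}. hat (t - real i) *\<^sub>R (turning_point i - of_nat i) = 0"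
    proof
      fix i assume "i \<in> {..N} - {j, Suc j}"
      then have "i < j \<or> Suc j < i" by auto
      then have "real i \<le> real j - 1 \<or> real j + 2 \<le> real i" by auto
      then have "1 \<le> \<bar>t - real i\<bar>" using t by linarith
      then show "hat (t - real i) *\<^sub>R (turning_point i - of_nat i) = 0" by (simp add: hat_def)
    qed
  qed (use j in auto)
  have h: "hat (t - real j) = 1 - (t - real j)" "hat (t - real (Suc j)) = t - real j"
    using t by (auto simp: hat_def)
  have "zigzag N t = of_real t + ((1 - (t - real j)) *\<^sub>R (turning_point j - of_nat j) +
      (t - real j) *\<^sub>R (turning_point (Suc j) - of_nat (Suc j)))"
    unfolding zigzag_def S by (simp only: h sum.insert finite.intros empty_iff insert_iff n_not_Suc_n simp_thms sum.empty add_0_right)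
  then show ?thesis by (simp add: complex_eq_iff algebra_simps)
qed

lemma zigzag_right:
  assumes t: "real N \<le> t" "t \<le> real N + 1"
  shows "zigzag N t = (1 - (t - real N)) *\<^sub>R turning_point N + of_real ((t - real N) * (real N + 1))"
proof -
  have S: "(\<Sum>k\<le>N. hat (t - real k) *\<^sub>R (turning_point k - of_nat k)) =
    (\<Sum>k\<in>{N}. hat (t - real k) *\<^sub>R (turning_point k - of_nat k))"
  proof (rule sum.mono_neutral_right)
    show "\<forall>i\<in>{..N} - {N}. hat (t - real i) *\<^sub>R (turning_point i - of_nat i) = 0"
    proof
      fix i assume "i \<in> {..N} - {N}"
      then have "real i \<le> real N - 1" by auto
      then have "1 \<le> \<bar>t - real i\<bar>" using t by linarith
      then show "hat (t - real i) *\<^sub>R (turning_point i - of_nat i) = 0" by (simp add: hat_def)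
    qed
  qed auto
  have h: "hat (t - real N) = 1 - (t - real N)" using t by (auto simp: hat_def)
  have "zigzag N t = of_real t + (1 - (t - real N)) *\<^sub>R (turning_point N - of_nat N)"
    unfolding zigzag_def S by (simp only: h sum.insert finite.intros empty_iff simp_thms sum.empty add_0_right)
  then show ?thesis by (simp add: complex_eq_iff algebra_simps)
qed

lemma zigzag_outside:
  assumes "t \<le> 0 \<or> real N + 1 \<le> t"
  shows "zigzag N t = of_real t"
proof -
  have "(\<Sum>k\<le>N. hat (t - real k) *\<^sub>R (turning_point k - of_nat k)) = 0"
  proof (rule sum.neutral, rule ballI)
    fix k assume k: "k \<in> {..N}"
    show "hat (t - real k) *\<^sub>R (turning_point k - of_nat k) = 0"
    proof (cases "k = 0 \<and> t \<le> 0")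
      case True
      then show ?thesis by (simp add: turning_point_def complex_eq_iff)
    next
      case False
      then have "1 \<le> \<bar>t - real k\<bar>" using k assms by (cases k) auto
      then show ?thesis by (simp add: hat_def)
    qed
  qed
  then show ?thesis by (simp add: zigzag_def)
qed

lemma slope_param_inj: "slope_param j = slope_param k \<longleftrightarrow> j = k"
  by (auto simp: slope_param_def split: if_splits)

text \<open>For adjacent edges the sum is 1 or -1 and the lines meet at the turning point. The bound
  2 for all other pairs puts their crossings into the middle half of the strip, well inside both
  edges.\<close>

lemma slope_param_sum:
  assumes "j \<noteq> k" shows "1 \<le> \<bar>slope_param j + slope_param k\<bar>"
    and "k \<noteq> Suc j \<Longrightarrow> j \<noteq> Suc k \<Longrightarrow> 2 \<le> \<bar>slope_param j + slope_param k\<bar>"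
proof -
  consider "real j + 1 \<le> real k" | "real k + 1 \<le> real j" using assms by linarith
  then show "1 \<le> \<bar>slope_param j + slope_param k\<bar>" by cases (auto simp: slope_param_def)
  assume "k \<noteq> Suc j" "j \<noteq> Suc k"
  then consider "real j + 2 \<le> real k" | "real k + 2 \<le> real j" using assms by linarith
  then show "2 \<le> \<bar>slope_param j + slope_param k\<bar>"
    by cases (use assms in \<open>auto simp: slope_param_def\<close>)
qed

lemma zigzag_edge_Re:
  assumes "j < N" "real j \<le> t" "t \<le> real j + 1"
  shows "Re (zigzag N t) = (if even j then t - real j else 1 - (t - real j))"
  unfolding zigzag_edge[OF assms] by (auto simp: turning_point_def)

lemma zigzag_edge_Im:
  assumes "j < N" "real j \<le> t" "t \<le> real j + 1"
  shows "Im (zigzag N t) = - slope_param j - ((slope_param j)\<^sup>2 + 1/4) * (2 * Re (zigzag N t) - 1)"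
  unfolding zigzag_edge_Re[OF assms] unfolding zigzag_edge[OF assms]
  by (cases "even j") (simp_all add: turning_point_def slope_param_def power2_eq_square field_simps)

lemma crossing_time_bounds:
  assumes "j \<noteq> k" "k \<noteq> Suc j" "j \<noteq> Suc k"
  shows "real j + 1/4 \<le> crossing_time j k" "crossing_time j k \<le> real j + 3/4"
proof -
  define s where "s = slope_param j + slope_param k"
  have "2 \<le> \<bar>s\<bar>" using slope_param_sum(2)[OF assms] by (simp add: s_def)
  define Q where "Q = (if even j then 1 else -1) / s"
  have "\<bar>Q\<bar> = 1 / \<bar>s\<bar>" by (simp add: Q_def)
  also have "\<dots> \<le> 1 / 2" using \<open>2 \<le> \<bar>s\<bar>\<close> by (intro divide_left_mono) auto
  finally have "\<bar>Q\<bar> \<le> 1/2" .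
  moreover have "crossing_time j k = real j + (1 - Q) / 2" by (simp add: crossing_time_def s_def Q_def)
  ultimately show "real j + 1/4 \<le> crossing_time j k" "crossing_time j k \<le> real j + 3/4"
    by (simp_all add: abs_le_iff)
qed

lemma floor_crossing_time:
  assumes "j \<noteq> k" "k \<noteq> Suc j" "j \<noteq> Suc k"
  shows "\<lfloor>crossing_time j k\<rfloor> = int j"
  using crossing_time_bounds[OF assms] by (intro floor_unique) auto

lemma crossing_time_Re:
  assumes "j < N" "j \<noteq> k" "k \<noteq> Suc j" "j \<noteq> Suc k"
  shows "2 * Re (zigzag N (crossing_time j k)) - 1 = - 1 / (slope_param j + slope_param k)"
proof -
  have b: "real j \<le> crossing_time j k" "crossing_time j k \<le> real j + 1"
    using crossing_time_bounds[OF assms(2-4)] by auto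
  have "2 * (if even j then T - real j else 1 - (T - real j)) - 1 = - 1 / c"
    if "T = real j + (1 - (if even j then 1 else -1) / c) / 2" for T c :: real
    using that by (cases "even j") (simp_all add: diff_divide_distrib add_divide_distrib)
  from this[OF crossing_time_def] show ?thesis unfolding zigzag_edge_Re[OF assms(1) b] .
qed

lemma zigzag_crossing:
  assumes "j < N" "k < N" "j \<noteq> k" "k \<noteq> Suc j" "j \<noteq> Suc k"
  shows "zigzag N (crossing_time j k) = zigzag N (crossing_time k j)"
proof -
  define s where "s = slope_param j + slope_param k"
  have s: "s \<noteq> 0" using slope_param_sum(1)[OF assms(3)] by (auto simp: s_def)
  have b: "real j \<le> crossing_time j k" "crossing_time j k \<le> real j + 1" "real k \<le> crossing_time k j" "crossing_time k j \<le> real k + 1"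
    using crossing_time_bounds[of j k] crossing_time_bounds[of k j] assms by auto
  have R: "2 * Re (zigzag N (crossing_time j k)) - 1 = - 1 / s" "2 * Re (zigzag N (crossing_time k j)) - 1 = - 1 / s"
    using crossing_time_Re[of j N k] crossing_time_Re[of k N j] assms by (auto simp: s_def add.commute)
  have e: "slope_param k = s - slope_param j" by (simp add: s_def)
  have "Im (zigzag N (crossing_time j k)) = Im (zigzag N (crossing_time k j))"
    unfolding zigzag_edge_Im[OF assms(1) b(1,2)] zigzag_edge_Im[OF assms(2) b(3,4)] R e
    using s by (simp add: field_simps power2_eq_square)
  then show ?thesis using R by (simp add: complex_eq_iff)
qed

text \<open>Before time \<open>0\<close> and after time \<open>N\<close> the curve is outside the
  strip and its first coordinate is injective there, so a double point lies on two edges. Equating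
  the two lines leaves a factor \<open>slope_param j - slope_param k\<close>, which is nonzero, and
  a linear equation for \<open>X\<close>. For odd \<open>N\<close> the last turning point is on the
  right, where the curve can leave.\<close>

lemma zigzag_double:
  assumes N: "odd N" and st: "s \<noteq> t" "zigzag N s = zigzag N t"
  shows "\<exists>j k. j < N \<and> k < N \<and> j \<noteq> k \<and> k \<noteq> Suc j \<and> j \<noteq> Suc k \<and> s = crossing_time j k \<and> t = crossing_time k j"
proof -
  have N1: "real N \<ge> 1" using N by (cases N) auto
  have left: "Re (zigzag N u) = u" if "u < 0" for u using that zigzag_outside[of u N] by simp
  have edge: "\<exists>j<N. real j \<le> u \<and> u \<le> real j + 1" if "0 \<le> u" "u \<le> real N" for u
  proof (cases "u = real N")
    case True
    then show ?thesis using N1 N by (intro exI[of _ "N - 1"]) (auto simp: of_nat_diff)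
  next
    case False
    then show ?thesis using that by (intro exI[of _ "nat \<lfloor>u\<rfloor>"]) (auto simp: of_nat_nat nat_less_iff floor_less_iff)
  qed
  have mid: "0 \<le> Re (zigzag N u) \<and> Re (zigzag N u) \<le> 1" if u: "0 \<le> u" "u \<le> real N" for u
    using edge[OF u] zigzag_edge_Re by fastforce
  have right: "Re (zigzag N u) = (if u \<le> real N + 1 then 1 + (u - real N) * real N else u)" if "real N < u" for u
  proof (cases "u \<le> real N + 1")
    case True
    then have "zigzag N u = (1 - (u - real N)) *\<^sub>R turning_point N + of_real ((u - real N) * (real N + 1))"
      using that by (intro zigzag_right) auto
    then have "Re (zigzag N u) = (1 - (u - real N)) * Re (turning_point N) + (u - real N) * (real N + 1)" by simp
    then show ?thesis using True N by (simp add: turning_point_def algebra_simps)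
  qed (use zigzag_outside[of u N] in simp)
  have right1: "1 < Re (zigzag N u)" if "real N < u" for u using right[OF that] that N1 by auto
  have right_inj: "u = v" if uv: "real N < u" "real N < v" "Re (zigzag N u) = Re (zigzag N v)" for u v
  proof -
    have *: "1 + (u - real N) * real N < v" if "u \<le> real N + 1" "real N + 1 < v" for u v
    proof -
      have "(u - real N) * real N \<le> 1 * real N" using that by (intro mult_right_mono) auto
      then show ?thesis using that by simp
    qed
    show ?thesis using uv(3) *[of u v] *[of v u] N1 unfolding right[OF uv(1)] right[OF uv(2)]
      by (auto split: if_splits)
  qed
  have s: "0 \<le> s \<and> s \<le> real N" and t: "0 \<le> t \<and> t \<le> real N"
  proof -
    have "\<not> (u < 0 \<or> real N < u)" if uv: "u \<noteq> v" "zigzag N u = zigzag N v" for u v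
    proof
      assume "u < 0 \<or> real N < u"
      then show False
        using uv left[of u] left[of v] mid[of v] right1[of u] right1[of v] right_inj[of u v]
        by (cases "v < 0"; cases "real N < v") auto
    qed
    from this[of s t] this[of t s] st show "0 \<le> s \<and> s \<le> real N" "0 \<le> t \<and> t \<le> real N" by auto
  qed
  obtain j where j: "j < N" "real j \<le> s" "s \<le> real j + 1" using edge s by blast
  obtain k where k: "k < N" "real k \<le> t" "t \<le> real k + 1" using edge t by blast
  define X where "X = 2 * Re (zigzag N s) - 1"
  have X: "X = 2 * Re (zigzag N t) - 1" using st by (simp add: X_def)
  have Re: "(if even j then s - real j else 1 - (s - real j)) = (X + 1) / 2"
    "(if even k then t - real k else 1 - (t - real k)) = (X + 1) / 2"
    using zigzag_edge_Re[OF j] zigzag_edge_Re[OF k] X X_def by auto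
  have jk: "j \<noteq> k" using Re st(1) by (auto split: if_splits)
  define c where "c = slope_param j + slope_param k"
  have c: "c \<noteq> 0" using slope_param_sum(1)[OF jk] by (auto simp: c_def)
  have d: "slope_param j \<noteq> slope_param k" using jk slope_param_inj by simp
  have "- slope_param j - ((slope_param j)\<^sup>2 + 1/4) * X = - slope_param k - ((slope_param k)\<^sup>2 + 1/4) * X"
    using zigzag_edge_Im[OF j] zigzag_edge_Im[OF k] st(2) X X_def by simp
  then have "(slope_param j - slope_param k) * (1 + c * X) = 0" by (simp add: c_def power2_eq_square algebra_simps)
  then have "c * X = -1" using d by simp
  then have X': "X = - 1 / c" using c by (simp add: field_simps)
  have sj: "s = crossing_time j k" "t = crossing_time k j"
    using Re unfolding crossing_time_def c_def[symmetric] X' add.commute[of "slope_param k"]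
    by (auto simp: c_def[symmetric] field_simps split: if_splits)
  \<comment> \<open>For adjacent edges both crossing times are the time of the common turning point,
    so they do not give two different times.\<close>
  have nadj: False if "b = Suc a" "u = crossing_time a b" "v = crossing_time b a" "u \<noteq> v" for a b u v
  proof -
    have sl: "slope_param a + slope_param (Suc a) = (if even a then -1 else 1)"
      "slope_param (Suc a) + slope_param a = (if even a then -1 else 1)"
      by (simp_all add: slope_param_def)
    show False using that(2-4) unfolding that(1) crossing_time_def sl by (cases "even a") simp_all
  qed
  show ?thesis using j(1) k(1) jk sj st(1) nadj[of k j s t] nadj[of j k t s] nadj[of j k s t] nadj[of k j t s] by metis
qed

lemma zigzag_velocity:
  assumes "j < N" "real j < t" "t < real j + 1"
  shows "(zigzag N has_vector_derivative turning_point (Suc j) - turning_point j) (at t)"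
proof -
  have "((\<lambda>t. (1 - (t - real j)) *\<^sub>R turning_point j + (t - real j) *\<^sub>R turning_point (Suc j))
      has_vector_derivative turning_point (Suc j) - turning_point j) (at t)"
    by (auto intro!: derivative_eq_intros)
  then show ?thesis
    by (rule has_vector_derivative_transform_within_open[of _ _ _ "{real j<..<real j + 1}"])
      (use assms zigzag_edge[OF assms(1)] in auto)
qed

text \<open>The sign of a crossing thus depends on which edge has the larger number and on whether
  the numbers have the same parity. The parity is the freedom used to prescribe signs.\<close>

lemma det2_zigzag:
  "det2 (turning_point (Suc j) - turning_point j) (turning_point (Suc k) - turning_point k) =
    (if even j = even k then 1 else -1) * (((real j)\<^sup>2 + (real (Suc j))\<^sup>2) - ((real k)\<^sup>2 + (real (Suc k))\<^sup>2))"
  by (auto simp: det2_def turning_point_def algebra_simps)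

text \<open>Every end of a chord gets an edge of its own, and the chords select which double points
  become real; all others are virtual. Moving the later end of a chord to the next edge reverses the
  sign of its crossing.\<close>

theorem gauss_diagram_realizable:
  fixes R :: "(nat \<times> nat) set"
  assumes R: "chords R"
  shows "\<exists>D f. long_virtual_diagram D \<and> strict_mono_on (Field (arrows D)) f \<and> map_prod f f ` arrows D = R \<and>
    (\<forall>e\<in>arrows D. positive D (fst e) (snd e) \<longleftrightarrow> P (map_prod f f e))"
proof -
  \<comment> \<open>Spacing by 4 preserves the order and keeps the edges of different ends
    nonadjacent. With equal parities a crossing is negative if the over passage comes first and
    positive otherwise; the offset 1 at the later end is used when the other sign is wanted.\<close>
  define e where "e i = 4 * i + (if \<exists>c\<in>R. i = hi c \<and> (fst c < snd c \<longleftrightarrow> P c) then 1 else 0)" for i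
  have "finite (Field R)" using R by (simp add: chords_def finite_Field)
  then obtain M where M: "\<forall>i\<in>Field R. i \<le> M" using finite_nat_set_iff_bounded_le by blast
  \<comment> \<open>Odd, as the zigzag requires, and larger than every edge number
    \<open>e i\<close> with \<open>i \<le> M\<close>.\<close>
  define N where "N = 4 * M + 5"
  have N: "odd N" by (simp add: N_def)
  have ediv: "e i div 4 = i" for i by (simp add: e_def)
  have far: "e i \<noteq> e j \<and> e j \<noteq> Suc (e i) \<and> e i \<noteq> Suc (e j)" if "i \<noteq> j" for i j
  proof -
    have "4 * i \<le> e i" "e i \<le> 4 * i + 1" "4 * j \<le> e j" "e j \<le> 4 * j + 1" by (simp_all add: e_def)
    moreover have "i < j \<or> j < i" using that by auto
    ultimately show ?thesis by linarith
  qed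
  have eN: "e i < N" if "i \<in> Field R" for i
  proof -
    have "i \<le> M" using M that by blast
    then show ?thesis by (simp add: e_def N_def)
  qed
  have mem: "fst c \<in> Field R" "snd c \<in> Field R" "fst c \<noteq> snd c" if "c \<in> R" for c
    using that chordsD(2)[OF R] by (auto simp: Field_def Domain_fst Range_snd)
  define \<sigma> where "\<sigma> c = (crossing_time (e (fst c)) (e (snd c)), crossing_time (e (snd c)) (e (fst c)))" for c
  define D where "D = \<lparr>curve = zigzag N, arrows = \<sigma> ` R\<rparr>"
  define f where "f t = nat \<lfloor>t\<rfloor> div 4" for t :: real
  have f: "f (crossing_time (e i) (e j)) = i" if "i \<noteq> j" for i j
    using far[OF that] by (simp add: f_def floor_crossing_time ediv)
  have dbl: "(crossing_time j k, crossing_time k j) \<in> double_pairs (zigzag N)"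
    if "j < N" "k < N" "j \<noteq> k" "k \<noteq> Suc j" "j \<noteq> Suc k" for j k
  proof -
    have "\<lfloor>crossing_time j k\<rfloor> \<noteq> \<lfloor>crossing_time k j\<rfloor>"
      using that floor_crossing_time[of j k] floor_crossing_time[of k j] by simp
    then have "crossing_time j k \<noteq> crossing_time k j" by metis
    then show ?thesis using zigzag_crossing[OF that] by (simp add: double_pairs_def)
  qed
  have form: "\<exists>j k. j < N \<and> k < N \<and> j \<noteq> k \<and> k \<noteq> Suc j \<and> j \<noteq> Suc k \<and> s = crossing_time j k \<and> t = crossing_time k j"
    if "(s, t) \<in> double_pairs (zigzag N)" for s t
    using zigzag_double[OF N, of s t] that by (simp add: double_pairs_def)
  have vel: "zigzag N differentiable at (crossing_time j k)" 
    "velocity (zigzag N) (crossing_time j k) = turning_point (Suc j) - turning_point j"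
    if "j < N" "j \<noteq> k" "k \<noteq> Suc j" "j \<noteq> Suc k" for j k
  proof -
    have "(zigzag N has_vector_derivative turning_point (Suc j) - turning_point j) (at (crossing_time j k))"
      using crossing_time_bounds[OF that(2-4)] that(1) by (intro zigzag_velocity) auto
    then show "zigzag N differentiable at (crossing_time j k)" 
      "velocity (zigzag N) (crossing_time j k) = turning_point (Suc j) - turning_point j"
      by (auto simp: velocity_def vector_derivative_at intro: differentiableI_vector)
  qed
  have sq: "(real j)\<^sup>2 + (real (Suc j))\<^sup>2 < (real k)\<^sup>2 + (real (Suc k))\<^sup>2" if "j < k" for j k
    using that by (intro add_strict_mono power_strict_mono) auto
  have imm: "long_immersed_line (zigzag N)"
    unfolding long_immersed_line_def
  proof (intro conjI)
    show "\<exists>r. \<forall>t. r \<le> \<bar>t\<bar> \<longrightarrow> zigzag N t = complex_of_real t"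
      by (intro exI[of _ "real N + 1"]) (auto intro!: zigzag_outside)
    have "double_pairs (zigzag N) \<subseteq> (\<lambda>(j, k). (crossing_time j k, crossing_time k j)) ` ({..<N} \<times> {..<N})"
      using form by fastforce
    then show "finite (double_pairs (zigzag N))" by (rule finite_subset) simp
    show "\<forall>s t u. (s, t) \<in> double_pairs (zigzag N) \<and> (s, u) \<in> double_pairs (zigzag N) \<longrightarrow> t = u"
    proof (intro allI impI, elim conjE)
      fix s t u assume "(s, t) \<in> double_pairs (zigzag N)" "(s, u) \<in> double_pairs (zigzag N)"
      then obtain j k j' k' where 1: "j < N" "k < N" "j \<noteq> k" "k \<noteq> Suc j" "j \<noteq> Suc k" "s = crossing_time j k" "t = crossing_time k j"
        and 2: "j' < N" "k' < N" "j' \<noteq> k'" "k' \<noteq> Suc j'" "j' \<noteq> Suc k'" "s = crossing_time j' k'" "u = crossing_time k' j'"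
        using form by meson
      have jj: "j = j'" using floor_crossing_time[OF 1(3-5)] floor_crossing_time[OF 2(3-5)] 1(6) 2(6) by simp
      have "- 1 / (slope_param j + slope_param k) = - 1 / (slope_param j + slope_param k')"
        using crossing_time_Re[OF 1(1,3-5)] crossing_time_Re[OF 2(1,3-5)] 1(6) 2(6) jj by simp
      then have "slope_param k = slope_param k'"
        using slope_param_sum(1)[OF 1(3)] slope_param_sum(1)[OF 2(3)] jj by (auto simp: field_simps)
      then show "t = u" using slope_param_inj jj 1(7) 2(7) by simp
    qed
    show "\<forall>(s, t)\<in>double_pairs (zigzag N). zigzag N differentiable at s \<and> zigzag N differentiable at t \<and>
       det2 (velocity (zigzag N) s) (velocity (zigzag N) t) \<noteq> 0"
    proof (clarify)
      fix s t assume "(s, t) \<in> double_pairs (zigzag N)"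
      then obtain j k where 1: "j < N" "k < N" "j \<noteq> k" "k \<noteq> Suc j" "j \<noteq> Suc k" "s = crossing_time j k" "t = crossing_time k j"
        using form by meson
      have "j < k \<or> k < j" using 1 by auto
      then have "det2 (velocity (zigzag N) s) (velocity (zigzag N) t) \<noteq> 0"
        using vel(2)[of j k] vel(2)[of k j] 1 sq[of j k] sq[of k j] unfolding 1 by (auto simp: det2_zigzag)
      then show "zigzag N differentiable at s \<and> zigzag N differentiable at t \<and>
       det2 (velocity (zigzag N) s) (velocity (zigzag N) t) \<noteq> 0"
        using vel(1)[of j k] vel(1)[of k j] 1 by auto
    qed
  qed (rule continuous_zigzag)
  have \<sigma>f: "map_prod f f (\<sigma> c) = c" if "c \<in> R" for c
    using mem(3)[OF that] by (simp add: \<sigma>_def f prod_eq_iff)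
  have Farr: "\<exists>i j. i \<noteq> j \<and> ((i, j) \<in> R \<or> (j, i) \<in> R) \<and> x = crossing_time (e i) (e j)" if "x \<in> Field (arrows D)" for x
  proof -
    obtain a where "a \<in> arrows D" "x = fst a \<or> x = snd a" using \<open>x \<in> Field (arrows D)\<close> unfolding Field_def by force
    then obtain c where c: "c \<in> R" "x = fst (\<sigma> c) \<or> x = snd (\<sigma> c)" unfolding D_def by auto
    from c(2) show ?thesis
    proof
      assume "x = fst (\<sigma> c)"
      then show ?thesis using c(1) mem(3)[OF c(1)] by (intro exI[of _ "fst c"] exI[of _ "snd c"]) (simp add: \<sigma>_def)
    next
      assume "x = snd (\<sigma> c)"
      then show ?thesis using c(1) mem(3)[OF c(1)] by (intro exI[of _ "snd c"] exI[of _ "fst c"]) (simp add: \<sigma>_def)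
    qed
  qed
  show ?thesis
  proof (intro exI[of _ D] exI[of _ f] conjI ballI)
    show "long_virtual_diagram D"
      unfolding long_virtual_diagram_def
    proof (intro conjI allI impI)
      show "long_immersed_line (curve D)" using imm by (simp add: D_def)
      show "arrows D \<subseteq> double_pairs (curve D)"
      proof
        fix x assume "x \<in> arrows D"
        then obtain c where c: "c \<in> R" "x = \<sigma> c" by (auto simp: D_def)
        then show "x \<in> double_pairs (curve D)"
          using dbl[of "e (fst c)" "e (snd c)"] mem[OF c(1)] eN far[OF mem(3)[OF c(1)]] by (simp add: D_def \<sigma>_def)
      qed
      fix s t assume "(s, t) \<in> arrows D"
      then obtain c where c: "c \<in> R" "(s, t) = \<sigma> c" by (auto simp: D_def)
      show "(t, s) \<notin> arrows D"
      proof
        assume "(t, s) \<in> arrows D"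
        then obtain c' where c': "c' \<in> R" "(t, s) = \<sigma> c'" by (auto simp: D_def)
        have "c = (f s, f t)" "c' = (f t, f s)" using \<sigma>f[OF c(1)] \<sigma>f[OF c'(1)] c(2)[symmetric] c'(2)[symmetric] by auto
        then show False using chordsD(5)[OF R c(1) c'(1)] by simp
      qed
    qed
    show "strict_mono_on (Field (arrows D)) f"
    proof (rule strict_mono_onI)
      fix x y assume xy: "x \<in> Field (arrows D)" "y \<in> Field (arrows D)" "x < y"
      obtain i j where i: "i \<noteq> j" "(i, j) \<in> R \<or> (j, i) \<in> R" "x = crossing_time (e i) (e j)" using Farr[OF xy(1)] by blast
      obtain i' j' where i': "i' \<noteq> j'" "(i', j') \<in> R \<or> (j', i') \<in> R" "y = crossing_time (e i') (e j')" using Farr[OF xy(2)] by blast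
      have fx: "f x = i" "f y = i'" using i i' f by auto
      have "\<lfloor>x\<rfloor> \<le> \<lfloor>y\<rfloor>" using xy(3) by (intro floor_mono) simp
      then have "f x \<le> f y" unfolding f_def by (intro div_le_mono nat_mono)
      moreover have "f x \<noteq> f y"
      proof
        assume "f x = f y"
        then have "i = i'" using fx by simp
        then have "j = j'" using i(2) i'(2) chordsD(3)[OF R, of "(i, j)" "(i, j')"] chordsD(4)[OF R, of "(j, i)" "(j', i)"]
            chordsD(5)[OF R, of "(i, j)" "(j', i)"] chordsD(5)[OF R, of "(i, j')" "(j, i)"] by auto
        then show False using \<open>i = i'\<close> i(3) i'(3) xy(3) by simp
      qed
      ultimately show "f x < f y" by simp
    qed
    show "map_prod f f ` arrows D = R"
      using \<sigma>f by (auto simp: D_def image_image)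
    fix x assume "x \<in> arrows D"
    then obtain c where c: "c \<in> R" "x = \<sigma> c" by (auto simp: D_def)
    note m = mem[OF c(1)]
    have d: "positive D (fst x) (snd x) \<longleftrightarrow>
      0 < (if even (e (fst c)) = even (e (snd c)) then 1 else -1) *
        (((real (e (fst c)))\<^sup>2 + (real (Suc (e (fst c))))\<^sup>2) - ((real (e (snd c)))\<^sup>2 + (real (Suc (e (snd c))))\<^sup>2))"
      unfolding positive_def c(2) using vel(2)[of "e (fst c)" "e (snd c)"] vel(2)[of "e (snd c)" "e (fst c)"] eN m far[OF m(3)]
      by (simp add: D_def \<sigma>_def det2_zigzag)
    have lo: "e (lo c) = 4 * lo c"
    proof -
      have "\<not> (\<exists>c'\<in>R. lo c = hi c' \<and> (fst c' < snd c' \<longleftrightarrow> P c'))"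
      proof
        assume "\<exists>c'\<in>R. lo c = hi c' \<and> (fst c' < snd c' \<longleftrightarrow> P c')"
        then obtain c' where c': "c' \<in> R" "lo c = hi c'" by blast
        have "{fst c, snd c} \<inter> {fst c', snd c'} \<noteq> {}" using c'(2) by (auto simp: lo_def hi_def min_def max_def split: if_splits)
        then have "c = c'" using R c(1) c'(1) unfolding chords_def by blast
        then show False using c'(2) lo_less_hi[OF m(3)] by simp
      qed
      then show ?thesis unfolding e_def by simp
    qed
    have hi: "e (hi c) = 4 * hi c + (if fst c < snd c \<longleftrightarrow> P c then 1 else 0)"
    proof -
      have "(\<exists>c'\<in>R. hi c = hi c' \<and> (fst c' < snd c' \<longleftrightarrow> P c')) \<longleftrightarrow> (fst c < snd c \<longleftrightarrow> P c)"
      proof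
        assume "\<exists>c'\<in>R. hi c = hi c' \<and> (fst c' < snd c' \<longleftrightarrow> P c')"
        then obtain c' where c': "c' \<in> R" "hi c = hi c'" "fst c' < snd c' \<longleftrightarrow> P c'" by blast
        have "{fst c, snd c} \<inter> {fst c', snd c'} \<noteq> {}" using c'(2) by (auto simp: hi_def max_def split: if_splits)
        then have "c = c'" using R c(1) c'(1) unfolding chords_def by blast
        then show "fst c < snd c \<longleftrightarrow> P c" using c'(3) by simp
      qed (use c(1) in blast)
      then show ?thesis unfolding e_def by simp
    qed
    have "e (lo c) < e (hi c)" using lo hi lo_less_hi[OF m(3)] by simp
    note sq = sq[OF this]
    have par: "even (e (lo c)) = even (e (hi c)) \<longleftrightarrow> (fst c < snd c) \<noteq> P c" using lo hi by auto
    have val: "(0 < (if even (e (fst c)) = even (e (snd c)) then 1 else -1) *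
        (((real (e (fst c)))\<^sup>2 + (real (Suc (e (fst c))))\<^sup>2) - ((real (e (snd c)))\<^sup>2 + (real (Suc (e (snd c))))\<^sup>2))) = P c"
    proof (cases "fst c < snd c")
      case True
      then have "lo c = fst c" "hi c = snd c" by (auto simp: lo_def hi_def)
      then show ?thesis
        using par sq True by (cases "P c") auto
    next
      case False
      then have "lo c = snd c" "hi c = fst c" by (auto simp: lo_def hi_def)
      then show ?thesis
        using par sq False by (cases "P c") auto
    qed
    show "positive D (fst x) (snd x) \<longleftrightarrow> P (map_prod f f x)"
      unfolding d val using \<sigma>f[OF c(1)] c(2) by simp
  qed
qed

section \<open>Mod 2 intersection numbers on surfaces\<close>

locale surf =
  fixes \<Sigma> :: surface
  assumes closed: "closed_surface \<Sigma>"
begin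

abbreviation "fo \<equiv> follow \<Sigma>"
abbreviation "gl \<equiv> glue \<Sigma>"
abbreviation "tu \<equiv> turn \<Sigma>"
abbreviation "vx \<equiv> initial_vertex \<Sigma>"

lemma finite_sides [simp]: "finite (sides \<Sigma>)" and sides_nonempty: "sides \<Sigma> \<noteq> {}"
  and follow_permutes: "fo permutes sides \<Sigma>" and glue_permutes: "gl permutes sides \<Sigma>"
  using closed by (simp_all add: closed_surface_def)

lemma glue_glue [simp]: "d \<in> sides \<Sigma> \<Longrightarrow> gl (gl d) = d"
  and glue_neq: "d \<in> sides \<Sigma> \<Longrightarrow> gl d \<noteq> d"
  using closed by (simp_all add: closed_surface_def)

lemma side_closed [simp]: "fo d \<in> sides \<Sigma> \<longleftrightarrow> d \<in> sides \<Sigma>" "gl d \<in> sides \<Sigma> \<longleftrightarrow> d \<in> sides \<Sigma>"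
  "inv fo d \<in> sides \<Sigma> \<longleftrightarrow> d \<in> sides \<Sigma>"
  using permutes_in_image[OF follow_permutes] permutes_in_image[OF glue_permutes]
    permutes_in_image[OF permutes_inv[OF follow_permutes]] by auto

lemma turn_permutes: "tu permutes sides \<Sigma>"
proof -
  have "tu = gl \<circ> inv fo" by (simp add: fun_eq_iff turn_def)
  then show ?thesis using permutes_compose[OF permutes_inv[OF follow_permutes] glue_permutes] by simp
qed

lemma turn_closed [simp]: "tu d \<in> sides \<Sigma> \<longleftrightarrow> d \<in> sides \<Sigma>"
  using permutes_in_image[OF turn_permutes] .

lemma turn_follow: "tu (fo d) = gl d"
  using permutes_inverses(2)[OF follow_permutes] by (simp add: turn_def)

lemma glue_turn: "d \<in> sides \<Sigma> \<Longrightarrow> gl (tu d) = inv fo d"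
  by (simp add: turn_def)

lemma permutation_turn: "permutation tu" and permutation_follow: "permutation fo"
  using turn_permutes follow_permutes finite_sides permutation_permutes by blast+

lemma in_vertex: "d \<in> vx d"
  unfolding initial_vertex_def using permutation_turn by (rule permutation_self_in_orbit)

lemma vertex_eqI: "e \<in> vx d \<Longrightarrow> vx e = vx d"
  unfolding initial_vertex_def using cyclic_on_orbit[OF turn_permutes finite_sides] orbit_cyclic_eq3 by metis

lemma vertex_iff: "e \<in> vx d \<longleftrightarrow> vx e = vx d"
  using vertex_eqI in_vertex by metis

lemma vertex_subset: "d \<in> sides \<Sigma> \<Longrightarrow> vx d \<subseteq> sides \<Sigma>"
  unfolding initial_vertex_def using permutes_orbit_subset[OF turn_permutes] .

lemma finite_vertex: "d \<in> sides \<Sigma> \<Longrightarrow> finite (vx d)"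
  using vertex_subset finite_sides finite_subset by blast

lemma vertex_turn: "vx (tu d) = vx d"
  by (intro vertex_eqI) (simp add: initial_vertex_def orbit.base)

lemma vertex_follow: "vx (fo d) = vx (gl d)"
  using vertex_turn[of "fo d"] by (simp add: turn_follow)

lemma bij_turn_vertex: "bij_betw tu (vx d) (vx d)"
proof (rule bij_betw_imageI)
  show "inj_on tu (vx d)" using permutes_inj[OF turn_permutes] by (rule inj_on_subset) simp
  show "tu ` vx d = vx d"
  proof
    show "tu ` vx d \<subseteq> vx d" using vertex_turn vertex_iff by auto
    show "vx d \<subseteq> tu ` vx d"
    proof
      fix e assume e: "e \<in> vx d"
      obtain y where y: "e = tu y" using permutes_surj[OF turn_permutes] by (metis surjD)
      then show "e \<in> tu ` vx d" using e vertex_turn[of y] by (auto simp: vertex_iff)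
    qed
  qed
qed

definition poly :: "nat \<Rightarrow> nat set" where "poly d = orbit fo d"

lemma poly_follow: "poly (fo d) = poly d"
proof -
  have "fo d \<in> orbit fo d" by (rule orbit.base)
  then show ?thesis unfolding poly_def using cyclic_on_orbit[OF follow_permutes finite_sides] orbit_cyclic_eq3 by metis
qed

lemma poly_inv_follow: "poly (inv fo d) = poly d"
  using poly_follow[of "inv fo d"] permutes_inverses(1)[OF follow_permutes] by simp

section \<open>Chains modulo 2 and the Euler characteristic\<close>

text \<open>Chains are functions on directed sides; the symmetric ones are the chains of undirected
  edges.\<close>

definition sym :: "(nat \<Rightarrow> bit) \<Rightarrow> bool" where
  "sym \<phi> \<longleftrightarrow> (\<forall>d\<in>sides \<Sigma>. \<phi> (gl d) = \<phi> d)"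

text \<open>Every edge appears through both of its directions, each at its own initial vertex. For
  symmetric chains this is the usual boundary, and a loop at \<open>v\<close> cancels.\<close>

definition bd :: "(nat \<Rightarrow> bit) \<Rightarrow> nat set \<Rightarrow> bit" where
  "bd \<phi> v = (\<Sum>h\<in>v. \<phi> h)"

definition edge_chain :: "nat \<Rightarrow> nat \<Rightarrow> bit" where
  "edge_chain x d = of_bool (d = x \<or> d = gl x)"

text \<open>The boundary of the union of the polygons in \<open>T\<close>: an edge survives if just
  one of its two sides belongs to a polygon in \<open>T\<close>.\<close>

definition face_chain :: "nat set set \<Rightarrow> nat \<Rightarrow> bit" where
  "face_chain T d = of_bool (poly d \<in> T) + of_bool (poly (gl d) \<in> T)"

lemma bd_add: "bd (\<lambda>d. \<phi> d + \<psi> d) v = bd \<phi> v + bd \<psi> v"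
  by (simp add: bd_def sum.distrib)

lemma bd_sum: "bd (\<lambda>d. \<Sum>x\<in>X. \<phi> x d) v = (\<Sum>x\<in>X. bd (\<phi> x) v)"
  unfolding bd_def by (rule sum.swap)

lemma bd_cong: "v \<in> vertices \<Sigma> \<Longrightarrow> (\<And>d. d \<in> sides \<Sigma> \<Longrightarrow> \<phi> d = \<psi> d) \<Longrightarrow> bd \<phi> v = bd \<psi> v"
  unfolding bd_def vertices_def using vertex_subset by (auto intro!: sum.cong)

lemma sym_edge_chain: "x \<in> sides \<Sigma> \<Longrightarrow> sym (edge_chain x)"
proof -
  assume x: "x \<in> sides \<Sigma>"
  have 1: "gl d = x \<longleftrightarrow> d = gl x" if "d \<in> sides \<Sigma>" for d
    using arg_cong[of "gl d" x gl] arg_cong[of d "gl x" gl] unfolding glue_glue[OF x] glue_glue[OF that] by blast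
  have 2: "gl d = gl x \<longleftrightarrow> d = x" for d
    using permutes_inj[OF glue_permutes] by (rule inj_eq)
  show "sym (edge_chain x)" unfolding sym_def edge_chain_def
    by (rule ballI, rule arg_cong[where f = of_bool], unfold 2, subst 1, assumption, rule disj_commute)
qed

lemma sym_sum: "(\<And>x. x \<in> X \<Longrightarrow> sym (\<phi> x)) \<Longrightarrow> sym (\<lambda>d. \<Sum>x\<in>X. \<phi> x d)"
  unfolding sym_def by (auto intro: sum.cong)

lemma sym_add: "sym \<phi> \<Longrightarrow> sym \<psi> \<Longrightarrow> sym (\<lambda>d. \<phi> d + \<psi> d)"
  by (simp add: sym_def)

lemma sym_face_chain: "sym (face_chain T)"
  by (simp add: sym_def face_chain_def add.commute)

lemma bd_edge_chain:
  assumes x: "x \<in> sides \<Sigma>" and v: "v \<in> vertices \<Sigma>"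
  shows "bd (edge_chain x) v = of_bool (vx x = v) + of_bool (vx (gl x) = v)"
proof -
  obtain e where e: "e \<in> sides \<Sigma>" "v = vx e" using v by (auto simp: vertices_def)
  have "edge_chain x h = of_bool (h = x) + of_bool (h = gl x)" for h
    using glue_neq[OF x] by (auto simp: edge_chain_def)
  moreover have "(\<Sum>h\<in>v. of_bool (h = y)) = (of_bool (vx y = v) :: bit)" for y
    using finite_vertex[OF e(1)] by (simp add: of_bool_def e(2) vertex_iff if_distrib cong: if_cong)
  ultimately show ?thesis by (simp add: bd_def sum.distrib)
qed

text \<open>The side \<open>gl (tu y)\<close> precedes \<open>y\<close> in the same polygon, so a
  rotation about the vertex matches the two summands of the chain.\<close>

lemma bd_face_chain:
  assumes v: "v \<in> vertices \<Sigma>"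
  shows "bd (face_chain T) v = 0"
proof -
  obtain e where e: "e \<in> sides \<Sigma>" "v = vx e" using v by (auto simp: vertices_def)
  have "(\<Sum>h\<in>v. of_bool (poly (gl h) \<in> T)) = (\<Sum>y\<in>v. of_bool (poly (gl (tu y)) \<in> T) :: bit)"
    unfolding e(2) by (rule sum.reindex_bij_betw[OF bij_turn_vertex, symmetric])
  also have "\<dots> = (\<Sum>y\<in>v. of_bool (poly y \<in> T))"
    using vertex_subset[OF e(1)] by (intro sum.cong) (auto simp: e(2) glue_turn poly_inv_follow)
  finally show ?thesis by (simp add: bd_def face_chain_def sum.distrib)
qed

text \<open>Both kinds of step, to the following side and to the glued side, move the initial vertex
  of a side to its final vertex. Adding the edge of that side carries the boundary along.\<close>

lemma connecting_chain:
  assumes "d \<in> sides \<Sigma>" "e \<in> sides \<Sigma>"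
  shows "\<exists>\<phi>. sym \<phi> \<and> (\<forall>v\<in>vertices \<Sigma>. bd \<phi> v = of_bool (vx d = v) + of_bool (vx e = v))"
proof -
  have "(d, e) \<in> ({(x, fo x) | x. x \<in> sides \<Sigma>} \<union> {(x, gl x) | x. x \<in> sides \<Sigma>})\<^sup>*"
    using closed assms unfolding closed_surface_def by blast
  then show ?thesis
  proof (induction rule: rtrancl_induct)
    case base
    show ?case by (intro exI[of _ "\<lambda>_. 0"]) (simp add: sym_def bd_def)
  next
    case (step y z)
    then obtain \<phi> where \<phi>: "sym \<phi>" "\<And>v. v \<in> vertices \<Sigma> \<Longrightarrow> bd \<phi> v = of_bool (vx d = v) + of_bool (vx y = v)" by blast
    have y: "y \<in> sides \<Sigma>" and z: "vx z = vx (gl y)" using step.hyps(2) vertex_follow by auto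
    show ?case
    proof (intro exI[of _ "\<lambda>x. \<phi> x + edge_chain y x"] conjI ballI)
      show "sym (\<lambda>x. \<phi> x + edge_chain y x)" using \<phi>(1) sym_edge_chain[OF y] by (rule sym_add)
      show "bd (\<lambda>x. \<phi> x + edge_chain y x) v = of_bool (vx d = v) + of_bool (vx z = v)" if "v \<in> vertices \<Sigma>" for v
        using that \<phi>(2) z y by (simp add: bd_add bd_edge_chain add.assoc)
    qed
  qed
qed

text \<open>Linear functionals on chains that vanish on boundaries, such as intersection with a closed curve.\<close>

definition functional :: "((nat \<Rightarrow> bit) \<Rightarrow> bit) \<Rightarrow> bool" where
  "functional \<Lambda> \<longleftrightarrow> (\<forall>\<phi> \<psi>. \<Lambda> (\<lambda>d. \<phi> d + \<psi> d) = \<Lambda> \<phi> + \<Lambda> \<psi>) \<and> (\<forall>T. \<Lambda> (face_chain T) = 0) \<and>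
     (\<forall>\<phi> \<psi>. (\<forall>d\<in>sides \<Sigma>. \<phi> d = \<psi> d) \<longrightarrow> \<Lambda> \<phi> = \<Lambda> \<psi>)"

lemma functional_add:
  assumes "functional \<Lambda>"
  shows "\<Lambda> (\<lambda>d. \<phi> d + \<psi> d) = \<Lambda> \<phi> + \<Lambda> \<psi>"
proof -
  have "\<forall>\<phi> \<psi>. \<Lambda> (\<lambda>d. \<phi> d + \<psi> d) = \<Lambda> \<phi> + \<Lambda> \<psi>" by (rule conjunct1[OF assms[unfolded functional_def]])
  then have "\<forall>\<psi>. \<Lambda> (\<lambda>d. \<phi> d + \<psi> d) = \<Lambda> \<phi> + \<Lambda> \<psi>" by (rule spec)
  then show ?thesis by (rule spec)
qed

lemma functional_face_chain:
  assumes "functional \<Lambda>"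
  shows "\<Lambda> (face_chain T) = 0"
proof -
  have "\<forall>T. \<Lambda> (face_chain T) = 0" by (rule conjunct1[OF conjunct2[OF assms[unfolded functional_def]]])
  then show ?thesis by (rule spec)
qed

lemma functional_cong:
  assumes "functional \<Lambda>" and eq: "\<And>d. d \<in> sides \<Sigma> \<Longrightarrow> \<phi> d = \<psi> d"
  shows "\<Lambda> \<phi> = \<Lambda> \<psi>"
proof -
  have "\<forall>\<phi> \<psi>. (\<forall>d\<in>sides \<Sigma>. \<phi> d = \<psi> d) \<longrightarrow> \<Lambda> \<phi> = \<Lambda> \<psi>"
    by (rule conjunct2[OF conjunct2[OF assms(1)[unfolded functional_def]]])
  then have "\<forall>\<psi>. (\<forall>d\<in>sides \<Sigma>. \<phi> d = \<psi> d) \<longrightarrow> \<Lambda> \<phi> = \<Lambda> \<psi>" by (rule spec)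
  then have "(\<forall>d\<in>sides \<Sigma>. \<phi> d = \<psi> d) \<longrightarrow> \<Lambda> \<phi> = \<Lambda> \<psi>" by (rule spec)
  moreover have "\<forall>d\<in>sides \<Sigma>. \<phi> d = \<psi> d" by (rule ballI) (rule eq)
  ultimately show ?thesis by (rule mp)
qed

lemma functionalI:
  assumes "\<And>\<phi> \<psi>. \<Lambda> (\<lambda>d. \<phi> d + \<psi> d) = \<Lambda> \<phi> + \<Lambda> \<psi>" "\<And>T. \<Lambda> (face_chain T) = 0"
    "\<And>\<phi> \<psi>. (\<And>d. d \<in> sides \<Sigma> \<Longrightarrow> \<phi> d = \<psi> d) \<Longrightarrow> \<Lambda> \<phi> = \<Lambda> \<psi>"
  shows "functional \<Lambda>"
  unfolding functional_def by (rule conjI, intro allI, rule assms(1), rule conjI, rule allI, rule assms(2),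
    intro allI impI, rule assms(3), erule bspec)

lemma functional_sum:
  assumes "functional \<Lambda>" "finite X"
  shows "\<Lambda> (\<lambda>d. \<Sum>x\<in>X. \<phi> x d) = (\<Sum>x\<in>X. \<Lambda> (\<phi> x))"
  using assms(2)
proof (induction rule: finite_induct)
  case empty
  have "face_chain {} = (\<lambda>d. 0)" by (simp add: fun_eq_iff face_chain_def)
  then show ?case using functional_face_chain[OF assms(1), of "{}"] by simp
next
  case (insert x X)
  then show ?case using functional_add[OF assms(1), of "\<phi> x" "\<lambda>d. \<Sum>x\<in>X. \<phi> x d"] by simp
qed

lemma functional_sum_functionals:
  assumes "\<And>x. x \<in> X \<Longrightarrow> functional (\<Lambda> x)"
  shows "functional (\<lambda>\<phi>. \<Sum>x\<in>X. \<Lambda> x \<phi>)"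
proof (rule functionalI)
  fix \<phi> \<psi> :: "nat \<Rightarrow> bit" and T
  show "(\<Sum>x\<in>X. \<Lambda> x (\<lambda>d. \<phi> d + \<psi> d)) = (\<Sum>x\<in>X. \<Lambda> x \<phi>) + (\<Sum>x\<in>X. \<Lambda> x \<psi>)"
    unfolding sum.distrib[symmetric] by (rule sum.cong[OF refl]) (rule functional_add[OF assms])
  show "(\<Sum>x\<in>X. \<Lambda> x (face_chain T)) = 0"
    by (rule sum.neutral, rule ballI) (rule functional_face_chain[OF assms])
  assume eq: "\<And>d. d \<in> sides \<Sigma> \<Longrightarrow> \<phi> d = \<psi> d"
  show "(\<Sum>x\<in>X. \<Lambda> x \<phi>) = (\<Sum>x\<in>X. \<Lambda> x \<psi>)"
  proof (rule sum.cong[OF refl])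
    fix x assume "x \<in> X"
    show "\<Lambda> x \<phi> = \<Lambda> x \<psi>" by (rule functional_cong[OF assms[OF \<open>x \<in> X\<close>]]) (rule eq)
  qed
qed

text \<open>The chain tells for each edge whether membership changes between the polygons on its two
  sides. Connectedness propagates this from the polygon of \<open>d0\<close>, which is in neither
  set.\<close>

lemma face_chain_inject:
  assumes T: "T \<subseteq> polygons \<Sigma> - {poly d0}" "T' \<subseteq> polygons \<Sigma> - {poly d0}" and d0: "d0 \<in> sides \<Sigma>"
    and eq: "\<And>d. d \<in> sides \<Sigma> \<Longrightarrow> face_chain T d = face_chain T' d"
  shows "T = T'"
proof -
  have same: "poly e \<in> T \<longleftrightarrow> poly e \<in> T'" if "e \<in> sides \<Sigma>" for e
  proof -
    have "(d0, e) \<in> ({(x, fo x) | x. x \<in> sides \<Sigma>} \<union> {(x, gl x) | x. x \<in> sides \<Sigma>})\<^sup>*"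
      using closed d0 that unfolding closed_surface_def by blast
    then show ?thesis
    proof (induction rule: rtrancl_induct)
      case base
      then show ?case using T by blast
    next
      case (step y z)
      then consider "z = fo y" | "z = gl y" "y \<in> sides \<Sigma>" by blast
      then show ?case
      proof cases
        case 1
        then show ?thesis using step.IH poly_follow by simp
      next
        case 2
        then show ?thesis using step.IH eq[of y] by (auto simp: face_chain_def split: if_splits)
      qed
    qed
  qed
  have "\<exists>e\<in>sides \<Sigma>. t = poly e" if "t \<in> polygons \<Sigma>" for t using that by (auto simp: polygons_def poly_def)
  then show ?thesis using same T by blast
qed

text \<open>Counting takes the place of ranks. Boundaries of polygons other than one, subsets of the
  \<open>k\<close> cycles and paths from a base vertex to other vertices add up to pairwise
  different chains of edges, and there are only \<open>2 ^ card (edges \<Sigma>)\<close> of these.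
  The boundary of the sum recovers the vertices, the functionals recover the cycles, and then the
  polygons are determined.\<close>

lemma euler_characteristic_bound:
  fixes z :: "nat \<Rightarrow> nat \<Rightarrow> bit"
  assumes sym: "\<And>j. j < k \<Longrightarrow> sym (z j)" and cyc: "\<And>j v. j < k \<Longrightarrow> v \<in> vertices \<Sigma> \<Longrightarrow> bd (z j) v = 0"
    and ess: "\<And>X. X \<subseteq> {..<k} \<Longrightarrow> X \<noteq> {} \<Longrightarrow> \<exists>\<Lambda>. functional \<Lambda> \<and> (\<Sum>j\<in>X. \<Lambda> (z j)) \<noteq> 0"
  shows "card (vertices \<Sigma>) + card (polygons \<Sigma>) + k \<le> card (edges \<Sigma>) + 2"
proof -
  obtain d0 where d0: "d0 \<in> sides \<Sigma>" using sides_nonempty by blast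
  have "\<exists>q. sym q \<and> (\<forall>v\<in>vertices \<Sigma>. bd q v = of_bool (vx d0 = v) + of_bool (w = v))" if "w \<in> vertices \<Sigma>" for w
  proof -
    obtain x where x: "x \<in> sides \<Sigma>" "w = vx x" using \<open>w \<in> vertices \<Sigma>\<close> by (auto simp: vertices_def)
    show ?thesis using connecting_chain[OF d0 x(1)] unfolding x(2) .
  qed
  then have "\<forall>w\<in>vertices \<Sigma>. \<exists>q. sym q \<and> (\<forall>v\<in>vertices \<Sigma>. bd q v = of_bool (vx d0 = v) + of_bool (w = v))"
    by (rule ballI)
  from bchoice[OF this] obtain q where q': "\<forall>w\<in>vertices \<Sigma>. sym (q w) \<and>
      (\<forall>v\<in>vertices \<Sigma>. bd (q w) v = of_bool (vx d0 = v) + of_bool (w = v))" by (rule exE)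
  have q: "sym (q w)" "v \<in> vertices \<Sigma> \<Longrightarrow> bd (q w) v = of_bool (vx d0 = v) + of_bool (w = v)"
    if "w \<in> vertices \<Sigma>" for w v
    using bspec[OF q' that] by simp_all
  define ch where "ch T X W d = face_chain T d + ((\<Sum>j\<in>X. z j d) + (\<Sum>w\<in>W. q w d))" for T X W d
  \<comment> \<open>A set of polygons and its complement have the same boundary, and a boundary has
    an even number of vertices; this is why one polygon and one vertex are left out.\<close>
  define Dom where "Dom = Pow (polygons \<Sigma> - {poly d0}) \<times> Pow {..<k} \<times> Pow (vertices \<Sigma> - {vx d0})"
  define F where "F = (\<lambda>(T, X, W). {{d, gl d} | d. d \<in> sides \<Sigma> \<and> ch T X W d = 1})"
  have fin: "finite (vertices \<Sigma>)" "finite (polygons \<Sigma>)" "finite (edges \<Sigma>)"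
    by (simp_all add: vertices_def polygons_def edges_def)
  have symch: "sym (ch T X W)" if "(T, X, W) \<in> Dom" for T X W
  proof -
    have X: "X \<subseteq> {..<k}" and W: "W \<subseteq> vertices \<Sigma>" using that unfolding Dom_def by blast+
    have "sym (\<lambda>d. \<Sum>j\<in>X. z j d)"
      by (rule sym_sum[where \<phi> = z]) (rule sym, use X in blast)
    moreover have "sym (\<lambda>d. \<Sum>w\<in>W. q w d)"
      by (rule sym_sum[where \<phi> = q]) (rule q(1), use W in blast)
    ultimately have "sym (\<lambda>d. (\<Sum>j\<in>X. z j d) + (\<Sum>w\<in>W. q w d))" by (rule sym_add)
    then show ?thesis unfolding ch_def by (rule sym_add[OF sym_face_chain])
  qed
  have inj: "inj_on F Dom"
  proof (rule inj_onI)
    fix x y assume xy: "x \<in> Dom" "y \<in> Dom" "F x = F y"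
    obtain T X W T' X' W' where xe: "x = (T, X, W)" "y = (T', X', W')" by (cases x, cases y)
    have D: "(T, X, W) \<in> Dom" and D': "(T', X', W') \<in> Dom" and FF: "F (T, X, W) = F (T', X', W')"
      using xy unfolding xe .
    have memF: "{d, gl d} \<in> F (T, X, W) \<longleftrightarrow> ch T X W d = 1" if "(T, X, W) \<in> Dom" "d \<in> sides \<Sigma>" for T X W d
    proof
      assume "{d, gl d} \<in> F (T, X, W)"
      then obtain e where e: "e \<in> sides \<Sigma>" "ch T X W e = 1" "{d, gl d} = {e, gl e}" by (auto simp: F_def)
      then have "d = e \<or> d = gl e" by auto
      then show "ch T X W d = 1" using symch[OF that(1)] e by (auto simp: sym_def)
    qed (use that in \<open>auto simp: F_def\<close>)
    have eq: "ch T X W d = ch T' X' W' d" if "d \<in> sides \<Sigma>" for d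
      using memF[OF D that] memF[OF D' that] FF
      by (cases "ch T X W d"; cases "ch T' X' W' d") simp_all
    have bdch: "bd (ch T X W) v = of_bool (v \<in> W)" if "(T, X, W) \<in> Dom" "v \<in> vertices \<Sigma>" "v \<noteq> vx d0" for T X W v
    proof -
      have "finite W" "W \<subseteq> vertices \<Sigma>" "X \<subseteq> {..<k}" using that fin by (auto simp: Dom_def intro: finite_subset)
      have "(\<Sum>j\<in>X. bd (z j) v) = 0"
      proof (rule sum.neutral, rule ballI)
        fix j assume "j \<in> X"
        show "bd (z j) v = 0" by (rule cyc[OF _ that(2)]) (use \<open>j \<in> X\<close> \<open>X \<subseteq> {..<k}\<close> in blast)
      qed
      moreover have "(\<Sum>w\<in>W. bd (q w) v) = (\<Sum>w\<in>W. of_bool (w = v))"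
      proof (rule sum.cong[OF refl])
        fix w assume "w \<in> W"
        then have "bd (q w) v = of_bool (vx d0 = v) + of_bool (w = v)"
          by (intro q(2)[OF _ that(2)]) (use \<open>W \<subseteq> vertices \<Sigma>\<close> in blast)
        then show "bd (q w) v = of_bool (w = v)" using that(3) by simp
      qed
      moreover have "(\<Sum>w\<in>W. of_bool (w = v)) = (of_bool (v \<in> W) :: bit)"
        using \<open>finite W\<close> by (simp add: of_bool_def cong: if_cong)
      ultimately show ?thesis unfolding ch_def bd_add bd_sum using bd_face_chain[OF that(2)] by simp
    qed
    have "v \<in> W \<longleftrightarrow> v \<in> W'" if "v \<in> vertices \<Sigma>" "v \<noteq> vx d0" for v
      using bdch[OF D that] bdch[OF D' that] bd_cong[OF that(1) eq] by (auto split: if_splits)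
    moreover have sub: "T \<subseteq> polygons \<Sigma> - {poly d0}" "X \<subseteq> {..<k}" "W \<subseteq> vertices \<Sigma> - {vx d0}"
        "T' \<subseteq> polygons \<Sigma> - {poly d0}" "X' \<subseteq> {..<k}" "W' \<subseteq> vertices \<Sigma> - {vx d0}"
      using D D' unfolding Dom_def by blast+
    ultimately have WW: "W = W'" by blast
    have eq2: "face_chain T d + (\<Sum>j\<in>X. z j d) = face_chain T' d + (\<Sum>j\<in>X'. z j d)" if "d \<in> sides \<Sigma>" for d
      using eq[OF that] unfolding ch_def WW by (simp add: add.assoc[symmetric])
    have finX: "finite X" "finite X'" using sub(2,5) finite_subset by blast+
    have XX: "X = X'"
    proof (rule ccontr)
      assume "X \<noteq> X'"
      \<comment> \<open>Up to boundaries of polygons, the cycles in the symmetric difference would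
        add up to zero, against the functional that \<open>ess\<close> provides for them.\<close>
      define Y where "Y = (X - X') \<union> (X' - X)"
      have "Y \<subseteq> {..<k}" "Y \<noteq> {}" using sub(2,5) \<open>X \<noteq> X'\<close> unfolding Y_def by blast+
      then obtain \<Lambda> where \<Lambda>: "functional \<Lambda>" "(\<Sum>j\<in>Y. \<Lambda> (z j)) \<noteq> 0" using ess by blast
      have "\<Lambda> (\<lambda>d. face_chain T d + (\<Sum>j\<in>X. z j d)) = \<Lambda> (\<lambda>d. face_chain T' d + (\<Sum>j\<in>X'. z j d))"
        by (rule functional_cong[OF \<Lambda>(1)]) (rule eq2)
      then have "\<Lambda> (\<lambda>d. \<Sum>j\<in>X. z j d) = \<Lambda> (\<lambda>d. \<Sum>j\<in>X'. z j d)"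
        unfolding functional_add[OF \<Lambda>(1)] functional_face_chain[OF \<Lambda>(1)] by simp
      then have L: "(\<Sum>j\<in>X. \<Lambda> (z j)) = (\<Sum>j\<in>X'. \<Lambda> (z j))"
        unfolding functional_sum[OF \<Lambda>(1) finX(1)] functional_sum[OF \<Lambda>(1) finX(2)] .
      have "(\<Sum>j\<in>Y. \<Lambda> (z j)) = (\<Sum>j\<in>X - X'. \<Lambda> (z j)) + (\<Sum>j\<in>X' - X. \<Lambda> (z j))"
        unfolding Y_def using finX by (intro sum.union_disjoint) auto
      also have "\<dots> = 0"
        using L sum.Int_Diff[OF finX(1), of "\<lambda>j. \<Lambda> (z j)" X'] sum.Int_Diff[OF finX(2), of "\<lambda>j. \<Lambda> (z j)" X]
        by (simp add: Int_commute)
      finally show False using \<Lambda>(2) by simp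
    qed
    have fc: "face_chain T d = face_chain T' d" if "d \<in> sides \<Sigma>" for d
      using eq2[OF that] unfolding XX by simp
    have TT: "T = T'" by (rule face_chain_inject[OF sub(1,4) d0]) (rule fc)
    have "x = y" unfolding xe TT XX WW by (rule refl)
    then show "x = y" .
  qed
  have "F ` Dom \<subseteq> Pow (edges \<Sigma>)" by (auto simp: F_def edges_def)
  then have "card Dom \<le> card (Pow (edges \<Sigma>))"
    using inj fin by (intro card_inj_on_le[of F]) auto
  moreover have "card Dom = 2 ^ (card (polygons \<Sigma>) - 1) * (2 ^ k * 2 ^ (card (vertices \<Sigma>) - 1))"
  proof -
    have "poly d0 \<in> polygons \<Sigma>" "vx d0 \<in> vertices \<Sigma>" using d0 by (auto simp: polygons_def poly_def vertices_def)
    then show ?thesis using fin by (simp add: Dom_def card_cartesian_product card_Pow card_Diff_singleton)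
  qed
  ultimately have "2 ^ (card (polygons \<Sigma>) - 1 + (k + (card (vertices \<Sigma>) - 1))) \<le> (2::nat) ^ card (edges \<Sigma>)"
    using fin by (simp add: card_Pow power_add)
  then have "card (polygons \<Sigma>) - 1 + (k + (card (vertices \<Sigma>) - 1)) \<le> card (edges \<Sigma>)" by simp
  moreover have "card (polygons \<Sigma>) > 0" "card (vertices \<Sigma>) > 0"
    using d0 fin by (auto simp: card_gt_0_iff polygons_def vertices_def)
  ultimately show ?thesis by simp
qed

text \<open>In effect the bound \<open>2 * g\<close> for the dimension of the first homology modulo
  2, with independence certified by functionals.\<close>

corollary genus_bound:
  fixes z :: "nat \<Rightarrow> nat \<Rightarrow> bit"
  assumes "has_genus \<Sigma> g" "\<And>j. j < k \<Longrightarrow> sym (z j)" "\<And>j v. j < k \<Longrightarrow> v \<in> vertices \<Sigma> \<Longrightarrow> bd (z j) v = 0"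
    "\<And>X. X \<subseteq> {..<k} \<Longrightarrow> X \<noteq> {} \<Longrightarrow> \<exists>\<Lambda>. functional \<Lambda> \<and> (\<Sum>j\<in>X. \<Lambda> (z j)) \<noteq> 0"
  shows "k \<le> 2 * g"
proof -
  have "card (vertices \<Sigma>) + card (polygons \<Sigma>) + k \<le> card (edges \<Sigma>) + 2"
    by (rule euler_characteristic_bound[where z = z and k = k])
      (rule assms(2), assumption, rule assms(3), assumption+, rule assms(4), assumption+)
  then show ?thesis using assms(1) unfolding has_genus_def by linarith
qed

end

section \<open>Sectors at a vertex\<close>

context surf
begin

text \<open>The sides strictly between \<open>x\<close> and \<open>y\<close> in counterclockwise order around a vertex.\<close>

definition sector :: "nat \<Rightarrow> nat \<Rightarrow> nat set" where
  "sector x y = (\<lambda>i. (tu ^^ i) x) ` {1..<funpow_dist1 tu x y}"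

lemma turn_power_inj:
  assumes "(tu ^^ i) x = (tu ^^ j) x" "i < card (vx x)" "j < card (vx x)"
  shows "i = j"
proof -
  define r where "r = funpow_dist1 tu x x"
  have x: "x \<in> orbit tu x" using in_vertex by (simp add: initial_vertex_def)
  have "vx x = (\<lambda>n. (tu ^^ n) x) ` {0..<r}"
    unfolding initial_vertex_def r_def by (rule orbit_conv_funpow_dist1[OF x])
  moreover have inj: "inj_on (\<lambda>n. (tu ^^ n) x) {0..<r}" unfolding r_def by (rule inj_on_funpow_dist1[OF x])
  ultimately have "card (vx x) = r" by (simp only: card_image card_atLeastLessThan diff_zero)
  then have "i \<in> {0..<r}" "j \<in> {0..<r}" using assms by simp_all
  with inj_onD[OF inj assms(1)] show ?thesis by blast
qed

lemma funpow_dist1_turn: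
  assumes "(tu ^^ b) x = y" "0 < b" "b < card (vx x)"
  shows "funpow_dist1 tu x y = b"
proof -
  define r where "r = funpow_dist1 tu x y"
  have "y \<in> orbit tu x" unfolding orbit_altdef using assms(1,2) by blast
  then have r: "(tu ^^ r) x = y" unfolding r_def by (rule funpow_dist1_prop)
  have "r \<le> b"
  proof (rule ccontr)
    assume "\<not> r \<le> b"
    then have "b < funpow_dist1 tu x y" unfolding r_def by simp
    from funpow_dist1_least[OF assms(2) this] assms(1) show False by (rule notE)
  qed
  then have "r < card (vx x)" using assms(3) by simp
  moreover have "(tu ^^ r) x = (tu ^^ b) x" unfolding r assms(1) ..
  ultimately have "r = b" using turn_power_inj assms(3) by blast
  then show ?thesis unfolding r_def .
qed

lemma sector_turn:
  assumes "(tu ^^ b) x = y" "0 < b" "b < card (vx x)" "0 < a" "a < card (vx x)"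
  shows "(tu ^^ a) x \<in> sector x y \<longleftrightarrow> a < b"
proof
  assume "(tu ^^ a) x \<in> sector x y"
  then obtain i where i: "i < b" "(tu ^^ i) x = (tu ^^ a) x"
    unfolding sector_def funpow_dist1_turn[OF assms(1-3)] by auto
  then have "i = a" using turn_power_inj[of i x a] assms by simp
  then show "a < b" using i by simp
qed (use assms in \<open>auto simp: sector_def funpow_dist1_turn[OF assms(1-3)]\<close>)

lemma sector_ccw:
  assumes "counterclockwise \<Sigma> a b c d"
  shows "b \<in> sector a c" "d \<notin> sector a c" "b \<in> sector a d" "c \<in> sector a d" "c \<notin> sector a b" "d \<notin> sector a b"
    "distinct [a, b, c, d]"
proof -
  obtain i j k where *: "0 < i" "i < j" "j < k" "k < card (vx a)"
    "b = (tu ^^ i) a" "c = (tu ^^ j) a" "d = (tu ^^ k) a"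
    using assms unfolding counterclockwise_def by blast
  note st = sector_turn[of i a b] sector_turn[of j a c] sector_turn[of k a d]
  show "b \<in> sector a c" "d \<notin> sector a c" "b \<in> sector a d" "c \<in> sector a d" "c \<notin> sector a b" "d \<notin> sector a b"
    using st(1)[of j] st(1)[of k] st(2)[of i] st(2)[of k] st(3)[of i] st(3)[of j] * by auto
  show "distinct [a, b, c, d]"
    using * turn_power_inj[of 0 a i] turn_power_inj[of 0 a j] turn_power_inj[of 0 a k]
      turn_power_inj[of i a j] turn_power_inj[of i a k] turn_power_inj[of j a k] by auto
qed

lemma turn_power_sides: "x \<in> sides \<Sigma> \<Longrightarrow> (tu ^^ i) x \<in> sides \<Sigma>"
  by (induction i) simp_all

lemma sector_subset:
  assumes "x \<in> sides \<Sigma>" shows "sector x y \<subseteq> vx x" "finite (sector x y)" "sector x y \<subseteq> sides \<Sigma>"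
proof -
  show "sector x y \<subseteq> vx x"
  proof
    fix h assume "h \<in> sector x y"
    then obtain i where "i \<in> {1..<funpow_dist1 tu x y}" "h = (tu ^^ i) x" unfolding sector_def by blast
    then have "0 < i" "h = (tu ^^ i) x" by simp_all
    then show "h \<in> vx x" unfolding initial_vertex_def by (auto simp: orbit_altdef)
  qed
  then show "finite (sector x y)" "sector x y \<subseteq> sides \<Sigma>"
    using finite_vertex[OF assms] vertex_subset[OF assms] finite_subset by blast+
qed

lemma sector_ends:
  assumes "y \<in> vx x" shows "x \<notin> sector x y" "y \<notin> sector x y" 
proof -
  have y: "y \<in> orbit tu x" using assms by (simp add: initial_vertex_def)
  show "y \<notin> sector x y"
  proof
    assume "y \<in> sector x y"
    then obtain i where i: "i \<in> {1..<funpow_dist1 tu x y}" "y = (tu ^^ i) x" unfolding sector_def by blast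
    then have "0 < i" "i < funpow_dist1 tu x y" by simp_all
    from funpow_dist1_least[OF this] i(2) show False by simp
  qed
  show "x \<notin> sector x y"
  proof
    assume "x \<in> sector x y"
    then obtain i where i: "i \<in> {1..<funpow_dist1 tu x y}" "x = (tu ^^ i) x" unfolding sector_def by blast
    then have "i = 0" by (intro inj_onD[OF inj_on_funpow_dist1[OF y], of i 0]) auto
    then show False using i(1) by simp
  qed
qed

text \<open>Consecutive sides at a vertex enclose one corner of a polygon, and
  \<open>face_chain\<close> compares the corners before and after a side. The sum telescopes to the
  first corner, to the left of \<open>x\<close>, and the last, to the right of
  \<open>y\<close>.\<close>

lemma sum_sector_face_chain:
  assumes x: "x \<in> sides \<Sigma>" and y: "y \<in> vx x"
  shows "(\<Sum>h\<in>sector x y. face_chain T h) = of_bool (poly x \<in> T) + of_bool (poly (gl y) \<in> T)"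
proof -
  have y': "y \<in> orbit tu x" using y by (simp add: initial_vertex_def)
  define r where "r = funpow_dist1 tu x y"
  then obtain n where n: "r = Suc n" by blast
  have inj: "inj_on (\<lambda>i. (tu ^^ i) x) {1..<r}"
    using inj_on_funpow_dist1[OF y'] unfolding r_def by (rule inj_on_subset) auto
  define t where "t i = (of_bool (poly ((tu ^^ i) x) \<in> T) :: bit)" for i
  have step: "poly (gl (tu ((tu ^^ i) x))) = poly ((tu ^^ i) x)" for i
    unfolding glue_turn[OF turn_power_sides[OF x]] by (rule poly_inv_follow)
  have ft: "face_chain T ((tu ^^ Suc i) x) = t (Suc i) + t i" for i
    unfolding face_chain_def t_def funpow.simps(2) comp_apply step ..
  have "(\<Sum>h\<in>sector x y. face_chain T h) = (\<Sum>i\<in>{1..<r}. face_chain T ((tu ^^ i) x))"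
    unfolding sector_def r_def[symmetric] sum.reindex[OF inj] comp_apply ..
  also have "\<dots> = (\<Sum>i<n. t (Suc i) + t i)"
    unfolding n ft[symmetric] by (rule sum.reindex_bij_witness[where i = Suc and j = "\<lambda>i. i - 1"]) auto
  also have "\<dots> = t n + t 0"
    by (induction n) (simp_all add: add.assoc add.left_commute)
  also have "t n = of_bool (poly (gl y) \<in> T)"
  proof -
    have "(tu ^^ r) x = y" unfolding r_def using y' by (rule funpow_dist1_prop)
    then have "y = tu ((tu ^^ n) x)" unfolding n funpow.simps(2) comp_apply by (rule HOL.sym)
    then show ?thesis unfolding t_def using step[of n] by (simp only:)
  qed
  also have "t 0 = of_bool (poly x \<in> T)" unfolding t_def by simp
  finally show ?thesis by (simp only: add.commute)
qed

lemma ccw_rotate: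
  assumes "counterclockwise \<Sigma> a b c d"
  shows "counterclockwise \<Sigma> b c d a"
proof -
  obtain i j k where *: "0 < i" "i < j" "j < k" "k < card (vx a)"
    "b = (tu ^^ i) a" "c = (tu ^^ j) a" "d = (tu ^^ k) a"
    using assms unfolding counterclockwise_def by blast
  have a: "a \<in> orbit tu a" using in_vertex by (simp add: initial_vertex_def)
  let ?n = "funpow_dist1 tu a a"
  have "vx a = (\<lambda>n. (tu ^^ n) a) ` {0..<?n}"
    unfolding initial_vertex_def using orbit_conv_funpow_dist1[OF a] .
  then have N: "card (vx a) = ?n" using inj_on_funpow_dist1[OF a] by (simp add: card_image)
  have ret: "(tu ^^ card (vx a)) a = a" unfolding N using funpow_dist1_prop[OF a] .
  have "b \<in> vx a" unfolding initial_vertex_def using *(1,5) by (auto simp: orbit_altdef)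
  then have vb: "vx b = vx a" by (rule vertex_eqI)
  have sh: "(tu ^^ (l - i)) b = (tu ^^ l) a" if "i \<le> l" for l
  proof -
    have "(tu ^^ (l - i + i)) a = (tu ^^ (l - i)) ((tu ^^ i) a)" by (simp only: funpow_add comp_apply)
    then show ?thesis unfolding *(5) using that by simp
  qed
  let ?N = "card (vx a)"
  have "0 < j - i" "j - i < k - i" "k - i < ?N - i" "?N - i < ?N" using *(1-4) by simp_all
  moreover have "c = (tu ^^ (j - i)) b" using sh[of j] *(2,6) by simp
  moreover have "d = (tu ^^ (k - i)) b" using sh[of k] *(2,3,7) by simp
  moreover have "a = (tu ^^ (?N - i)) b" using sh[of ?N] *(2-4) ret by simp
  ultimately show ?thesis unfolding counterclockwise_def vb by blast
qed

end

section \<open>Intersection numbers along a path\<close>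

text \<open>Treats based closed curves and arcs between holes together: the path may be closed or
  not, as long as its inner visits avoid both ends. For an arc, all computations take place in the
  closed surface whose polygons include the two that are removed.\<close>

locale surf_path = surf +
  fixes p :: "nat list" and R :: "(nat \<times> nat) set"
  assumes generic: "generic_path \<Sigma> p"
    and ends: "\<And>i. i \<in> {1..<length p} \<Longrightarrow> initial_vertex \<Sigma> (p ! i) \<noteq> initial_vertex \<Sigma> (hd p) \<and>
        initial_vertex \<Sigma> (p ! i) \<noteq> final_vertex \<Sigma> (last p)"
    and R: "over_under \<Sigma> p R"
begin

abbreviation "n \<equiv> length p"
abbreviation "CT \<equiv> crossing_times \<Sigma> p"
abbreviation "RL \<equiv> crosses_right_to_left \<Sigma> p"
abbreviation "LR \<equiv> crosses_left_to_right \<Sigma> p"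

text \<open>Points back along the path from visit \<open>i\<close>. Together with
  \<open>p ! i\<close> it divides the sides at the vertex into those on the left and those on the
  right of the path.\<close>

definition inn :: "nat \<Rightarrow> nat" where "inn i = gl (p ! (i - 1))"

lemma p_subset: "set p \<subseteq> sides \<Sigma>" and distinct_p: "distinct p" and p_nonempty: "p \<noteq> []"
  by (rule generic[unfolded generic_path_def, THEN conjunct2, THEN conjunct1],
      rule generic[unfolded generic_path_def, THEN conjunct2, THEN conjunct2, THEN conjunct2, THEN conjunct1],
      rule generic[unfolded generic_path_def, THEN conjunct1])

lemma p_sides [simp]: "k < n \<Longrightarrow> p ! k \<in> sides \<Sigma>"
  using p_subset nth_mem[of k p] by blast

lemma p_inj: "k < n \<Longrightarrow> l < n \<Longrightarrow> p ! k = p ! l \<longleftrightarrow> k = l"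
  using distinct_p by (rule nth_eq_iff_index_eq)

lemma p_glue: "k < n \<Longrightarrow> l < n \<Longrightarrow> p ! k \<noteq> gl (p ! l)"
  using bspec[OF generic[unfolded generic_path_def, THEN conjunct2, THEN conjunct2, THEN conjunct2, THEN conjunct2, THEN conjunct1] nth_mem[of l p]] nth_mem[of k p] by force

lemma nonempty: "0 < n" using p_nonempty by simp

lemma p_step: "Suc i < n \<Longrightarrow> vx (gl (p ! i)) = vx (p ! Suc i)"
  using spec[OF generic[unfolded generic_path_def, THEN conjunct2, THEN conjunct2, THEN conjunct1], of i] by (simp add: final_vertex_def)

lemma inn_vertex: "0 < i \<Longrightarrow> i < n \<Longrightarrow> inn i \<in> vx (p ! i)"
  using p_step[of "i - 1"] unfolding inn_def by (simp add: vertex_iff)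

lemma CT_sym: "(i, j) \<in> CT \<Longrightarrow> (j, i) \<in> CT" by (simp add: crossing_times_def)

lemma CT_D: "(i, j) \<in> CT \<Longrightarrow> 0 < i \<and> i < n \<and> 0 < j \<and> j < n \<and> i \<noteq> j \<and> vx (p ! i) = vx (p ! j)"
  by (auto simp: crossing_times_def)

lemma CT_unique: "(i, j) \<in> CT \<Longrightarrow> (i, k) \<in> CT \<Longrightarrow> j = k"
  using spec[OF spec[OF spec[OF generic[unfolded generic_path_def, THEN conjunct2, THEN conjunct2, THEN conjunct2, THEN conjunct2, THEN conjunct2, THEN conjunct1]]], of i j k] by simp

lemma CT_cases: "(i, j) \<in> CT \<Longrightarrow> RL i j \<or> LR i j"
  using bspec[OF generic[unfolded generic_path_def, THEN conjunct2, THEN conjunct2, THEN conjunct2, THEN conjunct2, THEN conjunct2, THEN conjunct2], of "(i, j)"] by simp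

lemma RL_def': "RL i j \<longleftrightarrow> counterclockwise \<Sigma> (p ! i) (p ! j) (inn i) (inn j)"
  and LR_def': "LR i j \<longleftrightarrow> counterclockwise \<Sigma> (p ! i) (inn j) (inn i) (p ! j)"
  by (simp_all add: crosses_right_to_left_def crosses_left_to_right_def inn_def)

lemma not_both: "\<not> (RL i j \<and> LR i j)"
proof
  assume "RL i j \<and> LR i j"
  then have "counterclockwise \<Sigma> (p ! i) (p ! j) (inn i) (inn j)" "counterclockwise \<Sigma> (p ! i) (inn j) (inn i) (p ! j)"
    unfolding RL_def' LR_def' by simp_all
  then show False using sector_ccw(1)[of "p ! i" "p ! j" "inn i" "inn j"] sector_ccw(2)[of "p ! i" "inn j" "inn i" "p ! j"]
    by simp
qed

lemma RL_swap: "(i, j) \<in> CT \<Longrightarrow> RL j i \<longleftrightarrow> \<not> RL i j"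
proof -
  assume ij: "(i, j) \<in> CT"
  have 1: "LR i j \<Longrightarrow> RL j i" for i j
    unfolding RL_def' LR_def' by (rule ccw_rotate[OF ccw_rotate[OF ccw_rotate]])
  have 3: "RL j i \<Longrightarrow> LR i j" for i j
    unfolding RL_def' LR_def' by (rule ccw_rotate)
  show ?thesis using 1[of i j] not_both[of i j] 3[of j i] CT_cases[OF ij] by blast
qed

lemma R_sub: "R \<subseteq> CT" and R_iff: "(i, j) \<in> CT \<Longrightarrow> (i, j) \<in> R \<longleftrightarrow> (j, i) \<notin> R"
  using R unfolding over_under_def by fast+

lemma chords_R: "chords R"
proof -
  have "CT \<subseteq> {..<n} \<times> {..<n}" by (auto simp: crossing_times_def)
  then have "finite R" using R_sub finite_subset by (metis finite_SigmaI finite_lessThan)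
  moreover have "e = e'" if e: "e \<in> R" "e' \<in> R" "{fst e, snd e} \<inter> {fst e', snd e'} \<noteq> {}" for e e'
  proof -
    obtain i j i' j' where ee: "e = (i, j)" "e' = (i', j')" by (metis surj_pair)
    have c: "(i, j) \<in> CT" "(i', j') \<in> CT" using e ee R_sub by auto
    have "i = i' \<or> i = j' \<or> j = i' \<or> j = j'" using e(3) ee by auto
    then show ?thesis
    proof (elim disjE)
      assume "i = i'"
      then show ?thesis using CT_unique[of i j j'] c ee by simp
    next
      assume i: "i = j'"
      then have "j = i'" using CT_unique[of i j i'] c(1) CT_sym[OF c(2)] by simp
      then show ?thesis using R_iff[OF c(1)] e(1,2) ee i by simp
    next
      assume j: "j = i'"
      then have "i = j'" using CT_unique[of j i j'] c(2) CT_sym[OF c(1)] by simp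
      then show ?thesis using R_iff[OF c(1)] e(1,2) ee j by simp
    next
      assume "j = j'"
      then show ?thesis using CT_unique[of j i i'] CT_sym[OF c(1)] CT_sym[OF c(2)] ee by simp
    qed
  qed
  moreover have "fst e \<noteq> snd e" if "e \<in> R" for e
    using that R_sub CT_D[of "fst e" "snd e"] by auto
  ultimately show ?thesis unfolding chords_def by blast
qed

definition arc_chain :: "nat \<Rightarrow> nat \<Rightarrow> nat \<Rightarrow> bit" where
  "arc_chain s t d = (\<Sum>k\<in>{s..<t}. edge_chain (p ! k) d)"

lemma sym_arc_chain: "t \<le> n \<Longrightarrow> sym (arc_chain s t)"
  unfolding arc_chain_def by (intro sym_sum sym_edge_chain) simp

lemma bd_arc_chain:
  assumes "s < t" "t \<le> n" "v \<in> vertices \<Sigma>"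
  shows "bd (arc_chain s t) v = of_bool (vx (p ! s) = v) + of_bool (vx (gl (p ! (t - 1))) = v)"
  using assms(1,2)
proof (induction t)
  case (Suc t)
  have *: "bd (edge_chain (p ! t)) v = of_bool (vx (p ! t) = v) + of_bool (vx (gl (p ! t)) = v)"
    using Suc.prems assms(3) by (intro bd_edge_chain) auto
  show ?case
  proof (cases "s = t")
    case True
    then show ?thesis using * by (simp add: arc_chain_def)
  next
    case False
    then have st: "s < t" using Suc.prems by simp
    have "arc_chain s (Suc t) = (\<lambda>d. arc_chain s t d + edge_chain (p ! t) d)"
      using st by (simp add: arc_chain_def fun_eq_iff)
    moreover have "vx (gl (p ! (t - 1))) = vx (p ! t)" using p_step[of "t - 1"] st Suc.prems by simp
    ultimately show ?thesis using Suc st * by (simp add: bd_add add.assoc)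
  qed
qed simp

lemma arc_chain_value:
  assumes "k < n" "t \<le> n"
  shows "arc_chain s t (p ! k) = of_bool (s \<le> k \<and> k < t)" "arc_chain s t (gl (p ! k)) = of_bool (s \<le> k \<and> k < t)"
proof -
  have "edge_chain (p ! l) (p ! k) = of_bool (l = k)" "edge_chain (p ! l) (gl (p ! k)) = of_bool (l = k)" if "l < t" for l
  proof -
    have "gl (p ! k) = gl (p ! l) \<longleftrightarrow> k = l"
      using p_inj[of k l] assms that inj_eq[OF permutes_inj[OF glue_permutes]] by simp
    then show "edge_chain (p ! l) (p ! k) = of_bool (l = k)" "edge_chain (p ! l) (gl (p ! k)) = of_bool (l = k)"
      using p_inj[of k l] p_glue[of k l] p_glue[of l k] assms that unfolding edge_chain_def by auto
  qed
  then have "arc_chain s t (p ! k) = (\<Sum>l\<in>{s..<t}. of_bool (l = k))" "arc_chain s t (gl (p ! k)) = (\<Sum>l\<in>{s..<t}. of_bool (l = k))"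
    unfolding arc_chain_def by (auto intro!: sum.cong)
  then show "arc_chain s t (p ! k) = of_bool (s \<le> k \<and> k < t)" "arc_chain s t (gl (p ! k)) = of_bool (s \<le> k \<and> k < t)"
    by (simp_all add: of_bool_def cong: if_cong)
qed

text \<open>At an inner visit the path uses at most four sides, two for this visit and two for the
  other visit of a crossing. The assumption on the ends excludes sides of the first and last edge
  that would arrive there without being a visit.\<close>

lemma arc_chain_support:
  assumes i: "0 < i" "i < n" and h: "h \<in> vx (p ! i)" "arc_chain s t h \<noteq> 0" "t \<le> n"
  shows "h = p ! i \<or> h = inn i \<or> (\<exists>j. (i, j) \<in> CT \<and> (h = p ! j \<or> h = inn j))"
proof -
  obtain k where k: "k \<in> {s..<t}" "edge_chain (p ! k) h \<noteq> 0"
    using h(2) unfolding arc_chain_def by (meson sum.neutral)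
  have kn: "k < n" using k h by simp
  have vh: "vx h = vx (p ! i)" using h(1) vertex_eqI by simp
  consider "h = p ! k" | "h = gl (p ! k)" using k(2) unfolding edge_chain_def by (auto split: if_splits)
  then show ?thesis
  proof cases
    case 1
    have "k \<noteq> 0"
    proof
      assume "k = 0"
      then have "vx (p ! i) = vx (hd p)" using 1 vh nonempty by (simp add: hd_conv_nth)
      then show False using ends[of i] i by simp
    qed
    then have "k = i \<or> (i, k) \<in> CT" using 1 vh kn i by (auto simp: crossing_times_def)
    then show ?thesis using 1 by blast
  next
    case 2
    have "Suc k < n"
    proof (rule ccontr)
      assume "\<not> Suc k < n"
      then have "k = n - 1" using kn by simp
      then have "vx (p ! i) = final_vertex \<Sigma> (last p)" using 2 vh nonempty by (simp add: last_conv_nth final_vertex_def)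
      then show False using ends[of i] i by simp
    qed
    moreover from this have "Suc k = i \<or> (i, Suc k) \<in> CT" using 2 vh p_step[of k] i by (auto simp: crossing_times_def)
    ultimately show ?thesis using 2 unfolding inn_def by (metis diff_Suc_1)
  qed
qed

lemma sum_sector_single:
  assumes "finite H" "x \<in> H" "\<And>h. h \<in> H \<Longrightarrow> h \<noteq> x \<Longrightarrow> f h = (0::bit)"
  shows "(\<Sum>h\<in>H. f h) = f x"
  using sum.remove[OF assms(1,2), of f] assms(3) by simp

text \<open>Contribution of a transversal visit, counted on the left of the path.\<close>

definition visit :: "nat \<Rightarrow> nat \<Rightarrow> nat \<Rightarrow> bit" where
  "visit s t i = (\<Sum>h\<in>sector (p ! i) (inn i). arc_chain s t h)"

lemma visit_noncrossing:
  assumes "0 < i" "i < n" "\<And>j. (i, j) \<notin> CT" "t \<le> n"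
  shows "visit s t i = 0"
  unfolding visit_def
proof (rule sum.neutral, rule ballI, rule ccontr)
  fix h assume h: "h \<in> sector (p ! i) (inn i)" "arc_chain s t h \<noteq> 0"
  have "h \<in> vx (p ! i)" using h sector_subset(1)[of "p ! i"] assms by auto
  then have "h = p ! i \<or> h = inn i" using arc_chain_support[OF assms(1,2) _ h(2) assms(4)] assms(3) by blast
  then show False using sector_ends[OF inn_vertex[OF assms(1,2)]] h by auto
qed

text \<open>The sector from \<open>p ! i\<close> to \<open>inn i\<close> is the left of the path. A
  strand that crosses from right to left leaves into it through its outgoing edge; one that crosses
  the other way comes from it through its incoming edge.\<close>

lemma visit_crossing:
  assumes ij: "(i, j) \<in> CT" and t: "t \<le> n"
  shows "visit s t i = (if RL i j then of_bool (s \<le> j \<and> j < t) else of_bool (s \<le> j - 1 \<and> j - 1 < t))"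
proof -
  have i: "0 < i" "i < n" "0 < j" "j < n" using CT_D[OF ij] by auto
  have supp: "h = p ! j \<or> h = inn j" if "h \<in> sector (p ! i) (inn i)" "arc_chain s t h \<noteq> 0" for h
  proof -
    have "h \<in> vx (p ! i)" using that sector_subset(1)[of "p ! i"] i by auto
    then show ?thesis using arc_chain_support[OF i(1,2) _ that(2) t] CT_unique[OF ij]
        sector_ends[OF inn_vertex[OF i(1,2)]] that by blast
  qed
  have fin: "finite (sector (p ! i) (inn i))" using sector_subset i by simp
  have v: "arc_chain s t (p ! j) = of_bool (s \<le> j \<and> j < t)" "arc_chain s t (inn j) = of_bool (s \<le> j - 1 \<and> j - 1 < t)"
    using arc_chain_value(1)[of j t s] arc_chain_value(2)[of "j - 1" t s] i t by (auto simp: inn_def)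
  show ?thesis
  proof (cases "RL i j")
    case True
    then have "p ! j \<in> sector (p ! i) (inn i)" "inn j \<notin> sector (p ! i) (inn i)"
      unfolding RL_def' using sector_ccw by blast+
    then have "visit s t i = arc_chain s t (p ! j)"
      unfolding visit_def using supp by (intro sum_sector_single[OF fin]) blast+
    then show ?thesis using True v by simp
  next
    case False
    then have "LR i j" using CT_cases[OF ij] by simp
    then have "inn j \<in> sector (p ! i) (inn i)" "p ! j \<notin> sector (p ! i) (inn i)"
      unfolding LR_def' using sector_ccw by blast+
    then have "visit s t i = arc_chain s t (inn j)"
      unfolding visit_def using supp by (intro sum_sector_single[OF fin]) blast+
    then show ?thesis using False v by simp
  qed
qed

text \<open>For a loop that leaves along \<open>p ! i\<close> and returns through
  \<open>inn j\<close>, the two other half edges at the corner are both on its left or both on its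
  right, according to the sign.\<close>

lemma corner_crossing:
  assumes ij: "(i, j) \<in> CT" and t: "t \<le> n"
  shows "(\<Sum>h\<in>sector (p ! i) (inn j). arc_chain s t h) =
    (if RL i j then of_bool (s \<le> j \<and> j < t) + of_bool (s \<le> i - 1 \<and> i - 1 < t) else 0)"
proof -
  have i: "0 < i" "i < n" "0 < j" "j < n" using CT_D[OF ij] by auto
  have ij': "inn j \<in> vx (p ! i)" using inn_vertex[of j] i CT_D[OF ij] by simp
  have supp: "h = p ! j \<or> h = inn i" if "h \<in> sector (p ! i) (inn j)" "arc_chain s t h \<noteq> 0" for h
  proof -
    have "h \<in> vx (p ! i)" using that sector_subset(1)[of "p ! i"] i by auto
    then show ?thesis using arc_chain_support[OF i(1,2) _ that(2) t] CT_unique[OF ij]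
        sector_ends[OF ij'] that by blast
  qed
  have fin: "finite (sector (p ! i) (inn j))" using sector_subset i by simp
  show ?thesis
  proof (cases "RL i j")
    case True
    then have m: "p ! j \<in> sector (p ! i) (inn j)" "inn i \<in> sector (p ! i) (inn j)" "p ! j \<noteq> inn i"
      unfolding RL_def' using sector_ccw(3,4,7) by fastforce+
    have "(\<Sum>h\<in>sector (p ! i) (inn j). arc_chain s t h) = (\<Sum>h\<in>{p ! j, inn i}. arc_chain s t h)"
    proof (rule sum.mono_neutral_right[OF fin])
      show "{p ! j, inn i} \<subseteq> sector (p ! i) (inn j)" using m by simp
      show "\<forall>h\<in>sector (p ! i) (inn j) - {p ! j, inn i}. arc_chain s t h = 0" using supp by blast
    qed
    also have "\<dots> = arc_chain s t (p ! j) + arc_chain s t (inn i)" using m(3) by simp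
    finally show ?thesis using True arc_chain_value(1)[of j t s] arc_chain_value(2)[of "i - 1" t s] i t by (simp add: inn_def)
  next
    case False
    then have "LR i j" using CT_cases[OF ij] by simp
    then have "inn i \<notin> sector (p ! i) (inn j)" "p ! j \<notin> sector (p ! i) (inn j)"
      unfolding LR_def' using sector_ccw(5,6) by blast+
    then have "(\<Sum>h\<in>sector (p ! i) (inn j). arc_chain s t h) = 0" using supp by (intro sum.neutral) blast
    then show ?thesis using False by simp
  qed
qed

text \<open>Intersection with the loop that the path runs through between the two visits of a crossing.\<close>

definition loop_int :: "nat \<times> nat \<Rightarrow> (nat \<Rightarrow> bit) \<Rightarrow> bit" where
  "loop_int d \<phi> = (\<Sum>h\<in>sector (p ! lo d) (inn (hi d)). \<phi> h) +
     (\<Sum>i\<in>{lo d<..<hi d}. \<Sum>h\<in>sector (p ! i) (inn i). \<phi> h)"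

lemma lo_hi_CT: 
  assumes "d \<in> R" shows "(lo d, hi d) \<in> CT" "0 < lo d" "lo d < hi d" "hi d < n"
proof -
  have "(fst d, snd d) \<in> CT" using assms R_sub by auto
  then show "(lo d, hi d) \<in> CT" using CT_sym by (auto simp: lo_def hi_def min_def max_def)
  from CT_D[OF this] lo_less_hi[OF chordsD(2)[OF chords_R assms]]
  show "0 < lo d" "lo d < hi d" "hi d < n" by simp_all
qed

text \<open>A visit records the polygons to the left of the incoming and of the outgoing edge, and
  so does the corner. Around the loop every edge is recorded twice, hence boundaries of polygons
  give zero.\<close>

lemma functional_loop_int:
  assumes d: "d \<in> R"
  shows "functional (loop_int d)"
proof -
  note lh = lo_hi_CT[OF d]
  have cong: "(\<Sum>h\<in>sector (p ! i) y. \<phi> h) = (\<Sum>h\<in>sector (p ! i) y. \<psi> h)"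
    if "\<forall>d\<in>sides \<Sigma>. \<phi> d = \<psi> d" "i < n" for i y and \<phi> \<psi> :: "nat \<Rightarrow> bit"
    using that sector_subset(3)[of "p ! i" y] by (intro sum.cong) auto
  have lface: "loop_int d (face_chain T) = 0" for T
  proof -
    define P where "P i = (of_bool (poly (p ! i) \<in> T) :: bit)" for i
    have c: "(\<Sum>h\<in>sector (p ! lo d) (inn (hi d)). face_chain T h) = P (lo d) + P (hi d - 1)"
      using lh CT_D[OF lh(1)] inn_vertex[of "hi d"]
      by (subst sum_sector_face_chain) (auto simp: inn_def P_def)
    have "(\<Sum>i\<in>{lo d<..<hi d}. \<Sum>h\<in>sector (p ! i) (inn i). face_chain T h) = (\<Sum>i\<in>{lo d<..<hi d}. P i + P (i - 1))"
    proof (rule sum.cong)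
      fix i assume i: "i \<in> {lo d<..<hi d}"
      then show "(\<Sum>h\<in>sector (p ! i) (inn i). face_chain T h) = P i + P (i - 1)"
        using lh inn_vertex[of i] by (subst sum_sector_face_chain) (auto simp: inn_def P_def)
    qed simp
    also have "\<dots> = P (lo d) + P (hi d - 1)"
    proof -
      have "(\<Sum>i\<in>{l<..<Suc (l + m)}. P i + P (i - 1)) = P l + P (l + m)" for l m
      proof (induction m)
        case 0
        have "{l<..<Suc l} = {}" by auto
        then show ?case by simp
      next
        case (Suc m)
        have "{l<..<Suc (l + Suc m)} = insert (Suc (l + m)) {l<..<Suc (l + m)}" by auto
        then show ?case using Suc by (simp add: add.assoc add.left_commute)
      qed
      from this[of "lo d" "hi d - Suc (lo d)"] show ?thesis using lh(3) by simp
    qed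
    finally show ?thesis unfolding loop_int_def c by simp
  qed
  have lcong: "loop_int d \<phi> = loop_int d \<psi>" if "\<And>d. d \<in> sides \<Sigma> \<Longrightarrow> \<phi> d = \<psi> d" for \<phi> \<psi>
  proof -
    have "(\<Sum>h\<in>sector (p ! lo d) (inn (hi d)). \<phi> h) = (\<Sum>h\<in>sector (p ! lo d) (inn (hi d)). \<psi> h)"
      using that lh by (intro cong ballI) auto
    moreover have "(\<Sum>i\<in>{lo d<..<hi d}. \<Sum>h\<in>sector (p ! i) (inn i). \<phi> h) = (\<Sum>i\<in>{lo d<..<hi d}. \<Sum>h\<in>sector (p ! i) (inn i). \<psi> h)"
      using that lh by (intro sum.cong[OF refl] cong ballI) auto
    ultimately show ?thesis by (simp add: loop_int_def)
  qed
  have ladd: "loop_int d (\<lambda>h. \<phi> h + \<psi> h) = loop_int d \<phi> + loop_int d \<psi>" for \<phi> \<psi>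
    by (simp add: loop_int_def sum.distrib add.assoc add.left_commute)
  show ?thesis
  proof (rule functionalI)
    fix \<phi> \<psi> :: "nat \<Rightarrow> bit" assume "\<And>d. d \<in> sides \<Sigma> \<Longrightarrow> \<phi> d = \<psi> d"
    then show "loop_int d \<phi> = loop_int d \<psi>" by (rule lcong)
  qed (rule ladd, rule lface)
qed

end

context surf_path
begin

abbreviation "PR \<equiv> \<lambda>e. RL (fst e) (snd e)"

text \<open>Visits that are no crossings contribute nothing, and every other visit is an end of
  exactly one chord.\<close>

lemma sum_visits:
  assumes st: "0 < a" "b \<le> n" "t \<le> n"
  shows "(\<Sum>i\<in>{a..<b}. visit s t i) =
    (\<Sum>e\<in>R. of_bool (a \<le> fst e \<and> fst e < b) * visit s t (fst e) + of_bool (a \<le> snd e \<and> snd e < b) * visit s t (snd e))"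
proof -
  have fin: "finite R" using chords_R by (rule chordsD)
  have inj: "inj_on fst R" "inj_on snd R" using chordsD(3,4)[OF chords_R] by (auto intro!: inj_onI)
  have disj: "fst ` R \<inter> snd ` R = {}" using chordsD(5)[OF chords_R] by fastforce
  define w where "w i = of_bool (a \<le> i \<and> i < b) * visit s t i" for i
  have "(\<Sum>i\<in>{a..<b}. visit s t i) = (\<Sum>i\<in>{a..<b}. w i)" by (intro sum.cong) (auto simp: w_def)
  also have "\<dots> = (\<Sum>i\<in>{a..<b} \<union> (fst ` R \<union> snd ` R). w i)"
    using fin by (intro sum.mono_neutral_left) (auto simp: w_def)
  also have "\<dots> = (\<Sum>i\<in>fst ` R \<union> snd ` R. w i)"
  proof (intro sum.mono_neutral_right ballI)
    fix i assume i: "i \<in> {a..<b} \<union> (fst ` R \<union> snd ` R) - (fst ` R \<union> snd ` R)"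
    have "(i, j) \<notin> CT" for j
    proof
      assume "(i, j) \<in> CT"
      then have "(i, j) \<in> R \<or> (j, i) \<in> R" using R_iff by blast
      then show False using i by force
    qed
    then show "w i = 0" using i visit_noncrossing[of i t s] st by (auto simp: w_def)
  qed (use fin in auto)
  also have "\<dots> = (\<Sum>i\<in>fst ` R. w i) + (\<Sum>i\<in>snd ` R. w i)"
    using fin disj by (intro sum.union_disjoint) auto
  also have "\<dots> = (\<Sum>e\<in>R. w (fst e) + w (snd e))"
    by (simp add: sum.reindex[OF inj(1)] sum.reindex[OF inj(2)] sum.distrib)
  finally show ?thesis by (simp add: w_def)
qed

lemma visit_R:
  assumes "e \<in> R" "t \<le> n"
  shows "visit s t (fst e) = (if PR e then of_bool (s \<le> snd e \<and> snd e < t) else of_bool (s \<le> snd e - 1 \<and> snd e - 1 < t))"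
    "visit s t (snd e) = (if PR e then of_bool (s \<le> fst e - 1 \<and> fst e - 1 < t) else of_bool (s \<le> fst e \<and> fst e < t))"
proof -
  have c: "(fst e, snd e) \<in> CT" "(snd e, fst e) \<in> CT" using assms R_sub CT_sym by auto
  show "visit s t (fst e) = (if PR e then of_bool (s \<le> snd e \<and> snd e < t) else of_bool (s \<le> snd e - 1 \<and> snd e - 1 < t))"
    using visit_crossing[OF c(1) assms(2)] by simp
  show "visit s t (snd e) = (if PR e then of_bool (s \<le> fst e - 1 \<and> fst e - 1 < t) else of_bool (s \<le> fst e \<and> fst e < t))"
    using visit_crossing[OF c(2) assms(2)] RL_swap[OF c(1)] by simp
qed

lemma loop_int_expand:
  assumes d: "d \<in> R" and t: "t \<le> n"
  shows "loop_int d (arc_chain s t) =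
    (if RL (lo d) (hi d) then of_bool (s \<le> hi d \<and> hi d < t) + of_bool (s \<le> lo d - 1 \<and> lo d - 1 < t) else 0) +
    (\<Sum>e\<in>R. of_bool (Suc (lo d) \<le> fst e \<and> fst e < hi d) * visit s t (fst e) +
            of_bool (Suc (lo d) \<le> snd e \<and> snd e < hi d) * visit s t (snd e))"
proof -
  have "{lo d<..<hi d} = {Suc (lo d)..<hi d}" by auto
  then show ?thesis
    unfolding loop_int_def corner_crossing[OF lo_hi_CT(1)[OF d] t] visit_def[symmetric]
    using sum_visits[of "Suc (lo d)" "hi d" t s] lo_hi_CT[OF d] t by simp
qed

lemma ins_strict:
  assumes "d \<in> R"
  shows "ins d x = of_bool (Suc (lo d) \<le> x \<and> x < hi d) + of_bool (x = lo d)"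
  using lo_hi_CT[OF assms] by (auto simp: ins_def)

lemma sum_lo:
  fixes f :: "nat \<Rightarrow> bit"
  assumes d: "d \<in> R"
  shows "(\<Sum>e\<in>R. of_bool (fst e = lo d) * f (snd e) + of_bool (snd e = lo d) * f (fst e)) = f (hi d)"
proof -
  have "(\<Sum>e\<in>R. of_bool (fst e = lo d) * f (snd e) + of_bool (snd e = lo d) * f (fst e)) =
    of_bool (fst d = lo d) * f (snd d) + of_bool (snd d = lo d) * f (fst d)"
  proof (rule sum_delta_endpoint[OF chords_R d])
    fix e assume e: "e \<in> R" "e \<noteq> d"
    have "lo d = fst d \<or> lo d = snd d" by (auto simp: lo_def min_def)
    then have "fst e \<noteq> lo d" "snd e \<noteq> lo d" using chordsD(3-5)[OF chords_R] e d by metis+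
    then show "of_bool (fst e = lo d) * f (snd e) + of_bool (snd e = lo d) * f (fst e) = 0" by simp
  qed
  also have "\<dots> = f (hi d)" using chordsD(2)[OF chords_R d] by (auto simp: lo_def hi_def min_def max_def)
  finally show ?thesis .
qed

text \<open>All edges of the path are in the chain, so each visit inside the loop counts 1, and the
  corner counts 0 or 2. The value makes sense for an arc too, although the chain is then not a
  cycle.\<close>

lemma loop_int_path:
  assumes d: "d \<in> R"
  shows "loop_int d (arc_chain 0 n) = par R d"
proof -
  note lh = lo_hi_CT[OF d]
  have v: "visit 0 n (fst e) = 1" "visit 0 n (snd e) = 1" if "e \<in> R" for e
  proof -
    have "(fst e, snd e) \<in> CT" using that R_sub by auto
    from CT_D[OF this] show "visit 0 n (fst e) = 1" "visit 0 n (snd e) = 1"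
      using visit_R[OF that, of n 0] by auto
  qed
  have "loop_int d (arc_chain 0 n) = 
    (\<Sum>e\<in>R. of_bool (Suc (lo d) \<le> fst e \<and> fst e < hi d) + of_bool (Suc (lo d) \<le> snd e \<and> snd e < hi d))"
    unfolding loop_int_expand[OF d order_refl] using lh v by (auto intro!: sum.cong)
  moreover have "(\<Sum>e\<in>R. of_bool (fst e = lo d) + of_bool (snd e = lo d)) = (1::bit)"
    using sum_lo[OF d, of "\<lambda>_. 1"] by simp
  ultimately show ?thesis
    unfolding par_def ins_strict[OF d] by (simp add: sum.distrib algebra_simps)
qed

text \<open>The origin of the formula for \<open>lk\<close>: the chords met by the loop pushed to
  its left give the sum, and the choice between incoming and outgoing edge, at \<open>c\<close> and
  at the corner of \<open>d\<close>, gives the terms that depend on signs.\<close>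

lemma loop_int_loop:
  assumes c: "c \<in> R" and d: "d \<in> R"
  shows "loop_int d (arc_chain (lo c) (hi c)) = lk R PR c d"
proof -
  note lh = lo_hi_CT[OF d] and lhc = lo_hi_CT[OF c]
  define I where "I x = (of_bool (Suc (lo d) \<le> x \<and> x < hi d) :: bit)" for x
  \<comment> \<open>The edge entering visit \<open>k\<close> has number \<open>k - 1\<close>.
    Compared with the outgoing edge this moves the half-open interval by one, which shows at its two
    ends.\<close>
  have pre: "of_bool (lo c \<le> k - 1 \<and> k - 1 < hi c) = ins c k + of_bool (k = lo c) + of_bool (k = hi c)" if "0 < k" for k
    using that lhc by (cases "k < lo c"; cases "k = lo c"; cases "k < hi c"; cases "k = hi c") (auto simp: ins_def)
  have pos: "0 < fst e" "0 < snd e" if "e \<in> R" for e using that R_sub CT_D[of "fst e" "snd e"] by auto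
  \<comment> \<open>The shift matters only for visits at \<open>lo c\<close> and
    \<open>hi c\<close>, that is, for the chord \<open>c\<close> itself, and leaves one term that
    depends on its sign.\<close>
  have vis: "I (fst e) * visit (lo c) (hi c) (fst e) + I (snd e) * visit (lo c) (hi c) (snd e) =
     I (fst e) * ins c (snd e) + I (snd e) * ins c (fst e) + of_bool (e = c) * I (if PR c then snd c else fst c)"
    if e: "e \<in> R" for e
  proof -
    have "hi c \<le> n" using lhc by simp
    note V = visit_R[OF e this, of "lo c"]
    have own: "of_bool (snd e = lo c) + of_bool (snd e = hi c) = (of_bool (e = c) :: bit)"
      "of_bool (fst e = lo c) + of_bool (fst e = hi c) = (of_bool (e = c) :: bit)"
    proof -
      have "lo c \<in> {fst c, snd c}" "hi c \<in> {fst c, snd c}" "lo c \<noteq> hi c" "fst c \<noteq> snd c"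
        using lhc chordsD(2)[OF chords_R c] by (auto simp: lo_def hi_def min_def max_def)
      moreover have "e \<noteq> c \<Longrightarrow> fst e \<notin> {fst c, snd c} \<and> snd e \<notin> {fst c, snd c}"
        using chordsD(3)[OF chords_R e c] chordsD(4)[OF chords_R e c] chordsD(5)[OF chords_R e c] chordsD(5)[OF chords_R c e]
        by auto
      ultimately show "of_bool (snd e = lo c) + of_bool (snd e = hi c) = (of_bool (e = c) :: bit)"
        "of_bool (fst e = lo c) + of_bool (fst e = hi c) = (of_bool (e = c) :: bit)"
        by (cases "e = c"; auto)+
    qed
    show ?thesis
    proof (cases "PR e")
      case True
      have "visit (lo c) (hi c) (fst e) = ins c (snd e)" unfolding V(1) if_P[OF True] ins_def ..
      moreover have "visit (lo c) (hi c) (snd e) = ins c (fst e) + of_bool (e = c)"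
        unfolding V(2) if_P[OF True] pre[OF pos(1)[OF e]] add.assoc own ..
      ultimately show ?thesis using True by (cases "e = c") (simp_all add: distrib_left add.assoc)
    next
      case False
      have "visit (lo c) (hi c) (snd e) = ins c (fst e)" unfolding V(2) if_not_P[OF False] ins_def ..
      moreover have "visit (lo c) (hi c) (fst e) = ins c (snd e) + of_bool (e = c)"
        unfolding V(1) if_not_P[OF False] pre[OF pos(2)[OF e]] add.assoc own ..
      ultimately show ?thesis using False by (cases "e = c") (simp_all add: distrib_left add.assoc add.left_commute add.commute)
    qed
  qed
  define K where "K = (if PR c then snd c else fst c)"
  define S where "S = (\<Sum>e\<in>R. ins c (fst e) * ins d (snd e) + ins c (snd e) * ins d (fst e))"
  have Ii: "I x = ins d x + of_bool (x = lo d)" for x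
    unfolding I_def ins_strict[OF d] by (simp add: add.assoc)
  have "(\<Sum>e\<in>R. I (fst e) * visit (lo c) (hi c) (fst e) + I (snd e) * visit (lo c) (hi c) (snd e)) =
    (\<Sum>e\<in>R. I (fst e) * ins c (snd e) + I (snd e) * ins c (fst e) + of_bool (e = c) * I K)"
    by (rule sum.cong[OF refl]) (unfold K_def, rule vis)
  also have "\<dots> = (\<Sum>e\<in>R. I (fst e) * ins c (snd e) + I (snd e) * ins c (fst e)) + (\<Sum>e\<in>R. of_bool (e = c) * I K)"
    by (rule sum.distrib)
  also have "(\<Sum>e\<in>R. of_bool (e = c) * I K) = of_bool (c = c) * I K"
    by (rule sum_delta_endpoint[OF chords_R c]) simp
  also have "(\<Sum>e\<in>R. I (fst e) * ins c (snd e) + I (snd e) * ins c (fst e)) =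
    (\<Sum>e\<in>R. (ins c (fst e) * ins d (snd e) + ins c (snd e) * ins d (fst e)) +
       (of_bool (fst e = lo d) * ins c (snd e) + of_bool (snd e = lo d) * ins c (fst e)))"
    by (rule sum.cong[OF refl]) (simp only: Ii distrib_right distrib_left mult.commute add.assoc add.left_commute add.commute)
  also have "\<dots> = S + (\<Sum>e\<in>R. of_bool (fst e = lo d) * ins c (snd e) + of_bool (snd e = lo d) * ins c (fst e))"
    unfolding S_def by (rule sum.distrib)
  also have "(\<Sum>e\<in>R. of_bool (fst e = lo d) * ins c (snd e) + of_bool (snd e = lo d) * ins c (fst e)) = ins c (hi d)"
    by (rule sum_lo[OF d])
  finally have V: "(\<Sum>e\<in>R. I (fst e) * visit (lo c) (hi c) (fst e) + I (snd e) * visit (lo c) (hi c) (snd e)) =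
    S + ins c (hi d) + (ins d K + of_bool (K = lo d))" unfolding Ii by simp
  have A: "loop_int d (arc_chain (lo c) (hi c)) =
    (if RL (lo d) (hi d) then ins c (hi d) + (ins c (lo d) + of_bool (lo d = lo c) + of_bool (lo d = hi c)) else 0) +
    (S + ins c (hi d) + (ins d K + of_bool (K = lo d)))"
    unfolding loop_int_expand[OF d less_imp_le[OF lhc(4)]] I_def[symmetric] V pre[OF lh(2)]
    unfolding ins_def[symmetric] ..
  have lkS: "lk R PR c d = S + ins d K + ins c (if PR d then fst d else snd d) + of_bool (c = d)"
    unfolding lk_def S_def K_def ..
  have ct: "(fst d, snd d) \<in> CT" using d R_sub by auto
  have ld: "lo d = fst d \<and> hi d = snd d \<and> RL (lo d) (hi d) = PR d \<or> lo d = snd d \<and> hi d = fst d \<and> RL (lo d) (hi d) = (\<not> PR d)"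
    using RL_swap[OF ct] by (cases "fst d < snd d") (simp_all add: lo_def hi_def)
  have insd: "ins d (lo d) = 1" "ins d (hi d) = 0" "lo d \<noteq> hi d" using lh by (simp_all add: ins_def)
  show ?thesis
  proof (cases "c = d")
    case True
    have Kd: "K = (if PR d then snd d else fst d)" unfolding K_def True ..
    show ?thesis unfolding A lkS unfolding Kd True
      using ld insd by (cases "PR d"; elim disjE conjE) simp_all
  next
    case False
    have n: "fst c \<noteq> fst d" "snd c \<noteq> snd d" "fst c \<noteq> snd d" "snd c \<noteq> fst d"
      using chordsD(3)[OF chords_R c d] chordsD(4)[OF chords_R c d] chordsD(5)[OF chords_R c d] chordsD(5)[OF chords_R d c] False
      by auto
    have ne: "lo d \<noteq> lo c" "lo d \<noteq> hi c" "K \<noteq> lo d"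
      unfolding lo_def hi_def min_def max_def K_def using n n[symmetric] by (auto split: if_splits)
    show ?thesis unfolding A lkS
      using ld ne False by (cases "PR d"; elim disjE conjE) (simp_all add: add.assoc add.left_commute)
  qed
qed

lemma bd_loop:
  assumes "c \<in> R" "v \<in> vertices \<Sigma>"
  shows "bd (arc_chain (lo c) (hi c)) v = 0"
proof -
  note lh = lo_hi_CT[OF assms(1)]
  have "vx (gl (p ! (hi c - 1))) = vx (p ! lo c)" 
    using p_step[of "hi c - 1"] lh CT_D[OF lh(1)] by simp
  then show ?thesis using bd_arc_chain[of "lo c" "hi c" v] lh assms(2) by simp
qed

section \<open>Obstructions in genus zero and one\<close>

text \<open>If \<open>lk\<close> were odd, the loop of \<open>c\<close> would be a cycle detected by
  the functional of \<open>d\<close>, and one essential cycle already exceeds the bound for genus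
  0.\<close>

theorem genus_zero_lk:
  assumes g: "has_genus \<Sigma> 0" and c: "c \<in> R" and d: "d \<in> R"
  shows "lk R PR c d = 0"
proof (rule ccontr)
  assume "lk R PR c d \<noteq> 0"
  then have "1 \<le> 2 * (0::nat)"
    using lo_hi_CT[OF c] bd_loop[OF c] loop_int_loop[OF c d] functional_loop_int[OF d]
    by (intro genus_bound[where k = 1 and z = "\<lambda>_. arc_chain (lo c) (hi c)", OF g] sym_arc_chain)
       (auto simp: subset_singleton_iff lessThan_Suc intro!: exI[of _ "loop_int d"])
  then show False by simp
qed

lemma bd_path:
  assumes "final_vertex \<Sigma> (last p) = initial_vertex \<Sigma> (hd p)" "v \<in> vertices \<Sigma>"
  shows "bd (arc_chain 0 n) v = 0"
  using bd_arc_chain[OF nonempty order_refl assms(2)] assms(1) nonempty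
  by (simp add: hd_conv_nth last_conv_nth final_vertex_def)

text \<open>As for loops, but with the whole curve as the cycle; this is where the curve has to be
  closed.\<close>

theorem genus_zero_par:
  assumes g: "has_genus \<Sigma> 0" and cl: "final_vertex \<Sigma> (last p) = initial_vertex \<Sigma> (hd p)" and d: "d \<in> R"
  shows "par R d = 0"
proof (rule ccontr)
  assume "par R d \<noteq> 0"
  then have "1 \<le> 2 * (0::nat)"
    using bd_path[OF cl] loop_int_path[OF d] functional_loop_int[OF d]
    by (intro genus_bound[where k = 1 and z = "\<lambda>_. arc_chain 0 n", OF g] sym_arc_chain)
       (auto simp: subset_singleton_iff lessThan_Suc intro!: exI[of _ "loop_int d"])
  then show False by simp
qed

text \<open>On a torus the class of the curve and two classes with odd intersection number are dependent.\<close>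

theorem genus_one_lk:
  assumes g: "has_genus \<Sigma> g" "g \<le> 1" and cl: "final_vertex \<Sigma> (last p) = initial_vertex \<Sigma> (hd p)"
    and S: "S \<subseteq> R" and T: "T \<subseteq> R" and ST: "(\<Sum>c\<in>S. \<Sum>d\<in>T. lk R PR c d) = 1"
    and b: "b \<in> R" "par R b = 1" and bS: "(\<Sum>d\<in>S. lk R PR b d) = 0" and bT: "(\<Sum>d\<in>T. lk R PR b d) = 0"
  shows False
proof -
  have fin: "finite S" "finite T" using S T chordsD(1)[OF chords_R] finite_subset by auto
  note comm = lk_commute[OF chords_R] and self = lk_self[OF chords_R]
  define cyc where "cyc U h = (\<Sum>c\<in>U. arc_chain (lo c) (hi c) h)" for U h
  \<comment> \<open>The curve and the total loops of \<open>S\<close> and \<open>T\<close>, to be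
    shown independent.\<close>
  define z where "z j = (if j = 0 then arc_chain 0 n else if j = 1 then cyc S else cyc T)" for j :: nat
  define \<Lambda> where "\<Lambda> U \<phi> = (\<Sum>d\<in>U. loop_int d \<phi>)" for U \<phi>
  have fL: "functional (\<Lambda> U)" if "U \<subseteq> R" for U
    unfolding \<Lambda>_def[abs_def] by (rule functional_sum_functionals, rule functional_loop_int) (use that in blast)
  have val: "loop_int d (cyc U) = (\<Sum>c\<in>U. lk R PR d c)" if "U \<subseteq> R" "finite U" "d \<in> R" for d U
  proof -
    have "loop_int d (cyc U) = (\<Sum>c\<in>U. loop_int d (arc_chain (lo c) (hi c)))"
      unfolding cyc_def using functional_sum[OF functional_loop_int[OF that(3)] that(2)] .
    also have "\<dots> = (\<Sum>c\<in>U. lk R PR d c)"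
    proof (rule sum.cong[OF refl])
      fix c assume "c \<in> U"
      then have "c \<in> R" using that(1) by blast
      then show "loop_int d (arc_chain (lo c) (hi c)) = lk R PR d c"
        using loop_int_loop[OF _ that(3), of c] comm[OF _ that(3), of c PR] by simp
    qed
    finally show ?thesis .
  qed
  have valU: "\<Lambda> V (cyc U) = (\<Sum>d\<in>V. \<Sum>c\<in>U. lk R PR d c)" if "U \<subseteq> R" "finite U" "V \<subseteq> R" for U V
    unfolding \<Lambda>_def by (rule sum.cong[OF refl], rule val[OF that(1,2)]) (use that(3) in blast)
  have TS: "(\<Sum>d\<in>T. \<Sum>c\<in>S. lk R PR d c) = 1"
  proof -
    have "(\<Sum>d\<in>T. \<Sum>c\<in>S. lk R PR d c) = (\<Sum>c\<in>S. \<Sum>d\<in>T. lk R PR d c)" by (rule sum.swap)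
    also have "\<dots> = (\<Sum>c\<in>S. \<Sum>d\<in>T. lk R PR c d)" 
      by (rule sum.cong[OF refl], rule sum.cong[OF refl], rule comm) (use S T in blast)+
    finally show ?thesis using ST by simp
  qed
  have TT: "(\<Sum>d\<in>T. \<Sum>c\<in>T. lk R PR d c) = 0"
  proof (rule sum_alternating[OF fin(2)])
    fix x y assume "x \<in> T" "y \<in> T"
    then show "lk R PR x y = lk R PR y x" using T by (intro comm) blast+
  next
    fix x assume "x \<in> T"
    then show "lk R PR x x = 0" using T by (intro self) blast
  qed
  have "3 \<le> 2 * g"
  proof (rule genus_bound[where k = 3 and z = z, OF g(1)])
    have "sym (arc_chain (lo c) (hi c))" if "c \<in> R" for c
      by (rule sym_arc_chain) (use lo_hi_CT(4)[OF that] in simp)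
    then have symU: "sym (cyc U)" if "U \<subseteq> R" for U
      unfolding cyc_def[abs_def] by (rule sym_sum) (use that in blast)
    show "sym (z j)" for j
      unfolding z_def using symU[OF S] symU[OF T] sym_arc_chain[OF order_refl] by simp
    have bdU: "bd (cyc U) v = 0" if "U \<subseteq> R" "v \<in> vertices \<Sigma>" for U v
      unfolding cyc_def[abs_def] bd_sum by (rule sum.neutral, rule ballI, rule bd_loop[OF _ that(2)]) (use that(1) in blast)
    show "bd (z j) v = 0" if "v \<in> vertices \<Sigma>" for j v
      unfolding z_def using bdU[OF S that] bdU[OF T that] bd_path[OF cl that] by simp
    fix X :: "nat set" assume X: "X \<subseteq> {..<3}" "X \<noteq> {}"
    have "X \<in> Pow {0, 1, 2}" using X(1) by (auto simp: lessThan_def)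
    then consider "0 \<in> X" | "X = {1}" | "X = {2}" | "X = {1, 2}" using X(2) by (auto simp: Pow_insert)
    \<comment> \<open>The loop of \<open>b\<close> meets the curve oddly and the other two cycles
      evenly, so it detects every combination that contains the curve. Among the two totals,
      \<open>ST\<close> gives odd intersection, and \<open>TT\<close> lets
      \<open>\<Lambda> T\<close> detect their sum as well.\<close>
    then show "\<exists>\<Lambda>. functional \<Lambda> \<and> (\<Sum>j\<in>X. \<Lambda> (z j)) \<noteq> 0"
    proof cases
      case 1
      have z: "loop_int b (z 0) = 1" "loop_int b (z (Suc j)) = 0" for j
        using loop_int_path[OF b(1)] b(2) val[OF S fin(1) b(1)] val[OF T fin(2) b(1)] bS bT by (auto simp: z_def)
      have "finite X" using X(1) finite_subset by blast
      then have "(\<Sum>j\<in>X. loop_int b (z j)) = loop_int b (z 0)"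
        using 1 z(2) by (intro sum_sector_single) (auto simp: gr0_conv_Suc)
      then show ?thesis using functional_loop_int[OF b(1)] z(1) by (intro exI[of _ "loop_int b"]) simp
    next
      case 2
      then show ?thesis using fL[OF T] valU[OF S fin(1) T] TS by (intro exI[of _ "\<Lambda> T"]) (simp add: z_def)
    next
      case 3
      then show ?thesis using fL[OF S] valU[OF T fin(2) S] ST by (intro exI[of _ "\<Lambda> S"]) (simp add: z_def)
    next
      case 4
      then show ?thesis using fL[OF T] valU[OF S fin(1) T] valU[OF T fin(2) T] TS TT
        by (intro exI[of _ "\<Lambda> T"]) (simp add: z_def)
    qed
  qed
  then show False using g(2) by simp
qed

end

section \<open>Surfaces from Gauss codes\<close>

lemma permutes_of_bij: "bij f \<Longrightarrow> (\<And>x. x \<notin> S \<Longrightarrow> f x = x) \<Longrightarrow> f permutes S"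
  unfolding permutes_def bij_iff by blast

lemma orbit_funpow3:
  assumes "f (f (f x)) = x"
  shows "orbit f x = {x, f x, f (f x)}"
proof
  show "orbit f x \<subseteq> {x, f x, f (f x)}"
  proof
    fix y assume "y \<in> orbit f x"
    then show "y \<in> {x, f x, f (f x)}"
      by (induction rule: orbit.induct) (use assms in auto)
  qed
  have "f x \<in> orbit f x" "f (f x) \<in> orbit f x" "f (f (f x)) \<in> orbit f x"
    by (intro orbit.intros)+
  then show "{x, f x, f (f x)} \<subseteq> orbit f x" using assms by simp
qed

lemma orbit_funpow4:
  assumes "f (f (f (f x))) = x"
  shows "orbit f x = {x, f x, f (f x), f (f (f x))}"
proof
  show "orbit f x \<subseteq> {x, f x, f (f x), f (f (f x))}"
  proof
    fix y assume "y \<in> orbit f x"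
    then show "y \<in> {x, f x, f (f x), f (f (f x))}"
      by (induction rule: orbit.induct) (use assms in auto)
  qed
  have "f x \<in> orbit f x" "f (f x) \<in> orbit f x" "f (f (f x)) \<in> orbit f x" "f (f (f (f x))) \<in> orbit f x"
    by (intro orbit.intros)+
  then show "{x, f x, f (f x), f (f (f x))} \<subseteq> orbit f x" using assms by simp
qed

text \<open>
  The visits \<open>1, \<dots>, m\<close> of a Gauss code are paired by \<open>\<mu>\<close>; \<open>\<rho> i\<close> says that the visit \<open>\<mu> i\<close> crosses the
  visit \<open>i\<close> from right to left, and \<open>ov i\<close> that visit \<open>i\<close> is the upper one. The sides \<open>2 i\<close> and \<open>2 i + 1\<close>
  are the edge of the curve from visit \<open>i\<close> to visit \<open>i + 1\<close> and its reverse. If \<open>holed\<close>, two loops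
  are attached at the ends of the path, which bound the holes.
\<close>

locale code =
  fixes m :: nat and \<mu> :: "nat \<Rightarrow> nat" and \<rho> ov :: "nat \<Rightarrow> bool" and holed :: bool
  assumes mate: "i \<in> {1..m} \<Longrightarrow> \<mu> i \<in> {1..m}" "i \<in> {1..m} \<Longrightarrow> \<mu> (\<mu> i) = i"
    "i \<in> {1..m} \<Longrightarrow> \<rho> (\<mu> i) \<longleftrightarrow> \<not> \<rho> i" "i \<in> {1..m} \<Longrightarrow> ov (\<mu> i) \<longleftrightarrow> \<not> ov i"
begin

definition num :: nat where "num = 2 * m + (if holed then 6 else 2)"

definition flip :: "nat \<Rightarrow> nat" where
  "flip x = (if x < num then if even x then x + 1 else x - 1 else x)"

text \<open>The counterclockwise rotation at every vertex. At a crossing the sides of the two visits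
  alternate and \<open>\<rho>\<close> gives the direction. At an end of a holed path the two sides
  of the extra loop are consecutive, so that \<open>2 * m + 2\<close> and \<open>2 * m + 4\<close>
  bound monogons.\<close>

definition rot :: "nat \<Rightarrow> nat" where
  "rot x = (if 1 \<le> x \<and> x \<le> 2 * m then
       if even x = \<rho> ((x + 1) div 2) then 2 * \<mu> ((x + 1) div 2) else 2 * \<mu> ((x + 1) div 2) - 1
     else if holed then
       if x = 0 then 2 * m + 2 else if x = 2 * m + 1 then 2 * m + 4 else if x = 2 * m + 2 then 2 * m + 3
       else if x = 2 * m + 3 then 0 else if x = 2 * m + 4 then 2 * m + 5 else if x = 2 * m + 5 then 2 * m + 1
       else x
     else if x = 0 then 2 * m + 1 else if x = 2 * m + 1 then 0 else x)"

lemma rot_visit: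
  assumes "i \<in> {1..m}"
  shows "rot (2 * i) = (if \<rho> i then 2 * \<mu> i else 2 * \<mu> i - 1)"
    "rot (2 * i - 1) = (if \<rho> i then 2 * \<mu> i - 1 else 2 * \<mu> i)"
proof -
  have d: "(2 * i + 1) div 2 = i" "(2 * i - 1 + 1) div 2 = i" and e: "even (2 * i - 1) \<longleftrightarrow> False"
    and r: "1 \<le> 2 * i \<and> 2 * i \<le> 2 * m" "1 \<le> 2 * i - 1 \<and> 2 * i - 1 \<le> 2 * m" using assms by auto
  show "rot (2 * i) = (if \<rho> i then 2 * \<mu> i else 2 * \<mu> i - 1)"
    unfolding rot_def if_P[OF r(1)] d(1) by simp
  show "rot (2 * i - 1) = (if \<rho> i then 2 * \<mu> i - 1 else 2 * \<mu> i)"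
    unfolding rot_def if_P[OF r(2)] d(2) e by simp
qed

lemma rot_holed:
  assumes holed
  shows "rot 0 = 2 * m + 2" "rot (2 * m + 1) = 2 * m + 4" "rot (2 * m + 2) = 2 * m + 3" "rot (2 * m + 3) = 0"
    "rot (2 * m + 4) = 2 * m + 5" "rot (2 * m + 5) = 2 * m + 1"
  using assms unfolding rot_def by simp_all

lemma rot_closed:
  assumes "\<not> holed"
  shows "rot 0 = 2 * m + 1" "rot (2 * m + 1) = 0"
  using assms unfolding rot_def by simp_all

lemma rot_rot_visit:
  assumes "i \<in> {1..m}"
  shows "rot (rot (2 * i)) = 2 * i - 1" "rot (rot (2 * i - 1)) = 2 * i"
  using rot_visit[OF assms] rot_visit[OF mate(1)[OF assms]] mate(2,3)[OF assms] by auto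

lemma visit_cases:
  assumes "1 \<le> x" "x \<le> 2 * m"
  obtains i where "i \<in> {1..m}" "x = 2 * i" | i where "i \<in> {1..m}" "x = 2 * i - 1"
proof -
  have "x = 2 * (x div 2) \<and> x div 2 \<in> {1..m} \<or> x = 2 * (x div 2 + 1) - 1 \<and> x div 2 + 1 \<in> {1..m}"
    using assms by (auto; presburger)
  then show ?thesis using that by blast
qed

text \<open>12 is a common multiple of the orbit lengths 4, 3, 2 and 1. It is used to exhibit
  \<open>rot ^^ 11\<close> as the inverse of \<open>rot\<close>.\<close>

lemma rot_period: "(rot ^^ 12) x = x"
proof (cases "1 \<le> x \<and> x \<le> 2 * m")
  case True
  have four: "rot (rot (rot (rot y))) = y" if y: "1 \<le> y" "y \<le> 2 * m" for y
    using y
  proof (rule visit_cases)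
    fix i assume i: "i \<in> {1..m}" "y = 2 * i"
    show ?thesis unfolding i(2) rot_rot_visit[OF i(1)] ..
  next
    fix i assume i: "i \<in> {1..m}" "y = 2 * i - 1"
    show ?thesis unfolding i(2) rot_rot_visit[OF i(1)] ..
  qed
  show ?thesis using four True by (simp add: numeral_eq_Suc)
next
  case False
  have e: "(rot ^^ 12) y = rot (rot (rot (rot (rot (rot (rot (rot (rot (rot (rot (rot y)))))))))))" for y
    by (simp add: numeral_eq_Suc)
  show ?thesis
  proof (cases holed)
    case True
    have "x = 0 \<or> x = 2 * m + 1 \<or> x = 2 * m + 2 \<or> x = 2 * m + 3 \<or> x = 2 * m + 4 \<or> x = 2 * m + 5 \<or> rot x = x"
      unfolding rot_def if_not_P[OF False] if_P[OF True] by auto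
    then show ?thesis unfolding e by (elim disjE) (simp_all only: rot_holed[OF True])
  next
    case closed: False
    have "x = 0 \<or> x = 2 * m + 1 \<or> rot x = x"
      unfolding rot_def if_not_P[OF False] if_not_P[OF closed] by auto
    then show ?thesis unfolding e by (elim disjE) (simp_all only: rot_closed[OF closed])
  qed
qed

lemma bij_rot: "bij rot"
proof (rule bijI)
  show "inj rot"
  proof (rule injI)
    fix x y assume "rot x = rot y"
    then have "(rot ^^ 11) (rot x) = (rot ^^ 11) (rot y)" by simp
    moreover have "(rot ^^ 12) z = (rot ^^ 11) (rot z)" for z
      using funpow_Suc_right[of 11 rot] by (simp add: fun_eq_iff)
    ultimately show "x = y" using rot_period by metis
  qed
  show "surj rot"
  proof (rule surjI)
    fix x
    show "rot ((rot ^^ 11) x) = x" using rot_period[of x] funpow.simps(2)[of 11 rot] by (simp add: fun_eq_iff)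
  qed
qed

lemma rot_permutes: "rot permutes {..<num}"
proof (rule permutes_of_bij[OF bij_rot])
  fix x assume "x \<notin> {..<num}"
  then have "2 * m + 2 \<le> x" "holed \<longrightarrow> 2 * m + 6 \<le> x" unfolding num_def by (auto split: if_splits)
  then show "rot x = x" unfolding rot_def by auto
qed

lemma flip_flip: "flip (flip x) = x"
  unfolding flip_def num_def by (auto elim!: oddE evenE; arith)

lemma flip_permutes: "flip permutes {..<num}"
proof (rule permutes_of_bij)
  show "bij flip" by (rule o_bij[of flip flip]) (simp_all add: fun_eq_iff flip_flip)
qed (simp add: flip_def)

lemma flip_neq: "x < num \<Longrightarrow> flip x \<noteq> x"
  by (auto simp: flip_def elim: oddE)

text \<open>A rotation at the vertices together with the pairing of sides determines the polygons;
  \<open>follow\<close> is what makes \<open>turn\<close> equal to \<open>rot\<close>.\<close>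

definition surface_of :: surface where
  "surface_of = \<lparr>sides = {..<num}, follow = inv rot \<circ> flip, glue = flip\<rparr>"

lemma surface_of_simps [simp]: "sides surface_of = {..<num}" "glue surface_of = flip"
    "follow surface_of = inv rot \<circ> flip"
  by (simp_all add: surface_of_def)

lemma turn_surface_of: "turn surface_of = rot"
proof
  fix d
  have "(inv rot \<circ> flip) (flip (rot d)) = d" using bij_rot flip_flip by (simp add: bij_is_inj)
  moreover have "inj (inv rot \<circ> flip)"
    by (rule inj_compose[OF bij_is_inj[OF bij_imp_bij_inv[OF bij_rot]] permutes_inj[OF flip_permutes]])
  ultimately have "inv (inv rot \<circ> flip) d = flip (rot d)" by (metis inv_f_eq)
  then show "turn surface_of d = rot d" by (simp add: turn_def flip_flip)
qed

lemma num_pos: "0 < num" by (simp add: num_def)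

text \<open>For connectedness, the set of reachable sides is finite and mapped injectively into
  itself by \<open>follow\<close>, so it is closed under the inverse and under \<open>rot\<close>
  too. Consecutive sides of the path are then linked by \<open>flip\<close> or by two rotations at a
  crossing.\<close>

lemma closed_surface_surface_of: "closed_surface surface_of"
proof -
  let ?r = "{(x, follow surface_of x) | x. x \<in> sides surface_of} \<union> {(x, glue surface_of x) | x. x \<in> sides surface_of}"
  have f: "follow surface_of permutes {..<num}"
    using permutes_compose[OF flip_permutes permutes_inv[OF rot_permutes]] by simp
  have conn: "(d, e) \<in> ?r\<^sup>*" if d: "d < num" and e: "e < num" for d e
  proof -
    define C where "C = {x. (d, x) \<in> ?r\<^sup>* \<and> x < num}"
    have Cf: "x \<in> C \<Longrightarrow> follow surface_of x \<in> C" for x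
      using permutes_in_image[OF f, of x] unfolding C_def by (auto intro: rtrancl_into_rtrancl)
    have Cg: "x \<in> C \<Longrightarrow> flip x \<in> C" for x
      using permutes_in_image[OF flip_permutes, of x] unfolding C_def by (auto intro: rtrancl_into_rtrancl)
    have "finite C" unfolding C_def by simp
    moreover have "follow surface_of ` C \<subseteq> C" using Cf by blast
    moreover have "inj_on (follow surface_of) C" using permutes_inj[OF f] by (rule inj_on_subset) simp
    ultimately have eq: "follow surface_of ` C = C" by (rule endo_inj_surj)
    have Cr: "rot x \<in> C" if "x \<in> C" for x
    proof -
      obtain y where y: "y \<in> C" "x = follow surface_of y" using eq \<open>x \<in> C\<close> by blast
      have "rot x = flip y" using y(2) bij_rot by (simp add: surj_f_inv_f bij_is_surj)
      then show ?thesis using Cg[OF y(1)] by simp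
    qed
    have step: "Suc x \<in> C \<longleftrightarrow> x \<in> C" if x: "x \<le> 2 * m" for x
    proof (cases "even x")
      case True
      then have "flip x = Suc x" "flip (Suc x) = x" using x by (auto simp: flip_def num_def)
      then show ?thesis using Cg by metis
    next
      case False
      then have "Suc x div 2 \<in> {1..m}" "2 * (Suc x div 2) = Suc x" "2 * (Suc x div 2) - 1 = x"
        using x by (auto elim!: oddE)
      then have "rot (rot (Suc x)) = x" "rot (rot x) = Suc x" using rot_rot_visit by metis+
      then show ?thesis using Cr by metis
    qed
    have low: "x \<in> C \<longleftrightarrow> 0 \<in> C" if "x \<le> 2 * m + 1" for x
      using that by (induction x) (auto simp: step)
    have all: "x \<in> C \<longleftrightarrow> 0 \<in> C" if x: "x < num" for x
    proof (cases "x \<le> 2 * m + 1")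
      case False
      then have h: "holed" and xs: "x \<in> {2 * m + 2, 2 * m + 3, 2 * m + 4, 2 * m + 5}"
        using x unfolding num_def by (auto split: if_splits)
      note r = rot_holed[OF h]
      have "2 * m + 2 \<in> C \<longleftrightarrow> 0 \<in> C" "2 * m + 3 \<in> C \<longleftrightarrow> 0 \<in> C"
         "2 * m + 4 \<in> C \<longleftrightarrow> 2 * m + 1 \<in> C" "2 * m + 5 \<in> C \<longleftrightarrow> 2 * m + 1 \<in> C"
        using Cr[of 0] Cr[of "2 * m + 1"] Cr[of "2 * m + 2"] Cr[of "2 * m + 3"] Cr[of "2 * m + 4"] Cr[of "2 * m + 5"]
        unfolding r by blast+
      then show ?thesis using low[of "2 * m + 1"] xs by auto
    qed (rule low)
    have "d \<in> C" using d by (simp add: C_def)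
    then have "e \<in> C" using all[OF d] all[OF e] by simp
    then show ?thesis by (simp add: C_def)
  qed
  show ?thesis unfolding closed_surface_def
    using f flip_permutes num_pos flip_flip flip_neq conn by auto
qed

sublocale surf surface_of
  using closed_surface_surface_of by unfold_locales

lemma vertex_visit:
  assumes i: "i \<in> {1..m}"
  shows "vx (2 * i) = {2 * i, 2 * i - 1, 2 * \<mu> i, 2 * \<mu> i - 1}" "card (vx (2 * i)) = 4"
proof -
  have "rot (rot (rot (rot (2 * i)))) = 2 * i" unfolding rot_rot_visit[OF i] ..
  then have "vx (2 * i) = {2 * i, rot (2 * i), 2 * i - 1, rot (2 * i - 1)}"
    unfolding initial_vertex_def turn_surface_of by (subst orbit_funpow4) (simp_all add: rot_rot_visit[OF i])
  then show *: "vx (2 * i) = {2 * i, 2 * i - 1, 2 * \<mu> i, 2 * \<mu> i - 1}"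
    using rot_visit[OF i] by auto
  have "\<mu> i \<noteq> i" "1 \<le> \<mu> i" using mate[OF i] by auto
  then have "distinct [2 * i, 2 * i - 1, 2 * \<mu> i, 2 * \<mu> i - 1]" using i by (auto; presburger)
  from distinct_card[OF this] show "card (vx (2 * i)) = 4" unfolding * by simp
qed

lemma vertex_start: "vx 0 = (if holed then {0, 2 * m + 2, 2 * m + 3} else {0, 2 * m + 1})"
proof (cases holed)
  case True
  show ?thesis unfolding if_P[OF True] initial_vertex_def turn_surface_of
    by (subst orbit_funpow3) (simp_all only: rot_holed[OF True])
next
  case False
  have "orbit rot 0 = {0, 2 * m + 1, 0, 2 * m + 1}"
    by (subst orbit_funpow4) (simp_all only: rot_closed[OF False])
  then show ?thesis unfolding if_not_P[OF False] initial_vertex_def turn_surface_of by auto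
qed

lemma vertex_end: "vx (2 * m + 1) = (if holed then {2 * m + 1, 2 * m + 4, 2 * m + 5} else {0, 2 * m + 1})"
proof (cases holed)
  case True
  show ?thesis unfolding if_P[OF True] initial_vertex_def turn_surface_of
    by (subst orbit_funpow3) (simp_all only: rot_holed[OF True])
next
  case False
  have "orbit rot (2 * m + 1) = {2 * m + 1, 0, 2 * m + 1, 0}"
    by (subst orbit_funpow4) (simp_all only: rot_closed[OF False])
  then show ?thesis unfolding if_not_P[OF False] initial_vertex_def turn_surface_of by auto
qed

text \<open>The map \<open>flip (rot y)\<close> goes to the preceding side of the same polygon, so
  an invariant label is constant on polygons. A lower bound for their number is obtained without
  tracing a single one.\<close>

lemma card_faces: "card (F ` sides surface_of) \<le> card (polygons surface_of)"
  if F: "\<And>y. y < num \<Longrightarrow> F (flip (rot y)) = F y"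
proof -
  have inv: "F (fo x) = F x" if "x < num" for x
  proof -
    have "rot (fo x) = flip x" using bij_rot by (simp add: surj_f_inv_f bij_is_surj)
    moreover have "fo x < num" using side_closed(1)[of x] that by simp
    ultimately show ?thesis using F[of "fo x"] flip_flip by simp
  qed
  have orb: "y < num \<and> F y = F x" if "x < num" "y \<in> orbit fo x" for x y
    using that(2)
  proof (induction rule: orbit.induct)
    case base
    then show ?case using inv[OF that(1)] side_closed(1)[of x] that(1) by simp
  next
    case (step y)
    then show ?case using inv[of y] side_closed(1)[of y] by simp
  qed
  have "F ` sides surface_of \<subseteq> (\<lambda>P. F (SOME y. y \<in> P)) ` polygons surface_of"
  proof
    fix a assume "a \<in> F ` sides surface_of"
    then obtain x where x: "x < num" "a = F x" by auto
    have "fo x \<in> orbit fo x" by (rule orbit.base)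
    then have "(SOME y. y \<in> orbit fo x) \<in> orbit fo x" by (rule someI[of "\<lambda>y. y \<in> orbit fo x"])
    from orb[OF x(1) this] have "a = F (SOME y. y \<in> orbit fo x)" using x(2) by simp
    then show "a \<in> (\<lambda>P. F (SOME y. y \<in> P)) ` polygons surface_of"
      using x(1) by (auto simp: polygons_def)
  qed
  moreover have "finite (polygons surface_of)" by (simp add: polygons_def)
  ultimately show ?thesis by (rule surj_card_le[rotated])
qed

lemma card_edges: "card (edges surface_of) = m + (if holed then 3 else 1)"
proof -
  define k where "k = m + (if holed then 3 else 1)"
  have k: "num = 2 * k" by (simp add: num_def k_def)
  have "edges surface_of = (\<lambda>i. {2 * i, 2 * i + 1}) ` {..<k}"
  proof
    show "edges surface_of \<subseteq> (\<lambda>i. {2 * i, 2 * i + 1}) ` {..<k}"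
    proof
      fix a assume "a \<in> edges surface_of"
      then obtain x where x: "x < 2 * k" "a = {x, flip x}" using k by (auto simp: edges_def)
      then have "x div 2 < k" "a = {2 * (x div 2), 2 * (x div 2) + 1}"
        by (auto simp: flip_def k elim!: evenE oddE)
      then show "a \<in> (\<lambda>i. {2 * i, 2 * i + 1}) ` {..<k}" by blast
    qed
    have "{2 * i, 2 * i + 1} = {2 * i, flip (2 * i)}" "2 * i < num" if "i < k" for i
      using that by (auto simp: flip_def k)
    then show "(\<lambda>i. {2 * i, 2 * i + 1}) ` {..<k} \<subseteq> edges surface_of"
      unfolding edges_def by auto
  qed
  moreover have "inj_on (\<lambda>i. {2 * i, 2 * i + 1}) {..<k}"
    by (rule inj_onI) (auto simp: doubleton_eq_iff; presburger)
  ultimately show ?thesis by (simp add: card_image k_def)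
qed

lemma card_half: "2 * card {i \<in> {1..m}. \<rho> i} = m"
proof -
  let ?U = "{i \<in> {1..m}. \<rho> i}" and ?V = "{i \<in> {1..m}. \<not> \<rho> i}"
  have "bij_betw \<mu> ?U ?V"
    by (rule bij_betwI[where g = \<mu>]) (use mate in auto)
  then have "card ?V = card ?U" using bij_betw_same_card by metis
  moreover have "card (?U \<union> ?V) = card ?U + card ?V" by (intro card_Un_disjoint) auto
  moreover have "?U \<union> ?V = {1..m}" by auto
  ultimately show ?thesis by simp
qed

text \<open>One vertex for each pair of visits, represented by the visit with \<open>\<rho>\<close>,
  and in addition the two ends of the path, which are one vertex in the closed case.\<close>

lemma card_vertices: "2 * card (vertices surface_of) = m + (if holed then 4 else 2)"
proof -
  let ?U = "{i \<in> {1..m}. \<rho> i}"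
  let ?W = "(\<lambda>i. vx (2 * i)) ` ?U"
  have vodd: "vx (2 * i - 1) = vx (2 * i)" if "i \<in> {1..m}" for i
    by (rule vertex_eqI) (simp add: vertex_visit(1)[OF that])
  have vmu: "vx (2 * \<mu> i) = vx (2 * i)" if "i \<in> {1..m}" for i
    by (rule vertex_eqI) (simp add: vertex_visit(1)[OF that])
  have mem: "vx (2 * i) \<in> ?W" if "i \<in> {1..m}" for i
  proof (cases "\<rho> i")
    case False
    then have "\<mu> i \<in> ?U" using mate[OF that] by simp
    then have "vx (2 * \<mu> i) \<in> ?W" by (rule imageI)
    then show ?thesis using vmu[OF that] by simp
  qed (use that in auto)
  have veq: "vertices surface_of = insert (vx 0) (insert (vx (2 * m + 1)) ?W)"
  proof
    show "vertices surface_of \<subseteq> insert (vx 0) (insert (vx (2 * m + 1)) ?W)"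
    proof
      fix a assume "a \<in> vertices surface_of"
      then obtain x where x: "x < num" "a = vx x" by (auto simp: vertices_def)
      show "a \<in> insert (vx 0) (insert (vx (2 * m + 1)) ?W)"
      proof (cases "1 \<le> x \<and> x \<le> 2 * m")
        case True
        then show ?thesis
        proof (elim conjE visit_cases)
          fix i assume "i \<in> {1..m}" "x = 2 * i"
          then show ?thesis using mem[of i] x(2) by simp
        next
          fix i assume "i \<in> {1..m}" "x = 2 * i - 1"
          then show ?thesis using mem[of i] vodd[of i] x(2) by simp
        qed
      next
        case False
        have "x \<in> vx 0 \<or> x \<in> vx (2 * m + 1)" unfolding vertex_start vertex_end
          using x(1) False by (auto simp: num_def split: if_splits)
        then show ?thesis using vertex_eqI x(2) by blast
      qed
    qed
    have "2 * i < num" if "i \<in> {1..m}" for i using that by (simp add: num_def)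
    then show "insert (vx 0) (insert (vx (2 * m + 1)) ?W) \<subseteq> vertices surface_of"
      using num_pos by (auto simp: vertices_def num_def)
  qed
  have cW: "card ?W = card ?U"
  proof (rule card_image, rule inj_onI)
    fix i j assume i: "i \<in> ?U" and j: "j \<in> ?U" and eq: "vx (2 * i) = vx (2 * j)"
    have "2 * i \<in> {2 * j, 2 * j - 1, 2 * \<mu> j, 2 * \<mu> j - 1}"
      using in_vertex[of "2 * i"] unfolding eq using vertex_visit(1)[of j] j by simp
    then have "i = j \<or> i = \<mu> j" using i j mate(1)[of j] by (auto; presburger)
    then show "i = j" using i j mate(3)[of j] by auto
  qed
  have nW: "vx 0 \<notin> ?W" "vx (2 * m + 1) \<notin> ?W"
  proof -
    have "0 \<notin> vx (2 * i)" "2 * m + 1 \<notin> vx (2 * i)" if "i \<in> ?U" for i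
      using vertex_visit(1)[of i] mate(1)[of i] that by (auto simp: num_def)
    then show "vx 0 \<notin> ?W" "vx (2 * m + 1) \<notin> ?W" using in_vertex[of 0] in_vertex[of "2 * m + 1"] by blast+
  qed
  have fW: "finite ?W" by simp
  have eqv: "vx 0 = vx (2 * m + 1) \<longleftrightarrow> \<not> holed" unfolding vertex_start vertex_end by auto
  show ?thesis
  proof (cases holed)
    case True
    then have "vx 0 \<noteq> vx (2 * m + 1)" using eqv by blast
    then have n0: "vx 0 \<notin> insert (vx (2 * m + 1)) ?W" using nW(1) by blast
    have "finite (insert (vx (2 * m + 1)) ?W)" using fW by (rule finite.insertI)
    from card_insert_disjoint[OF this n0] have "card (vertices surface_of) = card ?W + 2"
      unfolding veq card_insert_disjoint[OF fW nW(2)] by linarith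
    then show ?thesis unfolding if_P[OF True] cW using card_half by linarith
  next
    case False
    then have "vx 0 = vx (2 * m + 1)" using eqv by blast
    then have "vertices surface_of = insert (vx (2 * m + 1)) ?W" unfolding veq by blast
    then have "card (vertices surface_of) = card ?W + 1"
      using card_insert_disjoint[OF fW nW(2)] by (simp only: Suc_eq_plus1)
    then show ?thesis unfolding if_not_P[OF False] cW using card_half by linarith
  qed
qed

definition path :: "nat list" where "path = map (\<lambda>i. 2 * i) [0..<m + 1]"

lemma path_simps: "length path = m + 1" "i \<le> m \<Longrightarrow> path ! i = 2 * i" "hd path = 0" "last path = 2 * m"
  by (simp_all add: path_def nth_append hd_map last_map del: upt_Suc)

lemma flip_even: "i \<le> m \<Longrightarrow> flip (2 * i) = 2 * i + 1"
  by (simp add: flip_def num_def)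

lemma final_path: "Suc i \<le> m \<Longrightarrow> vx (flip (2 * i)) = vx (2 * Suc i)"
proof (rule vertex_eqI)
  assume i: "Suc i \<le> m"
  then show "flip (2 * i) \<in> vx (2 * Suc i)"
    using flip_even[of i] by (subst vertex_visit(1)) auto
qed

lemma flip_odd: "i \<le> m \<Longrightarrow> flip (2 * i + 1) = 2 * i"
  using flip_flip[of "2 * i"] flip_even[of i] by simp

lemma crossing_times_path: "crossing_times surface_of path = {(i, \<mu> i) | i. i \<in> {1..m}}"
proof -
  have key: "vx (path ! i) = vx (path ! j) \<and> i \<noteq> j \<longleftrightarrow> j = \<mu> i" if i: "i \<in> {1..m}" and j: "j \<in> {1..m}" for i j
  proof -
    have "vx (2 * i) = vx (2 * j) \<longleftrightarrow> 2 * j \<in> {2 * i, 2 * i - 1, 2 * \<mu> i, 2 * \<mu> i - 1}"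
      using vertex_visit(1)[OF i] vertex_iff[of "2 * j" "2 * i"] by auto
    also have "\<dots> \<longleftrightarrow> j = i \<or> j = \<mu> i" using i mate(1)[OF i] by (auto; presburger)
    moreover have "\<mu> i \<noteq> i" using mate(3)[OF i] by auto
    ultimately show ?thesis using i j by (auto simp: path_simps)
  qed
  have "(i, j) \<in> crossing_times surface_of path \<longleftrightarrow> i \<in> {1..m} \<and> j = \<mu> i" for i j
  proof (cases "i \<in> {1..m} \<and> j \<in> {1..m}")
    case True
    then have "i \<in> {1..<length path}" "j \<in> {1..<length path}" by (auto simp: path_simps(1))
    then show ?thesis using key[of i j] True unfolding crossing_times_def by blast
  next
    case False
    then have "i \<notin> {1..<length path} \<or> j \<notin> {1..<length path}" by (auto simp: path_simps(1))
    then show ?thesis using False mate(1)[of i] unfolding crossing_times_def by blast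
  qed
  then show ?thesis by (auto simp: set_eq_iff)
qed

lemma crossing_path:
  assumes i: "i \<in> {1..m}"
  shows "\<rho> i \<Longrightarrow> crosses_right_to_left surface_of path i (\<mu> i)"
    "\<not> \<rho> i \<Longrightarrow> crosses_left_to_right surface_of path i (\<mu> i)"
proof -
  note mi = mate(1)[OF i]
  have r: "flip (path ! (i - 1)) = 2 * i - 1" "flip (path ! (\<mu> i - 1)) = 2 * \<mu> i - 1" "path ! i = 2 * i" "path ! \<mu> i = 2 * \<mu> i"
    using i mi by (auto simp: path_simps flip_even)
  have three: "(rot ^^ 1) x = rot x" "(rot ^^ 2) x = rot (rot x)" "(rot ^^ 3) x = rot (rot (rot x))" for x
    by (simp_all add: numeral_eq_Suc)
  show "\<rho> i \<Longrightarrow> crosses_right_to_left surface_of path i (\<mu> i)"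
    unfolding crosses_right_to_left_def counterclockwise_def surface_of_simps r turn_surface_of
    by (intro exI[of _ 1] exI[of _ 2] exI[of _ 3], unfold three) 
       (use rot_visit[OF i] rot_rot_visit[OF i] vertex_visit(2)[OF i] in simp)
  show "\<not> \<rho> i \<Longrightarrow> crosses_left_to_right surface_of path i (\<mu> i)"
    unfolding crosses_left_to_right_def counterclockwise_def surface_of_simps r turn_surface_of
    by (intro exI[of _ 1] exI[of _ 2] exI[of _ 3], unfold three) 
       (use rot_visit[OF i] rot_rot_visit[OF i] vertex_visit(2)[OF i] in simp)
qed

lemma generic_path_path: "generic_path surface_of path"
proof -
  have "distinct path" by (simp add: path_def distinct_map inj_on_def del: upt_Suc)
  moreover have "path \<noteq> []" "set path \<subseteq> sides surface_of" by (auto simp: path_def num_def)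
  moreover have "\<forall>i. Suc i < length path \<longrightarrow> final_vertex surface_of (path ! i) = initial_vertex surface_of (path ! Suc i)"
    using final_path by (simp add: path_simps final_vertex_def)
  moreover have "\<forall>d\<in>set path. glue surface_of d \<notin> set path"
  proof
    fix d assume "d \<in> set path"
    then obtain i where "i \<le> m" "d = 2 * i" by (auto simp: path_def)
    then show "glue surface_of d \<notin> set path" using flip_even[of i] by (auto simp: path_def; presburger)
  qed
  moreover have "\<forall>i j k. (i, j) \<in> {(i, \<mu> i) | i. i \<in> {1..m}} \<and> (i, k) \<in> {(i, \<mu> i) | i. i \<in> {1..m}} \<longrightarrow> j = k"
    by auto
  moreover have "\<forall>(i, j)\<in>{(i, \<mu> i) | i. i \<in> {1..m}}.
      crosses_right_to_left surface_of path i j \<or> crosses_left_to_right surface_of path i j"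
    using crossing_path by blast
  ultimately show ?thesis unfolding generic_path_def crossing_times_path by (intro conjI) (assumption | blast)+
qed

definition crossings :: "(nat \<times> nat) set" where "crossings = {(i, \<mu> i) | i. i \<in> {1..m} \<and> ov i}"

lemma over_under_path: "over_under surface_of path crossings"
proof -
  have "(\<mu> i, i) \<in> crossings \<longleftrightarrow> \<not> ov i" if "i \<in> {1..m}" for i
    using mate[OF that] that mate(2)[of "\<mu> i"] by (auto simp: crossings_def)
  moreover have "(i, \<mu> i) \<in> crossings \<longleftrightarrow> ov i" if "i \<in> {1..m}" for i
    using that by (auto simp: crossings_def)
  ultimately show ?thesis unfolding over_under_def crossing_times_path by (auto simp: crossings_def)
qed

lemma ends_path:
  assumes "i \<in> {1..<length path}"
  shows "vx (path ! i) \<noteq> vx 0" "vx (path ! i) \<noteq> vx (2 * m + 1)"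
proof -
  have i: "i \<in> {1..m}" "path ! i = 2 * i" using assms by (auto simp: path_simps)
  have "2 * i \<notin> vx 0" "2 * i \<notin> vx (2 * m + 1)" unfolding vertex_start vertex_end using i by (auto; presburger)+
  then show "vx (path ! i) \<noteq> vx 0" "vx (path ! i) \<noteq> vx (2 * m + 1)" unfolding i(2) using in_vertex by metis+
qed

lemma final_last: "final_vertex surface_of (last path) = vx (2 * m + 1)"
  using flip_even[of m] by (simp add: path_simps final_vertex_def)

sublocale surf_path surface_of path crossings
  using generic_path_path over_under_path ends_path final_last
  by unfold_locales (simp_all add: path_simps)

lemma crosses_iff: "i \<in> {1..m} \<Longrightarrow> crosses_right_to_left surface_of path i (\<mu> i) \<longleftrightarrow> \<rho> i"
  using crossing_path not_both by blast

lemma based_closed_curve_path: "\<not> holed \<Longrightarrow> based_closed_curve surface_of path"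
  unfolding based_closed_curve_def
  using closed_surface_surface_of generic_path_path final_last ends_path(1) vertex_start vertex_end
  by (auto simp: path_simps(3))

text \<open>The extra loops bound monogons, so each hole has a single side, and the boundaries are
  disjoint because the two end vertices differ.\<close>

lemma arc_between_holes_path:
  assumes holed
  shows "arc_between_holes surface_of {2 * m + 2} {2 * m + 4} path"
proof -
  note r = rot_holed(3,5)[OF assms]
  have g: "flip (2 * m + 2) = 2 * m + 3" "flip (2 * m + 4) = 2 * m + 5" using assms unfolding flip_def num_def by simp_all
  have "fo (2 * m + 2) = 2 * m + 2" "fo (2 * m + 4) = 2 * m + 4"
    unfolding surface_of_simps comp_apply g r[symmetric] by (rule inv_f_f[OF bij_is_inj[OF bij_rot]])+
  then have orb: "orbit fo (2 * m + 2) = {2 * m + 2}" "orbit fo (2 * m + 4) = {2 * m + 4}"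
    by (simp_all only: orbit_eq_singleton_iff)
  have "2 * m + 2 < num" "2 * m + 4 < num" using assms unfolding num_def by simp_all
  then have "orbit fo (2 * m + 2) \<in> polygons surface_of" "orbit fo (2 * m + 4) \<in> polygons surface_of"
    unfolding polygons_def by (simp_all only: image_eqI surface_of_simps lessThan_iff imageI)
  then have P: "{2 * m + 2} \<in> polygons surface_of" "{2 * m + 4} \<in> polygons surface_of"
    unfolding orb .
  have v: "vx (2 * m + 2) = vx 0" "vx (2 * m + 4) = vx (2 * m + 1)"
  proof -
    have "2 * m + 2 \<in> vx 0" unfolding vertex_start if_P[OF assms] by blast
    then show "vx (2 * m + 2) = vx 0" by (rule vertex_eqI)
    have "2 * m + 4 \<in> vx (2 * m + 1)" unfolding vertex_end if_P[OF assms] by blast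
    then show "vx (2 * m + 4) = vx (2 * m + 1)" by (rule vertex_eqI)
  qed
  have "vx 0 \<noteq> vx (2 * m + 1)" unfolding vertex_start vertex_end using assms by auto
  then have "two_holed_surface surface_of {2 * m + 2} {2 * m + 4}"
    unfolding two_holed_surface_def using closed_surface_surface_of P v by simp
  then show ?thesis unfolding arc_between_holes_def
    using generic_path_path final_last ends_path v by (simp add: path_simps)
qed

section \<open>Counting polygons and determining the genus\<close>

text \<open>
  For the three families below, the faces are counted by labels \<open>LF i\<close> and \<open>LB i\<close> of the faces to the
  left and to the right of the edge from visit \<open>i\<close> to visit \<open>i + 1\<close>. It suffices to bound their number from
  below, because intersection numbers bound the Euler characteristic from above.
\<close>

lemma card_polygons:
  fixes LF LB :: "nat \<Rightarrow> nat"
  assumes F: "\<And>i. i \<in> {1..m} \<Longrightarrow> LF i = (if \<rho> i then LB (\<mu> i) else LF (\<mu> i - 1))"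
    and B: "\<And>i. i \<in> {1..m} \<Longrightarrow> LB (i - 1) = (if \<rho> i then LF (\<mu> i - 1) else LB (\<mu> i))"
    and ends: "if holed then LF 0 = LB 0 \<and> LF m = LB m else LF 0 = LF m \<and> LB 0 = LB m"
  shows "card (LF ` {..m} \<union> LB ` {..m}) + (if holed then 2 else 0) \<le> card (polygons surface_of)"
proof -
  \<comment> \<open>Extends the labels to the sides of the extra loops. \<open>None\<close> and
    \<open>Inr ()\<close> are set aside for the two monogons, which therefore count as two further
    faces.\<close>
  define L where "L x = (if x \<le> 2 * m + 1 then Some (Inl (if even x then LF (x div 2) else LB (x div 2)))
     else if x = 2 * m + 3 then Some (Inl (LF 0)) else if x = 2 * m + 5 then Some (Inl (LF m))
     else if x = 2 * m + 2 then None else Some (Inr ()))" for x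
  have LE: "L (2 * i) = Some (Inl (LF i))" "L (2 * i + 1) = Some (Inl (LB i))" if "i \<le> m" for i
    using that by (simp_all add: L_def)
  have inv: "L (flip (rot y)) = L y" if "y < num" for y
  proof (cases "1 \<le> y \<and> y \<le> 2 * m")
    case True
    then show ?thesis
    proof (elim conjE visit_cases)
      fix i assume i: "i \<in> {1..m}" "y = 2 * i"
      obtain k where K: "\<mu> i = Suc k" "k \<le> m" "Suc k \<le> m" using mate(1)[OF i(1)] by (cases "\<mu> i") auto
      have e: "2 * Suc k - 1 = 2 * k + 1" "Suc k - 1 = k" by simp_all
      have y: "L y = Some (Inl (LF i))" unfolding i(2) by (rule LE(1)) (use i in simp)
      show ?thesis
      proof (cases "\<rho> i")
        case True
        have "L (flip (rot y)) = Some (Inl (LB (Suc k)))"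
          unfolding i(2) rot_visit(1)[OF i(1)] if_P[OF True] K(1) flip_even[OF K(3)] by (rule LE(2)[OF K(3)])
        then show ?thesis using F[OF i(1)] True unfolding y K(1) by simp
      next
        case False
        have "L (flip (rot y)) = Some (Inl (LF k))"
          unfolding i(2) rot_visit(1)[OF i(1)] if_not_P[OF False] K(1) e flip_odd[OF K(2)] by (rule LE(1)[OF K(2)])
        then show ?thesis using F[OF i(1)] False unfolding y K(1) e by simp
      qed
    next
      fix i assume i: "i \<in> {1..m}" "y = 2 * i - 1"
      obtain k where K: "\<mu> i = Suc k" "k \<le> m" "Suc k \<le> m" using mate(1)[OF i(1)] by (cases "\<mu> i") auto
      have e: "2 * Suc k - 1 = 2 * k + 1" "Suc k - 1 = k" by simp_all
      have e': "2 * i - 1 = 2 * (i - 1) + 1" using i by auto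
      have y: "L y = Some (Inl (LB (i - 1)))" unfolding i(2) e' by (rule LE(2)) (use i in auto)
      show ?thesis
      proof (cases "\<rho> i")
        case True
        have "L (flip (rot y)) = Some (Inl (LF k))"
          unfolding i(2) rot_visit(2)[OF i(1)] if_P[OF True] K(1) e flip_odd[OF K(2)] by (rule LE(1)[OF K(2)])
        then show ?thesis using B[OF i(1)] True unfolding y K(1) e by simp
      next
        case False
        have "L (flip (rot y)) = Some (Inl (LB (Suc k)))"
          unfolding i(2) rot_visit(2)[OF i(1)] if_not_P[OF False] K(1) flip_even[OF K(3)] by (rule LE(2)[OF K(3)])
        then show ?thesis using B[OF i(1)] False unfolding y K(1) by simp
      qed
    qed
  next
    case False
    have Lv: "L 0 = Some (Inl (LF 0))" "L (0 + 1) = Some (Inl (LB 0))" "L (2 * m) = Some (Inl (LF m))"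
      "L (2 * m + 1) = Some (Inl (LB m))" "L (2 * m + 3) = Some (Inl (LF 0))" "L (2 * m + 5) = Some (Inl (LF m))"
      by (simp_all add: L_def)
    have fl: "flip 0 = 0 + 1" "flip (2 * m + 1) = 2 * m" using flip_even[of 0] flip_odd[of m] by simp_all
    have "y = 0 \<or> y = 2 * m + 1 \<or> holed \<and> (y = 2 * m + 2 \<or> y = 2 * m + 3 \<or> y = 2 * m + 4 \<or> y = 2 * m + 5)"
      using that False unfolding num_def by (cases holed; simp; presburger)
    note ys = this
    show ?thesis
    proof (cases holed)
      case h: True
      have flh: "flip (2 * m + 2) = 2 * m + 3" "flip (2 * m + 3) = 2 * m + 2" "flip (2 * m + 4) = 2 * m + 5" "flip (2 * m + 5) = 2 * m + 4"
        using h unfolding flip_def num_def by simp_all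
      have e: "LF 0 = LB 0" "LF m = LB m" using ends unfolding if_P[OF h] by simp_all
      have "y = 0 \<or> y = 2 * m + 1 \<or> y = 2 * m + 2 \<or> y = 2 * m + 3 \<or> y = 2 * m + 4 \<or> y = 2 * m + 5"
        using ys by blast
      then show ?thesis
        by (elim disjE) (simp_all only: rot_holed[OF h] flh fl Lv e)
    next
      case c: False
      have e: "LF 0 = LF m" "LB 0 = LB m" using ends unfolding if_not_P[OF c] by simp_all
      have "y = 0 \<or> y = 2 * m + 1" using ys c by blast
      then show ?thesis
        by (elim disjE) (simp_all only: rot_closed[OF c] fl Lv e)
    qed
  qed
  have "card (LF ` {..m} \<union> LB ` {..m}) + (if holed then 2 else 0) \<le> card (L ` sides surface_of)"
  proof -
    let ?S = "(\<lambda>a. Some (Inl a)) ` (LF ` {..m} \<union> LB ` {..m}) \<union> (if holed then {None, Some (Inr ())} else {})"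
    have "card ?S = card (LF ` {..m} \<union> LB ` {..m}) + (if holed then 2 else 0)"
      by (subst card_Un_disjoint) (auto simp: card_image inj_on_def)
    moreover have "?S \<subseteq> L ` sides surface_of"
    proof -
      have f: "Some (Inl (LF i)) \<in> L ` {..<num}" "Some (Inl (LB i)) \<in> L ` {..<num}" if "i \<le> m" for i
      proof -
        have lt: "2 * i < num" "2 * i + 1 < num" using that unfolding num_def by simp_all
        show "Some (Inl (LF i)) \<in> L ` {..<num}" unfolding LE(1)[OF that, symmetric] by (rule imageI) (simp only: lessThan_iff lt)
        show "Some (Inl (LB i)) \<in> L ` {..<num}" unfolding LE(2)[OF that, symmetric] by (rule imageI) (simp only: lessThan_iff lt)
      qed
      have h: "None \<in> L ` {..<num}" "Some (Inr ()) \<in> L ` {..<num}" if holed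
      proof -
        have lt: "2 * m + 2 < num" "2 * m + 4 < num" using that unfolding num_def by simp_all
        have l: "L (2 * m + 2) = None" "L (2 * m + 4) = Some (Inr ())" by (simp_all add: L_def)
        show "None \<in> L ` {..<num}" unfolding l(1)[symmetric] by (rule imageI) (simp only: lessThan_iff lt)
        show "Some (Inr ()) \<in> L ` {..<num}" unfolding l(2)[symmetric] by (rule imageI) (simp only: lessThan_iff lt)
      qed
      show ?thesis
      proof (cases holed)
        case True
        show ?thesis unfolding if_P[OF True] surface_of_simps using f h[OF True] by blast
      next
        case False
        show ?thesis unfolding if_not_P[OF False] surface_of_simps using f by blast
      qed
    qed
    moreover have "finite (L ` sides surface_of)" by simp
    ultimately show ?thesis using card_mono by metis
  qed
  then show ?thesis using card_faces[of L, OF inv] by linarith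
qed

text \<open>Two loops with odd intersection number are independent modulo boundaries, as each has
  \<open>lk\<close> zero with itself. With \<open>k = 2\<close> the Euler characteristic is at most
  0, so the genus is bounded from below by one.\<close>

lemma genus_le_one:
  assumes "c \<in> crossings" "d \<in> crossings" "lk crossings PR c d = 1"
  shows "card (vertices surface_of) + card (polygons surface_of) \<le> card (edges surface_of)"
proof -
  define z where "z j = arc_chain (lo (if j = 0 then c else d)) (hi (if j = 0 then c else d))" for j :: nat
  have val: "loop_int x (z 0) = lk crossings PR c x" "loop_int x (z 1) = lk crossings PR d x" if "x \<in> crossings" for x
    using loop_int_loop assms(1,2) that by (simp_all add: z_def)
  have "card (vertices surface_of) + card (polygons surface_of) + 2 \<le> card (edges surface_of) + 2"
  proof (rule euler_characteristic_bound[where k = 2 and z = z])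
    fix j :: nat
    show "sym (z j)" unfolding z_def by (rule sym_arc_chain) (use lo_hi_CT(4)[OF assms(1)] lo_hi_CT(4)[OF assms(2)] in auto)
    show "bd (z j) v = 0" if "v \<in> vertices surface_of" for v unfolding z_def by (rule bd_loop) (use that assms in auto)
  next
    fix X :: "nat set" assume X: "X \<subseteq> {..<2}" "X \<noteq> {}"
    have "X \<in> Pow {0, 1}" using X(1) by (auto simp: lessThan_def)
    then consider "X = {0}" | "X = {1}" | "X = {0, 1}" using X(2) by (auto simp: Pow_insert)
    then show "\<exists>\<Lambda>. functional \<Lambda> \<and> (\<Sum>j\<in>X. \<Lambda> (z j)) \<noteq> 0"
    proof cases
      case 1
      then show ?thesis using val[OF assms(2)] assms(3) functional_loop_int[OF assms(2)]
        by (intro exI[of _ "loop_int d"]) simp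
    next
      case 2
      then show ?thesis using val[OF assms(1)] assms(3) lk_commute[OF chords_R assms(1,2)] functional_loop_int[OF assms(1)]
        by (intro exI[of _ "loop_int c"]) simp
    next
      case 3
      then show ?thesis using val[OF assms(2)] assms(3) lk_self[OF chords_R assms(2)] functional_loop_int[OF assms(2)]
        by (intro exI[of _ "loop_int d"]) simp
    qed
  qed
  then show ?thesis by simp
qed

text \<open>The Euler characteristic is at most 2 already for \<open>k = 0\<close>, so enough
  polygons force equality.\<close>

lemma genus_zero:
  assumes "card (edges surface_of) + 2 \<le> card (vertices surface_of) + card (polygons surface_of)"
  shows "has_genus surface_of 0"
proof -
  have "card (vertices surface_of) + card (polygons surface_of) + 0 \<le> card (edges surface_of) + 2"
    by (rule euler_characteristic_bound[where k = 0 and z = "\<lambda>_ _. 0"]) auto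
  then show ?thesis using assms unfolding has_genus_def by linarith
qed

end

section \<open>Three families of Gauss codes\<close>

lemma sum_two: "(\<Sum>x\<in>{min i i'..<max i i'}. f x) = f a + (f (Suc a) :: bit)" if "min i i' = a" "max i i' = a + 2"
  using that by (simp add: numeral_2_eq_2)

section \<open>Parity and linking of a Gauss code\<close>

context code
begin

text \<open>A symmetrized sum over chords is a sum over visits and their mates, so the over/under
  information drops out of it.\<close>

lemma sum_crossings:
  fixes f :: "nat \<Rightarrow> nat \<Rightarrow> bit"
  shows "(\<Sum>e\<in>crossings. f (fst e) (snd e) + f (snd e) (fst e)) = (\<Sum>i\<in>{1..m}. f i (\<mu> i))"
proof -
  let ?U = "{i \<in> {1..m}. ov i}" and ?V = "{i \<in> {1..m}. \<not> ov i}"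
  have C: "crossings = (\<lambda>i. (i, \<mu> i)) ` ?U" by (auto simp: crossings_def)
  have "(\<Sum>e\<in>crossings. f (fst e) (snd e) + f (snd e) (fst e)) = (\<Sum>i\<in>?U. f i (\<mu> i) + f (\<mu> i) i)"
    unfolding C by (subst sum.reindex) (auto simp: inj_on_def)
  also have "\<dots> = (\<Sum>i\<in>?U. f i (\<mu> i)) + (\<Sum>i\<in>?U. f (\<mu> i) i)" by (rule sum.distrib)
  also have "(\<Sum>i\<in>?U. f (\<mu> i) i) = (\<Sum>i\<in>?V. f i (\<mu> i))"
    by (rule sum.reindex_bij_witness[where i = \<mu> and j = \<mu>]) (use mate in auto)
  also have "(\<Sum>i\<in>?U. f i (\<mu> i)) + (\<Sum>i\<in>?V. f i (\<mu> i)) = (\<Sum>i\<in>?U \<union> ?V. f i (\<mu> i))"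
    by (rule sum.union_disjoint[symmetric]) auto
  also have "?U \<union> ?V = {1..m}" by auto
  finally show ?thesis .
qed

lemma sum_ins:
  assumes "c \<in> crossings"
  shows "(\<Sum>i\<in>{1..m}. ins c i * g i) = (\<Sum>i\<in>{lo c..<hi c}. g i)"
proof -
  have "{lo c..<hi c} \<subseteq> {1..m}" using lo_hi_CT(2,4)[OF assms] by (auto simp: path_simps)
  then have "(\<Sum>i\<in>{1..m}. ins c i * g i) = (\<Sum>i\<in>{lo c..<hi c}. ins c i * g i)"
    by (intro sum.mono_neutral_right) (auto simp: ins_def)
  also have "\<dots> = (\<Sum>i\<in>{lo c..<hi c}. g i)" by (intro sum.cong) (auto simp: ins_def)
  finally show ?thesis .
qed

text \<open>In a code every position from 1 to \<open>m\<close> is an end of a chord, so the parity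
  can be read off from the distance of the two ends.\<close>

lemma par_crossings:
  assumes "c \<in> crossings"
  shows "par crossings c = 1 \<longleftrightarrow> even (hi c - lo c)"
proof -
  have "of_nat k = (of_bool (odd k) :: bit)" for k by (induction k) auto
  then have "par crossings c = 1 + of_bool (odd (hi c - lo c))"
    unfolding par_def using sum_crossings[of "\<lambda>x y. ins c x"] sum_ins[OF assms, of "\<lambda>_. 1"] by simp
  then show ?thesis by simp
qed

lemma lk_crossings:
  assumes c: "(i, i') \<in> crossings" and d: "(j, j') \<in> crossings"
  shows "lk crossings PR (i, i') (j, j') = (\<Sum>x\<in>{min i i'..<max i i'}. ins (j, j') (\<mu> x)) +
     ins (j, j') (if \<rho> i then i' else i) + ins (i, i') (if \<rho> j then j else j') + of_bool ((i, i') = (j, j'))"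
proof -
  have P: "PR (x, y) \<longleftrightarrow> \<rho> x" if "(x, y) \<in> crossings" for x y
    using that crosses_iff by (auto simp: crossings_def)
  show ?thesis unfolding lk_def P[OF c] P[OF d]
    using sum_crossings[of "\<lambda>x y. ins (i, i') x * ins (j, j') y"] sum_ins[OF c, of "\<lambda>x. ins (j, j') (\<mu> x)"]
    by (simp add: lo_def hi_def)
qed

text \<open>A chord over two steps has just one visit between its ends, so two mates suffice. All
  chords of the families have this length except one, which is always put second.\<close>

lemma lk_short:
  assumes "(i, i') \<in> crossings" "(j, j') \<in> crossings" "min i i' = a" "max i i' = a + 2"
  shows "lk crossings PR (i, i') (j, j') = ins (j, j') (\<mu> a) + ins (j, j') (\<mu> (Suc a)) +
     ins (j, j') (if \<rho> i then i' else i) + ins (i, i') (if \<rho> j then j else j') + of_bool ((i, i') = (j, j'))"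
  unfolding lk_crossings[OF assms(1,2)] sum_two[OF assms(3,4)] ..

text \<open>Mates at even distance make every chord odd, and the two classes are then given by the
  order of over and under passage.\<close>

lemma early_crossings:
  assumes "\<forall>i\<in>{1..m}. even (i + \<mu> i)"
  shows "early_over crossings = {(i, \<mu> i) | i. i \<in> {1..m} \<and> ov i \<and> i < \<mu> i}"
    "early_under crossings = {(i, \<mu> i) | i. i \<in> {1..m} \<and> ov i \<and> \<mu> i < i}"
proof -
  have "par crossings c = 1" if c: "c \<in> crossings" for c
    unfolding par_crossings[OF c] using assms c by (auto simp: crossings_def lo_def hi_def min_def max_def)
  then have *: "early_over crossings = {c \<in> crossings. fst c < snd c}" "early_under crossings = {c \<in> crossings. snd c < fst c}"
    by (auto simp: early_over_def early_under_def)
  show "early_over crossings = {(i, \<mu> i) | i. i \<in> {1..m} \<and> ov i \<and> i < \<mu> i}"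
    "early_under crossings = {(i, \<mu> i) | i. i \<in> {1..m} \<and> ov i \<and> \<mu> i < i}"
    unfolding * by (auto simp: crossings_def)
qed

lemma genus_one:
  assumes "c \<in> crossings" "d \<in> crossings" "lk crossings PR c d = 1"
    and "card (edges surface_of) \<le> card (vertices surface_of) + card (polygons surface_of)"
  shows "has_genus surface_of 1"
  using genus_le_one[OF assms(1-3)] assms(4) unfolding has_genus_def by simp

lemma chord_sign_PR: "i \<in> {1..m} \<Longrightarrow> chord_sign PR (i, \<mu> i) = (if \<rho> i then 1 else -1)"
  unfolding chord_sign_def using crosses_iff by simp

end

section \<open>Chains of blocks between two holes\<close>

text \<open>
  The basic block consists of two crossings met in the order over, under, under, over and linked once
  with each other.
\<close>

definition block_mate :: "nat \<Rightarrow> nat" where "block_mate i = (if i mod 4 \<in> {1, 2} then i + 2 else i - 2)"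

definition block_over :: "nat \<Rightarrow> bool" where "block_over i \<longleftrightarrow> i mod 4 \<in> {0, 1}"

text \<open>In a chain of positive blocks, face \<open>2 * k\<close> lies in front of block
  \<open>k\<close>; the block adds the faces \<open>2 * k + 1\<close> and \<open>2 * k + 2\<close>,
  the latter shared with the next block.\<close>

definition label_left :: "nat \<Rightarrow> nat" where
  "label_left i = (if i mod 4 = 1 then 2 * (i div 4) + 1 else 2 * (i div 4))"

definition label_right :: "nat \<Rightarrow> nat" where
  "label_right i = (if i mod 4 = 0 then 2 * (i div 4) else if i mod 4 = 3 then 2 * (i div 4) + 1 else 2 * (i div 4) + 2)"

lemma quarters:
  fixes i :: nat
  assumes "1 \<le> i"
  obtains k where "i = 4 * k + 1" | k where "i = 4 * k + 2" | k where "i = 4 * k + 3" | k where "i = 4 * k + 4"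
proof -
  define k where "k = (i - 1) div 4"
  have "i = 4 * k + 1 \<or> i = 4 * k + 2 \<or> i = 4 * k + 3 \<or> i = 4 * k + 4"
    unfolding k_def using assms by presburger
  then show ?thesis using that by blast
qed

lemma quarter_div_mod:
  "(4 * k) mod 4 = (0::nat)" "(4 * k + 1) mod 4 = (1::nat)" "(4 * k + 2) mod 4 = (2::nat)" "(4 * k + 3) mod 4 = (3::nat)"
  "(4 * k + 4) mod 4 = (0::nat)" "(4 * k + 5) mod 4 = (1::nat)"
  "(4 * k) div 4 = (k::nat)" "(4 * k + 1) div 4 = (k::nat)" "(4 * k + 2) div 4 = (k::nat)" "(4 * k + 3) div 4 = (k::nat)"
  "(4 * k + 4) div 4 = (k + 1::nat)"
  by presburger+

lemma block_mate_simps: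
  "block_mate (4 * k + 1) = 4 * k + 3" "block_mate (4 * k + 2) = 4 * k + 4"
  "block_mate (4 * k + 3) = 4 * k + 1" "block_mate (4 * k + 4) = 4 * k + 2"
  unfolding block_mate_def quarter_div_mod by simp_all

lemma block_over_simps:
  "block_over (4 * k + 1)" "\<not> block_over (4 * k + 2)" "\<not> block_over (4 * k + 3)" "block_over (4 * k + 4)"
  unfolding block_over_def quarter_div_mod by simp_all

lemma label_simps:
  "label_left (4 * k) = 2 * k" "label_left (4 * k + 1) = 2 * k + 1" "label_left (4 * k + 2) = 2 * k"
  "label_left (4 * k + 3) = 2 * k" "label_left (4 * k + 4) = 2 * k + 2"
  "label_right (4 * k) = 2 * k" "label_right (4 * k + 1) = 2 * k + 2" "label_right (4 * k + 2) = 2 * k + 2"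
  "label_right (4 * k + 3) = 2 * k + 1" "label_right (4 * k + 4) = 2 * k + 2"
  unfolding label_left_def label_right_def quarter_div_mod by simp_all

lemma block_mate:
  assumes "i \<in> {1..4 * n}"
  shows "block_mate i \<in> {1..4 * n}" "block_mate (block_mate i) = i"
    "block_over (block_mate i) \<longleftrightarrow> \<not> block_over i" "even (i + block_mate i)"
proof -
  have "1 \<le> i" using assms by simp
  then have "block_mate i \<in> {1..4 * n} \<and> block_mate (block_mate i) = i \<and>
    (block_over (block_mate i) \<longleftrightarrow> \<not> block_over i) \<and> even (i + block_mate i)"
  proof (cases rule: quarters)
    case (1 k)
    then show ?thesis using assms unfolding 1 block_mate_simps using block_over_simps by (simp; presburger)
  next
    case (2 k)
    then show ?thesis using assms unfolding 2 block_mate_simps using block_over_simps by (simp; presburger)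
  next
    case (3 k)
    then show ?thesis using assms unfolding 3 block_mate_simps using block_over_simps by simp
  next
    case (4 k)
    then show ?thesis using assms unfolding 4 block_mate_simps using block_over_simps by simp
  qed
  then show "block_mate i \<in> {1..4 * n}" "block_mate (block_mate i) = i"
    "block_over (block_mate i) \<longleftrightarrow> \<not> block_over i" "even (i + block_mate i)" by simp_all
qed

lemma label_block:
  assumes "1 \<le> i"
  shows "label_left i = (if block_over i then label_right (block_mate i) else label_left (block_mate i - 1))"
    "label_right (i - 1) = (if block_over i then label_left (block_mate i - 1) else label_right (block_mate i))"
proof -
  have s: "4 * k + 3 - 1 = 4 * k + 2" "4 * k + 4 - 1 = 4 * k + 3" "4 * k + 1 - 1 = 4 * k" "4 * k + 2 - 1 = 4 * k + 1" for k :: nat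
    by simp_all
  have "label_left i = (if block_over i then label_right (block_mate i) else label_left (block_mate i - 1)) \<and>
    label_right (i - 1) = (if block_over i then label_left (block_mate i - 1) else label_right (block_mate i))"
    using assms by (cases rule: quarters) (simp_all only: block_mate_simps block_over_simps label_simps s if_True if_False simp_thms)
  then show "label_left i = (if block_over i then label_right (block_mate i) else label_left (block_mate i - 1))"
    "label_right (i - 1) = (if block_over i then label_left (block_mate i - 1) else label_right (block_mate i))" by simp_all
qed

lemma label_range: "{..2 * n} \<subseteq> label_left ` {..4 * n}"
proof
  fix j assume j: "j \<in> {..2 * n}"
  show "j \<in> label_left ` {..4 * n}"
  proof (cases "even j")
    case True
    then obtain k where "j = 2 * k" by (rule evenE)
    then show ?thesis using j label_simps(1)[of k] by (intro image_eqI[where x = "4 * k"]) auto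
  next
    case False
    then obtain k where "j = 2 * k + 1" by (rule oddE)
    then show ?thesis using j label_simps(2)[of k] by (intro image_eqI[where x = "4 * k + 1"]) auto
  qed
qed

lemma early_over_blocks:
  "{(i, block_mate i) | i. i \<in> {1..4 * n} \<and> block_over i \<and> i < block_mate i} = (\<lambda>k. (4 * k + 1, 4 * k + 3)) ` {..<n}"
    (is "?E = ?F")
proof
  show "?E \<subseteq> ?F"
  proof
    fix e assume "e \<in> ?E"
    then obtain i where i: "e = (i, block_mate i)" "1 \<le> i" "i \<le> 4 * n" "block_over i" "i < block_mate i" by auto
    from i(2) show "e \<in> ?F"
    proof (cases rule: quarters)
      case (1 k)
      then show ?thesis using i(1,3) block_mate_simps(1)[of k] by auto
    next
      case (4 k)
      then show ?thesis using i(5) block_mate_simps(4)[of k] by simp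
    qed (use i(4) block_over_simps in auto)
  qed
  have "(4 * k + 1, 4 * k + 3) \<in> ?E" if "k < n" for k
    using block_mate_simps(1)[of k] block_over_simps(1)[of k] that by (auto intro!: exI[of _ "4 * k + 1"])
  then show "?F \<subseteq> ?E" by blast
qed

lemma early_under_blocks:
  "{(i, block_mate i) | i. i \<in> {1..4 * n} \<and> block_over i \<and> block_mate i < i} = (\<lambda>k. (4 * k + 4, 4 * k + 2)) ` {..<n}"
    (is "?E = ?F")
proof
  show "?E \<subseteq> ?F"
  proof
    fix e assume "e \<in> ?E"
    then obtain i where i: "e = (i, block_mate i)" "1 \<le> i" "i \<le> 4 * n" "block_over i" "block_mate i < i" by auto
    from i(2) show "e \<in> ?F"
    proof (cases rule: quarters)
      case (1 k)
      then show ?thesis using i(5) block_mate_simps(1)[of k] by simp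
    next
      case (4 k)
      then show ?thesis using i(1,3) block_mate_simps(4)[of k] by auto
    qed (use i(4) block_over_simps in auto)
  qed
  have "(4 * k + 4, 4 * k + 2) \<in> ?E" if "k < n" for k
    using block_mate_simps(4)[of k] block_over_simps(4)[of k] that by (auto intro!: exI[of _ "4 * k + 4"])
  then show "?F \<subseteq> ?E" by blast
qed

text \<open>There are \<open>2 * n + 2\<close> vertices, \<open>4 * n + 3\<close> edges and at least
  \<open>2 * n + 3\<close> polygons, the two monogons included, which forces genus 0. Each block
  contributes one odd positive crossing with the over passage first.\<close>

theorem positive_blocks:
  "\<exists>\<Sigma> B C p R. has_genus \<Sigma> 0 \<and> arc_between_holes \<Sigma> B C p \<and> over_under \<Sigma> p R \<and>
    odd_writhe R (\<lambda>e. crosses_right_to_left \<Sigma> p (fst e) (snd e)) = int n"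
proof -
  interpret code "4 * n" block_mate block_over block_over True
    using block_mate by unfold_locales auto
  have ev: "\<forall>i\<in>{1..4 * n}. even (i + block_mate i)" using block_mate(4) by blast
  have "odd_writhe crossings PR = (\<Sum>k<n. chord_sign PR (4 * k + 1, 4 * k + 3))"
    unfolding odd_writhe_def early_crossings(1)[OF ev] early_over_blocks
    by (subst sum.reindex) (auto simp: inj_on_def)
  also have "\<dots> = (\<Sum>k<n. 1)"
  proof (rule sum.cong[OF refl])
    fix k assume "k \<in> {..<n}"
    then show "chord_sign PR (4 * k + 1, 4 * k + 3) = 1"
      using chord_sign_PR[of "4 * k + 1"] unfolding block_mate_simps using block_over_simps(1)[of k] by simp
  qed
  finally have w: "odd_writhe crossings PR = int n" by simp
  have "card (label_left ` {..4 * n} \<union> label_right ` {..4 * n}) + 2 \<le> card (polygons surface_of)"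
  proof -
    have "card (label_left ` {..4 * n} \<union> label_right ` {..4 * n}) + (if True then 2 else 0) \<le> card (polygons surface_of)"
    proof (rule card_polygons)
      show "if True then label_left 0 = label_right 0 \<and> label_left (4 * n) = label_right (4 * n)
        else label_left 0 = label_left (4 * n) \<and> label_right 0 = label_right (4 * n)"
        using label_simps(1,6)[of 0] label_simps(1,6)[of n] by simp
    qed (rule label_block; simp)+
    then show ?thesis by simp
  qed
  moreover have "card {..2 * n} \<le> card (label_left ` {..4 * n} \<union> label_right ` {..4 * n})"
    using label_range by (intro card_mono) auto
  ultimately have "has_genus surface_of 0"
    using card_vertices card_edges by (intro genus_zero) simp
  then show ?thesis using arc_between_holes_path over_under_path w by blast
qed

text \<open>Reverses the sign of the crossing visited at times 2 and 4. This makes the two loops of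
  the first block meet an odd number of times, while those of the other blocks still have
  \<open>lk\<close> zero.\<close>

definition first_negative :: "nat \<Rightarrow> bool" where "first_negative i \<longleftrightarrow> block_over i \<noteq> (i \<in> {2, 4})"

text \<open>The first block supplies the odd \<open>cross_lk\<close>, and each other block one
  positive chord that has \<open>lk\<close> zero with all chords of both classes. Compared with
  positive blocks only two faces are lost, so the genus is 1.\<close>

theorem negative_block:
  "\<exists>\<Sigma> B C p R. has_genus \<Sigma> 1 \<and> arc_between_holes \<Sigma> B C p \<and> over_under \<Sigma> p R \<and>
    cross_lk R (\<lambda>e. crosses_right_to_left \<Sigma> p (fst e) (snd e)) = 1 \<and>
    free_writhe R (\<lambda>e. crosses_right_to_left \<Sigma> p (fst e) (snd e)) = int n"
proof -
  \<comment> \<open>One block for \<open>cross_lk\<close> and \<open>n\<close> further ones for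
    \<open>free_writhe\<close>.\<close>
  define N where "N = n + 1"
  have bm: "block_mate 2 = 4" "block_mate 4 = 2" "block_over 4" "\<not> block_over 2" "block_over 1" "block_mate 1 = 3" "block_mate 3 = 1"
    by (simp_all add: block_mate_def block_over_def)
  have fn: "first_negative (block_mate i) \<longleftrightarrow> \<not> first_negative i" if "i \<in> {1..4 * N}" for i
  proof -
    have "block_mate i \<in> {2, 4} \<longleftrightarrow> i \<in> {2, 4}" using block_mate(2)[OF that] bm by force
    then show ?thesis using block_mate(3)[OF that] unfolding first_negative_def by blast
  qed
  interpret code "4 * N" block_mate first_negative block_over True
    using block_mate fn by unfold_locales auto
  define c where "c = (\<lambda>k::nat. (4 * k + 1, 4 * k + 3))"
  define d where "d = (\<lambda>k::nat. (4 * k + 4, 4 * k + 2))"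
  have ev: "\<forall>i\<in>{1..4 * N}. even (i + block_mate i)" using block_mate(4) by blast
  have EO: "early_over crossings = c ` {..<N}"
    unfolding early_crossings[OF ev] early_over_blocks c_def by (rule refl)
  have EU: "early_under crossings = d ` {..<N}"
    unfolding early_crossings[OF ev] early_under_blocks d_def by (rule refl)
  have cC: "c k \<in> crossings" and dC: "d k \<in> crossings" if "k < N" for k
    using that EO EU unfolding early_over_def early_under_def by blast+
  have inj: "inj_on c {..<N}" "inj_on d {..<N}" by (auto simp: inj_on_def c_def d_def)
  have fnc: "first_negative (4 * k + 1)" "first_negative (4 * k + 4) \<longleftrightarrow> k \<noteq> 0" for k
    using block_over_simps[of k] unfolding first_negative_def by (auto; presburger)+
  have mS: "block_mate (Suc (4 * k + 1)) = 4 * k + 4" for k using block_mate_simps(2)[of k] by simp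
  have lkcc: "lk crossings PR (c k) (c l) = 0" if "k < N" "l < N" for k l
  proof -
    have "lk crossings PR (4 * k + 1, 4 * k + 3) (4 * l + 1, 4 * l + 3) =
        ins (4 * l + 1, 4 * l + 3) (block_mate (4 * k + 1)) + ins (4 * l + 1, 4 * l + 3) (block_mate (Suc (4 * k + 1))) +
        ins (4 * l + 1, 4 * l + 3) (if first_negative (4 * k + 1) then 4 * k + 3 else 4 * k + 1) +
        ins (4 * k + 1, 4 * k + 3) (if first_negative (4 * l + 1) then 4 * l + 1 else 4 * l + 3) +
        of_bool ((4 * k + 1, 4 * k + 3) = (4 * l + 1, 4 * l + 3))"
      by (rule lk_short) (use cC[OF that(1)] cC[OF that(2)] in \<open>simp_all add: c_def\<close>)
    then show ?thesis unfolding c_def block_mate_simps mS if_P[OF fnc(1)]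
      by (cases k l rule: linorder_cases) (auto simp: ins_def lo_def hi_def)
  qed
  have lkcd: "lk crossings PR (c k) (d l) = of_bool (k = 0 \<and> l = 0)" if "k < N" "l < N" for k l
  proof -
    have "lk crossings PR (4 * k + 1, 4 * k + 3) (4 * l + 4, 4 * l + 2) =
        ins (4 * l + 4, 4 * l + 2) (block_mate (4 * k + 1)) + ins (4 * l + 4, 4 * l + 2) (block_mate (Suc (4 * k + 1))) +
        ins (4 * l + 4, 4 * l + 2) (if first_negative (4 * k + 1) then 4 * k + 3 else 4 * k + 1) +
        ins (4 * k + 1, 4 * k + 3) (if first_negative (4 * l + 4) then 4 * l + 4 else 4 * l + 2) +
        of_bool ((4 * k + 1, 4 * k + 3) = (4 * l + 4, 4 * l + 2))"
      by (rule lk_short) (use cC[OF that(1)] dC[OF that(2)] in \<open>simp_all add: c_def d_def\<close>)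
    then show ?thesis unfolding c_def d_def block_mate_simps mS if_P[OF fnc(1)] fnc(2)
      by (cases k l rule: linorder_cases; cases "l = 0") (auto simp: ins_def lo_def hi_def)
  qed
  have ol: "over_lk crossings PR (c k) = 0" if "k < N" for k
    unfolding over_lk_def EO using lkcc[OF that] by (auto intro!: sum.neutral)
  have ul: "under_lk crossings PR (c k) = of_bool (k = 0)" if "k < N" for k
  proof -
    have "under_lk crossings PR (c k) = (\<Sum>l<N. of_bool (k = 0 \<and> l = 0))"
      unfolding under_lk_def EU using lkcd[OF that] by (simp add: sum.reindex[OF inj(2)])
    also have "\<dots> = (\<Sum>l<N. if l = 0 then of_bool (k = 0) else 0)" by (intro sum.cong) auto
    also have "\<dots> = of_bool (k = 0)" unfolding N_def by (subst sum.delta) auto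
    finally show ?thesis .
  qed
  have "cross_lk crossings PR = (\<Sum>k<N. of_bool (k = 0))"
    unfolding cross_lk_def EO using ul by (simp add: sum.reindex[OF inj(1)])
  also have "\<dots> = 1" unfolding N_def by (simp add: of_bool_def)
  finally have q: "cross_lk crossings PR = 1" .
  have free: "{e \<in> early_over crossings. over_lk crossings PR e = 0 \<and> under_lk crossings PR e = 0} = c ` {1..<N}"
    unfolding EO using ol ul by (auto simp: image_iff)
  have "inj_on c {1..<N}" using inj(1) by (rule inj_on_subset) auto
  then have "free_writhe crossings PR = (\<Sum>k\<in>{1..<N}. chord_sign PR (c k))"
    unfolding free_writhe_def free by (simp only: sum.reindex o_def)
  also have "\<dots> = (\<Sum>k\<in>{1..<N}. 1)"
  proof (rule sum.cong[OF refl])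
    fix k assume "k \<in> {1..<N}"
    then show "chord_sign PR (c k) = 1"
      using chord_sign_PR[of "4 * k + 1"] unfolding block_mate_simps using fnc(1)[of k] by (simp add: c_def)
  qed
  finally have w: "free_writhe crossings PR = int n" by (simp add: N_def)
  \<comment> \<open>The reversed crossing merges the faces 0, 1 and 2 of the first block; the
    maximum identifies their labels.\<close>
  define LF where "LF i = max 2 (label_left i)" for i
  define LB where "LB i = max 2 (label_right i)" for i
  have lab: "label_left 1 = 1" "label_left 2 = 0" "label_left 3 = 0" "label_left 4 = 2" 
    "label_right 1 = 2" "label_right 2 = 2" "label_right 3 = 1" "label_right 4 = 2"
    by (simp_all add: label_left_def label_right_def)
  have "card (LF ` {..4 * N} \<union> LB ` {..4 * N}) + 2 \<le> card (polygons surface_of)"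
  proof -
    have "LF i = (if first_negative i then LB (block_mate i) else LF (block_mate i - 1)) \<and>
       LB (i - 1) = (if first_negative i then LF (block_mate i - 1) else LB (block_mate i))" if "i \<in> {1..4 * N}" for i
    proof (cases "i \<in> {2, 4}")
      case True
      then show ?thesis using bm lab by (auto simp: LF_def LB_def first_negative_def)
    next
      case False
      then show ?thesis using label_block[of i] that by (auto simp: LF_def LB_def first_negative_def)
    qed
    then have inv: "i \<in> {1..4 * N} \<Longrightarrow> LF i = (if first_negative i then LB (block_mate i) else LF (block_mate i - 1))"
       "i \<in> {1..4 * N} \<Longrightarrow> LB (i - 1) = (if first_negative i then LF (block_mate i - 1) else LB (block_mate i))" for i by blast+
    have "card (LF ` {..4 * N} \<union> LB ` {..4 * N}) + (if True then 2 else 0) \<le> card (polygons surface_of)"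
    proof (rule card_polygons)
      show "if True then LF 0 = LB 0 \<and> LF (4 * N) = LB (4 * N) else LF 0 = LF (4 * N) \<and> LB 0 = LB (4 * N)"
        using label_simps(1,6)[of 0] label_simps(1,6)[of N] by (simp add: LF_def LB_def)
    qed (erule inv)+
    then show ?thesis by simp
  qed
  moreover have "card {2..2 * N} \<le> card (LF ` {..4 * N} \<union> LB ` {..4 * N})"
  proof (rule card_mono)
    show "{2..2 * N} \<subseteq> LF ` {..4 * N} \<union> LB ` {..4 * N}"
    proof
      fix j assume "j \<in> {2..2 * N}"
      moreover from this obtain i where "i \<le> 4 * N" "j = label_left i" using label_range[of N] by auto
      ultimately show "j \<in> LF ` {..4 * N} \<union> LB ` {..4 * N}" by (auto simp: LF_def intro!: image_eqI[where x = i])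
    qed
  qed simp
  moreover have "lk crossings PR (c 0) (d 0) = 1" using lkcd[of 0 0] by (simp add: N_def)
  ultimately have "has_genus surface_of 1"
    using card_vertices card_edges cC[of 0] dC[of 0] by (intro genus_one[of "c 0" "d 0"]) (auto simp: N_def)
  then show ?thesis using arc_between_holes_path over_under_path q w by blast
qed

lemma of_nat_bit: "of_nat k = (of_bool (odd k) :: bit)"
  by (induction k) auto

section \<open>Wrapped blocks on a closed torus\<close>

text \<open>
  Positive blocks enclosed by a crossing of the first visit with a late one and followed by a negative crossing.
\<close>

definition wrap_mate :: "nat \<Rightarrow> nat \<Rightarrow> nat" where
  "wrap_mate n i = (if i = 1 then 4 * n + 3 else if i = 4 * n + 3 then 1 else if i = 4 * n + 2 then 4 * n + 4
     else if i = 4 * n + 4 then 4 * n + 2 else Suc (block_mate (i - 1)))"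

definition wrap_left :: "nat \<Rightarrow> nat \<Rightarrow> bool" where
  "wrap_left n i \<longleftrightarrow> i \<in> {1, 4 * n + 2} \<or> i \<notin> {1, 4 * n + 2, 4 * n + 3, 4 * n + 4} \<and> block_over (i - 1)"

definition wrap_over :: "nat \<Rightarrow> nat \<Rightarrow> bool" where
  "wrap_over n i \<longleftrightarrow> i \<in> {1, 4 * n + 4} \<or> i \<notin> {1, 4 * n + 2, 4 * n + 3, 4 * n + 4} \<and> block_over (i - 1)"

lemma wrap_cases:
  assumes "i \<in> {1..4 * n + 4}"
  obtains "i = 1" | "i = 4 * n + 2" | "i = 4 * n + 3" | "i = 4 * n + 4" | j where "j \<in> {1..4 * n}" "i = Suc j"
proof -
  have "i = 1 \<or> i = 4 * n + 2 \<or> i = 4 * n + 3 \<or> i = 4 * n + 4 \<or> i - 1 \<in> {1..4 * n} \<and> i = Suc (i - 1)"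
    using assms by auto
  then show ?thesis using that by blast
qed

lemma wrap_simps:
  "wrap_mate n 1 = 4 * n + 3" "wrap_mate n (4 * n + 2) = 4 * n + 4" "wrap_mate n (4 * n + 3) = 1"
  "wrap_mate n (4 * n + 4) = 4 * n + 2"
  "wrap_left n 1" "wrap_left n (4 * n + 2)" "\<not> wrap_left n (4 * n + 3)" "\<not> wrap_left n (4 * n + 4)"
  "wrap_over n 1" "\<not> wrap_over n (4 * n + 2)" "\<not> wrap_over n (4 * n + 3)" "wrap_over n (4 * n + 4)"
  by (simp_all add: wrap_mate_def wrap_left_def wrap_over_def)

lemma wrap_block:
  assumes "j \<in> {1..4 * n}"
  shows "wrap_mate n (Suc j) = Suc (block_mate j)" "wrap_left n (Suc j) \<longleftrightarrow> block_over j"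
    "wrap_over n (Suc j) \<longleftrightarrow> block_over j"
  using assms by (auto simp: wrap_mate_def wrap_left_def wrap_over_def)

lemma wrap_mate:
  assumes "i \<in> {1..4 * n + 4}"
  shows "wrap_mate n i \<in> {1..4 * n + 4} \<and> wrap_mate n (wrap_mate n i) = i \<and>
    (wrap_left n (wrap_mate n i) \<longleftrightarrow> \<not> wrap_left n i) \<and> (wrap_over n (wrap_mate n i) \<longleftrightarrow> \<not> wrap_over n i) \<and>
    even (i + wrap_mate n i)"
  using assms
proof (cases rule: wrap_cases)
  case (5 j)
  note b = block_mate[OF 5(1)]
  show ?thesis unfolding 5(2) wrap_block[OF 5(1)] wrap_block[OF b(1)] using b by simp
qed (simp_all only: wrap_simps, auto)

text \<open>The labels of the blocks, moved by one visit. The edges outside the blocks reuse the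
  faces 0 and \<open>2 * n\<close> and border on one new face, \<open>2 * n + 1\<close>.\<close>

definition wrap_label_left :: "nat \<Rightarrow> nat \<Rightarrow> nat" where
  "wrap_label_left n i = (if i = 0 \<or> 4 * n + 3 \<le> i then 2 * n else if i = 4 * n + 2 then 2 * n + 1 else label_left (i - 1))"

definition wrap_label_right :: "nat \<Rightarrow> nat \<Rightarrow> nat" where
  "wrap_label_right n i = (if i = 0 \<or> i = 4 * n + 4 then 2 * n + 1 else if i = 4 * n + 2 \<or> i = 4 * n + 3 then 0
     else label_right (i - 1))"

lemma wrap_label_simps:
  "wrap_label_left n 0 = 2 * n" "wrap_label_left n (4 * n + 2) = 2 * n + 1" "wrap_label_left n (4 * n + 3) = 2 * n"
  "wrap_label_left n (4 * n + 4) = 2 * n" "wrap_label_right n 0 = 2 * n + 1" "wrap_label_right n (4 * n + 2) = 0"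
  "wrap_label_right n (4 * n + 3) = 0" "wrap_label_right n (4 * n + 4) = 2 * n + 1"
  by (simp_all add: wrap_label_left_def wrap_label_right_def)

lemma wrap_label_block:
  assumes "j \<le> 4 * n"
  shows "wrap_label_left n (Suc j) = label_left j" "wrap_label_right n (Suc j) = label_right j"
  using assms by (auto simp: wrap_label_left_def wrap_label_right_def)

lemma wrap_label:
  assumes "i \<in> {1..4 * n + 4}"
  shows "wrap_label_left n i = (if wrap_left n i then wrap_label_right n (wrap_mate n i) else wrap_label_left n (wrap_mate n i - 1)) \<and>
    wrap_label_right n (i - 1) = (if wrap_left n i then wrap_label_left n (wrap_mate n i - 1) else wrap_label_right n (wrap_mate n i))"
  using assms
proof (cases rule: wrap_cases)
  case (5 j)
  obtain j' where j': "j = Suc j'" using 5(1) by (cases j) auto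
  obtain l where l: "block_mate j = Suc l" using block_mate(1)[OF 5(1)] by (cases "block_mate j") auto
  have le: "j' \<le> 4 * n" "l \<le> 4 * n" "Suc l \<le> 4 * n" "Suc j' \<le> 4 * n" using 5(1) block_mate(1)[OF 5(1)] j' l by auto
  have "1 \<le> j" using 5(1) by simp
  note L = label_block[OF this, unfolded l, unfolded j' diff_Suc_1]
  show ?thesis unfolding 5(2) wrap_block[OF 5(1)] l diff_Suc_1 unfolding j' wrap_label_block[OF le(1)] wrap_label_block[OF le(2)]
      wrap_label_block[OF le(3)] wrap_label_block[OF le(4)] using L by simp
next
  case 1
  have e: "4 * n + 3 - 1 = 4 * n + 2" "(1::nat) - 1 = 0" by simp_all
  have "wrap_label_left n 1 = 0" using wrap_label_block(1)[of 0 n] label_simps(1)[of 0] by simp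
  then show ?thesis unfolding 1 wrap_simps e wrap_label_simps using wrap_simps(5)[of n] by simp
next
  case 2
  have e: "4 * n + 4 - 1 = 4 * n + 3" "4 * n + 2 - 1 = 4 * n + 1" by simp_all
  have "wrap_label_right n (4 * n + 1) = 2 * n" using wrap_label_block(2)[of "4 * n" n] label_simps(6)[of n] by simp
  then show ?thesis unfolding 2 wrap_simps e wrap_label_simps using wrap_simps(6)[of n] by simp
next
  case 3
  have e: "4 * n + 3 - 1 = 4 * n + 2" "(1::nat) - 1 = 0" by simp_all
  have "wrap_label_right n 1 = 0" using wrap_label_block(2)[of 0 n] label_simps(6)[of 0] by simp
  then show ?thesis unfolding 3 wrap_simps e wrap_label_simps using wrap_simps(7)[of n] by simp
next
  case 4
  have e: "4 * n + 4 - 1 = 4 * n + 3" "4 * n + 2 - 1 = 4 * n + 1" by simp_all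
  have "wrap_label_left n (4 * n + 1) = 2 * n" using wrap_label_block(1)[of "4 * n" n] label_simps(1)[of n] by simp
  then show ?thesis unfolding 4 wrap_simps e wrap_label_simps using wrap_simps(8)[of n] by simp
qed

lemma wrap_label_range: "{..2 * n + 1} \<subseteq> wrap_label_left n ` {..4 * n + 4}"
proof
  fix j assume j: "j \<in> {..2 * n + 1}"
  show "j \<in> wrap_label_left n ` {..4 * n + 4}"
  proof (cases "j = 2 * n + 1")
    case True
    then show ?thesis using wrap_label_simps(2)[of n] by (intro image_eqI[where x = "4 * n + 2"]) auto
  next
    case False
    then have "j \<in> {..2 * n}" using j by auto
    then obtain i where "i \<le> 4 * n" "j = label_left i" using label_range[of n] by auto
    then show ?thesis using wrap_label_block(1)[of i n] by (intro image_eqI[where x = "Suc i"]) auto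
  qed
qed

lemma early_over_wrap:
  "{(i, wrap_mate n i) | i. i \<in> {1..4 * n + 4} \<and> wrap_over n i \<and> i < wrap_mate n i} =
    insert (1, 4 * n + 3) ((\<lambda>k. (4 * k + 2, 4 * k + 4)) ` {..<n})" (is "?E = _")
proof -
  have "?E = insert (1, 4 * n + 3) (map_prod Suc Suc ` {(i, block_mate i) | i. i \<in> {1..4 * n} \<and> block_over i \<and> i < block_mate i})"
    (is "_ = ?F")
  proof
    show "?E \<subseteq> ?F"
    proof
      fix e assume "e \<in> ?E"
      then obtain i where i: "e = (i, wrap_mate n i)" "i \<in> {1..4 * n + 4}" "wrap_over n i" "i < wrap_mate n i" by auto
      from i(2) show "e \<in> ?F"
      proof (cases rule: wrap_cases)
        case 1
        then show ?thesis using i(1) wrap_simps(1)[of n] by simp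
      next
        case (5 j)
        then show ?thesis using i wrap_block[OF 5(1)] by (auto intro!: image_eqI[where x = "(j, block_mate j)"])
      qed (use i wrap_simps[of n] in auto)
    qed
    show "?F \<subseteq> ?E"
    proof
      fix e assume "e \<in> ?F"
      then consider "e = (1, 4 * n + 3)" | j where "j \<in> {1..4 * n}" "block_over j" "j < block_mate j" "e = (Suc j, Suc (block_mate j))"
        by auto
      then show "e \<in> ?E"
      proof cases
        case 1
        then show ?thesis using wrap_simps(1,9)[of n] by (auto intro!: exI[of _ 1])
      next
        case (2 j)
        then show ?thesis using wrap_block[OF 2(1)] by (auto intro!: exI[of _ "Suc j"])
      qed
    qed
  qed
  moreover have "map_prod Suc Suc ` (\<lambda>k. (4 * k + 1, 4 * k + 3)) ` {..<n} = (\<lambda>k. (4 * k + 2, 4 * k + 4)) ` {..<n}"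
    unfolding image_image by (rule image_cong[OF refl]) simp
  ultimately show ?thesis unfolding early_over_blocks by (simp only:)
qed

lemma early_under_wrap:
  "{(i, wrap_mate n i) | i. i \<in> {1..4 * n + 4} \<and> wrap_over n i \<and> wrap_mate n i < i} =
    insert (4 * n + 4, 4 * n + 2) ((\<lambda>k. (4 * k + 5, 4 * k + 3)) ` {..<n})" (is "?E = _")
proof -
  have "?E = insert (4 * n + 4, 4 * n + 2) (map_prod Suc Suc ` {(i, block_mate i) | i. i \<in> {1..4 * n} \<and> block_over i \<and> block_mate i < i})"
    (is "_ = ?F")
  proof
    show "?E \<subseteq> ?F"
    proof
      fix e assume "e \<in> ?E"
      then obtain i where i: "e = (i, wrap_mate n i)" "i \<in> {1..4 * n + 4}" "wrap_over n i" "wrap_mate n i < i" by auto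
      from i(2) show "e \<in> ?F"
      proof (cases rule: wrap_cases)
        case 4
        then show ?thesis using i(1) wrap_simps(4)[of n] by simp
      next
        case (5 j)
        then show ?thesis using i wrap_block[OF 5(1)] by (auto intro!: image_eqI[where x = "(j, block_mate j)"])
      qed (use i wrap_simps[of n] in auto)
    qed
    show "?F \<subseteq> ?E"
    proof
      fix e assume "e \<in> ?F"
      then consider "e = (4 * n + 4, 4 * n + 2)" | j where "j \<in> {1..4 * n}" "block_over j" "block_mate j < j" "e = (Suc j, Suc (block_mate j))"
        by auto
      then show "e \<in> ?E"
      proof cases
        case 1
        then show ?thesis using wrap_simps(4,12)[of n] by (auto intro!: exI[of _ "4 * n + 4"])
      next
        case (2 j)
        then show ?thesis using wrap_block[OF 2(1)] by (auto intro!: exI[of _ "Suc j"])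
      qed
    qed
  qed
  moreover have "map_prod Suc Suc ` (\<lambda>k. (4 * k + 4, 4 * k + 2)) ` {..<n} = (\<lambda>k. (4 * k + 5, 4 * k + 3)) ` {..<n}"
    unfolding image_image by (rule image_cong[OF refl]) simp
  ultimately show ?thesis unfolding early_under_blocks by (simp only:)
qed

text \<open>The long chord \<open>c\<close> has odd \<open>lk\<close> with \<open>d\<close> and with
  the later crossing \<open>e k\<close> of each block, and all other pairs between the two classes
  have even \<open>lk\<close>; hence \<open>1 + of_nat n\<close>. With \<open>2 * n + 3\<close>
  vertices and \<open>4 * n + 5\<close> edges, the \<open>2 * n + 2\<close> faces found by the
  labels give genus 1.\<close>

theorem wrapped_blocks:
  "\<exists>\<Sigma> p R. has_genus \<Sigma> 1 \<and> based_closed_curve \<Sigma> p \<and> over_under \<Sigma> p R \<and>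
    odd_writhe R (\<lambda>e. crosses_right_to_left \<Sigma> p (fst e) (snd e)) = int n + 1 \<and>
    cross_lk R (\<lambda>e. crosses_right_to_left \<Sigma> p (fst e) (snd e)) = 1 + of_nat n"
proof -
  interpret code "4 * n + 4" "wrap_mate n" "wrap_left n" "wrap_over n" False
    using wrap_mate by unfold_locales blast+
  define b where "b = (\<lambda>k::nat. (4 * k + 2, 4 * k + 4))"
  define e where "e = (\<lambda>k::nat. (4 * k + 5, 4 * k + 3))"
  define c where "c = (1::nat, 4 * n + 3)"
  define d where "d = (4 * n + 4, 4 * n + 2)"
  have ev: "\<forall>i\<in>{1..4 * n + 4}. even (i + wrap_mate n i)" using wrap_mate by blast
  have EO: "early_over crossings = insert c (b ` {..<n})"
    unfolding early_crossings[OF ev] early_over_wrap b_def c_def by (rule refl)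
  have EU: "early_under crossings = insert d (e ` {..<n})"
    unfolding early_crossings[OF ev] early_under_wrap e_def d_def by (rule refl)
  have "early_over crossings \<subseteq> crossings" "early_under crossings \<subseteq> crossings"
    by (auto simp: early_over_def early_under_def)
  then have mem: "c \<in> crossings" "d \<in> crossings" "k < n \<Longrightarrow> b k \<in> crossings" "k < n \<Longrightarrow> e k \<in> crossings" for k
    unfolding EO EU by auto
  have inj: "inj_on b {..<n}" "inj_on e {..<n}" by (auto simp: inj_on_def b_def e_def)
  have new: "c \<notin> b ` {..<n}" "d \<notin> e ` {..<n}" by (auto simp: b_def c_def d_def e_def; presburger)+
  have wm: "wrap_mate n (4 * k + 2) = 4 * k + 4" "wrap_mate n (4 * k + 3) = 4 * k + 5" "wrap_mate n (4 * k + 4) = 4 * k + 2"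
    "wrap_left n (4 * k + 2)" "wrap_left n (4 * k + 5)" if "k < n" for k
    using wrap_block[of "4 * k + 1" n] wrap_block[of "4 * k + 2" n] wrap_block[of "4 * k + 3" n] wrap_block[of "4 * k + 4" n] that
      block_mate_simps[of k] block_over_simps[of k] by (simp_all add: eval_nat_numeral)
  have suc: "Suc (4 * k + 2) = 4 * k + 3" "Suc (4 * k + 3) = 4 * k + 4" for k by simp_all
  have wl: "(if wrap_left n (4 * n + 4) then x else y) = y" "(if wrap_left n 1 then x else y) = x" for x y :: nat
    using wrap_simps by simp_all
  have lkcd: "lk crossings PR c d = 1"
  proof -
    \<comment> \<open>Computed with the short chord in first position, as required by
      \<open>lk_short\<close>, and transposed afterwards.\<close>
    have "lk crossings PR (4 * n + 4, 4 * n + 2) (1, 4 * n + 3) =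
        ins (1, 4 * n + 3) (wrap_mate n (4 * n + 2)) + ins (1, 4 * n + 3) (wrap_mate n (Suc (4 * n + 2))) +
        ins (1, 4 * n + 3) (if wrap_left n (4 * n + 4) then 4 * n + 2 else 4 * n + 4) +
        ins (4 * n + 4, 4 * n + 2) (if wrap_left n (1) then 1 else 4 * n + 3) +
        of_bool ((4 * n + 4, 4 * n + 2) = (1, 4 * n + 3))"
      by (rule lk_short) (use mem(1,2) in \<open>simp_all add: b_def c_def d_def e_def\<close>)
    then have "lk crossings PR d c = 1"
      unfolding b_def c_def d_def e_def suc wrap_simps(2,3) wl
      by (auto simp: ins_def lo_def hi_def)
    then show ?thesis using lk_commute[OF chords_R mem(1,2)] by simp
  qed
  have lkce: "lk crossings PR c (e k) = 1" if "k < n" for k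
  proof -
    have "lk crossings PR (4 * k + 5, 4 * k + 3) (1, 4 * n + 3) =
        ins (1, 4 * n + 3) (wrap_mate n (4 * k + 3)) + ins (1, 4 * n + 3) (wrap_mate n (Suc (4 * k + 3))) +
        ins (1, 4 * n + 3) (if wrap_left n (4 * k + 5) then 4 * k + 3 else 4 * k + 5) +
        ins (4 * k + 5, 4 * k + 3) (if wrap_left n (1) then 1 else 4 * n + 3) +
        of_bool ((4 * k + 5, 4 * k + 3) = (1, 4 * n + 3))"
      by (rule lk_short) (use mem(1) mem(4)[OF that] in \<open>simp_all add: b_def c_def d_def e_def\<close>)
    then have "lk crossings PR (e k) c = 1"
      unfolding b_def c_def d_def e_def suc wm(2,3)[OF that] wl if_P[OF wm(5)[OF that]]
      using that by (auto simp: ins_def lo_def hi_def)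
    then show ?thesis using lk_commute[OF chords_R mem(1) mem(4)[OF that]] by simp
  qed
  have lkbd: "lk crossings PR (b k) d = 0" if "k < n" for k
  proof -
    have "lk crossings PR (4 * k + 2, 4 * k + 4) (4 * n + 4, 4 * n + 2) =
        ins (4 * n + 4, 4 * n + 2) (wrap_mate n (4 * k + 2)) + ins (4 * n + 4, 4 * n + 2) (wrap_mate n (Suc (4 * k + 2))) +
        ins (4 * n + 4, 4 * n + 2) (if wrap_left n (4 * k + 2) then 4 * k + 4 else 4 * k + 2) +
        ins (4 * k + 2, 4 * k + 4) (if wrap_left n (4 * n + 4) then 4 * n + 4 else 4 * n + 2) +
        of_bool ((4 * k + 2, 4 * k + 4) = (4 * n + 4, 4 * n + 2))"
      by (rule lk_short) (use mem(2) mem(3)[OF that] in \<open>simp_all add: b_def c_def d_def e_def\<close>)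
    then have "lk crossings PR (b k) d = 0"
      unfolding b_def c_def d_def e_def suc wm(1,2)[OF that] wl if_P[OF wm(4)[OF that]]
      using that by (auto simp: ins_def lo_def hi_def)
    then show ?thesis .
  qed
  have lkbe: "lk crossings PR (b k) (e l) = 0" if "k < n" "l < n" for k l
  proof -
    have "lk crossings PR (4 * k + 2, 4 * k + 4) (4 * l + 5, 4 * l + 3) =
        ins (4 * l + 5, 4 * l + 3) (wrap_mate n (4 * k + 2)) + ins (4 * l + 5, 4 * l + 3) (wrap_mate n (Suc (4 * k + 2))) +
        ins (4 * l + 5, 4 * l + 3) (if wrap_left n (4 * k + 2) then 4 * k + 4 else 4 * k + 2) +
        ins (4 * k + 2, 4 * k + 4) (if wrap_left n (4 * l + 5) then 4 * l + 5 else 4 * l + 3) +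
        of_bool ((4 * k + 2, 4 * k + 4) = (4 * l + 5, 4 * l + 3))"
      by (rule lk_short) (use mem(3)[OF that(1)] mem(4)[OF that(2)] in \<open>simp_all add: b_def c_def d_def e_def\<close>)
    then have "lk crossings PR (b k) (e l) = 0"
      unfolding b_def c_def d_def e_def suc wm(1,2)[OF that(1)] if_P[OF wm(4)[OF that(1)]] if_P[OF wm(5)[OF that(2)]]
      by (cases k l rule: linorder_cases) (auto simp: ins_def lo_def hi_def)
    then show ?thesis .
  qed
  have sumEU: "(\<Sum>y\<in>early_under crossings. f y) = f d + (\<Sum>k<n. f (e k))" for f :: "_ \<Rightarrow> bit"
    unfolding EU using new(2) by (simp add: sum.reindex[OF inj(2)])
  have "under_lk crossings PR c = 1 + (\<Sum>k<n. 1)"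
    unfolding under_lk_def sumEU lkcd using lkce by (auto intro!: sum.cong)
  moreover have "under_lk crossings PR (b k) = 0" if "k < n" for k
    unfolding under_lk_def sumEU lkbd[OF that] using lkbe[OF that] by (auto intro!: sum.neutral)
  ultimately have q: "cross_lk crossings PR = 1 + of_nat n"
    unfolding cross_lk_def EO using new(1) by (simp add: sum.reindex[OF inj(1)])
  have "chord_sign PR c = 1"
    using chord_sign_PR[of 1] unfolding wrap_simps using wrap_simps(5)[of n] by (simp add: c_def)
  moreover have "chord_sign PR (b k) = 1" if "k < n" for k
    using chord_sign_PR[of "4 * k + 2"] wm(1,4)[OF that] that by (simp add: b_def)
  ultimately have w: "odd_writhe crossings PR = int n + 1"
    unfolding odd_writhe_def EO using new(1) by (simp add: sum.reindex[OF inj(1)])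
  have "card (wrap_label_left n ` {..4 * n + 4} \<union> wrap_label_right n ` {..4 * n + 4}) + (if False then 2 else 0) \<le> card (polygons surface_of)"
  proof (rule card_polygons)
    show "if False then wrap_label_left n 0 = wrap_label_right n 0 \<and> wrap_label_left n (4 * n + 4) = wrap_label_right n (4 * n + 4)
      else wrap_label_left n 0 = wrap_label_left n (4 * n + 4) \<and> wrap_label_right n 0 = wrap_label_right n (4 * n + 4)"
      using wrap_label_simps by simp
  qed (use wrap_label in blast)+
  moreover have "card {..2 * n + 1} \<le> card (wrap_label_left n ` {..4 * n + 4} \<union> wrap_label_right n ` {..4 * n + 4})"
    using wrap_label_range by (intro card_mono) auto
  ultimately have "has_genus surface_of 1"
    using card_vertices card_edges by (intro genus_one[OF mem(1,2) lkcd]) simp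
  then show ?thesis using based_closed_curve_path over_under_path w q by blast
qed

section \<open>Supporting genera\<close>

lemma same_crossings_inv:
  assumes "same_crossings D \<Sigma> p R"
  shows "diagram_inv D = gauss_inv R (\<lambda>e. crosses_right_to_left \<Sigma> p (fst e) (snd e))"
proof -
  obtain f where f: "strict_mono_on (Field (arrows D)) f" "R = map_prod f f ` arrows D"
    "\<forall>(s, t)\<in>arrows D. positive D s t \<longleftrightarrow> crosses_right_to_left \<Sigma> p (f s) (f t)"
    using assms unfolding same_crossings_def by blast
  show ?thesis unfolding diagram_inv_def f(2)
    by (rule gauss_inv_strict_mono[OF f(1)]) (use f(3) in \<open>auto simp: sign_of_def\<close>)
qed

lemma surf_path_closed:
  assumes "based_closed_curve \<Sigma> p" "over_under \<Sigma> p R"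
  shows "surf_path \<Sigma> p R"
  using assms unfolding based_closed_curve_def by unfold_locales auto

lemma surf_path_holed:
  assumes "arc_between_holes \<Sigma> B C p" "over_under \<Sigma> p R"
  shows "surf_path \<Sigma> p R"
proof -
  have a: "closed_surface \<Sigma>" "generic_path \<Sigma> p" "initial_vertex \<Sigma> (hd p) \<in> initial_vertex \<Sigma> ` (B \<union> C)"
    "final_vertex \<Sigma> (last p) \<in> initial_vertex \<Sigma> ` (B \<union> C)"
    "\<And>i. i \<in> {1..<length p} \<Longrightarrow> initial_vertex \<Sigma> (p ! i) \<notin> initial_vertex \<Sigma> ` (B \<union> C)"
    using assms(1) unfolding arc_between_holes_def two_holed_surface_def by blast+
  show ?thesis
  proof
    show "initial_vertex \<Sigma> (p ! i) \<noteq> initial_vertex \<Sigma> (hd p) \<and> initial_vertex \<Sigma> (p ! i) \<noteq> final_vertex \<Sigma> (last p)"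
      if "i \<in> {1..<length p}" for i using a(3,4) a(5)[OF that] by metis
  qed (fact a(1) a(2) assms(2))+
qed

text \<open>Virtual crossings absorb all further intersections of a plane curve, so the Gauss
  diagram of any such path on a surface comes from a long virtual diagram.\<close>

lemma diagram_with_crossings:
  assumes "surf_path \<Sigma> p R"
  shows "\<exists>D. long_virtual_diagram D \<and> same_crossings D \<Sigma> p R"
proof -
  obtain D f where D: "long_virtual_diagram D" "strict_mono_on (Field (arrows D)) f" "map_prod f f ` arrows D = R"
    "\<forall>e\<in>arrows D. positive D (fst e) (snd e) \<longleftrightarrow> crosses_right_to_left \<Sigma> p (fst (map_prod f f e)) (snd (map_prod f f e))"
    using gauss_diagram_realizable[OF surf_path.chords_R[OF assms],
        of "\<lambda>e. crosses_right_to_left \<Sigma> p (fst e) (snd e)"] by blast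
  then have "same_crossings D \<Sigma> p R" unfolding same_crossings_def by (intro exI[of _ f]) auto
  then show ?thesis using D(1) by blast
qed

section \<open>What a realization forces on the invariants\<close>

text \<open>On a closed sphere every crossing is even, so the class counted by the odd writhe is
  empty.\<close>

lemma closed_genus_zero_writhe:
  assumes "realized_on_closed_surface D 0"
  shows "fst (diagram_inv D) = 0"
proof -
  obtain \<Sigma> p R where *: "has_genus \<Sigma> 0" "based_closed_curve \<Sigma> p" "over_under \<Sigma> p R" "same_crossings D \<Sigma> p R"
    using assms unfolding realized_on_closed_surface_def by blast
  interpret surf_path \<Sigma> p R using *(2,3) by (rule surf_path_closed)
  have "final_vertex \<Sigma> (last p) = initial_vertex \<Sigma> (hd p)" using *(2) by (simp add: based_closed_curve_def)
  from genus_zero_par[OF *(1) this] have "early_over R = {}" by (auto simp: early_over_def)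
  then show ?thesis unfolding same_crossings_inv[OF *(4)] by (simp add: gauss_inv_def odd_writhe_def)
qed

lemma holed_genus_zero_lk:
  assumes "realized_on_two_holed_surface D 0"
  shows "fst (snd (diagram_inv D)) = 0"
proof -
  obtain \<Sigma> B C p R where *: "has_genus \<Sigma> 0" "arc_between_holes \<Sigma> B C p" "over_under \<Sigma> p R" "same_crossings D \<Sigma> p R"
    using assms unfolding realized_on_two_holed_surface_def by blast
  interpret surf_path \<Sigma> p R using *(2,3) by (rule surf_path_holed)
  have "cross_lk R PR = 0"
    unfolding cross_lk_def under_lk_def
    by (intro sum.neutral ballI genus_zero_lk[OF *(1)]) (auto simp: early_over_def early_under_def)
  then show ?thesis unfolding same_crossings_inv[OF *(4)] by (simp add: gauss_inv_def)
qed

text \<open>A chord counted by \<open>free_writhe\<close> could serve as \<open>b\<close> in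
  \<open>genus_one_lk\<close>, with the two classes as \<open>S\<close> and \<open>T\<close>. If
  \<open>cross_lk\<close> is odd, there is no such chord.\<close>

lemma closed_genus_one_writhe:
  assumes "realized_on_closed_surface D g" "g \<le> 1" and lk: "fst (snd (diagram_inv D)) = 1"
  shows "snd (snd (diagram_inv D)) = 0"
proof -
  obtain \<Sigma> p R where *: "has_genus \<Sigma> g" "based_closed_curve \<Sigma> p" "over_under \<Sigma> p R" "same_crossings D \<Sigma> p R"
    using assms(1) unfolding realized_on_closed_surface_def by blast
  interpret surf_path \<Sigma> p R using *(2,3) by (rule surf_path_closed)
  have cl: "final_vertex \<Sigma> (last p) = initial_vertex \<Sigma> (hd p)" using *(2) by (simp add: based_closed_curve_def)
  have sub: "early_over R \<subseteq> R" "early_under R \<subseteq> R" by (auto simp: early_over_def early_under_def)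
  have ST: "(\<Sum>c\<in>early_over R. \<Sum>d\<in>early_under R. lk R PR c d) = 1"
    using lk unfolding same_crossings_inv[OF *(4)] by (simp add: gauss_inv_def cross_lk_def under_lk_def)
  have "\<not> (over_lk R PR b = 0 \<and> under_lk R PR b = 0)" if b: "b \<in> early_over R" for b
  proof
    assume "over_lk R PR b = 0 \<and> under_lk R PR b = 0"
    then have "(\<Sum>d\<in>early_over R. lk R PR b d) = 0" "(\<Sum>d\<in>early_under R. lk R PR b d) = 0"
      by (simp_all add: over_lk_def under_lk_def)
    moreover have "b \<in> R" "par R b = 1" using b by (auto simp: early_over_def)
    ultimately show False using genus_one_lk[OF *(1) assms(2) cl sub ST] by blast
  qed
  then have "{c \<in> early_over R. over_lk R PR c = 0 \<and> under_lk R PR c = 0} = {}" by blast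
  then show ?thesis unfolding same_crossings_inv[OF *(4)] gauss_inv_def snd_conv free_writhe_def by (simp only: sum.empty)
qed

section \<open>Knots and their supporting genera\<close>

definition knot :: "diagram \<Rightarrow> diagram set" where
  "knot D = {(D, D'). long_virtual_diagram D \<and> long_virtual_diagram D' \<and> equivclp move D D'} `` {D}"

lemma knot_mem:
  assumes "long_virtual_diagram D"
  shows "knot D \<in> long_virtual_knots" "D \<in> knot D"
proof -
  show "knot D \<in> long_virtual_knots"
    unfolding knot_def long_virtual_knots_def by (rule quotientI) (simp add: assms)
  show "D \<in> knot D" using assms by (simp add: knot_def)
qed

lemma knot_inv: "D' \<in> knot D \<Longrightarrow> diagram_inv D' = diagram_inv D"
  using equivalent_inv[of D D'] by (simp add: knot_def)

text \<open>The infimum of a nonempty set of naturals is attained, and for the empty set it is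
  infinite and thus above every \<open>enat n\<close>.\<close>

lemma Inf_enat_le: "Inf {enat g | g. P g} \<le> enat n \<longleftrightarrow> (\<exists>g\<le>n. P g)"
proof
  assume le: "Inf {enat g | g. P g} \<le> enat n"
  show "\<exists>g\<le>n. P g"
  proof (rule ccontr)
    assume no: "\<not> (\<exists>g\<le>n. P g)"
    have "enat (Suc n) \<le> Inf {enat g | g. P g}"
    proof (rule Inf_greatest)
      fix x assume "x \<in> {enat g | g. P g}"
      then obtain g where "x = enat g" "P g" by blast
      then show "enat (Suc n) \<le> x" using no by (metis enat_ord_simps(1) not_less_eq_eq)
    qed
    then have "enat (Suc n) \<le> enat n" using le by (rule order_trans)
    then show False by simp
  qed
next
  assume "\<exists>g\<le>n. P g"
  then obtain g where "g \<le> n" "P g" by blast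
  then have "Inf {enat g | g. P g} \<le> enat g" by (intro Inf_lower) blast
  then show "Inf {enat g | g. P g} \<le> enat n" using \<open>g \<le> n\<close> by (meson enat_ord_simps(1) order_trans)
qed

lemma mem_K1: "K \<in> K1 g \<longleftrightarrow> K \<in> long_virtual_knots \<and> (\<exists>g'\<le>g. \<exists>D\<in>K. realized_on_closed_surface D g')"
  by (simp add: K1_def sg1_def Inf_enat_le)

lemma mem_K2: "K \<in> K2 g \<longleftrightarrow> K \<in> long_virtual_knots \<and> (\<exists>g'\<le>g. \<exists>D\<in>K. realized_on_two_holed_surface D g')"
  by (simp add: K2_def sg2_def Inf_enat_le)

text \<open>Equal knots have equal invariants, so an injective sequence of values comes from
  pairwise different knots.\<close>

lemma infinite_knots:
  fixes h :: "nat \<Rightarrow> 'a"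
  assumes ex: "\<And>n. \<exists>D. long_virtual_diagram D \<and> knot D \<in> X \<and> F (diagram_inv D) = h n" and h: "inj h"
  shows "infinite X"
proof -
  obtain D where D: "\<And>n. long_virtual_diagram (D n)" "\<And>n. knot (D n) \<in> X" "\<And>n. F (diagram_inv (D n)) = h n"
    using ex by metis
  have "inj (\<lambda>n. knot (D n))"
  proof (rule injI)
    fix k l assume "knot (D k) = knot (D l)"
    then have "D k \<in> knot (D l)" using knot_mem(2)[OF D(1), of k] by simp
    then have "h k = h l" using knot_inv D(3) by metis
    then show "k = l" using h by (simp add: inj_eq)
  qed
  then have "infinite (range (\<lambda>n. knot (D n)))" by (rule range_inj_infinite)
  moreover have "range (\<lambda>n. knot (D n)) \<subseteq> X" using D(2) by blast
  ultimately show ?thesis by (rule infinite_super[rotated])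
qed

theorem theorem3p8:
  shows "K1 0 \<noteq> K2 0 \<and> K2 0 \<noteq> K1 1 \<and> K1 1 \<noteq> K2 1 \<and>
    infinite (K2 0 - K1 0) \<and> infinite (K1 1 - K2 0) \<and> infinite (K2 1 - K1 1)"
proof -
  have A: "infinite (K2 0 - K1 0)"
  \<comment> \<open>\<open>Suc n\<close> instead of \<open>n\<close>, since only a nonzero odd
    writhe excludes a closed sphere.\<close>
  proof (rule infinite_knots[where F = fst and h = "\<lambda>n. int (Suc n)"])
    fix n
    obtain \<Sigma> B C p R where *: "has_genus \<Sigma> 0" "arc_between_holes \<Sigma> B C p" "over_under \<Sigma> p R"
      "odd_writhe R (\<lambda>e. crosses_right_to_left \<Sigma> p (fst e) (snd e)) = int (Suc n)"
      using positive_blocks[of "Suc n"] by blast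
    obtain D where D: "long_virtual_diagram D" "same_crossings D \<Sigma> p R"
      using diagram_with_crossings[OF surf_path_holed[OF *(2,3)]] by blast
    have inv: "fst (diagram_inv D) = int (Suc n)"
      unfolding same_crossings_inv[OF D(2)] gauss_inv_def using *(4) by simp
    have "realized_on_two_holed_surface D 0" unfolding realized_on_two_holed_surface_def using * D(2) by blast
    then have "knot D \<in> K2 0" unfolding mem_K2 using knot_mem[OF D(1)] by blast
    moreover have "knot D \<notin> K1 0"
      unfolding mem_K1 using closed_genus_zero_writhe knot_inv[of _ D] inv by fastforce
    ultimately show "\<exists>D. long_virtual_diagram D \<and> knot D \<in> K2 0 - K1 0 \<and> fst (diagram_inv D) = int (Suc n)"
      using D(1) inv by blast
  qed (simp add: inj_def)
  have B: "infinite (K1 1 - K2 0)"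
  \<comment> \<open>An even number of wrapped blocks keeps \<open>cross_lk\<close> equal to 1, which
    excludes the sphere with two holes; the odd writhe tells the knots apart.\<close>
  proof (rule infinite_knots[where F = fst and h = "\<lambda>n. int (2 * n) + 1"])
    fix n
    obtain \<Sigma> p R where *: "has_genus \<Sigma> 1" "based_closed_curve \<Sigma> p" "over_under \<Sigma> p R"
      "odd_writhe R (\<lambda>e. crosses_right_to_left \<Sigma> p (fst e) (snd e)) = int (2 * n) + 1"
      "cross_lk R (\<lambda>e. crosses_right_to_left \<Sigma> p (fst e) (snd e)) = 1 + of_nat (2 * n)"
      using wrapped_blocks[of "2 * n"] by blast
    obtain D where D: "long_virtual_diagram D" "same_crossings D \<Sigma> p R"
      using diagram_with_crossings[OF surf_path_closed[OF *(2,3)]] by blast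
    have "(of_nat (2 * n) :: bit) = 0" unfolding of_nat_bit by simp
    then have inv: "fst (diagram_inv D) = int (2 * n) + 1" "fst (snd (diagram_inv D)) = 1"
      unfolding same_crossings_inv[OF D(2)] gauss_inv_def using *(4,5) by simp_all
    have "realized_on_closed_surface D 1" unfolding realized_on_closed_surface_def using * D(2) by blast
    then have "knot D \<in> K1 1" unfolding mem_K1 using knot_mem[OF D(1)] by blast
    moreover have "knot D \<notin> K2 0"
      unfolding mem_K2 using holed_genus_zero_lk knot_inv[of _ D] inv(2) by fastforce
    ultimately show "\<exists>D. long_virtual_diagram D \<and> knot D \<in> K1 1 - K2 0 \<and> fst (diagram_inv D) = int (2 * n) + 1"
      using D(1) inv by blast
  qed (simp add: inj_def)
  have C: "infinite (K2 1 - K1 1)"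
  \<comment> \<open>Here \<open>cross_lk = 1\<close> brings the torus obstruction into force, and a
    nonzero \<open>free_writhe\<close> violates it.\<close>
  proof (rule infinite_knots[where F = "\<lambda>v. snd (snd v)" and h = "\<lambda>n. int (Suc n)"])
    fix n
    obtain \<Sigma> B C p R where *: "has_genus \<Sigma> 1" "arc_between_holes \<Sigma> B C p" "over_under \<Sigma> p R"
      "cross_lk R (\<lambda>e. crosses_right_to_left \<Sigma> p (fst e) (snd e)) = 1"
      "free_writhe R (\<lambda>e. crosses_right_to_left \<Sigma> p (fst e) (snd e)) = int (Suc n)"
      using negative_block[of "Suc n"] by blast
    obtain D where D: "long_virtual_diagram D" "same_crossings D \<Sigma> p R"
      using diagram_with_crossings[OF surf_path_holed[OF *(2,3)]] by blast
    have inv: "fst (snd (diagram_inv D)) = 1" "snd (snd (diagram_inv D)) = int (Suc n)"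
      unfolding same_crossings_inv[OF D(2)] gauss_inv_def using *(4,5) by simp_all
    have "realized_on_two_holed_surface D 1" unfolding realized_on_two_holed_surface_def using * D(2) by blast
    then have "knot D \<in> K2 1" unfolding mem_K2 using knot_mem[OF D(1)] by blast
    moreover have "knot D \<notin> K1 1"
      unfolding mem_K1 using closed_genus_one_writhe knot_inv[of _ D] inv by fastforce
    ultimately show "\<exists>D. long_virtual_diagram D \<and> knot D \<in> K2 1 - K1 1 \<and> snd (snd (diagram_inv D)) = int (Suc n)"
      using D(1) inv by blast
  qed (simp add: inj_def)
  have ne: "X \<noteq> Y" "Y \<noteq> X" if "infinite (Y - X)" for X Y :: "diagram set set" using that by auto
  show ?thesis using A B C ne(1)[OF A] ne(1)[OF B] ne(1)[OF C] by blast
qed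

end
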